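(* Let $k$ and $u_0$ be real numbers and let $V_k(u) = \frac14 e^{2u} + k e^{u}$. The Schrödinger equation $$\left(-\frac{d^2}{du^2} + V_k(u)\right)\psi(u) = E\,\psi(u)$$ on the half-line $[u_0,\infty)$ has the following properties. (1) For each $E\in\mathbb{C}$, the two-dimensional complex vector space $\mathcal{E}_E(V_k)$ of its solutions on $[u_0,\infty)$ consists of the functions $$\varphi(u) = e^{-\frac{u}{2}} f(e^u),$$ where $f(x)$ is any solution (on $[e^{u_0},\infty)$) of Whittaker's differential equation $$\left(\frac{d^2}{dx^2} + \left(-\frac14 + \frac{\kappa}{x} + \frac{\frac14-\mu^2}{x^2}\right)\right) f(x) = 0$$ with parameters $(\kappa,\mu)$ given by $\kappa = -k$ and $\mu^2 = -E$. (2) For arbitrary $E\in\mathbb{C}$ there is a one-dimensional subspace of $\mathcal{E}_E(V_k)$ of solutions that belong to $L^2(u_0,\infty)$. Setting $E = z^2$, this subspace is spanned by the solution $$\psi(u,z^2) := e^{-\frac{u}{2}} W_{-k,iz}(e^u) = e^{-\frac{u}{2}} W_{-k,-iz}(e^u),$$ where $W_{\kappa,\mu}(x)$ denotes the Whittaker $W$-function. (3) The potential $V_k(u)$ is of limit point type at $+\infty$. If the constant boundary condition $$(\cos\alpha)\,\psi(u_0) + (\sin\alpha)\,\psi'(u_0) = 0,$$ for fixed $0\le\alpha<2\pi$, is imposed at the left endpoint $u=u_0$, then the Schrödinger operator $-\frac{d^2}{du^2}+V_k(u)$ on $L^2(u_0,\infty)$ is self-adjoint. This operator has a pure discrete simple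 real spectrum, bounded below. For Dirichlet boundary conditions ($\alpha=0$) its smallest eigenvalue $E_0$ satisfies $E_0>0$ when $k\ge 0$, and $E_0 > -k^2$ when $k<0$.
   Context: $L^2(u_0,\infty)$ means $L^2((u_0,\infty),du)$. Whittaker $W$-function: for complex $\kappa,\mu$ and real $x>0$, $W_{\kappa,\mu}(x)$ is the solution on $(0,\infty)$ of Whittaker's equation $f'' + \left(-\frac14+\frac{\kappa}{x}+\frac{\frac14-\mu^2}{x^2}\right)f=0$ determined uniquely by the asymptotics $W_{\kappa,\mu}(x) = e^{-x/2}x^{\kappa}\left(1+O(1/x)\right)$ as $x\to+\infty$. For real continuous $V$ on $[u_0,\infty)$, the potential is of limit point type at $+\infty$ if for each $E\in\mathbb{C}\setminus\mathbb{R}$ the equation $-\psi''+V\psi=E\psi$ has, up to scalar multiples, exactly one nonzero solution in $L^2(u_0,\infty)$. The Schrödinger operator with the boundary condition of parameter $\alpha$ is $f\mapsto -f''+Vf$ on the domain of all $f\in L^2(u_0,\infty)\cap C^1[u_0,\infty)$ such that $f'$ is locally absolutely continuous on $[u_0,\infty)$, $-f''+Vf\in L^2(u_0,\infty)$, and $(\cos\alpha)f(u_0)+(\sin\alpha)f'(u_0)=0$. *)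

theory Defs
  imports
    "HOL-Analysis.Analysis"
    "HOL-Library.Function_Algebras"
    "HOL-Library.Landau_Symbols"
begin

section \<open>Complex-valued functions as a complex vector space\<close>

definition fscale :: "complex \<Rightarrow> ('a \<Rightarrow> complex) \<Rightarrow> 'a \<Rightarrow> complex" where
  "fscale c f = (\<lambda>x. c * f x)"

global_interpretation cfun: vector_space "fscale :: complex \<Rightarrow> ('a \<Rightarrow> complex) \<Rightarrow> 'a \<Rightarrow> complex"
  by unfold_locales (auto simp: fscale_def fun_eq_iff algebra_simps)


section \<open>The two differential equations\<close>

text \<open>At a boundary point of \<open>S\<close> the derivatives are one-sided.\<close>

definition has_second_deriv_on ::
    "(real \<Rightarrow> complex) \<Rightarrow> (real \<Rightarrow> complex) \<Rightarrow> real set \<Rightarrow> bool" where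
  "has_second_deriv_on f f'' S \<longleftrightarrow>
     (\<exists>f'. \<forall>x\<in>S. (f has_vector_derivative f' x) (at x within S) \<and>
                 (f' has_vector_derivative f'' x) (at x within S))"

text \<open>
  A function on an interval \<open>S\<close> is represented by its extension by zero to the real line, so that
  equality and linear dependence of functions on \<open>S\<close> are those of the representing functions.
\<close>

definition schrodinger_solutions :: "real \<Rightarrow> (real \<Rightarrow> real) \<Rightarrow> complex \<Rightarrow> (real \<Rightarrow> complex) set" where
  "schrodinger_solutions u\<^sub>0 V E =
     {\<psi>. (\<forall>u. u \<notin> {u\<^sub>0..} \<longrightarrow> \<psi> u = 0) \<and>
          (\<exists>\<psi>''. has_second_deriv_on \<psi> \<psi>'' {u\<^sub>0..} \<and>
            (\<forall>u\<in>{u\<^sub>0..}. - \<psi>'' u + of_real (V u) * \<psi> u = E * \<psi> u))}"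

definition whittaker_solutions :: "real set \<Rightarrow> complex \<Rightarrow> complex \<Rightarrow> (real \<Rightarrow> complex) set" where
  "whittaker_solutions S \<kappa> \<mu> =
     {f. (\<forall>x. x \<notin> S \<longrightarrow> f x = 0) \<and>
         (\<exists>f''. has_second_deriv_on f f'' S \<and>
           (\<forall>x\<in>S. f'' x + (- 1/4 + \<kappa> / of_real x + (1/4 - \<mu>\<^sup>2) / (of_real x)\<^sup>2) * f x = 0))}"

definition whittaker_W :: "complex \<Rightarrow> complex \<Rightarrow> real \<Rightarrow> complex" where
  "whittaker_W \<kappa> \<mu> =
     (THE f. f \<in> whittaker_solutions {0<..} \<kappa> \<mu> \<and>
        (\<lambda>x. f x / (of_real (exp (- x / 2)) * of_real x powr \<kappa>) - 1)
          \<in> O[at_top](\<lambda>x. 1 / of_real x))"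

definition V_pot :: "real \<Rightarrow> real \<Rightarrow> real" where
  "V_pot k u = 1/4 * exp (2 * u) + k * exp u"


section \<open>Square-integrable functions and unbounded operators\<close>

text \<open>
  Elements of the Hilbert space are handled through representatives: \<open>L2 M\<close> consists of functions,
  and two of them are the same vector when they agree almost everywhere.
\<close>

definition L2 :: "'a measure \<Rightarrow> ('a \<Rightarrow> complex) set" where
  "L2 M = {f. f \<in> borel_measurable M \<and> integrable M (\<lambda>x. (norm (f x))\<^sup>2)}"

definition L2_inner :: "'a measure \<Rightarrow> ('a \<Rightarrow> complex) \<Rightarrow> ('a \<Rightarrow> complex) \<Rightarrow> complex" where
  "L2_inner M f g = (\<integral>x. f x * cnj (g x) \<partial>M)"

definition L2_norm :: "'a measure \<Rightarrow> ('a \<Rightarrow> complex) \<Rightarrow> real" where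
  "L2_norm M f = sqrt (\<integral>x. (norm (f x))\<^sup>2 \<partial>M)"

text \<open>
  An unbounded operator \<open>A\<close> is given by its graph, a set of pairs \<open>(f, A f)\<close> of square-integrable
  functions that contains with each pair every pair of a.e. equal functions.
\<close>

type_synonym 'a graph = "(('a \<Rightarrow> complex) \<times> ('a \<Rightarrow> complex)) set"

definition densely_defined :: "'a measure \<Rightarrow> 'a graph \<Rightarrow> bool" where
  "densely_defined M A \<longleftrightarrow>
     (\<forall>f\<in>L2 M. \<forall>\<epsilon>>0. \<exists>g\<in>Domain A. L2_norm M (\<lambda>x. f x - g x) < \<epsilon>)"

definition adjoint_graph :: "'a measure \<Rightarrow> 'a graph \<Rightarrow> 'a graph" where
  "adjoint_graph M A =
     {(g, h). g \<in> L2 M \<and> h \<in> L2 M \<and> (\<forall>(f, Af)\<in>A. L2_inner M Af g = L2_inner M f h)}"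

definition self_adjoint :: "'a measure \<Rightarrow> 'a graph \<Rightarrow> bool" where
  "self_adjoint M A \<longleftrightarrow> densely_defined M A \<and> adjoint_graph M A = A"

text \<open>
  The resolvent set: \<open>A - \<zeta>\<close> maps its domain onto the whole space, and is injective with bounded
  inverse; the last two properties are together the estimate with the constant \<open>C\<close>.
\<close>

definition resolvent_set :: "'a measure \<Rightarrow> 'a graph \<Rightarrow> complex set" where
  "resolvent_set M A =
     {\<zeta>. (\<forall>h\<in>L2 M. \<exists>(f, Af)\<in>A. AE x in M. Af x - \<zeta> * f x = h x) \<and>
          (\<exists>C. \<forall>(f, Af)\<in>A. L2_norm M f \<le> C * L2_norm M (\<lambda>x. Af x - \<zeta> * f x))}"

definition op_spectrum :: "'a measure \<Rightarrow> 'a graph \<Rightarrow> complex set" where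
  "op_spectrum M A = - resolvent_set M A"

definition eigenspace :: "'a graph \<Rightarrow> complex \<Rightarrow> ('a \<Rightarrow> complex) set" where
  "eigenspace A \<zeta> = {f. (f, fscale \<zeta> f) \<in> A}"

definition eigenvalues :: "'a measure \<Rightarrow> 'a graph \<Rightarrow> complex set" where
  "eigenvalues M A = {\<zeta>. \<exists>f\<in>eigenspace A \<zeta>. \<not> (AE x in M. f x = 0)}"

text \<open>Multiplicities are dimensions modulo a.e. equality.\<close>

definition finite_multiplicity :: "'a measure \<Rightarrow> 'a graph \<Rightarrow> complex \<Rightarrow> bool" where
  "finite_multiplicity M A \<zeta> \<longleftrightarrow>
     (\<exists>B. finite B \<and> (\<forall>f\<in>eigenspace A \<zeta>. \<exists>g\<in>cfun.span B. AE x in M. f x = g x))"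

definition simple_eigenvalue :: "'a measure \<Rightarrow> 'a graph \<Rightarrow> complex \<Rightarrow> bool" where
  "simple_eigenvalue M A \<zeta> \<longleftrightarrow>
     (\<exists>b\<in>eigenspace A \<zeta>. \<not> (AE x in M. b x = 0) \<and>
        (\<forall>f\<in>eigenspace A \<zeta>. \<exists>c. AE x in M. f x = c * b x))"

text \<open>The essential spectrum is empty.\<close>

definition pure_discrete_spectrum :: "'a measure \<Rightarrow> 'a graph \<Rightarrow> bool" where
  "pure_discrete_spectrum M A \<longleftrightarrow>
     (\<forall>\<zeta>\<in>op_spectrum M A. \<zeta> isolated_in op_spectrum M A \<and>
        \<zeta> \<in> eigenvalues M A \<and> finite_multiplicity M A \<zeta>)"

definition simple_spectrum :: "'a measure \<Rightarrow> 'a graph \<Rightarrow> bool" where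
  "simple_spectrum M A \<longleftrightarrow> (\<forall>\<zeta>\<in>eigenvalues M A. simple_eigenvalue M A \<zeta>)"


section \<open>Schroedinger operators on a half-line\<close>

abbreviation half_line :: "real \<Rightarrow> real measure" where
  "half_line u\<^sub>0 \<equiv> lebesgue_on {u\<^sub>0<..}"

definition limit_point_type :: "real \<Rightarrow> (real \<Rightarrow> real) \<Rightarrow> bool" where
  "limit_point_type u\<^sub>0 V \<longleftrightarrow>
     continuous_on {u\<^sub>0..} V \<and>
     (\<forall>E. E \<notin> \<real> \<longrightarrow>
        (\<exists>\<psi> \<in> schrodinger_solutions u\<^sub>0 V E \<inter> L2 (half_line u\<^sub>0). \<psi> \<noteq> 0 \<and>
           (\<forall>\<phi> \<in> schrodinger_solutions u\<^sub>0 V E \<inter> L2 (half_line u\<^sub>0). \<exists>c. \<phi> = fscale c \<psi>)))"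

definition abs_continuous_on :: "real \<Rightarrow> real \<Rightarrow> (real \<Rightarrow> complex) \<Rightarrow> bool" where
  "abs_continuous_on a b f \<longleftrightarrow>
     (\<forall>\<epsilon>>0. \<exists>\<delta>>0. \<forall>(n::nat) l r.
        (\<forall>i<n. a \<le> l i \<and> l i \<le> r i \<and> r i \<le> b) \<and>
        (\<forall>i<n. \<forall>j<n. i \<noteq> j \<longrightarrow> {l i<..<r i} \<inter> {l j<..<r j} = {}) \<and>
        (\<Sum>i<n. r i - l i) < \<delta> \<longrightarrow>
        (\<Sum>i<n. norm (f (r i) - f (l i))) < \<epsilon>)"

text \<open>
  The functions \<open>F\<close> of the domain are \<open>C\<^sup>1\<close> representatives of vectors; \<open>F''\<close> is the
  derivative of the locally absolutely continuous \<open>F'\<close>, which exists almost everywhere.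
\<close>

definition schrodinger_operator :: "real \<Rightarrow> real \<Rightarrow> (real \<Rightarrow> real) \<Rightarrow> real graph" where
  "schrodinger_operator u\<^sub>0 \<alpha> V =
     {(f, g). f \<in> L2 (half_line u\<^sub>0) \<and> g \<in> L2 (half_line u\<^sub>0) \<and>
        (\<exists>F F' F''.
           (\<forall>u\<in>{u\<^sub>0..}. (F has_vector_derivative F' u) (at u within {u\<^sub>0..})) \<and>
           continuous_on {u\<^sub>0..} F' \<and>
           (\<forall>b\<ge>u\<^sub>0. abs_continuous_on u\<^sub>0 b F') \<and>
           (AE u in half_line u\<^sub>0. (F' has_vector_derivative F'' u) (at u)) \<and>
           of_real (cos \<alpha>) * F u\<^sub>0 + of_real (sin \<alpha>) * F' u\<^sub>0 = 0 \<and>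
           (AE u in half_line u\<^sub>0. f u = F u) \<and>
           (AE u in half_line u\<^sub>0. g u = - F'' u + of_real (V u) * F u))}"

end

theory Submission
  imports Defs
begin

text \<open>
  The substitution \<open>x = exp u\<close>, \<open>f x = sqrt x * \<psi> (ln x)\<close> turns Whittaker's equation with
  \<open>\<kappa> = - k\<close> and \<open>\<mu>\<^sup>2 = - E\<close> into the Schroedinger equation \<open>\<psi>'' = (V_pot k - E) \<psi>\<close>, whose
  solution space is two-dimensional by existence and uniqueness for linear equations
  (\<open>linear_ode_exists\<close>, \<open>sol_on_unique_half_line\<close>).

  \<^emph>\<open>Square-integrable solutions.\<close> The prescribed asymptotics of the Whittaker function become
  \<open>\<psi> u / weight k u = 1 + O(exp (- u))\<close> with \<open>weight k u = exp (- u / 2 - exp u / 2 - k * u)\<close>. The weight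
  is itself a solution for the energy \<open>- (1 / 2 + k)\<^sup>2\<close>, so for every energy \<open>\<psi> / weight k\<close>
  solves an integral equation from infinity that a contraction solves near infinity; this yields a
  solution \<open>\<psi>\<close> for every complex \<open>E\<close> (\<open>recessive_solution_exists\<close>), called recessive below. On the
  other hand, beyond a point where \<open>V_pot k \<ge> Re E\<close> the square of the norm of a solution is convex, so
  it can only be integrable if it decreases (\<open>square_integrable_solution_decays\<close>). Two independent
  square-integrable solutions would have a combination with equal value and slope \<open>1\<close> at such a point,
  which increases. Hence the square-integrable solutions are the multiples of the recessive
  one, the potential is of limit point type, and the asymptotics determine the Whittaker function
  (\<open>whittaker_W_recessive\<close>), whose dependence on \<open>\<mu>\<close> is through \<open>\<mu>\<^sup>2\<close> only.

  \<^emph>\<open>The operator.\<close> Let \<open>\<phi>\<close> be the solution that satisfies the boundary condition at \<open>u\<^sub>0\<close>. When the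
  recessive \<open>\<psi>\<close> violates it, the two are independent and their Green kernel satisfies
  \<open>\<integral>v. (norm (kern u v))\<^sup>2 \<le> K * exp (- u)\<close> (\<open>kern_bound\<close>), because \<open>\<psi>\<close> decays like the weight and
  \<open>\<phi>\<close> grows at most like its inverse (\<open>solution_growth\<close>). So the integral operator of the kernel is
  bounded, and it inverts \<open>H - E\<close>: that it maps into the domain uses that indefinite integrals of
  integrable functions are absolutely continuous and differentiable almost everywhere, that nothing
  else is in the domain uses the fundamental theorem for absolutely continuous functions. When \<open>\<psi>\<close>
  satisfies the boundary condition, it is an eigenfunction. The spectrum therefore consists of
  eigenvalues, and they are simple.

  \<^emph>\<open>Self-adjointness.\<close> For \<open>E\<close> real and very negative, the decay of the recessive solution is so fast
  that it violates the boundary condition (\<open>recessive_boundary_nonzero\<close>). There the kernel is real and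
  symmetric, so by Fubini the inverse of \<open>H - E\<close> is a symmetric operator defined on the whole space,
  and \<open>H\<close> is self-adjoint; the domain is dense because it contains the products of polynomials with
  bump functions.

  \<^emph>\<open>Discreteness.\<close> An eigenfunction \<open>e\<close> for \<open>E'\<close> satisfies
  \<open>e u = (E' - E) * (\<integral>v. kern u v * e v)\<close>. Bessel's inequality for the function \<open>kern u\<close> and
  orthonormal eigenfunctions with \<open>norm (E' - E) \<le> R\<close>, integrated over \<open>u\<close>, bounds their number
  (\<open>finitely_many_eigenvalues_in_ball\<close>).

  \<^emph>\<open>The Dirichlet ground state.\<close> The real solution \<open>y\<close> with \<open>y u\<^sub>0 = 0\<close> and \<open>y' u\<^sub>0 = 1\<close> has no zero
  beyond \<open>u\<^sub>0\<close> for \<open>E = - k\<^sup>2\<close> and has one for large \<open>E\<close>. The energies with a zero form an open set,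
  and so would the energies without one if \<open>y\<close> were never square-integrable; since the real line is
  connected, some \<open>y\<close> is square-integrable and is an eigenfunction. A recessive solution cannot vanish
  at \<open>u\<^sub>0\<close> when \<open>V_pot k \<ge> E\<close> on the whole half-line, so every Dirichlet eigenvalue exceeds some value of
  the potential; as \<open>V_pot k u = (exp u / 2 + k)\<^sup>2 - k\<^sup>2\<close>, this gives the two lower bounds.
\<close>

section \<open>The fundamental theorem for absolutely continuous functions\<close>

text \<open>
  Tagged divisions are sets of tagged intervals, while \<open>abs_continuous_on\<close> speaks of enumerated
  end points; this is the condition in the form in which it meets a gauge.
\<close>

lemma abs_continuous_on_tagged:
  assumes ac: "abs_continuous_on a b f" and \<epsilon>: "0 < \<epsilon>"
  shows "\<exists>\<delta>>0. \<forall>P :: (real \<times> real set) set. finite P \<and>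
       (\<forall>(x, K)\<in>P. \<exists>l r. K = {l..r} \<and> a \<le> l \<and> l \<le> r \<and> r \<le> b) \<and>
       pairwise (\<lambda>X Y. interior (snd X) \<inter> interior (snd Y) = {}) P \<and>
       (\<Sum>(x, K)\<in>P. Sup K - Inf K) < \<delta> \<longrightarrow>
       (\<Sum>(x, K)\<in>P. norm (f (Sup K) - f (Inf K))) < \<epsilon>"
proof -
  obtain \<delta> where \<delta>: "\<delta> > 0" and D: "\<forall>(n::nat) l r.
        (\<forall>i<n. a \<le> l i \<and> l i \<le> r i \<and> r i \<le> b) \<and>
        (\<forall>i<n. \<forall>j<n. i \<noteq> j \<longrightarrow> {l i<..<r i} \<inter> {l j<..<r j} = {}) \<and>
        (\<Sum>i<n. r i - l i) < \<delta> \<longrightarrow> (\<Sum>i<n. norm (f (r i) - f (l i))) < \<epsilon>"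
    using mp[OF spec[OF ac[unfolded abs_continuous_on_def]] \<epsilon>] by (elim exE conjE) (rule that)
  show ?thesis
  proof (intro exI[of _ \<delta>] conjI allI impI \<delta>, elim conjE)
    fix P :: "(real \<times> real set) set"
    assume fin: "finite P"
      and int': "\<forall>(x, K)\<in>P. \<exists>l r. K = {l..r} \<and> a \<le> l \<and> l \<le> r \<and> r \<le> b"
      and pw: "pairwise (\<lambda>X Y. interior (snd X) \<inter> interior (snd Y) = {}) P"
      and small: "(\<Sum>(x, K)\<in>P. Sup K - Inf K) < \<delta>"
    have int: "\<exists>l r. K = {l..r} \<and> a \<le> l \<and> l \<le> r \<and> r \<le> b" if "(x, K) \<in> P" for x K
      using int' that by blast
    obtain h where h: "bij_betw h {..<card P} P"
      using fin ex_bij_betw_nat_finite[of P] by (auto simp: atLeast0LessThan)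
    define l where "l = (\<lambda>i. Inf (snd (h i)))"
    define r where "r = (\<lambda>i. Sup (snd (h i)))"
    have hP: "h i \<in> P" if "i < card P" for i
      using h that by (auto simp: bij_betw_def)
    have K: "snd (h i) = {l i..r i} \<and> a \<le> l i \<and> l i \<le> r i \<and> r i \<le> b" if "i < card P" for i
    proof -
      have "(fst (h i), snd (h i)) \<in> P" using hP[OF that] by simp
      from int[OF this] obtain u v where uv: "snd (h i) = {u..v}" "a \<le> u" "u \<le> v" "v \<le> b" by blast
      then have "l i = u" "r i = v" by (simp_all add: l_def r_def)
      then show ?thesis using uv by simp
    qed
    have "(\<Sum>i<card P. norm (f (r i) - f (l i))) < \<epsilon>"
    proof (rule D[THEN spec, THEN spec, THEN spec, THEN mp], intro conjI)
      show "\<forall>i<card P. \<forall>j<card P. i \<noteq> j \<longrightarrow> {l i<..<r i} \<inter> {l j<..<r j} = {}"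
      proof (intro allI impI)
        fix i j assume ij: "i < card P" "j < card P" "i \<noteq> j"
        then have "h i \<noteq> h j" using h by (auto simp: bij_betw_def inj_on_def)
        then have "interior (snd (h i)) \<inter> interior (snd (h j)) = {}"
          using pw hP ij by (auto simp: pairwise_def)
        then show "{l i<..<r i} \<inter> {l j<..<r j} = {}"
          using K ij by (simp add: interior_atLeastAtMost_real)
      qed
      have "(\<Sum>i<card P. r i - l i) = (\<Sum>X\<in>P. Sup (snd X) - Inf (snd X))"
        unfolding l_def r_def by (rule sum.reindex_bij_betw[OF h])
      then show "(\<Sum>i<card P. r i - l i) < \<delta>"
        using small by (simp add: case_prod_beta)
    qed (use K in auto)
    also have "(\<Sum>i<card P. norm (f (r i) - f (l i))) = (\<Sum>X\<in>P. norm (f (Sup (snd X)) - f (Inf (snd X))))"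
      unfolding l_def r_def
      by (rule sum.reindex_bij_betw[OF h, where g="\<lambda>X. norm (f (Sup (snd X)) - f (Inf (snd X)))"])
    finally show "(\<Sum>(x, K)\<in>P. norm (f (Sup K) - f (Inf K))) < \<epsilon>"
      by (simp add: case_prod_beta)
  qed
qed

text \<open>
  A difference quotient over an interval that contains the point \<open>x\<close> is as close to the derivative at
  \<open>x\<close> as the two one-sided ones.
\<close>

lemma straddle_bound:
  fixes f :: "real \<Rightarrow> 'a::real_normed_vector"
  assumes "u \<le> x" "x \<le> v"
    and "norm (f u - f x - (u - x) *\<^sub>R D) \<le> e * norm (u - x)"
    and "norm (f v - f x - (v - x) *\<^sub>R D) \<le> e * norm (v - x)"
  shows "norm ((v - u) *\<^sub>R D - (f v - f u)) \<le> e * (v - u)"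
proof -
  have eq: "(v - u) *\<^sub>R D - (f v - f u) = (f u - f x - (u - x) *\<^sub>R D) - (f v - f x - (v - x) *\<^sub>R D)"
    by (simp add: algebra_simps)
  have "norm ((v - u) *\<^sub>R D - (f v - f u)) \<le> e * norm (u - x) + e * norm (v - x)"
    unfolding eq by (rule order_trans[OF norm_triangle_ineq4 add_mono[OF assms(3,4)]])
  also have "\<dots> = e * (v - u)" using assms(1,2) by (simp add: algebra_simps)
  finally show ?thesis .
qed

text \<open>
  The gauge is chosen in two ways. At a point of differentiability the straddle bound makes the
  increment over a fine interval close to derivative times length. The exceptional null set is covered
  by an open set of measure below the \<open>\<delta>\<close> of absolute continuity, and the gauge keeps intervals with
  an exceptional tag inside it, so the sum of the increments over those intervals is small. Since the
  increments telescope to \<open>f b - f a\<close>, the Riemann sums converge to it. The Henstock-Kurzweil integral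
  makes this work without knowing beforehand that \<open>f'\<close> is integrable.
\<close>

theorem abs_continuous_on_has_integral:
  assumes ab: "a \<le> b" and ac: "abs_continuous_on a b f" and N: "negligible N"
    and der: "\<And>x. x \<in> {a..b} - N \<Longrightarrow> (f has_vector_derivative f' x) (at x within {a..b})"
  shows "(f' has_integral (f b - f a)) {a..b}"
proof (cases "a = b")
  case True then show ?thesis by (simp add: has_integral_refl)
next
  case False
  with ab have ab': "a < b" by simp
  \<comment> \<open>On the null set the derivative may be any value, so it is replaced by zero there.\<close>
  define g where "g x = (if x \<in> N then 0 else f' x)" for x
  have "(g has_integral (f b - f a)) {a..b}"
    unfolding has_integral_factor_content_real
  proof (intro allI impI)
    fix e :: real assume e: "e > 0"
    have pos: "0 < e / 2 * (b - a)" using e ab' by simp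
    obtain \<delta> where \<delta>: "0 < \<delta>" and D: "\<forall>P :: (real \<times> real set) set. finite P \<and>
       (\<forall>(x, K)\<in>P. \<exists>l r. K = {l..r} \<and> a \<le> l \<and> l \<le> r \<and> r \<le> b) \<and>
       pairwise (\<lambda>X Y. interior (snd X) \<inter> interior (snd Y) = {}) P \<and>
       (\<Sum>(x, K)\<in>P. Sup K - Inf K) < \<delta> \<longrightarrow>
       (\<Sum>(x, K)\<in>P. norm (f (Sup K) - f (Inf K))) < e / 2 * (b - a)"
      using abs_continuous_on_tagged[OF ac pos] by (elim exE conjE) (rule that)
    obtain T where T: "open T" "N \<subseteq> T" "(T - N) \<in> lmeasurable" "emeasure lebesgue (T - N) < ennreal \<delta>"
      using sets_lebesgue_outer_open[OF negligible_imp_sets[OF N] \<delta>] by blast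
    have Tm: "T \<in> lmeasurable" "measure lebesgue T < \<delta>"
    proof -
      have N': "N \<in> lmeasurable" using N by (rule negligible_imp_measurable)
      have "T = (T - N) \<union> N" using T(2) by auto
      then show "T \<in> lmeasurable" using T(3) N' by (metis fmeasurable.Un)
      have "measure lebesgue T \<le> measure lebesgue (T - N) + measure lebesgue N"
        using measure_Un_le[of "T - N" lebesgue N] T(3) N' \<open>T = (T - N) \<union> N\<close> by (metis fmeasurableD)
      also have "\<dots> = measure lebesgue (T - N)" using N by (simp add: negligible_imp_measure0)
      also have "\<dots> < \<delta>"
        using T(3,4) by (simp add: emeasure_eq_measure2 ennreal_less_iff)
      finally show "measure lebesgue T < \<delta>" .
    qed
    have "\<forall>x. \<exists>d>0. x \<in> {a..b} - N \<longrightarrow>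
         (\<forall>y\<in>{a..b}. norm (y-x) < d \<longrightarrow> norm (f y - f x - (y-x) *\<^sub>R f' x) \<le> e / 2 * norm (y-x))"
    proof
      fix x
      show "\<exists>d>0. x \<in> {a..b} - N \<longrightarrow>
         (\<forall>y\<in>{a..b}. norm (y-x) < d \<longrightarrow> norm (f y - f x - (y-x) *\<^sub>R f' x) \<le> e / 2 * norm (y-x))"
      proof (cases "x \<in> {a..b} - N")
        case True
        then show ?thesis
          using der[OF True] e unfolding has_vector_derivative_def has_derivative_within_alt
          by (meson half_gt_zero)
      qed (auto intro: exI[of _ 1])
    qed
    then obtain d where d: "\<And>x. 0 < d x"
       "\<And>x y. \<lbrakk>x \<in> {a..b} - N; y \<in> {a..b}; norm (y-x) < d x\<rbrakk>
              \<Longrightarrow> norm (f y - f x - (y-x) *\<^sub>R f' x) \<le> e / 2 * norm (y-x)"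
      by metis
    define \<gamma> where "\<gamma> = (\<lambda>x. if x \<in> N then T else ball x (d x))"
    have gauge: "gauge \<gamma>"
      using T(1,2) d(1) by (auto simp: gauge_def \<gamma>_def)
    show "\<exists>d. gauge d \<and> (\<forall>p. p tagged_division_of {a..b} \<and> d fine p \<longrightarrow>
      norm (sum (\<lambda>(x,k). measure lborel k *\<^sub>R g x) p - (f b - f a)) \<le> e * measure lborel {a..b})"
    proof (intro exI[of _ \<gamma>] conjI gauge allI impI)
      fix p assume p: "p tagged_division_of {a..b} \<and> \<gamma> fine p"
      note pd = tagged_division_ofD[OF p[THEN conjunct1]]
      have fine: "K \<subseteq> \<gamma> x" if "(x, K) \<in> p" for x K using p that by (auto simp: fine_def)
      have int: "\<exists>l r. K = {l..r} \<and> a \<le> l \<and> l \<le> r \<and> r \<le> b" if xK: "(x, K) \<in> p" for x K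
      proof -
        obtain l r where K: "K = cbox l r" using pd(4)[OF xK] by blast
        then show ?thesis using pd(2,3)[OF xK] by (intro exI[of _ l] exI[of _ r]) auto
      qed
      \<comment> \<open>The intervals with an exceptional tag: absolute continuity is applied to them.\<close>
      define q where "q = {X \<in> p. fst X \<in> N}"
      have qp: "q \<subseteq> p" by (auto simp: q_def)
      have finq: "finite q" using pd(1) qp finite_subset by blast
      have pwp: "pairwise (\<lambda>X Y. interior (snd X) \<inter> interior (snd Y) = {}) p"
        using pd(5) by (force simp: pairwise_def)
      have pwq: "pairwise (\<lambda>X Y. interior (snd X) \<inter> interior (snd Y) = {}) q"
        using pwp qp by (rule pairwise_subset)
      have neg: "pairwise (\<lambda>X Y. negligible (snd X \<inter> snd Y)) q"
        unfolding pairwise_def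
      proof (intro ballI impI)
        fix X Y assume XY: "X \<in> q" "Y \<in> q" "X \<noteq> Y"
        obtain l r l' r' where lr: "snd X = cbox l r" "snd Y = cbox l' r'"
          using XY qp by (metis pd(4) prod.collapse subsetD)
        have "interior (snd X) \<inter> interior (snd Y) = {}" using pwq XY by (auto simp: pairwise_def)
        then have "interior (snd X \<inter> snd Y) = {}" by simp
        moreover have "convex (snd X \<inter> snd Y)" using lr by (auto intro: convex_Int)
        ultimately show "negligible (snd X \<inter> snd Y)"
          using negligible_convex_interior by blast
      qed
      have "(\<Sum>(x, K)\<in>q. Sup K - Inf K) = (\<Sum>X\<in>q. measure lebesgue (snd X))"
      proof (rule sum.cong[OF refl])
        fix X assume "X \<in> q"
        then have "(fst X, snd X) \<in> p" using qp by auto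
        from int[OF this] obtain l r where "snd X = {l..r}" "l \<le> r" by blast
        then show "(case X of (x, K) \<Rightarrow> Sup K - Inf K) = measure lebesgue (snd X)"
          by (simp add: case_prod_beta)
      qed
      also have "\<dots> = measure lebesgue (\<Union>(snd ` q))"
      proof (rule measure_negligible_finite_Union_image[symmetric, OF finq _ neg])
        fix X assume "X \<in> q"
        then have "(fst X, snd X) \<in> p" using qp by auto
        from int[OF this] show "snd X \<in> lmeasurable" by auto
      qed
      also have "\<dots> \<le> measure lebesgue T"
      proof (rule measure_mono_fmeasurable)
        show "\<Union>(snd ` q) \<subseteq> T" using fine by (fastforce simp: q_def \<gamma>_def)
        show "\<Union>(snd ` q) \<in> sets lebesgue"
        proof (rule sets.finite_Union)
          show "snd ` q \<subseteq> sets lebesgue"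
          proof safe
            fix x K assume "(x, K) \<in> q"
            then have "(x, K) \<in> p" using qp by blast
            from int[OF this] show "snd (x, K) \<in> sets lebesgue" by auto
          qed
        qed (use finq in auto)
      qed (use Tm in auto)
      also have "\<dots> < \<delta>" by (rule Tm)
      finally have qsmall: "(\<Sum>(x, K)\<in>q. norm (f (Sup K) - f (Inf K))) < e / 2 * (b - a)"
        using int qp by (intro D[rule_format] conjI finq pwq) auto
      \<comment> \<open>Increments and lengths both telescope over the division.\<close>
      have tel: "f b - f a = (\<Sum>(x,K)\<in>p. f(Sup K) - f(Inf K))" "b - a = (\<Sum>(x,K)\<in>p. Sup K - Inf K)"
        using additive_tagged_division_1[OF ab p[THEN conjunct1], of f]
          additive_tagged_division_1[OF ab p[THEN conjunct1], of "\<lambda>x. x"] by auto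
      have "norm (sum (\<lambda>(x,k). measure lborel k *\<^sub>R g x) p - (f b - f a))
          = norm (\<Sum>(x,K)\<in>p. measure lborel K *\<^sub>R g x - (f(Sup K) - f(Inf K)))"
        unfolding tel(1) by (simp add: sum_subtractf case_prod_beta)
      also have "\<dots> \<le> (\<Sum>(x,K)\<in>p. e / 2 * (Sup K - Inf K) + (if x \<in> N then norm (f (Sup K) - f (Inf K)) else 0))"
      proof (rule sum_norm_le, safe)
        fix x K assume xK: "(x, K) \<in> p"
        obtain u v where uv: "K = {u..v}" "a \<le> u" "u \<le> v" "v \<le> b" using int[OF xK] by blast
        show "norm (measure lborel K *\<^sub>R g x - (f (Sup K) - f (Inf K)))
             \<le> e / 2 * (Sup K - Inf K) + (if x \<in> N then norm (f (Sup K) - f (Inf K)) else 0)"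
        proof (cases "x \<in> N")
          case True
          then show ?thesis using uv e by (simp add: g_def norm_minus_commute)
        next
          case False
          have x: "u \<le> x" "x \<le> v" "x \<in> {a..b} - N" using pd(2)[OF xK] uv False by auto
          have sub: "K \<subseteq> ball x (d x)" using fine[OF xK] False by (auto simp: \<gamma>_def)
          have "u \<in> K" "v \<in> K" using uv by auto
          with sub have "u \<in> ball x (d x)" "v \<in> ball x (d x)" by blast+
          then have "norm (u - x) < d x" "norm (v - x) < d x"
            by (simp_all add: dist_norm abs_minus_commute)
          then have "norm ((v - u) *\<^sub>R f' x - (f v - f u)) \<le> e / 2 * (v - u)"
            using uv x by (intro straddle_bound[of u x v] d) auto
          then show ?thesis using uv False by (simp add: g_def)
        qed
      qed
      also have "\<dots> = e / 2 * (b - a) + (\<Sum>(x,K)\<in>q. norm (f (Sup K) - f (Inf K)))"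
      proof -
        have "(\<Sum>X\<in>p. if fst X \<in> N then norm (f (Sup (snd X)) - f (Inf (snd X))) else 0)
          = (\<Sum>X\<in>q. norm (f (Sup (snd X)) - f (Inf (snd X))))"
          unfolding q_def using pd(1) by (simp add: sum.inter_filter)
        then show ?thesis
          unfolding tel(2) by (simp add: sum.distrib sum_distrib_left case_prod_beta)
      qed
      also have "\<dots> \<le> e / 2 * (b - a) + e / 2 * (b - a)" using qsmall by simp
      also have "\<dots> = e * measure lborel {a..b}" using ab by simp
      finally show "norm (sum (\<lambda>(x,k). measure lborel k *\<^sub>R g x) p - (f b - f a)) \<le> e * measure lborel {a..b}" .
    qed
  qed
  then show ?thesis
    by (rule has_integral_spike[OF N, rotated]) (simp add: g_def)
qed

section \<open>Closure properties of absolute continuity\<close>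

lemma abs_continuous_on_lipschitz:
  assumes "\<And>x y. a \<le> x \<Longrightarrow> x \<le> y \<Longrightarrow> y \<le> b \<Longrightarrow> norm (f y - f x) \<le> C * (y - x)"
  shows "abs_continuous_on a b f"
  unfolding abs_continuous_on_def
proof (intro allI impI)
  fix \<epsilon> :: real assume \<epsilon>: "\<epsilon> > 0"
  show "\<exists>\<delta>>0. \<forall>(n::nat) l r.
        (\<forall>i<n. a \<le> l i \<and> l i \<le> r i \<and> r i \<le> b) \<and>
        (\<forall>i<n. \<forall>j<n. i \<noteq> j \<longrightarrow> {l i<..<r i} \<inter> {l j<..<r j} = {}) \<and>
        (\<Sum>i<n. r i - l i) < \<delta> \<longrightarrow> (\<Sum>i<n. norm (f (r i) - f (l i))) < \<epsilon>"
  proof (intro exI[of _ "\<epsilon> / (\<bar>C\<bar> + 1)"] conjI allI impI)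
    show "\<epsilon> / (\<bar>C\<bar> + 1) > 0" using \<epsilon> by (simp add: add_nonneg_pos)
    fix n :: nat and l r :: "nat \<Rightarrow> real"
    assume A: "(\<forall>i<n. a \<le> l i \<and> l i \<le> r i \<and> r i \<le> b) \<and>
        (\<forall>i<n. \<forall>j<n. i \<noteq> j \<longrightarrow> {l i<..<r i} \<inter> {l j<..<r j} = {}) \<and>
        (\<Sum>i<n. r i - l i) < \<epsilon> / (\<bar>C\<bar> + 1)"
    have "(\<Sum>i<n. norm (f (r i) - f (l i))) \<le> (\<Sum>i<n. (\<bar>C\<bar> + 1) * (r i - l i))"
    proof (rule sum_mono)
      fix i assume "i \<in> {..<n}"
      then have i: "a \<le> l i" "l i \<le> r i" "r i \<le> b" using A by auto
      have "norm (f (r i) - f (l i)) \<le> C * (r i - l i)" using assms i by blast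
      also have "\<dots> \<le> (\<bar>C\<bar> + 1) * (r i - l i)" using i by (intro mult_right_mono) auto
      finally show "norm (f (r i) - f (l i)) \<le> (\<bar>C\<bar> + 1) * (r i - l i)" .
    qed
    also have "\<dots> = (\<bar>C\<bar> + 1) * (\<Sum>i<n. r i - l i)" by (simp add: sum_distrib_left)
    also have "\<dots> < \<epsilon>" using A by (auto simp: pos_less_divide_eq add_nonneg_pos mult.commute)
    finally show "(\<Sum>i<n. norm (f (r i) - f (l i))) < \<epsilon>" .
  qed
qed

text \<open>
  Linear combinations and products of absolutely continuous functions are both instances: their
  increments are controlled by the increments of the two factors.
\<close>

lemma abs_continuous_on_dominated:
  assumes f: "abs_continuous_on a b f" and g: "abs_continuous_on a b g" and C: "C \<ge> 0"
    and le: "\<And>x y. a \<le> x \<Longrightarrow> x \<le> y \<Longrightarrow> y \<le> b \<Longrightarrow>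
      norm (h y - h x) \<le> C * (norm (f y - f x) + norm (g y - g x))"
  shows "abs_continuous_on a b h"
  unfolding abs_continuous_on_def
proof (intro allI impI)
  fix \<epsilon> :: real assume \<epsilon>: "\<epsilon> > 0"
  define \<eta> where "\<eta> = \<epsilon> / (2 * (C + 1))"
  have \<eta>: "\<eta> > 0" using \<epsilon> C by (simp add: \<eta>_def)
  obtain d1 where d1: "d1 > 0" and D1: "\<forall>(n::nat) l r.
        (\<forall>i<n. a \<le> l i \<and> l i \<le> r i \<and> r i \<le> b) \<and>
        (\<forall>i<n. \<forall>j<n. i \<noteq> j \<longrightarrow> {l i<..<r i} \<inter> {l j<..<r j} = {}) \<and>
        (\<Sum>i<n. r i - l i) < d1 \<longrightarrow> (\<Sum>i<n. norm (f (r i) - f (l i))) < \<eta>"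
    using mp[OF spec[OF f[unfolded abs_continuous_on_def]] \<eta>] by (elim exE conjE) (rule that)
  obtain d2 where d2: "d2 > 0" and D2: "\<forall>(n::nat) l r.
        (\<forall>i<n. a \<le> l i \<and> l i \<le> r i \<and> r i \<le> b) \<and>
        (\<forall>i<n. \<forall>j<n. i \<noteq> j \<longrightarrow> {l i<..<r i} \<inter> {l j<..<r j} = {}) \<and>
        (\<Sum>i<n. r i - l i) < d2 \<longrightarrow> (\<Sum>i<n. norm (g (r i) - g (l i))) < \<eta>"
    using mp[OF spec[OF g[unfolded abs_continuous_on_def]] \<eta>] by (elim exE conjE) (rule that)
  show "\<exists>\<delta>>0. \<forall>(n::nat) l r.
        (\<forall>i<n. a \<le> l i \<and> l i \<le> r i \<and> r i \<le> b) \<and>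
        (\<forall>i<n. \<forall>j<n. i \<noteq> j \<longrightarrow> {l i<..<r i} \<inter> {l j<..<r j} = {}) \<and>
        (\<Sum>i<n. r i - l i) < \<delta> \<longrightarrow> (\<Sum>i<n. norm (h (r i) - h (l i))) < \<epsilon>"
  proof (intro exI[of _ "min d1 d2"] conjI allI impI)
    show "min d1 d2 > 0" using d1 d2 by simp
    fix n :: nat and l r :: "nat \<Rightarrow> real"
    assume A: "(\<forall>i<n. a \<le> l i \<and> l i \<le> r i \<and> r i \<le> b) \<and>
        (\<forall>i<n. \<forall>j<n. i \<noteq> j \<longrightarrow> {l i<..<r i} \<inter> {l j<..<r j} = {}) \<and>
        (\<Sum>i<n. r i - l i) < min d1 d2"
    have F: "(\<Sum>i<n. norm (f (r i) - f (l i))) < \<eta>" using A by (intro D1[THEN spec, THEN spec, THEN spec, THEN mp]) auto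
    have G: "(\<Sum>i<n. norm (g (r i) - g (l i))) < \<eta>" using A by (intro D2[THEN spec, THEN spec, THEN spec, THEN mp]) auto
    have "(\<Sum>i<n. norm (h (r i) - h (l i)))
        \<le> (\<Sum>i<n. C * (norm (f (r i) - f (l i)) + norm (g (r i) - g (l i))))"
      using A by (intro sum_mono le) auto
    also have "\<dots> = C * ((\<Sum>i<n. norm (f (r i) - f (l i))) + (\<Sum>i<n. norm (g (r i) - g (l i))))"
      by (simp add: sum_distrib_left sum.distrib distrib_left)
    also have "\<dots> \<le> C * (\<eta> + \<eta>)" using F G C by (intro mult_left_mono) auto
    also have "\<dots> < (C + 1) * (\<eta> + \<eta>)" using \<eta> by simp
    also have "\<dots> = \<epsilon>"
    proof -
      have "2 * (C + 1) \<noteq> 0" using C by simp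
      then have "2 * (C + 1) * \<eta> = \<epsilon>" unfolding \<eta>_def by (metis nonzero_mult_div_cancel_left times_divide_eq_right)
      then show ?thesis by (simp add: algebra_simps)
    qed
    finally show "(\<Sum>i<n. norm (h (r i) - h (l i))) < \<epsilon>" .
  qed
qed

lemma abs_continuous_on_linear_combination:
  assumes f: "abs_continuous_on a b f" and g: "abs_continuous_on a b g"
  shows "abs_continuous_on a b (\<lambda>x. c * f x + d * g x)"
proof (rule abs_continuous_on_dominated[OF f g, of "norm c + norm d"])
  fix x y
  have "norm (c * f y + d * g y - (c * f x + d * g x)) = norm (c * (f y - f x) + d * (g y - g x))"
    by (simp add: algebra_simps)
  also have "\<dots> \<le> norm c * norm (f y - f x) + norm d * norm (g y - g x)"
    by (metis norm_mult norm_triangle_ineq)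
  also have "\<dots> \<le> (norm c + norm d) * (norm (f y - f x) + norm (g y - g x))"
    by (simp add: algebra_simps)
  finally show "norm (c * f y + d * g y - (c * f x + d * g x))
      \<le> (norm c + norm d) * (norm (f y - f x) + norm (g y - g x))" .
qed simp

lemma abs_continuous_on_mult:
  assumes f: "abs_continuous_on a b f" and g: "abs_continuous_on a b g"
    and cf: "continuous_on {a..b} f" and cg: "continuous_on {a..b} g"
  shows "abs_continuous_on a b (\<lambda>x. f x * g x)"
proof -
  have "bounded (f ` {a..b})" "bounded (g ` {a..b})"
    using cf cg by (auto intro: compact_imp_bounded compact_continuous_image)
  then obtain A B where A: "\<And>x. x \<in> {a..b} \<Longrightarrow> norm (f x) \<le> A" and B: "\<And>x. x \<in> {a..b} \<Longrightarrow> norm (g x) \<le> B"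
    unfolding bounded_iff by (metis imageI)
  show ?thesis
  proof (rule abs_continuous_on_dominated[OF f g, of "\<bar>A\<bar> + \<bar>B\<bar>"])
    fix x y assume xy: "a \<le> x" "x \<le> y" "y \<le> b"
    have "f y * g y - f x * g x = f y * (g y - g x) + (f y - f x) * g x" by (simp add: algebra_simps)
    then have "norm (f y * g y - f x * g x) \<le> norm (f y) * norm (g y - g x) + norm (f y - f x) * norm (g x)"
      by (metis norm_mult norm_triangle_ineq)
    also have "\<dots> \<le> (\<bar>A\<bar> + \<bar>B\<bar>) * norm (g y - g x) + norm (f y - f x) * (\<bar>A\<bar> + \<bar>B\<bar>)"
      using A[of y] B[of x] xy by (intro add_mono mult_right_mono mult_left_mono) auto
    finally show "norm (f y * g y - f x * g x) \<le> (\<bar>A\<bar> + \<bar>B\<bar>) * (norm (f y - f x) + norm (g y - g x))"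
      by (simp add: algebra_simps)
  qed simp
qed

lemma abs_continuous_on_C1:
  assumes "\<And>x. x \<in> {a..b} \<Longrightarrow> (f has_vector_derivative f' x) (at x within {a..b})"
    and "continuous_on {a..b} f'"
  shows "abs_continuous_on a b f"
proof -
  have "bounded (f' ` {a..b})"
    using assms(2) by (auto intro: compact_imp_bounded compact_continuous_image)
  then obtain A where A: "\<And>x. x \<in> {a..b} \<Longrightarrow> norm (f' x) \<le> A"
    unfolding bounded_iff by (metis imageI)
  show ?thesis
  proof (rule abs_continuous_on_lipschitz)
    fix x y assume xy: "a \<le> x" "x \<le> y" "y \<le> b"
    have "norm (f y - f x) \<le> A * norm (y - x)"
    proof (rule differentiable_bound[of "{a..b}" f "\<lambda>x h. h *\<^sub>R f' x"])
      fix t assume "t \<in> {a..b}"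
      then show "(f has_derivative (\<lambda>h. h *\<^sub>R f' t)) (at t within {a..b})"
        using assms(1) by (simp add: has_vector_derivative_def)
      show "onorm (\<lambda>h. h *\<^sub>R f' t) \<le> A"
        using A[OF \<open>t \<in> {a..b}\<close>] by (intro onorm_le) (simp add: mult.commute[of A] mult_left_mono)
    qed (use xy in auto)
    then show "norm (f y - f x) \<le> A * (y - x)" using xy by simp
  qed
qed


section \<open>Differentiation of indefinite integrals almost everywhere\<close>

text \<open>
  By the Henstock lemma, the intervals of a fine tagged partial division over which the increment of
  the indefinite integral misses \<open>g x\<close> times the length by a fraction \<open>e\<close> have small total length.
  Around every point at which the difference quotients fail to converge there are arbitrarily short such
  intervals; a Vitali covering by disjoint ones shows that these points form a null set.
\<close>

theorem indefinite_integral_differentiable_ae: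
  fixes g :: "real \<Rightarrow> 'a::euclidean_space"
  assumes g: "g integrable_on {a..b}"
  obtains N where "negligible N"
    "\<And>x. x \<in> {a<..<b} - N \<Longrightarrow> ((\<lambda>u. integral {a..u} g) has_vector_derivative g x) (at x)"
proof -
  define F where "F u = integral {a..u} g" for u
  \<comment> \<open>The interval between \<open>x\<close> and \<open>y\<close> has a difference quotient that is off by more than \<open>e\<close>; \<open>E e\<close> collects the points with arbitrarily short bad intervals.\<close>
  define bad where "bad e x y \<longleftrightarrow> y \<in> {a<..<b} \<and> y \<noteq> x \<and> norm (F y - F x - (y - x) *\<^sub>R g x) > e * \<bar>y - x\<bar>" for e x y
  define E where "E e = {x \<in> {a<..<b}. \<forall>d>0. \<exists>y. bad e x y \<and> \<bar>y - x\<bar> < d}" for e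
  have Fdiff: "integral {u..v} g = F v - F u" if "a \<le> u" "u \<le> v" "v \<le> b" for u v
  proof -
    have "g integrable_on {a..v}" by (rule integrable_subinterval_real[OF g]) (use that in auto)
    then show ?thesis using Henstock_Kurzweil_Integration.integral_combine[of a u v g] that by (auto simp: F_def algebra_simps)
  qed
  have negE: "negligible (E e)" if e: "e > 0" for e
    unfolding negligible_outer_le
  proof (intro allI impI)
    fix \<eta> :: real assume \<eta>: "\<eta> > 0"
    obtain \<gamma> where \<gamma>: "gauge \<gamma>" and H: "\<And>p. \<lbrakk>p tagged_partial_division_of (cbox a b); \<gamma> fine p\<rbrakk> \<Longrightarrow>
             sum (\<lambda>(x,k). norm(measure lborel k *\<^sub>R g x - integral k g)) p < e * \<eta>"
      using Henstock_lemma[of g a b "e * \<eta>"] g e \<eta> by auto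
    define I where "I z = {min (fst z) (snd z)..max (fst z) (snd z)}" for z :: "real \<times> real"
    define K where "K = {z. fst z \<in> {a<..<b} \<and> bad e (fst z) (snd z) \<and> I z \<subseteq> \<gamma> (fst z)}"
    \<comment> \<open>The Vitali covering theorem is about balls, so the bad interval between \<open>x\<close> and \<open>y\<close> is written with its midpoint and radius.\<close>
    define c where "c z = (fst z + snd z) / 2" for z :: "real \<times> real"
    define r where "r z = \<bar>fst z - snd z\<bar> / 2" for z :: "real \<times> real"
    have cb: "cball (c z) (r z) = I z" for z
      unfolding cball_eq_atLeastAtMost I_def c_def r_def
      by (rule arg_cong2[where f=atLeastAtMost]) (auto simp: min_def max_def field_simps abs_real_def)
    have r0: "0 < r z" if "z \<in> K" for z using that by (auto simp: K_def bad_def r_def)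
    have cover: "\<exists>z. z \<in> K \<and> x \<in> cball (c z) (r z) \<and> r z < d" if x: "x \<in> E e" and d: "d > 0" for x d
    proof -
      obtain \<rho> where \<rho>: "\<rho> > 0" "ball x \<rho> \<subseteq> \<gamma> x"
        using \<gamma> by (metis gauge_def open_contains_ball)
      have "min \<rho> d > 0" using \<rho> d by simp
      then obtain y where y: "bad e x y" "\<bar>y - x\<bar> < min \<rho> d" using x unfolding E_def by blast
      have "I (x, y) \<subseteq> ball x \<rho>" using y(2) by (auto simp: I_def dist_real_def min_def max_def split: if_splits)
      then have "(x, y) \<in> K" using x y(1) \<rho> by (auto simp: K_def E_def)
      moreover have "x \<in> cball (c (x,y)) (r (x,y))" unfolding cb by (auto simp: I_def)
      moreover have "r (x, y) < d" using y(2) by (auto simp: r_def)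
      ultimately show ?thesis by blast
    qed
    obtain C where C: "countable C" "C \<subseteq> K" "pairwise (\<lambda>i j. disjnt (cball (c i) (r i)) (cball (c j) (r j))) C"
      "negligible (E e - (\<Union>i\<in>C. cball (c i) (r i)))"
      by (rule Vitali_covering_theorem_cballs[of K r "E e" c, OF r0 cover])
    have pw: "disjnt (I i) (I j)" if "i \<in> C" "j \<in> C" "i \<noteq> j" for i j
      using C(3) that unfolding cb by (auto simp: pairwise_def)
    \<comment> \<open>Finitely many disjoint bad intervals, tagged by their bad end point, form a fine partial division.\<close>
    have bound: "measure lebesgue (\<Union>i\<in>D. I i) \<le> \<eta>" if D: "D \<subseteq> C" "finite D" for D
    proof -
      define p where "p = (\<lambda>z. (fst z, I z)) ` D"
      have inj: "inj_on (\<lambda>z. (fst z, I z)) D"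
      proof (rule inj_onI)
        fix i j assume ij: "i \<in> D" "j \<in> D" "(fst i, I i) = (fst j, I j)"
        show "i = j"
        proof (rule ccontr)
          assume "i \<noteq> j"
          then have "disjnt (I i) (I j)" using pw ij D by blast
          moreover have "fst i \<in> I i" by (auto simp: I_def)
          ultimately show False using ij by (auto simp: disjnt_def)
        qed
      qed
      have tp: "p tagged_partial_division_of cbox a b"
        unfolding tagged_partial_division_of_def
      proof (intro conjI allI impI)
        show "finite p" using D by (simp add: p_def)
        fix x k assume "(x, k) \<in> p"
        then obtain z where z: "z \<in> D" "x = fst z" "k = I z" by (auto simp: p_def)
        with D C have zK: "z \<in> K" by blast
        show "x \<in> k" using z by (auto simp: I_def)
        show "k \<subseteq> cbox a b" using z zK by (auto simp: I_def K_def bad_def)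
        show "\<exists>a b. k = cbox a b" using z by (auto simp: I_def)
      next
        fix x1 k1 x2 k2 assume A: "(x1, k1) \<in> p \<and> (x2, k2) \<in> p \<and> (x1, k1) \<noteq> (x2, k2)"
        then obtain z1 z2 where z: "z1 \<in> D" "z2 \<in> D" "k1 = I z1" "k2 = I z2" "z1 \<noteq> z2" by (auto simp: p_def)
        then have "disjnt k1 k2" using pw D by blast
        then show "interior k1 \<inter> interior k2 = {}" using interior_subset by (fastforce simp: disjnt_def)
      qed
      have fine: "\<gamma> fine p"
        unfolding fine_def p_def using D C by (auto simp: K_def subset_eq)
      have le: "e * measure lborel (I z) \<le> norm (measure lborel (I z) *\<^sub>R g (fst z) - integral (I z) g)" if "z \<in> D" for z
      proof -
        have zK: "z \<in> K" using that D C by blast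
        obtain x y where z: "z = (x, y)" by (cases z)
        have x: "a < x" "x < b" and y: "a < y" "y < b" "norm (F y - F x - (y - x) *\<^sub>R g x) > e * \<bar>y - x\<bar>"
          using zK by (auto simp: K_def bad_def z)
        show ?thesis
        proof (cases "x \<le> y")
          case True
          then have "integral (I z) g = F y - F x" "measure lborel (I z) = y - x" using Fdiff[of x y] x y by (auto simp: I_def z)
          then show ?thesis using y True by (simp add: z norm_minus_commute)
        next
          case False
          then have eq: "integral (I z) g = F x - F y" "measure lborel (I z) = x - y" using Fdiff[of y x] x y by (auto simp: I_def z)
          have "(x - y) *\<^sub>R g x - (F x - F y) = F y - F x - (y - x) *\<^sub>R g x" by (simp add: algebra_simps)
          then show ?thesis unfolding eq using y False by (simp only: z fst_conv) simp
        qed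
      qed
      have "e * measure lebesgue (\<Union>i\<in>D. I i) \<le> e * (\<Sum>i\<in>D. measure lebesgue (I i))"
        using e D by (intro mult_left_mono measure_UNION_le) (auto simp: I_def)
      also have "\<dots> = (\<Sum>z\<in>D. e * measure lborel (I z))" by (simp add: sum_distrib_left I_def)
      also have "\<dots> \<le> (\<Sum>z\<in>D. norm (measure lborel (I z) *\<^sub>R g (fst z) - integral (I z) g))"
        by (intro sum_mono le)
      also have "\<dots> = (\<Sum>(x,k)\<in>p. norm (measure lborel k *\<^sub>R g x - integral k g))"
        unfolding p_def by (subst sum.reindex[OF inj]) simp
      also have "\<dots> < e * \<eta>" by (rule H[OF tp fine])
      finally show ?thesis using e by simp
    qed
    have Im: "I i \<in> lmeasurable" for i by (auto simp: I_def)
    define U where "U = (\<Union>i\<in>C. I i)"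
    have U: "U \<in> lmeasurable" "measure lebesgue U \<le> \<eta>"
      unfolding U_def by (rule fmeasurable_UN_bound[OF C(1) Im bound] measure_UN_bound[OF C(1) Im bound]; assumption)+
    have R: "negligible (E e - U)" using C(4) unfolding cb U_def .
    have Rm: "E e - U \<in> lmeasurable" by (rule negligible_imp_measurable[OF R])
    have "measure lebesgue ((E e - U) \<union> U) \<le> measure lebesgue (E e - U) + measure lebesgue U"
      by (rule measure_Un_le[OF fmeasurableD[OF Rm] fmeasurableD[OF U(1)]])
    then have "measure lebesgue ((E e - U) \<union> U) \<le> \<eta>" using U(2) negligible_imp_measure0[OF R] by linarith
    moreover have "(E e - U) \<union> U \<in> lmeasurable" by (rule fmeasurable.Un[OF Rm U(1)])
    moreover have "E e \<subseteq> (E e - U) \<union> U" by blast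
    ultimately show "\<exists>T. E e \<subseteq> T \<and> T \<in> lmeasurable \<and> measure lebesgue T \<le> \<eta>" by blast
  qed
  show ?thesis
  \<comment> \<open>Countably many tolerances suffice.\<close>
  proof (rule that[of "\<Union>n. E (1 / real (Suc n))"])
    show "negligible (\<Union>n. E (1 / real (Suc n)))" by (intro negligible_countable_Union) (auto intro: negE)
    fix x assume x: "x \<in> {a<..<b} - (\<Union>n. E (1 / real (Suc n)))"
    have "(F has_vector_derivative g x) (at x within {a<..<b})"
      unfolding has_vector_derivative_def has_derivative_within_alt
    proof (intro conjI allI impI)
      fix e :: real assume "e > 0"
      then obtain n where n: "1 / real (Suc n) < e" using nat_approx_posE by blast
      define \<epsilon> where "\<epsilon> = 1 / real (Suc n)"
      have "x \<notin> E \<epsilon>" "x \<in> {a<..<b}" using x unfolding \<epsilon>_def by blast+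
      then have "\<not> (\<forall>d>0. \<exists>y. bad \<epsilon> x y \<and> \<bar>y - x\<bar> < d)" unfolding E_def by simp
      then obtain d where d: "d > 0" "\<And>y. \<bar>y - x\<bar> < d \<Longrightarrow> \<not> bad (1 / real (Suc n)) x y"
        unfolding \<epsilon>_def by meson
      show "\<exists>d>0. \<forall>y\<in>{a<..<b}. norm (y - x) < d \<longrightarrow> norm (F y - F x - (y - x) *\<^sub>R g x) \<le> e * norm (y - x)"
      proof (intro exI[of _ d] conjI d(1) ballI impI)
        fix y assume y: "y \<in> {a<..<b}" "norm (y - x) < d"
        show "norm (F y - F x - (y - x) *\<^sub>R g x) \<le> e * norm (y - x)"
        proof (cases "y = x")
          case False
          then have "norm (F y - F x - (y - x) *\<^sub>R g x) \<le> 1 / real (Suc n) * \<bar>y - x\<bar>"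
            using d(2)[of y] y unfolding bad_def by force
          also have "\<dots> \<le> e * \<bar>y - x\<bar>" using n by (intro mult_right_mono) auto
          finally show ?thesis by simp
        qed simp
      qed
    qed (simp add: bounded_linear_scaleR_left)
    moreover have "at x within {a<..<b} = at x" using x by (intro at_within_open) auto
    ultimately show "((\<lambda>u. integral {a..u} g) has_vector_derivative g x) (at x)"
      unfolding F_def by simp
  qed
qed

text \<open>
  Split \<open>norm g\<close> into its truncation at a height \<open>n\<close> and a rest of small total integral: over
  intervals of total length below \<open>\<epsilon> / (2 * n)\<close> the bounded part contributes at most \<open>\<epsilon> / 2\<close>.
\<close>

theorem abs_continuous_on_indefinite_integral:
  fixes g :: "real \<Rightarrow> complex"
  assumes g: "g absolutely_integrable_on {a..b}"
  shows "abs_continuous_on a b (\<lambda>u. integral {a..u} g)"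
  unfolding abs_continuous_on_def
proof (intro allI impI)
  fix \<epsilon> :: real assume \<epsilon>: "\<epsilon> > 0"
  define h where "h = (\<lambda>x. norm (g x))"
  define t where "t = (\<lambda>n::nat. \<lambda>x. min (h x) (real n))"
  have gi: "g integrable_on {a..b}" and hi: "h integrable_on {a..b}"
    using g by (auto simp: absolutely_integrable_on_def h_def)
  have ha: "h absolutely_integrable_on {a..b}" unfolding h_def using absolutely_integrable_norm[OF g] by (simp add: comp_def)
  have ti: "t n integrable_on {a..b}" for n
  proof -
    have "t n absolutely_integrable_on {a..b}" unfolding t_def
      by (rule absolutely_integrable_min_1[OF ha]) (simp add: absolutely_integrable_on_const)
    then show ?thesis by (rule set_lebesgue_integral_eq_integral(1))
  qed
  have lim: "(\<lambda>n. integral {a..b} (t n)) \<longlonglongrightarrow> integral {a..b} h"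
  proof (rule Equivalence_Lebesgue_Henstock_Integration.dominated_convergence(2)[OF ti hi])
    show "norm (t n x) \<le> h x" if "x \<in> {a..b}" for n x by (auto simp: t_def h_def)
    show "(\<lambda>n. t n x) \<longlonglongrightarrow> h x" if "x \<in> {a..b}" for x
    proof (rule tendsto_eventually)
      obtain m where "h x \<le> real m" using real_arch_simple by blast
      then have "t n x = h x" if "n \<ge> m" for n using that unfolding t_def by (simp add: min_def)
      then show "\<forall>\<^sub>F n in sequentially. t n x = h x" unfolding eventually_sequentially by blast
    qed
  qed
  have "\<forall>\<^sub>F n in sequentially. dist (integral {a..b} (t n)) (integral {a..b} h) < \<epsilon> / 2"
    using tendstoD[OF lim, of "\<epsilon> / 2"] \<epsilon> by simp
  then obtain n where n: "dist (integral {a..b} (t n)) (integral {a..b} h) < \<epsilon> / 2"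
    by (auto simp: eventually_sequentially)
  define s where "s = (\<lambda>x. h x - t n x)"
  have si: "s integrable_on {a..b}" unfolding s_def using hi ti by (intro integrable_diff)
  have s0: "s x \<ge> 0" for x by (simp add: s_def t_def)
  have small: "integral {a..b} s < \<epsilon> / 2"
  proof -
    have "integral {a..b} s = integral {a..b} h - integral {a..b} (t n)"
      unfolding s_def by (rule Henstock_Kurzweil_Integration.integral_diff[OF hi ti])
    then show ?thesis using n unfolding dist_real_def by linarith
  qed
  show "\<exists>\<delta>>0. \<forall>(n::nat) l r.
        (\<forall>i<n. a \<le> l i \<and> l i \<le> r i \<and> r i \<le> b) \<and>
        (\<forall>i<n. \<forall>j<n. i \<noteq> j \<longrightarrow> {l i<..<r i} \<inter> {l j<..<r j} = {}) \<and>
        (\<Sum>i<n. r i - l i) < \<delta> \<longrightarrow>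
        (\<Sum>i<n. norm (integral {a..r i} g - integral {a..l i} g)) < \<epsilon>"
  proof (intro exI[of _ "\<epsilon> / (2 * real (Suc n))"] conjI allI impI)
    show "\<epsilon> / (2 * real (Suc n)) > 0" using \<epsilon> by simp
    fix m :: nat and l r :: "nat \<Rightarrow> real"
    assume A: "(\<forall>i<m. a \<le> l i \<and> l i \<le> r i \<and> r i \<le> b) \<and>
        (\<forall>i<m. \<forall>j<m. i \<noteq> j \<longrightarrow> {l i<..<r i} \<inter> {l j<..<r j} = {}) \<and>
        (\<Sum>i<m. r i - l i) < \<epsilon> / (2 * real (Suc n))"
    \<comment> \<open>Open intervals, because these are the disjoint ones.\<close>
    have one: "norm (integral {a..r i} g - integral {a..l i} g) \<le> real n * (r i - l i) + integral {l i<..<r i} s"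
      if "i < m" for i
    proof -
      have i: "a \<le> l i" "l i \<le> r i" "r i \<le> b" using A that by auto
      have sub: "{l i..r i} \<subseteq> {a..b}" "{a..r i} \<subseteq> {a..b}" using i by auto
      note int = integrable_subinterval_real[OF _ sub(1)]
      have "integral {a..r i} g - integral {a..l i} g = integral {l i..r i} g"
        using Henstock_Kurzweil_Integration.integral_combine[OF i(1,2) integrable_subinterval_real[OF gi sub(2)]]
        by (simp add: algebra_simps)
      also have "norm \<dots> \<le> integral {l i..r i} (\<lambda>x. real n + s x)"
      proof (rule integral_norm_bound_integral)
        show "(\<lambda>x. real n + s x) integrable_on {l i..r i}" by (intro integrable_add int si) auto
        show "norm (g x) \<le> real n + s x" for x by (simp add: s_def t_def h_def)
      qed (rule int[OF gi])
      also have "\<dots> = real n * (r i - l i) + integral {l i..r i} s"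
        using i by (subst Henstock_Kurzweil_Integration.integral_add) (auto intro: int si)
      finally show ?thesis using integral_open_interval_real by metis
    qed
    have "(\<Sum>i<m. integral {l i<..<r i} s) = (\<Sum>i<m. integral {a..b} (\<lambda>x. if x \<in> {l i<..<r i} then s x else 0))"
    proof (rule sum.cong[OF refl])
      fix i assume "i \<in> {..<m}"
      then have "{l i<..<r i} \<subseteq> {a..b}" using A by force
      then have "{l i<..<r i} \<inter> {a..b} = {l i<..<r i}" by blast
      then show "integral {l i<..<r i} s = integral {a..b} (\<lambda>x. if x \<in> {l i<..<r i} then s x else 0)"
        using integral_restrict_Int[of "{a..b}" "{l i<..<r i}" s] by simp
    qed
    also have "\<dots> = integral {a..b} (\<lambda>x. \<Sum>i<m. if x \<in> {l i<..<r i} then s x else 0)"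
    proof (rule integral_sum[symmetric])
      fix i assume "i \<in> {..<m}"
      then have sub: "{l i<..<r i} \<subseteq> {a..b}" "{l i..r i} \<subseteq> {a..b}" using A by force+
      then have "s integrable_on {l i<..<r i}"
        using integrable_subinterval_real[OF si sub(2)] integrable_on_Icc_iff_Ioo by blast
      moreover have "{l i<..<r i} \<inter> {a..b} = {l i<..<r i}" using sub by blast
      ultimately show "(\<lambda>x. if x \<in> {l i<..<r i} then s x else 0) integrable_on {a..b}"
        using integrable_restrict_Int[of "{l i<..<r i}" s "{a..b}"] by simp
    qed simp
    also have "\<dots> \<le> integral {a..b} s"
    proof (rule integral_le)
      show "(\<lambda>x. \<Sum>i<m. if x \<in> {l i<..<r i} then s x else 0) integrable_on {a..b}"
      proof (rule integrable_sum)
        fix i assume "i \<in> {..<m}"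
        then have sub: "{l i<..<r i} \<subseteq> {a..b}" "{l i..r i} \<subseteq> {a..b}" using A by force+
        then have "s integrable_on {l i<..<r i}"
          using integrable_subinterval_real[OF si sub(2)] integrable_on_Icc_iff_Ioo by blast
        moreover have "{l i<..<r i} \<inter> {a..b} = {l i<..<r i}" using sub by blast
        ultimately show "(\<lambda>x. if x \<in> {l i<..<r i} then s x else 0) integrable_on {a..b}"
          using integrable_restrict_Int[of "{l i<..<r i}" s "{a..b}"] by simp
      qed simp
      show "(\<Sum>i<m. if x \<in> {l i<..<r i} then s x else 0) \<le> s x" if "x \<in> {a..b}" for x
      proof (cases "\<exists>j<m. x \<in> {l j<..<r j}")
        case True
        then obtain j where j: "j < m" "x \<in> {l j<..<r j}" by blast
        have "x \<notin> {l i<..<r i}" if "i < m" "i \<noteq> j" for i using A j that by blast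
        then have "(\<Sum>i<m. if x \<in> {l i<..<r i} then s x else 0) = (\<Sum>i<m. if i = j then s x else 0)"
          using j by (intro sum.cong refl) auto
        also have "\<dots> = s x" using j by simp
        finally show ?thesis by simp
      next
        case False
        then have "(\<Sum>i<m. if x \<in> {l i<..<r i} then s x else 0) = 0" by (intro sum.neutral) auto
        then show ?thesis using s0 by simp
      qed
    qed (rule si)
    finally have sle: "(\<Sum>i<m. integral {l i<..<r i} s) < \<epsilon> / 2" using small by simp
    have "(\<Sum>i<m. norm (integral {a..r i} g - integral {a..l i} g))
        \<le> (\<Sum>i<m. real n * (r i - l i) + integral {l i<..<r i} s)"
      by (intro sum_mono one) simp
    also have "\<dots> = real n * (\<Sum>i<m. r i - l i) + (\<Sum>i<m. integral {l i<..<r i} s)"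
      by (simp add: sum.distrib sum_distrib_left)
    also have "\<dots> < \<epsilon> / 2 + \<epsilon> / 2"
    proof (rule add_le_less_mono[OF _ sle])
      have "real n * (\<Sum>i<m. r i - l i) \<le> real n * (\<epsilon> / (2 * real (Suc n)))"
        using A by (intro mult_left_mono) auto
      also have "\<dots> \<le> \<epsilon> / 2" using \<epsilon> by (simp add: field_simps)
      finally show "real n * (\<Sum>i<m. r i - l i) \<le> \<epsilon> / 2" .
    qed
    finally show "(\<Sum>i<m. norm (integral {a..r i} g - integral {a..l i} g)) < \<epsilon>" by simp
  qed
qed

section \<open>Uniqueness for second-order linear equations\<close>

text \<open>
  A solution of \<open>y'' = q y\<close> is carried together with its derivative, since initial conditions,
  Wronskians and boundary conditions all involve both.
\<close>

definition sol_on :: "real set \<Rightarrow> (real \<Rightarrow> complex) \<Rightarrow> (real \<Rightarrow> complex) \<Rightarrow> (real \<Rightarrow> complex) \<Rightarrow> bool" where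
  "sol_on S q y y' \<longleftrightarrow> (\<forall>u\<in>S. (y has_vector_derivative y' u) (at u within S) \<and>
     (y' has_vector_derivative q u * y u) (at u within S))"

lemma sol_onD:
  assumes "sol_on S q y y'" "u \<in> S"
  shows "(y has_vector_derivative y' u) (at u within S)"
    "(y' has_vector_derivative q u * y u) (at u within S)"
  using assms by (auto simp: sol_on_def)

lemma sol_on_subset: "sol_on S q y y' \<Longrightarrow> T \<subseteq> S \<Longrightarrow> sol_on T q y y'"
  unfolding sol_on_def by (meson has_vector_derivative_within_subset subsetD)

lemma sol_on_cong:
  assumes "sol_on S q y y'" "\<And>u. u \<in> S \<Longrightarrow> q u = r u" "\<And>u. u \<in> S \<Longrightarrow> y u = z u" "\<And>u. u \<in> S \<Longrightarrow> y' u = z' u"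
  shows "sol_on S r z z'"
  unfolding sol_on_def
proof (intro ballI conjI)
  fix u assume u: "u \<in> S"
  show "(z has_vector_derivative z' u) (at u within S)"
    using has_vector_derivative_transform[OF u _ sol_onD(1)[OF assms(1) u], of z] assms u by simp
  show "(z' has_vector_derivative r u * z u) (at u within S)"
    using has_vector_derivative_transform[OF u _ sol_onD(2)[OF assms(1) u], of z'] assms u by simp
qed

lemma sol_on_continuous:
  assumes "sol_on S q y y'"
  shows "continuous_on S y" "continuous_on S y'"
  using sol_onD[OF assms] by (auto simp: continuous_on_eq_continuous_within intro: has_vector_derivative_continuous)

lemma sol_on_combine:
  assumes "sol_on S q y y'" "sol_on S q z z'"
  shows "sol_on S q (\<lambda>u. c * y u + d * z u) (\<lambda>u. c * y' u + d * z' u)"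
  unfolding sol_on_def
proof (intro ballI conjI)
  fix u assume u: "u \<in> S"
  note D = sol_onD[OF assms(1) u] sol_onD[OF assms(2) u]
  show "((\<lambda>u. c * y u + d * z u) has_vector_derivative c * y' u + d * z' u) (at u within S)"
    using D by (intro has_vector_derivative_add has_vector_derivative_mult_right)
  have "((\<lambda>u. c * y' u + d * z' u) has_vector_derivative c * (q u * y u) + d * (q u * z u)) (at u within S)"
    using D by (intro has_vector_derivative_add has_vector_derivative_mult_right)
  then show "((\<lambda>u. c * y' u + d * z' u) has_vector_derivative q u * (c * y u + d * z u)) (at u within S)"
    by (simp add: algebra_simps)
qed

lemma sol_on_cnj:
  assumes "sol_on S q y y'"
  shows "sol_on S (\<lambda>u. cnj (q u)) (\<lambda>u. cnj (y u)) (\<lambda>u. cnj (y' u))"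
  using assms unfolding sol_on_def
  by (metis bounded_linear.has_vector_derivative bounded_linear_cnj complex_cnj_mult)

lemma has_real_derivative_inner:
  fixes y z :: "real \<Rightarrow> 'a::real_inner"
  assumes "(y has_vector_derivative dy) (at u within S)" "(z has_vector_derivative dz) (at u within S)"
  shows "((\<lambda>u. y u \<bullet> z u) has_real_derivative (y u \<bullet> dz + dy \<bullet> z u)) (at u within S)"
proof -
  have "((\<lambda>u. y u \<bullet> z u) has_derivative (\<lambda>h. y u \<bullet> (h *\<^sub>R dz) + (h *\<^sub>R dy) \<bullet> z u)) (at u within S)"
    using assms unfolding has_vector_derivative_def by (rule has_derivative_inner)
  then show ?thesis
    unfolding has_field_derivative_def by (rule has_derivative_eq_rhs) (auto simp: algebra_simps)
qed

lemma has_real_derivative_norm_squared: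
  fixes y :: "real \<Rightarrow> 'a::real_inner"
  assumes "(y has_vector_derivative dy) (at u within S)"
  shows "((\<lambda>u. (norm (y u))\<^sup>2) has_real_derivative 2 * (y u \<bullet> dy)) (at u within S)"
  using has_real_derivative_inner[OF assms assms] by (simp add: power2_norm_eq_inner inner_commute)

lemma nondecreasing_from_deriv:
  fixes f :: "real \<Rightarrow> real"
  assumes "a \<le> b" and "\<And>x. x \<in> {a..b} \<Longrightarrow> (f has_real_derivative f' x) (at x within {a..b})"
    and "\<And>x. x \<in> {a..b} \<Longrightarrow> f' x \<ge> 0"
  shows "f a \<le> f b"
proof (rule DERIV_nonneg_imp_increasing_open[OF assms(1)])
  fix x assume x: "a < x" "x < b"
  then have "at x within {a..b} = at x" by (intro at_within_interior) auto
  then show "\<exists>y. DERIV f x :> y \<and> 0 \<le> y" using assms(2)[of x] assms(3)[of x] x by auto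
next
  show "continuous_on {a..b} f"
    unfolding continuous_on_eq_continuous_within using assms(2) DERIV_continuous by blast
qed

text \<open>
  The function \<open>c * (x - a) - e x * exp (- M * (x - a))\<close> is nondecreasing.
\<close>

lemma gronwall:
  fixes e :: "real \<Rightarrow> real"
  assumes ab: "a \<le> b" and M: "M \<ge> 0" and c: "c \<ge> 0"
    and der: "\<And>x. x \<in> {a..b} \<Longrightarrow> (e has_real_derivative e' x) (at x within {a..b})"
    and le: "\<And>x. x \<in> {a..b} \<Longrightarrow> e' x \<le> M * e x + c"
  shows "e b \<le> exp (M * (b - a)) * (e a + c * (b - a))"
proof -
  define g where "g x = c * (x - a) - e x * exp (- M * (x - a))" for x
  have "g a \<le> g b"
  proof (rule nondecreasing_from_deriv[OF ab, where f=g])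
    fix x assume x: "x \<in> {a..b}"
    show "(g has_real_derivative (c - (e' x - M * e x) * exp (- M * (x - a)))) (at x within {a..b})"
      unfolding g_def by (rule derivative_eq_intros der[OF x] refl | simp)+ (simp add: algebra_simps)
    have "(e' x - M * e x) * exp (- M * (x - a)) \<le> c * exp (- M * (x - a))"
      using le[OF x] by (intro mult_right_mono) auto
    also have "\<dots> \<le> c * 1" using c M x by (intro mult_left_mono) auto
    finally show "0 \<le> c - (e' x - M * e x) * exp (- M * (x - a))" by simp
  qed
  then have "e b * exp (- M * (b - a)) \<le> e a + c * (b - a)" by (simp add: g_def)
  then have "exp (M * (b - a)) * (e b * exp (- M * (b - a))) \<le> exp (M * (b - a)) * (e a + c * (b - a))"
    by (rule mult_left_mono) simp
  moreover have "exp (M * (b - a)) * (e b * exp (- M * (b - a))) = e b"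
    by (simp add: exp_minus)
  ultimately show ?thesis by metis
qed

text \<open>
  Applied with \<open>r = 0\<close> this gives uniqueness; with \<open>r\<close> the difference of two equations it gives
  continuous dependence on the energy. It is Gronwall's inequality for \<open>norm y\<^sup>2 + norm y'\<^sup>2\<close>, whose
  derivative is estimated by completing squares.
\<close>

lemma energy_estimate:
  fixes y y' :: "real \<Rightarrow> complex"
  assumes ab: "a \<le> b"
    and y: "\<And>u. u \<in> {a..b} \<Longrightarrow> (y has_vector_derivative y' u) (at u within {a..b})"
    and y': "\<And>u. u \<in> {a..b} \<Longrightarrow> (y' has_vector_derivative q u * y u + r u) (at u within {a..b})"
    and Q: "\<And>u. u \<in> {a..b} \<Longrightarrow> norm (q u) \<le> Q" and R: "\<And>u. u \<in> {a..b} \<Longrightarrow> norm (r u) \<le> R"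
  shows "(norm (y b))\<^sup>2 + (norm (y' b))\<^sup>2
     \<le> exp ((2 + Q) * (b - a)) * ((norm (y a))\<^sup>2 + (norm (y' a))\<^sup>2 + R\<^sup>2 * (b - a))"
proof (rule gronwall[OF ab, where e'="\<lambda>u. 2 * (y u \<bullet> y' u) + 2 * (y' u \<bullet> (q u * y u + r u))"])
  have Q0: "Q \<ge> 0" using Q[of a] ab norm_ge_zero order_trans by (metis atLeastAtMost_iff order_refl)
  then show "0 \<le> 2 + Q" by simp
  fix u assume u: "u \<in> {a..b}"
  show "((\<lambda>u. (norm (y u))\<^sup>2 + (norm (y' u))\<^sup>2) has_real_derivative
      2 * (y u \<bullet> y' u) + 2 * (y' u \<bullet> (q u * y u + r u))) (at u within {a..b})"
    by (intro DERIV_add has_real_derivative_norm_squared y y' u)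
  define A where "A = norm (y u)"
  define B where "B = norm (y' u)"
  have AB: "A \<ge> 0" "B \<ge> 0" by (auto simp: A_def B_def)
  have "y u \<bullet> y' u \<le> A * B" unfolding A_def B_def by (rule norm_cauchy_schwarz)
  moreover have "y' u \<bullet> (q u * y u + r u) \<le> B * (Q * A + R)"
  proof -
    have "norm (q u * y u + r u) \<le> norm (q u) * norm (y u) + norm (r u)" by (metis norm_mult norm_triangle_ineq)
    also have "\<dots> \<le> Q * A + R" using Q[OF u] R[OF u] unfolding A_def by (intro add_mono mult_right_mono) auto
    finally have "norm (q u * y u + r u) \<le> Q * A + R" .
    then have "B * norm (q u * y u + r u) \<le> B * (Q * A + R)" using AB by (intro mult_left_mono)
    then show ?thesis using norm_cauchy_schwarz[of "y' u" "q u * y u + r u"] unfolding B_def by linarith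
  qed
  moreover have "2 * (A * B) + 2 * (B * (Q * A + R)) \<le> (2 + Q) * (A\<^sup>2 + B\<^sup>2) + R\<^sup>2"
  proof -
    \<comment> \<open>The difference of the two sides is this sum of squares.\<close>
    have "(1 + Q) * (A - B)\<^sup>2 + (B - R)\<^sup>2 + A\<^sup>2 \<ge> 0" using Q0 by simp
    then show ?thesis by (simp add: power2_eq_square algebra_simps)
  qed
  ultimately show "2 * (y u \<bullet> y' u) + 2 * (y' u \<bullet> (q u * y u + r u)) \<le> (2 + Q) * ((norm (y u))\<^sup>2 + (norm (y' u))\<^sup>2) + R\<^sup>2"
    unfolding A_def B_def by linarith
qed simp

lemma sol_on_zero_forward:
  assumes ab: "a \<le> b" and s: "sol_on {a..b} q y y'" and q: "continuous_on {a..b} q"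
    and 0: "y a = 0" "y' a = 0"
  shows "y b = 0 \<and> y' b = 0"
proof -
  have "bounded (q ` {a..b})" using q by (auto intro: compact_imp_bounded compact_continuous_image)
  then obtain Q where Q: "\<And>u. u \<in> {a..b} \<Longrightarrow> norm (q u) \<le> Q" unfolding bounded_iff by (metis imageI)
  have "(norm (y b))\<^sup>2 + (norm (y' b))\<^sup>2 \<le> exp ((2 + Q) * (b - a)) * ((norm (y a))\<^sup>2 + (norm (y' a))\<^sup>2 + 0\<^sup>2 * (b - a))"
    using sol_onD[OF s] Q by (intro energy_estimate[OF ab, where q=q and r="\<lambda>_. 0"]) auto
  then have "(norm (y b))\<^sup>2 + (norm (y' b))\<^sup>2 \<le> 0" using 0 by simp
  then show ?thesis using sum_power2_le_zero_iff[of "norm (y b)" "norm (y' b)"] by simp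
qed

text \<open>
  Reflection transfers uniqueness from the right of the initial point to the left.
\<close>

lemma sol_on_reflect:
  assumes "sol_on UNIV q y y'"
  shows "sol_on UNIV (\<lambda>u. q (- u)) (\<lambda>u. y (- u)) (\<lambda>u. - y' (- u))"
  unfolding sol_on_def
proof (intro ballI conjI)
  fix u :: real
  have m: "(uminus has_vector_derivative (-1::real)) (at u)"
    by (auto intro!: derivative_eq_intros simp: has_real_derivative_iff_has_vector_derivative[symmetric])
  note d = vector_diff_chain_at[OF m, unfolded comp_def]
  show "((\<lambda>u. y (- u)) has_vector_derivative - y' (- u)) (at u)"
    using d[of y "y' (- u)"] sol_onD[OF assms, of "-u"] by simp
  have "((\<lambda>u. y' (- u)) has_vector_derivative - (q (- u) * y (- u))) (at u)"
    using d[of y' "q (- u) * y (- u)"] sol_onD[OF assms, of "-u"] by simp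
  then show "((\<lambda>u. - y' (- u)) has_vector_derivative q (- u) * y (- u)) (at u)"
    using has_vector_derivative_minus by fastforce
qed

lemma sol_on_unique_half_line:
  assumes y: "sol_on {a..} q y y'" and z: "sol_on {a..} q z z'" and q: "continuous_on {a..} q"
    and eq: "y a = z a" "y' a = z' a" and u: "u \<ge> a"
  shows "y u = z u \<and> y' u = z' u"
proof -
  have "sol_on {a..} q (\<lambda>u. 1 * y u + (-1) * z u) (\<lambda>u. 1 * y' u + (-1) * z' u)"
    by (rule sol_on_combine[OF y z])
  then have s: "sol_on {a..u} q (\<lambda>u. 1 * y u + (-1) * z u) (\<lambda>u. 1 * y' u + (-1) * z' u)"
    by (rule sol_on_subset) auto
  have "continuous_on {a..u} q" using q by (rule continuous_on_subset) auto
  from sol_on_zero_forward[OF u s this] eq show ?thesis by simp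
qed

lemma sol_on_unique_UNIV:
  assumes y: "sol_on UNIV q y y'" and z: "sol_on UNIV q z z'" and q: "continuous_on UNIV q"
    and eq: "y a = z a" "y' a = z' a"
  shows "y = z" "y' = z'"
proof -
  have "y u = z u \<and> y' u = z' u" for u
  proof (cases "u \<ge> a")
    case True
    show ?thesis
      by (rule sol_on_unique_half_line[OF sol_on_subset[OF y] sol_on_subset[OF z] continuous_on_subset[OF q] eq True]) auto
  next
    case False
    have q': "continuous_on {-a..} (\<lambda>u. q (- u))"
      by (intro continuous_on_compose2[OF q] continuous_intros) auto
    have "y (- (- u)) = z (- (- u)) \<and> - y' (- (- u)) = - z' (- (- u))"
      by (rule sol_on_unique_half_line[OF sol_on_subset[OF sol_on_reflect[OF y]] sol_on_subset[OF sol_on_reflect[OF z]] q'])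
        (use eq False in auto)
    then show ?thesis by simp
  qed
  then show "y = z" "y' = z'" by auto
qed

lemma wronskian_constant:
  assumes y: "sol_on S q y y'" and z: "sol_on S q z z'" and S: "convex S" and "u \<in> S" "v \<in> S"
  shows "y u * z' u - y' u * z u = y v * z' v - y' v * z v"
proof -
  have "((\<lambda>u. y u * z' u - y' u * z u) has_vector_derivative 0) (at u within S)" if u: "u \<in> S" for u
  proof -
    have "((\<lambda>u. y u * z' u - y' u * z u) has_vector_derivative
        (y u * (q u * z u) + y' u * z' u) - (y' u * z' u + (q u * y u) * z u)) (at u within S)"
      by (intro has_vector_derivative_diff has_vector_derivative_mult sol_onD[OF y u] sol_onD[OF z u])
    then show ?thesis by (simp add: algebra_simps)
  qed
  then obtain c where "\<And>u. u \<in> S \<Longrightarrow> y u * z' u - y' u * z u = c"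
    using has_vector_derivative_zero_constant[OF S] by blast
  then show ?thesis using assms by metis
qed

section \<open>Existence of solutions\<close>

lemma antiderivative_exists:
  fixes f :: "real \<Rightarrow> 'a::euclidean_space"
  assumes f: "continuous_on UNIV f"
  obtains G where "G a = 0" "\<And>u. (G has_vector_derivative f u) (at u)"
proof -
  define G where "G = (\<lambda>u. LBINT y=ereal a..ereal u. f y)"
  have 0: "G a = 0" by (simp add: G_def)
  have d: "(G has_vector_derivative f u) (at u)" for u
  proof -
    have "(G has_vector_derivative f u) (at u within {min a u - 1..max a u + 1})"
      unfolding G_def
      by (rule interval_integral_FTC2) (auto intro: continuous_on_subset[OF f])
    moreover have "at u within {min a u - 1..max a u + 1} = at u"
      by (intro at_within_interior) auto
    ultimately show ?thesis by simp
  qed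
  show ?thesis by (rule that[OF 0 d])
qed

lemma integral_growth_bound:
  fixes G :: "real \<Rightarrow> 'a::real_normed_vector"
  assumes G: "\<And>u. (G has_vector_derivative g u) (at u)" and p: "\<And>u. (p has_real_derivative p' u) (at u)"
    and le: "\<And>u. a \<le> u \<Longrightarrow> u \<le> b \<Longrightarrow> norm (g u) \<le> p' u" and ab: "a \<le> b"
  shows "norm (G b - G a) \<le> p b - p a"
proof (cases "a = b")
  case False
  show ?thesis
  proof (rule differentiable_bound_general[of a b G p g p'])
    show "continuous_on {a..b} G" using G by (auto intro!: continuous_at_imp_continuous_on has_vector_derivative_continuous)
    show "continuous_on {a..b} p" using p by (auto intro!: continuous_at_imp_continuous_on DERIV_isCont)
  qed (use False ab G p le in \<open>auto simp: has_real_derivative_iff_has_vector_derivative\<close>)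
qed simp

text \<open>
  The integral equation for the pair \<open>(y, y')\<close> is a contraction on the whole line at once if pairs are
  measured with the weight \<open>exp (2 * \<bar>Q\<bar>)\<close>, where \<open>Q\<close> is the antiderivative of the Lipschitz constant
  \<open>1 + norm q\<close> that vanishes at \<open>a\<close>: integrating the weight times \<open>1 + norm q\<close> from \<open>a\<close>
  gives at most half of the weight.
\<close>

theorem linear_ode_exists:
  fixes q :: "real \<Rightarrow> complex"
  assumes q: "continuous_on UNIV q"
  shows "\<exists>y y'. sol_on UNIV q y y' \<and> y a = A \<and> y' a = B"
proof -
  have "continuous_on UNIV (\<lambda>u. 1 + norm (q u))" by (intro continuous_intros q)
  then obtain Q where Qa: "Q a = 0" and Q': "\<And>u. (Q has_vector_derivative 1 + norm (q u)) (at u)"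
    by (rule antiderivative_exists[where a=a]) (rule that)
  have Qd: "(Q has_real_derivative 1 + norm (q u)) (at u)" for u
    using Q' by (simp add: has_real_derivative_iff_has_vector_derivative)
  have Qc: "continuous_on UNIV Q" using Qd by (auto intro!: continuous_at_imp_continuous_on DERIV_isCont)
  define \<rho> where "\<rho> u = exp (2 * \<bar>Q u\<bar>)" for u
  have \<rho>c: "continuous_on UNIV \<rho>" unfolding \<rho>_def by (intro continuous_intros Qc)
  have \<rho>1: "\<rho> u \<ge> 1" for u by (simp add: \<rho>_def)
  have \<rho>0: "\<rho> u > 0" for u by (simp add: \<rho>_def)
  have Qmono: "Q u \<le> Q v" if "u \<le> v" for u v
  proof (rule DERIV_nonneg_imp_nondecreasing[OF that])
    fix x show "\<exists>y. DERIV Q x :> y \<and> 0 \<le> y" by (intro exI[of _ "1 + norm (q x)"] conjI Qd) simp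
  qed
  define F where "F t Y = (snd Y, q t * fst Y)" for t and Y :: "complex \<times> complex"
  have Fle: "norm (F t Y) \<le> (1 + norm (q t)) * norm Y" for t Y
  proof -
    have "norm (F t Y) \<le> norm (snd Y) + norm (q t * fst Y)" unfolding F_def by (rule norm_Pair_le)
    also have "\<dots> \<le> norm Y + norm (q t) * norm Y"
      unfolding norm_mult
      using norm_fst_le[of "fst Y" "snd Y"] norm_snd_le[of "snd Y" "fst Y"] by (intro add_mono mult_left_mono) auto
    finally show ?thesis by (simp add: algebra_simps)
  qed
  have Fdiff: "F t Y - F t Z = F t (Y - Z)" for t Y Z by (simp add: F_def algebra_simps)
  have Fc: "continuous_on UNIV (\<lambda>t. F t (Y t))" if "continuous_on UNIV Y" for Y
    unfolding F_def by (intro continuous_intros that q)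
  \<comment> \<open>The antiderivative that vanishes at \<open>a\<close>, an oriented integral that treats both sides of \<open>a\<close> alike.\<close>
  define anti where "anti f = (SOME G. G a = 0 \<and> (\<forall>u. (G has_vector_derivative f u) (at u)))"
    for f :: "real \<Rightarrow> complex \<times> complex"
  have anti: "anti f a = 0" "(anti f has_vector_derivative f u) (at u)" if "continuous_on UNIV f" for f u
  proof -
    have "\<exists>G. G a = 0 \<and> (\<forall>u. (G has_vector_derivative f u) (at u))"
      using antiderivative_exists[OF that, of a] by metis
    from someI_ex[OF this] show "anti f a = 0" "(anti f has_vector_derivative f u) (at u)"
      by (auto simp: anti_def)
  qed
  \<comment> \<open>The contraction factor one half comes from the factor two in the exponent of the weight.\<close>
  have growth: "norm (G u) \<le> C / 2 * \<rho> u"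
    if G: "G a = 0" "\<And>u. (G has_vector_derivative g u) (at u)" and C: "C \<ge> 0"
      and g: "\<And>u. norm (g u) \<le> (1 + norm (q u)) * (\<rho> u * C)" for G :: "real \<Rightarrow> complex \<times> complex" and g C u
  proof (cases "a \<le> u")
    case True
    have "norm (G u - G a) \<le> C / 2 * exp (2 * Q u) - C / 2 * exp (2 * Q a)"
    proof (rule integral_growth_bound[OF G(2) _ _ True, where p'="\<lambda>u. (1 + norm (q u)) * (exp (2 * Q u) * C)"])
      show "((\<lambda>u. C / 2 * exp (2 * Q u)) has_real_derivative (1 + norm (q t)) * (exp (2 * Q t) * C)) (at t)" for t
        by (rule derivative_eq_intros Qd refl | simp)+
      show "norm (g t) \<le> (1 + norm (q t)) * (exp (2 * Q t) * C)" if "a \<le> t" "t \<le> u" for t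
        using g[of t] Qmono[of a t] Qa that by (simp add: \<rho>_def)
    qed
    also have "\<dots> \<le> C / 2 * \<rho> u" using C Qmono[OF True] Qa by (simp add: \<rho>_def)
    finally show ?thesis using G by simp
  next
    case False
    then have ua: "u \<le> a" by simp
    have "norm (G a - G u) \<le> (- (C / 2) * exp (- 2 * Q a)) - (- (C / 2) * exp (- 2 * Q u))"
    proof (rule integral_growth_bound[OF G(2) _ _ ua, where p'="\<lambda>u. (1 + norm (q u)) * (exp (- 2 * Q u) * C)"])
      show "((\<lambda>u. - (C / 2) * exp (- 2 * Q u)) has_real_derivative (1 + norm (q t)) * (exp (- 2 * Q t) * C)) (at t)" for t
        by (rule derivative_eq_intros Qd refl | simp)+ (simp add: field_simps)
      show "norm (g t) \<le> (1 + norm (q t)) * (exp (- 2 * Q t) * C)" if "u \<le> t" "t \<le> a" for t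
        using g[of t] Qmono[of t a] Qa that by (simp add: \<rho>_def)
    qed
    also have "\<dots> \<le> C / 2 * \<rho> u" using C Qmono[OF ua] Qa by (simp add: \<rho>_def)
    finally show ?thesis using G by simp
  qed
  define f where "f z = (\<lambda>t. F t (\<rho> t *\<^sub>R apply_bcontfun z t))" for z :: "real \<Rightarrow>\<^sub>C (complex \<times> complex)"
  have fc: "continuous_on UNIV (f z)" for z
    unfolding f_def by (intro Fc continuous_intros continuous_on_apply_bcontfun \<rho>c)
  \<comment> \<open>Banach's theorem is applied to the quotient of the pair by the weight, a bounded continuous function.\<close>
  define h where "h z = (\<lambda>u. (1 / \<rho> u) *\<^sub>R ((A, B) + anti (f z) u))" for z
  have hc: "h z \<in> bcontfun" for z
  proof (rule bcontfun_normI)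
    have "continuous_on UNIV (anti (f z))"
      using anti(2)[OF fc] by (auto intro!: continuous_at_imp_continuous_on has_vector_derivative_continuous)
    then show "continuous_on UNIV (h z)"
      unfolding h_def using \<rho>0 by (intro continuous_intros \<rho>c) (auto simp: less_imp_neq[THEN not_sym])
    fix u
    have "norm (anti (f z) u) \<le> norm z / 2 * \<rho> u"
    proof (rule growth[OF anti[OF fc]])
      fix t
      have "norm (f z t) \<le> (1 + norm (q t)) * norm (\<rho> t *\<^sub>R apply_bcontfun z t)" unfolding f_def by (rule Fle)
      also have "\<dots> \<le> (1 + norm (q t)) * (\<rho> t * norm z)"
        using \<rho>0[of t] norm_bounded[of z t] by (intro mult_left_mono) auto
      finally show "norm (f z t) \<le> (1 + norm (q t)) * (\<rho> t * norm z)" .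
    qed simp
    then have "norm ((A, B) + anti (f z) u) \<le> norm (A, B) * \<rho> u + norm z / 2 * \<rho> u"
      using norm_triangle_ineq[of "(A, B)" "anti (f z) u"] mult_left_mono[OF \<rho>1[of u], of "norm (A, B)"] by simp
    then have "norm ((A, B) + anti (f z) u) / \<rho> u \<le> norm (A, B) + norm z / 2"
      using \<rho>0[of u] by (simp add: divide_le_eq algebra_simps)
    then show "norm (h z u) \<le> norm (A, B) + norm z / 2" using \<rho>0[of u] by (simp add: h_def)
  qed
  have "\<exists>!z. Bcontfun (h z) = z"
  proof (rule banach_fix_type[of "1/2"])
    show "\<forall>z w. dist (Bcontfun (h z)) (Bcontfun (h w)) \<le> 1 / 2 * dist z w"
    proof (intro allI)
      fix z w
      show "dist (Bcontfun (h z)) (Bcontfun (h w)) \<le> 1 / 2 * dist z w"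
      proof (rule dist_bound)
        fix u
        have "norm ((\<lambda>u. anti (f z) u - anti (f w) u) u) \<le> dist z w / 2 * \<rho> u"
        proof (rule growth[where g="\<lambda>t. f z t - f w t"])
          show "((\<lambda>u. anti (f z) u - anti (f w) u) has_vector_derivative f z t - f w t) (at t)" for t
            by (intro has_vector_derivative_diff anti fc)
          fix t
          have "norm (f z t - f w t) \<le> (1 + norm (q t)) * norm (\<rho> t *\<^sub>R (apply_bcontfun z t - apply_bcontfun w t))"
            unfolding f_def Fdiff scaleR_right_diff_distrib[symmetric] by (rule Fle)
          also have "\<dots> \<le> (1 + norm (q t)) * (\<rho> t * dist z w)"
            using \<rho>0[of t] dist_bounded[of z t w] by (intro mult_left_mono) (auto simp: dist_norm)
          finally show "norm (f z t - f w t) \<le> (1 + norm (q t)) * (\<rho> t * dist z w)" .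
        qed (simp_all add: anti fc)
        then have "norm (h z u - h w u) \<le> dist z w / 2"
          using \<rho>0[of u] by (simp add: h_def scaleR_right_diff_distrib[symmetric] divide_le_eq)
        then show "dist (apply_bcontfun (Bcontfun (h z)) u) (apply_bcontfun (Bcontfun (h w)) u) \<le> 1 / 2 * dist z w"
          using hc by (simp add: Bcontfun_inverse dist_norm)
      qed
    qed
  qed auto
  then obtain z where z: "Bcontfun (h z) = z" by blast
  define Y where "Y u = \<rho> u *\<^sub>R apply_bcontfun z u" for u
  have Yeq: "Y u = (A, B) + anti (f z) u" for u
  proof -
    have "apply_bcontfun z = h z" using hc[of z] z by (metis Bcontfun_inverse)
    then show ?thesis unfolding Y_def using \<rho>0[of u] by (simp add: h_def)
  qed
  have Yd: "(Y has_vector_derivative F u (Y u)) (at u)" for u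
  proof -
    have "((\<lambda>u. (A, B) + anti (f z) u) has_vector_derivative 0 + f z u) (at u)"
      by (intro has_vector_derivative_add has_vector_derivative_const anti fc)
    moreover have "Y = (\<lambda>u. (A, B) + anti (f z) u)" using Yeq by auto
    moreover have "f z u = F u (Y u)" by (simp add: f_def Y_def)
    ultimately show ?thesis by simp
  qed
  have "sol_on UNIV q (\<lambda>u. fst (Y u)) (\<lambda>u. snd (Y u))"
    unfolding sol_on_def
    using bounded_linear.has_vector_derivative[OF bounded_linear_fst Yd]
      bounded_linear.has_vector_derivative[OF bounded_linear_snd Yd] by (simp add: F_def)
  moreover have "Y a = (A, B)" using Yeq[of a] anti(1)[OF fc] by simp
  ultimately show ?thesis by (intro exI[of _ "\<lambda>u. fst (Y u)"] exI[of _ "\<lambda>u. snd (Y u)"]) simp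
qed

section \<open>Decay of square-integrable solutions\<close>

lemma not_integrable_bounded_below:
  fixes N :: "real \<Rightarrow> real"
  assumes int: "N integrable_on {a..}" and N0: "\<And>u. u \<ge> a \<Longrightarrow> N u \<ge> 0"
    and \<eta>: "\<eta> > 0" and ge: "\<And>u. u \<ge> b \<Longrightarrow> N u \<ge> \<eta>" and ab: "a \<le> b"
  shows False
proof -
  obtain n :: nat where n: "integral {a..} N < real n * \<eta>" using reals_Archimedean3[OF \<eta>] by blast
  have sub: "{b..b + real n} \<subseteq> {a..}" using ab by auto
  have Ni: "N integrable_on {b..b + real n}" using integrable_on_subinterval[of N "{a..}" b "b + real n"] int sub by simp
  have "real n * \<eta> = integral {b..b + real n} (\<lambda>_. \<eta>)" by simp
  also have "\<dots> \<le> integral {b..b + real n} N" using ge by (intro integral_le Ni) auto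
  also have "\<dots> \<le> integral {a..} N" using N0 by (intro integral_subset_le sub Ni int) auto
  finally show False using n by simp
qed

text \<open>
  The quantity \<open>D = y \<bullet> y' + a * norm y\<^sup>2\<close> is nondecreasing, as
  \<open>D' \<ge> norm (y' + a * y)\<^sup>2\<close>. Since \<open>(norm y\<^sup>2)' + 2 * a * norm y\<^sup>2 = 2 * D\<close>, a positive value of \<open>D\<close>
  would keep \<open>norm y\<^sup>2\<close> away from zero and contradict integrability. With \<open>a = 0\<close> the conclusion is that
  the norm does not increase at \<open>u\<^sub>1\<close>; larger \<open>a\<close> bounds the logarithmic derivative by \<open>- a\<close>.
\<close>

theorem square_integrable_solution_decays:
  assumes s: "sol_on {u\<^sub>1..} q y y'" and a: "a \<ge> 0" and q: "\<And>u. u \<ge> u\<^sub>1 \<Longrightarrow> Re (q u) \<ge> a\<^sup>2"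
    and int: "(\<lambda>u. (norm (y u))\<^sup>2) integrable_on {u\<^sub>1..}"
  shows "y u\<^sub>1 \<bullet> y' u\<^sub>1 + a * (norm (y u\<^sub>1))\<^sup>2 \<le> 0"
proof (rule ccontr)
  define N where "N u = (norm (y u))\<^sup>2" for u
  define D where "D u = y u \<bullet> y' u + a * N u" for u
  assume "\<not> y u\<^sub>1 \<bullet> y' u\<^sub>1 + a * (norm (y u\<^sub>1))\<^sup>2 \<le> 0"
  then have \<delta>: "D u\<^sub>1 > 0" by (simp add: D_def N_def)
  have N': "(N has_real_derivative 2 * (y u \<bullet> y' u)) (at u within {b..c})" if "b \<ge> u\<^sub>1" "u \<in> {b..c}" for u b c
    unfolding N_def using that
    by (intro has_real_derivative_norm_squared sol_onD(1)[OF sol_on_subset[OF s]]) auto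
  have mono: "D u\<^sub>1 \<le> D u" if u: "u \<ge> u\<^sub>1" for u
  proof (rule nondecreasing_from_deriv[OF u, where f=D and f'="\<lambda>u. y u \<bullet> (q u * y u) + y' u \<bullet> y' u + a * (2 * (y u \<bullet> y' u))"])
    fix x assume x: "x \<in> {u\<^sub>1..u}"
    have s': "sol_on {u\<^sub>1..u} q y y'" by (rule sol_on_subset[OF s]) auto
    show "(D has_real_derivative y x \<bullet> (q x * y x) + y' x \<bullet> y' x + a * (2 * (y x \<bullet> y' x))) (at x within {u\<^sub>1..u})"
      unfolding D_def
      by (intro DERIV_add DERIV_cmult has_real_derivative_inner N' sol_onD[OF s' x] x order_refl)
    have "y x \<bullet> (q x * y x) = Re (q x) * (y x \<bullet> y x)"
      by (simp add: inner_complex_def algebra_simps)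
    also have "\<dots> \<ge> a\<^sup>2 * (y x \<bullet> y x)" using q[of x] x by (intro mult_right_mono) auto
    finally have "y x \<bullet> (q x * y x) \<ge> a\<^sup>2 * (y x \<bullet> y x)" .
    moreover have "(y' x + a *\<^sub>R y x) \<bullet> (y' x + a *\<^sub>R y x) \<ge> 0" by simp
    then have "y' x \<bullet> y' x + a * (2 * (y x \<bullet> y' x)) + a\<^sup>2 * (y x \<bullet> y x) \<ge> 0"
      by (simp add: inner_add_left inner_add_right inner_commute algebra_simps power2_eq_square)
    ultimately show "0 \<le> y x \<bullet> (q x * y x) + y' x \<bullet> y' x + a * (2 * (y x \<bullet> y' x))" by linarith
  qed
  have low: "N u \<ge> 2 * D u\<^sub>1 * exp (- 2 * a)" if u: "u \<ge> u\<^sub>1 + 1" for u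
  proof -
    \<comment> \<open>Integrate the differential inequality over \<open>{u - 1..u}\<close>, starting from \<open>N (u - 1) \<ge> 0\<close>.\<close>
    define g where "g t = N t * exp (2 * a * (t - (u - 1))) - 2 * D u\<^sub>1 * (t - (u - 1))" for t
    have "g (u - 1) \<le> g u"
    proof (rule nondecreasing_from_deriv[where f=g and f'="\<lambda>t. 2 * D t * exp (2 * a * (t - (u - 1))) - 2 * D u\<^sub>1"])
      fix t assume t: "t \<in> {u - 1..u}"
      show "(g has_real_derivative 2 * D t * exp (2 * a * (t - (u - 1))) - 2 * D u\<^sub>1) (at t within {u - 1..u})"
      proof -
        have E: "((\<lambda>t. exp (2 * a * (t - (u - 1)))) has_real_derivative 2 * a * exp (2 * a * (t - (u - 1)))) (at t within {u - 1..u})"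
          by (auto intro!: derivative_eq_intros)
        have L: "((\<lambda>t. 2 * D u\<^sub>1 * (t - (u - 1))) has_real_derivative 2 * D u\<^sub>1) (at t within {u - 1..u})"
          by (auto intro!: derivative_eq_intros)
        have Nt: "(N has_real_derivative 2 * (y t \<bullet> y' t)) (at t within {u - 1..u})"
          by (rule N') (use u t in auto)
        show ?thesis
          using DERIV_diff[OF DERIV_mult[OF Nt E] L] unfolding g_def by (simp add: D_def algebra_simps)
      qed
      have "2 * D u\<^sub>1 * 1 \<le> 2 * D t * exp (2 * a * (t - (u - 1)))"
        using mono[of t] \<delta> a t u by (intro mult_mono) auto
      then show "0 \<le> 2 * D t * exp (2 * a * (t - (u - 1))) - 2 * D u\<^sub>1" by simp
    qed simp
    moreover have "g (u - 1) \<ge> 0" by (simp add: g_def N_def)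
    ultimately have "2 * D u\<^sub>1 \<le> N u * exp (2 * a)" by (simp add: g_def)
    then show ?thesis by (simp add: exp_minus field_simps)
  qed
  show False
    by (rule not_integrable_bounded_below[of N u\<^sub>1 "2 * D u\<^sub>1 * exp (- 2 * a)" "u\<^sub>1 + 1"])
      (use int low \<delta> in \<open>auto simp: N_def[abs_def]\<close>)
qed

section \<open>Antiderivatives vanishing at infinity\<close>

text \<open>
  The improper integral of \<open>f\<close> from \<open>u\<close> to infinity, described by what is needed of it: minus its
  derivative is \<open>f\<close> and it tends to zero.
\<close>

definition tail :: "(real \<Rightarrow> complex) \<Rightarrow> real \<Rightarrow> complex" where
  "tail f = (SOME A. (\<forall>u. (A has_vector_derivative - f u) (at u)) \<and> (A \<longlongrightarrow> 0) at_top)"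

lemma decreasing_majorant_bound:
  fixes A :: "real \<Rightarrow> complex"
  assumes A: "\<And>u. (A has_vector_derivative - f u) (at u)" and A0: "(A \<longlongrightarrow> 0) at_top"
    and P: "\<And>u. (P has_real_derivative P' u) (at u)" and P0: "(P \<longlongrightarrow> 0) at_top"
    and le: "\<And>u. u \<ge> U \<Longrightarrow> norm (f u) \<le> - P' u" and u: "u \<ge> U"
  shows "norm (A u) \<le> P u"
proof -
  have step: "norm (A v - A u) \<le> P u - P v" if v: "v \<ge> u" for v
  proof -
    have "norm (A v - A u) \<le> - P v - (- P u)"
      by (rule integral_growth_bound[OF A _ _ v, where p'="\<lambda>u. - P' u"])
        (use P le u in \<open>auto intro: DERIV_minus\<close>)
    then show ?thesis by simp
  qed
  have "norm (0 - A u) \<le> P u - 0"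
  proof (rule tendsto_le[OF trivial_limit_at_top_linorder])
    show "((\<lambda>v. P u - P v) \<longlongrightarrow> P u - 0) at_top" by (intro tendsto_intros P0)
    show "((\<lambda>v. norm (A v - A u)) \<longlongrightarrow> norm (0 - A u)) at_top" by (intro tendsto_intros A0)
    show "\<forall>\<^sub>F v in at_top. norm (A v - A u) \<le> P u - P v"
      using eventually_ge_at_top[of u] by eventually_elim (rule step)
  qed
  then show ?thesis by simp
qed

text \<open>
  A majorant \<open>P\<close> that vanishes at infinity with \<open>norm f \<le> - P'\<close> makes every antiderivative of \<open>f\<close>
  Cauchy at infinity, and bounds the tail.
\<close>

lemma tail_exists:
  fixes f :: "real \<Rightarrow> complex"
  assumes f: "continuous_on UNIV f"
    and P: "\<And>u. (P has_real_derivative P' u) (at u)" and P0: "(P \<longlongrightarrow> 0) at_top"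
    and le: "\<And>u. u \<ge> U \<Longrightarrow> norm (f u) \<le> - P' u"
  shows "(tail f has_vector_derivative - f u) (at u)" "(tail f \<longlongrightarrow> 0) at_top"
    "u \<ge> U \<Longrightarrow> norm (tail f u) \<le> P u"
proof -
  obtain G where G: "G U = 0" "\<And>u. (G has_vector_derivative f u) (at u)"
    using antiderivative_exists[OF f, of U] by blast
  have step: "norm (G w - G v) \<le> P v - P w" if "U \<le> v" "v \<le> w" for v w
  proof -
    have "norm (G w - G v) \<le> - P w - (- P v)"
      by (rule integral_growth_bound[OF G(2) _ _ that(2), where p'="\<lambda>u. - P' u"])
        (use P le that in \<open>auto intro: DERIV_minus\<close>)
    then show ?thesis by simp
  qed
  have "\<exists>L. (G \<longlongrightarrow> L) at_top"
  proof -
    have "cauchy_filter (filtermap G at_top)"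
      unfolding cauchy_filter_metric
    proof (intro allI impI)
      fix e :: real assume e: "e > 0"
      have "\<forall>\<^sub>F u in at_top. dist (P u) 0 < e / 2" by (rule tendstoD[OF P0]) (use e in simp)
      then obtain B where B: "\<And>u. u \<ge> B \<Longrightarrow> \<bar>P u\<bar> < e / 2" by (auto simp: eventually_at_top_linorder)
      define c where "c = max U B"
      have cl: "dist (G u) (G c) < e" if "u \<ge> c" for u
        using step[of c u] B[of c] B[of u] that by (auto simp: c_def dist_norm)
      have cl2: "dist (G u) (G v) < e" if "u \<ge> c" "v \<ge> c" for u v
      proof (cases "u \<le> v")
        case True
        then show ?thesis using step[of u v] B[of u] B[of v] that by (auto simp: c_def dist_norm norm_minus_commute)
      next
        case False
        then show ?thesis using step[of v u] B[of u] B[of v] that by (auto simp: c_def dist_norm)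
      qed
      show "\<exists>P. eventually P (filtermap G at_top) \<and> (\<forall>x y. P x \<and> P y \<longrightarrow> dist x y < e)"
        by (rule exI[of _ "\<lambda>x. \<exists>u\<ge>c. x = G u"])
          (use cl2 in \<open>auto simp: eventually_filtermap eventually_at_top_linorder\<close>)
    qed
    then obtain L where "filtermap G at_top \<le> nhds L"
      using complete_UNIV[where 'a=complex] unfolding complete_uniform
      by (metis UNIV_I filtermap_bot_iff principal_UNIV top_greatest trivial_limit_at_top_linorder)
    then show ?thesis unfolding filterlim_def by blast
  qed
  then obtain L where L: "(G \<longlongrightarrow> L) at_top" by blast
  have "\<exists>A. (\<forall>u. (A has_vector_derivative - f u) (at u)) \<and> (A \<longlongrightarrow> 0) at_top"
  proof (intro exI[of _ "\<lambda>u. L - G u"] conjI allI)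
    show "((\<lambda>u. L - G u) has_vector_derivative - f u) (at u)" for u
      using has_vector_derivative_diff[OF has_vector_derivative_const G(2)] by simp
    show "((\<lambda>u. L - G u) \<longlongrightarrow> 0) at_top" using tendsto_diff[OF tendsto_const L, of L] by simp
  qed
  from someI_ex[OF this, folded tail_def]
  have T: "\<And>u. (tail f has_vector_derivative - f u) (at u)" "(tail f \<longlongrightarrow> 0) at_top" by auto
  then show "(tail f has_vector_derivative - f u) (at u)" "(tail f \<longlongrightarrow> 0) at_top" by auto
  show "norm (tail f u) \<le> P u" if "u \<ge> U"
    by (rule decreasing_majorant_bound[OF T P P0 le that])
qed

section \<open>Construction of the recessive solution\<close>

text \<open>
  The asymptotics \<open>exp (- x / 2) * x powr (- k)\<close> of the Whittaker function at \<open>x = exp u\<close>, times the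
  factor \<open>exp (- u / 2)\<close> from the change of variables.
\<close>

definition weight :: "real \<Rightarrow> real \<Rightarrow> real" where
  "weight k u = exp (- u / 2 - exp u / 2 - k * u)"

text \<open>
  Minus the logarithmic derivative of the weight.
\<close>

definition log_slope :: "real \<Rightarrow> real \<Rightarrow> real" where
  "log_slope k u = 1 / 2 + k + exp u / 2"

lemma weight_pos [simp]: "weight k u > 0" "weight k u \<noteq> 0" by (simp_all add: weight_def)

lemma weight_deriv: "(weight k has_real_derivative - log_slope k u * weight k u) (at u within S)"
  unfolding weight_def[abs_def] log_slope_def
  by (auto intro!: derivative_eq_intros simp: field_simps)

lemma log_slope_deriv: "(log_slope k has_real_derivative exp u / 2) (at u within S)"
  unfolding log_slope_def[abs_def] by (auto intro!: derivative_eq_intros)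

lemma weight_continuous: "continuous_on S (weight k)"
  unfolding weight_def[abs_def] by (intro continuous_intros) auto

definition potE :: "real \<Rightarrow> complex \<Rightarrow> real \<Rightarrow> complex" where
  "potE k E u = of_real (V_pot k u) - E"

lemma potE_continuous: "continuous_on S (potE k E)"
  unfolding potE_def[abs_def] V_pot_def by (intro continuous_intros)

text \<open>
  The left side is the coefficient \<open>weight''/weight = log_slope\<^sup>2 - log_slope'\<close> shifted by a constant:
  the weight solves the Schroedinger equation for the energy \<open>- (1 / 2 + k)\<^sup>2\<close>.
\<close>

lemma potE_weight:
  "of_real ((log_slope k u)\<^sup>2 - exp u / 2) - (E + of_real ((1 / 2 + k)\<^sup>2)) = potE k E u"
proof -
  have "exp (2 * u) = (exp u)\<^sup>2" by (simp add: exp_double)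
  then have "(log_slope k u)\<^sup>2 - exp u / 2 - (1 / 2 + k)\<^sup>2 = V_pot k u"
    unfolding log_slope_def V_pot_def by (simp add: power2_eq_square field_simps)
  then show ?thesis unfolding potE_def by (metis (no_types, opaque_lifting) diff_diff_eq of_real_diff add.commute)
qed

text \<open>
  Near infinity a majorant for the integral of \<open>(weight k)\<^sup>2\<close> over \<open>{u..}\<close>, as its logarithmic
  derivative is about \<open>- exp u\<close>; the factor 2 leaves room for the lower order terms.
\<close>

definition weight_tail :: "real \<Rightarrow> real \<Rightarrow> real" where
  "weight_tail k u = 2 * exp (- u) * (weight k u)\<^sup>2"

lemma weight_tail_deriv:
  "(weight_tail k has_real_derivative - (4 * exp (- u) * (1 + k) + 2) * (weight k u)\<^sup>2) (at u)"
proof -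
  have "(weight_tail k has_real_derivative
     (2 * (- exp (- u))) * (weight k u)\<^sup>2 + (2 * (weight k u) * (- log_slope k u * weight k u)) * (2 * exp (- u))) (at u)"
    unfolding weight_tail_def[abs_def] power2_eq_square
    by (auto intro!: derivative_eq_intros weight_deriv simp: algebra_simps)
  moreover have "(2 * (- exp (- u))) * (weight k u)\<^sup>2 + (2 * (weight k u) * (- log_slope k u * weight k u)) * (2 * exp (- u))
      = - (4 * exp (- u) * (1 + k) + 2) * (weight k u)\<^sup>2"
  proof -
    have e: "exp (- u) * exp u = 1" by (simp add: exp_minus)
    have "(2 * (- exp (- u))) * (weight k u)\<^sup>2 + (2 * (weight k u) * (- log_slope k u * weight k u)) * (2 * exp (- u))
      = - (4 * exp (- u) * (1 + k) + 2 * (exp (- u) * exp u)) * (weight k u)\<^sup>2"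
      unfolding log_slope_def by (simp add: power2_eq_square field_simps)
    then show ?thesis unfolding e by simp
  qed
  ultimately show ?thesis by simp
qed

text \<open>
  The factor \<open>exp (- u / 2)\<close> of the weight gives the exponential, and the remaining exponent
  \<open>- (exp u + 2 * k * u)\<close> of the square is bounded above on \<open>{a..}\<close>.
\<close>

lemma weight_square_bound: "\<exists>C. \<forall>u\<ge>a. (weight k u)\<^sup>2 \<le> C * exp (- u)"
proof -
  define m where "m = (if k \<ge> 0 then 2 * k * a else - (2 * k)\<^sup>2)"
  have "exp u + 2 * k * u \<ge> m" if "u \<ge> a" for u
  proof (cases "k \<ge> 0")
    case True
    then have "2 * k * a \<le> 2 * k * u" using that by (intro mult_left_mono) auto
    moreover have "0 < exp u" by simp
    ultimately have "2 * k * a \<le> exp u + 2 * k * u" by linarith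
    then show ?thesis using True by (simp add: m_def)
  next
    case False
    have "exp u + 2 * k * u \<ge> - (2 * k)\<^sup>2"
    proof (cases "u \<ge> 0")
      case True
      have "exp u \<ge> u\<^sup>2 / 2" using exp_lower_Taylor_quadratic[OF True] True by linarith
      moreover have "u\<^sup>2 / 2 + 2 * k * u + (2 * k)\<^sup>2 = (u + 2 * k)\<^sup>2 / 2 + (2 * k)\<^sup>2 / 2"
        by (simp add: power2_eq_square field_simps)
      ultimately show ?thesis using zero_le_power2[of "u + 2 * k"] zero_le_power2[of "2 * k"] by linarith
    next
      case u: False
      then have "2 * k * u \<ge> 0" using False by (simp add: mult_nonpos_nonpos)
      moreover have "0 < exp u" "0 \<le> (2 * k)\<^sup>2" by simp_all
      ultimately show ?thesis by linarith
    qed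
    then show ?thesis using False by (simp add: m_def)
  qed
  then have "(weight k u)\<^sup>2 \<le> exp (- m) * exp (- u)" if "u \<ge> a" for u
  proof -
    have "(weight k u)\<^sup>2 = exp (- (exp u + 2 * k * u) - u)"
      unfolding weight_def by (simp add: power2_eq_square exp_add[symmetric] algebra_simps)
    also have "\<dots> \<le> exp (- m - u)" using \<open>\<And>u. u \<ge> a \<Longrightarrow> exp u + 2 * k * u \<ge> m\<close>[OF that] by simp
    also have "\<dots> = exp (- m) * exp (- u)" by (simp add: exp_add[symmetric])
    finally show ?thesis .
  qed
  then show ?thesis by blast
qed

lemma exp_minus_tendsto_0: "((\<lambda>u::real. exp (- u)) \<longlongrightarrow> 0) at_top"
  by (rule filterlim_compose[OF exp_at_bot filterlim_uminus_at_bot_at_top])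

lemma weight_tail_tendsto_0: "(weight_tail k \<longlongrightarrow> 0) at_top"
proof -
  obtain C where C: "\<And>u. u \<ge> 0 \<Longrightarrow> (weight k u)\<^sup>2 \<le> C * exp (- u)" using weight_square_bound by blast
  have C0: "C \<ge> 0" using C[of 0] zero_le_power2[of "weight k 0"] by (metis exp_zero minus_zero mult.right_neutral order_refl order_trans)
  show ?thesis
  proof (rule tendsto_sandwich[where f="\<lambda>_. 0" and h="\<lambda>u. 2 * C * exp (- u)"])
    show "\<forall>\<^sub>F u in at_top. 0 \<le> weight_tail k u" by (simp add: weight_tail_def)
    show "\<forall>\<^sub>F u in at_top. weight_tail k u \<le> 2 * C * exp (- u)"
      using eventually_ge_at_top[of 0]
    proof eventually_elim
      fix u :: real assume u: "u \<ge> 0"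
      have "weight_tail k u \<le> 2 * 1 * (C * exp (- u))"
        unfolding weight_tail_def using C[OF u] u by (intro mult_mono) auto
      then show "weight_tail k u \<le> 2 * C * exp (- u)" by simp
    qed
    show "((\<lambda>u. 2 * C * exp (- u)) \<longlongrightarrow> 0) at_top"
      using tendsto_mult_left[OF exp_minus_tendsto_0, of "2 * C"] by simp
  qed simp
qed

text \<open>
  Write \<open>\<psi> = w * g\<close> with the weight \<open>w\<close>. As \<open>w\<close> is a solution for the energy \<open>- (1 / 2 + k)\<^sup>2\<close>, the
  equation for \<open>g\<close> is \<open>(w\<^sup>2 g')' = - D * w\<^sup>2 g\<close> with \<open>D = E + (1 / 2 + k)\<^sup>2\<close>. Integrating twice from
  infinity with \<open>g \<rightarrow> 1\<close> gives \<open>g = 1 - D * tail (tail (w\<^sup>2 g) / w\<^sup>2)\<close>. The inner tail is at most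
  \<open>weight_tail\<close> times the supremum of \<open>g\<close>, the outer one \<open>2 * exp (- u)\<close> times it. So this is a
  contraction on \<open>{U..}\<close> for large \<open>U\<close>, and the fixed point has \<open>g - 1 = O(exp (- u))\<close>. The
  solution is extended to the line by its initial data at \<open>U\<close>.
\<close>

theorem recessive_solution_exists:
  "\<exists>\<psi> \<psi>' C U. sol_on UNIV (potE k E) \<psi> \<psi>' \<and> (\<forall>u\<ge>U. norm (\<psi> u / of_real (weight k u) - 1) \<le> C * exp (- u))"
proof -
  define D where "D = E + of_real ((1 / 2 + k)\<^sup>2)"
  \<comment> \<open>This makes \<open>4 * norm D * exp (- u) \<le> 1\<close>, hence the contraction factor one half, and lets \<open>weight_tail\<close> be a majorant.\<close>
  define U where "U = ln (4 * \<bar>1 + k\<bar> + 4 * norm D + 1)"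
  have expU: "exp U = 4 * \<bar>1 + k\<bar> + 4 * norm D + 1"
    unfolding U_def by (rule exp_ln) (simp add: add_nonneg_pos)
  have small: "(4 * \<bar>1 + k\<bar> + 4 * norm D) * exp (- u) \<le> 1" if u: "u \<ge> U" for u
  proof -
    have "4 * \<bar>1 + k\<bar> + 4 * norm D \<le> exp u" using expU u by (smt (verit) exp_le_cancel_iff)
    then have "(4 * \<bar>1 + k\<bar> + 4 * norm D) * exp (- u) \<le> exp u * exp (- u)" by (intro mult_right_mono) auto
    then show ?thesis by (simp add: exp_minus)
  qed
  have smallk: "4 * \<bar>1 + k\<bar> * exp (- u) \<le> 1" and smallD: "4 * norm D * exp (- u) \<le> 1" if u: "u \<ge> U" for u
  proof -
    have "0 \<le> 4 * \<bar>1 + k\<bar> * exp (- u)" "0 \<le> 4 * norm D * exp (- u)" by simp_all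
    then show "4 * \<bar>1 + k\<bar> * exp (- u) \<le> 1" "4 * norm D * exp (- u) \<le> 1"
      using small[OF u] unfolding distrib_right by linarith+
  qed
  have wt: "(weight k u)\<^sup>2 \<le> (4 * exp (- u) * (1 + k) + 2) * (weight k u)\<^sup>2" if u: "u \<ge> U" for u
  proof -
    have "- (4 * exp (- u) * (1 + k)) \<le> 4 * \<bar>1 + k\<bar> * exp (- u)"
      using mult_left_mono[of "- (1 + k)" "\<bar>1 + k\<bar>" "4 * exp (- u)"] by (simp add: algebra_simps)
    then have "1 \<le> 4 * exp (- u) * (1 + k) + 2" using smallk[OF u] by linarith
    then have "1 * (weight k u)\<^sup>2 \<le> (4 * exp (- u) * (1 + k) + 2) * (weight k u)\<^sup>2" by (rule mult_right_mono) simp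
    then show ?thesis by simp
  qed
  define w where "w u = complex_of_real (weight k u)" for u
  have w0: "w u \<noteq> 0" for u by (simp add: w_def)
  have wc: "continuous_on S w" for S unfolding w_def[abs_def] by (intro continuous_intros weight_continuous)
  define f1 where "f1 g = (\<lambda>u. (w u)\<^sup>2 * g u)" for g :: "real \<Rightarrow> complex"
  define f2 where "f2 g = (\<lambda>u. tail (f1 g) u / (w u)\<^sup>2)" for g :: "real \<Rightarrow> complex"
  have T1: "(tail (f1 g) has_vector_derivative - f1 g u) (at u)" "(tail (f1 g) \<longlongrightarrow> 0) at_top"
     "u \<ge> U \<Longrightarrow> norm (tail (f1 g) u) \<le> B * weight_tail k u"
    if g: "continuous_on UNIV g" "\<And>u. u \<ge> U \<Longrightarrow> norm (g u) \<le> B" for g B u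
  proof -
    have B: "B \<ge> 0" using g(2)[of U] norm_ge_zero order_trans by blast
    have c: "continuous_on UNIV (f1 g)" unfolding f1_def by (intro continuous_intros wc g)
    have d: "((\<lambda>u. B * weight_tail k u) has_real_derivative B * (- (4 * exp (- u) * (1 + k) + 2) * (weight k u)\<^sup>2)) (at u)" for u
      by (rule DERIV_cmult[OF weight_tail_deriv])
    have l: "((\<lambda>u. B * weight_tail k u) \<longlongrightarrow> 0) at_top"
      using tendsto_mult_left[OF weight_tail_tendsto_0, of B] by simp
    have le: "norm (f1 g u) \<le> - (B * (- (4 * exp (- u) * (1 + k) + 2) * (weight k u)\<^sup>2))" if u: "u \<ge> U" for u
    proof -
      have "norm (f1 g u) \<le> (weight k u)\<^sup>2 * B"
        unfolding f1_def w_def norm_mult using g(2)[OF u] by (simp add: norm_power mult_left_mono)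
      also have "\<dots> \<le> ((4 * exp (- u) * (1 + k) + 2) * (weight k u)\<^sup>2) * B" using wt[OF u] B by (rule mult_right_mono)
      finally show ?thesis by (simp add: algebra_simps)
    qed
    note X = tail_exists[OF c d l le]
    show "(tail (f1 g) has_vector_derivative - f1 g u) (at u)" "(tail (f1 g) \<longlongrightarrow> 0) at_top"
     "u \<ge> U \<Longrightarrow> norm (tail (f1 g) u) \<le> B * weight_tail k u" using X by auto
  qed
  have T2c: "continuous_on UNIV (f2 g)" if g: "continuous_on UNIV g" "\<And>u. u \<ge> U \<Longrightarrow> norm (g u) \<le> B" for g B
    unfolding f2_def using w0 T1(1)[OF g]
    by (intro continuous_intros wc) (auto intro!: continuous_at_imp_continuous_on has_vector_derivative_continuous)
  have T2b: "norm (f2 g u) \<le> 2 * B * exp (- u)"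
    if t: "norm (tail (f1 g) u) \<le> B * weight_tail k u" for g B u
  proof -
    have "norm (f2 g u) = norm (tail (f1 g) u) / (weight k u)\<^sup>2" by (simp add: f2_def w_def norm_divide norm_power)
    also have "\<dots> \<le> (B * weight_tail k u) / (weight k u)\<^sup>2" using t by (intro divide_right_mono) auto
    also have "\<dots> = 2 * B * exp (- u)" by (simp add: weight_tail_def)
    finally show ?thesis .
  qed
  have expd: "((\<lambda>u. 2 * B * exp (- u)) has_real_derivative - (2 * B * exp (- u))) (at u)" for B u
    by (auto intro!: derivative_eq_intros)
  have expl: "((\<lambda>u. 2 * B * exp (- u)) \<longlongrightarrow> 0) at_top" for B :: real
    using tendsto_mult_left[OF exp_minus_tendsto_0, of "2 * B"] by simp
  have T2: "(tail (f2 g) has_vector_derivative - f2 g u) (at u)" "(tail (f2 g) \<longlongrightarrow> 0) at_top"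
     "u \<ge> U \<Longrightarrow> norm (tail (f2 g) u) \<le> 2 * B * exp (- u)"
    if g: "continuous_on UNIV g" "\<And>u. u \<ge> U \<Longrightarrow> norm (g u) \<le> B" for g B u
  proof -
    have le: "norm (f2 g u) \<le> - (- (2 * B * exp (- u)))" if "u \<ge> U" for u
      using T2b[OF T1(3)[OF g that]] by simp
    note X = tail_exists[OF T2c[OF g] expd expl le]
    show "(tail (f2 g) has_vector_derivative - f2 g u) (at u)" "(tail (f2 g) \<longlongrightarrow> 0) at_top"
     "u \<ge> U \<Longrightarrow> norm (tail (f2 g) u) \<le> 2 * B * exp (- u)" using X by auto
  qed
  have expmono: "exp (- max U u) \<le> exp (- U)" for u by simp
  have gz: "continuous_on UNIV (apply_bcontfun z)" "\<And>u. norm (apply_bcontfun z u) \<le> norm z" for z :: "real \<Rightarrow>\<^sub>C complex"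
    by (auto intro: continuous_intros norm_bounded)
  \<comment> \<open>Freezing the argument at \<open>U\<close> extends functions on \<open>{U..}\<close> to bounded continuous functions on the line.\<close>
  define h where "h z = (\<lambda>u. 1 - D * tail (f2 (apply_bcontfun z)) (max U u))" for z :: "real \<Rightarrow>\<^sub>C complex"
  have hc: "h z \<in> bcontfun" for z
  proof (rule bcontfun_normI)
    have "isCont (tail (f2 (apply_bcontfun z))) u" for u
      by (rule has_vector_derivative_continuous[OF T2(1)[OF gz]])
    then have c: "continuous_on UNIV (tail (f2 (apply_bcontfun z)))"
      by (simp add: continuous_at_imp_continuous_on)
    have m: "continuous_on UNIV (\<lambda>u. max U u)" by (intro continuous_intros)
    show "continuous_on UNIV (h z)"
      unfolding h_def using continuous_on_compose2[OF c m] by (intro continuous_intros) auto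
    fix u
    have "norm (tail (f2 (apply_bcontfun z)) (max U u)) \<le> 2 * norm z * exp (- max U u)"
      by (rule T2(3)[OF gz]) simp
    also have "\<dots> \<le> 2 * norm z * exp (- U)" using expmono by (intro mult_left_mono) auto
    finally have "norm D * norm (tail (f2 (apply_bcontfun z)) (max U u)) \<le> norm D * (2 * norm z * exp (- U))"
      by (intro mult_left_mono) auto
    then show "norm (h z u) \<le> 1 + norm D * (2 * norm z * exp (- U))"
      unfolding h_def using norm_triangle_ineq4[of 1 "D * tail (f2 (apply_bcontfun z)) (max U u)"]
      by (simp add: norm_mult)
  qed
  have "\<exists>!z. Bcontfun (h z) = z"
  proof (rule banach_fix_type[of "1/2"])
    show "\<forall>z y. dist (Bcontfun (h z)) (Bcontfun (h y)) \<le> 1 / 2 * dist z y"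
    proof (intro allI)
      fix z y :: "real \<Rightarrow>\<^sub>C complex"
      show "dist (Bcontfun (h z)) (Bcontfun (h y)) \<le> 1 / 2 * dist z y"
      proof (rule dist_bound)
        fix u
        define A where "A = (\<lambda>u. tail (f1 (apply_bcontfun z)) u - tail (f1 (apply_bcontfun y)) u)"
        define B where "B = (\<lambda>u. tail (f2 (apply_bcontfun z)) u - tail (f2 (apply_bcontfun y)) u)"
        have A: "norm (A t) \<le> dist z y * weight_tail k t" if t: "t \<ge> U" for t
        proof (rule decreasing_majorant_bound[where f="\<lambda>u. f1 (apply_bcontfun z) u - f1 (apply_bcontfun y) u" and U=U and A=A
              and P="\<lambda>u. dist z y * weight_tail k u" and P'="\<lambda>u. dist z y * (- (4 * exp (- u) * (1 + k) + 2) * (weight k u)\<^sup>2)"])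
          show "(A has_vector_derivative - (f1 (apply_bcontfun z) u - f1 (apply_bcontfun y) u)) (at u)" for u
            unfolding A_def using has_vector_derivative_diff[OF T1(1)[OF gz] T1(1)[OF gz]] by (simp add: algebra_simps)
          show "(A \<longlongrightarrow> 0) at_top"
            unfolding A_def using tendsto_diff[OF T1(2)[OF gz] T1(2)[OF gz]] by simp
          show "((\<lambda>u. dist z y * weight_tail k u) has_real_derivative dist z y * (- (4 * exp (- u) * (1 + k) + 2) * (weight k u)\<^sup>2)) (at u)" for u
            by (rule DERIV_cmult[OF weight_tail_deriv])
          show "((\<lambda>u. dist z y * weight_tail k u) \<longlongrightarrow> 0) at_top"
            using tendsto_mult_left[OF weight_tail_tendsto_0, of "dist z y"] by simp
          fix u assume u: "u \<ge> U"
          have "norm (f1 (apply_bcontfun z) u - f1 (apply_bcontfun y) u) = (weight k u)\<^sup>2 * norm (apply_bcontfun z u - apply_bcontfun y u)"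
            unfolding f1_def w_def right_diff_distrib[symmetric] norm_mult by (simp add: norm_power)
          also have "\<dots> \<le> (weight k u)\<^sup>2 * dist z y"
            using dist_bounded[of z u y] by (intro mult_left_mono) (auto simp: dist_norm)
          also have "\<dots> \<le> ((4 * exp (- u) * (1 + k) + 2) * (weight k u)\<^sup>2) * dist z y"
            using wt[OF u] by (rule mult_right_mono) simp
          finally show "norm (f1 (apply_bcontfun z) u - f1 (apply_bcontfun y) u)
              \<le> - (dist z y * (- (4 * exp (- u) * (1 + k) + 2) * (weight k u)\<^sup>2))"
            by (simp add: algebra_simps)
        qed (rule t)
        have B: "norm (B t) \<le> 2 * dist z y * exp (- t)" if t: "t \<ge> U" for t
        proof (rule decreasing_majorant_bound[where f="\<lambda>u. f2 (apply_bcontfun z) u - f2 (apply_bcontfun y) u" and U=U and A=B, OF _ _ expd expl])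
          show "(B has_vector_derivative - (f2 (apply_bcontfun z) u - f2 (apply_bcontfun y) u)) (at u)" for u
            unfolding B_def using has_vector_derivative_diff[OF T2(1)[OF gz] T2(1)[OF gz]] by (simp add: algebra_simps)
          show "(B \<longlongrightarrow> 0) at_top"
            unfolding B_def using tendsto_diff[OF T2(2)[OF gz] T2(2)[OF gz]] by simp
          fix u assume u: "u \<ge> U"
          have "norm (f2 (apply_bcontfun z) u - f2 (apply_bcontfun y) u) = norm (A u) / (weight k u)\<^sup>2"
            unfolding f2_def w_def diff_divide_distrib[symmetric] A_def by (simp add: norm_divide norm_power)
          also have "\<dots> \<le> (dist z y * weight_tail k u) / (weight k u)\<^sup>2" using A[OF u] by (intro divide_right_mono) auto
          also have "\<dots> = 2 * dist z y * exp (- u)" by (simp add: weight_tail_def)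
          finally show "norm (f2 (apply_bcontfun z) u - f2 (apply_bcontfun y) u) \<le> - (- (2 * dist z y * exp (- u)))" by simp
        qed (rule t)
        have "norm (h z u - h y u) = norm D * norm (B (max U u))"
          unfolding h_def B_def by (simp add: norm_mult[symmetric] algebra_simps norm_minus_commute)
        also have "\<dots> \<le> norm D * (2 * dist z y * exp (- max U u))" using B[of "max U u"] by (intro mult_left_mono) auto
        also have "\<dots> = (4 * norm D * exp (- max U u)) * (1 / 2 * dist z y)" by simp
        also have "\<dots> \<le> 1 * (1 / 2 * dist z y)" using smallD[of "max U u"] by (intro mult_right_mono) auto
        finally show "dist (apply_bcontfun (Bcontfun (h z)) u) (apply_bcontfun (Bcontfun (h y)) u) \<le> 1 / 2 * dist z y"
          using hc by (simp add: Bcontfun_inverse dist_norm)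
      qed
    qed
  qed auto
  then obtain z where z: "Bcontfun (h z) = z" by blast
  define g where "g = apply_bcontfun z"
  define A1 where "A1 = tail (f1 g)"
  define A2 where "A2 = tail (f2 g)"
  note gz' = gz[of z, folded g_def]
  have geq: "g u = 1 - D * A2 u" if "u \<ge> U" for u
  proof -
    have "g = h z" unfolding g_def using hc[of z] z by (metis Bcontfun_inverse)
    then have "g u = h z u" by simp
    also have "\<dots> = 1 - D * A2 u" using that by (simp add: h_def A2_def g_def max_absorb2)
    finally show ?thesis .
  qed
  have A1d: "(A1 has_vector_derivative - ((w u)\<^sup>2 * g u)) (at u within S)" for u S
    using T1(1)[OF gz'] unfolding A1_def f1_def by (rule has_vector_derivative_at_within)
  have A2d: "(A2 has_vector_derivative - (A1 u / (w u)\<^sup>2)) (at u within S)" for u S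
    using T2(1)[OF gz'] unfolding A2_def f2_def A1_def by (rule has_vector_derivative_at_within)
  define s where "s u = complex_of_real (log_slope k u)" for u
  have wd: "(w has_vector_derivative - s u * w u) (at u within S)" for u S
    unfolding w_def[abs_def] s_def using has_vector_derivative_of_real[OF weight_deriv] by simp
  have sd: "(s has_vector_derivative of_real (exp u / 2)) (at u within S)" for u S
    unfolding s_def[abs_def] by (rule has_vector_derivative_of_real[OF log_slope_deriv])
  have wid: "((\<lambda>u. inverse (w u)) has_vector_derivative s u / w u) (at u within S)" for u S
  proof -
    have "((\<lambda>u. of_real (inverse (weight k u))) has_vector_derivative complex_of_real (log_slope k u / weight k u)) (at u within S)"
      by (rule has_vector_derivative_of_real)
        (rule derivative_eq_intros weight_deriv refl | simp add: field_simps)+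
    then show ?thesis by (simp add: w_def[abs_def] s_def)
  qed
  \<comment> \<open>From here on, the fixed point \<open>g\<close> is converted back into a solution \<open>y\<close> of the equation.\<close>
  define y where "y u = w u * (1 - D * A2 u)" for u
  define y' where "y' u = - s u * y u + D * (A1 u * inverse (w u))" for u
  have ysol: "sol_on {U..} (potE k E) y y'"
    unfolding sol_on_def
  proof (intro ballI conjI)
    fix u assume u: "u \<in> {U..}"
    have yd: "(y has_vector_derivative y' u) (at u within {U..})"
    proof -
      have "((\<lambda>u. w u * (1 - D * A2 u)) has_vector_derivative
        w u * (0 - D * (- (A1 u / (w u)\<^sup>2))) + (- s u * w u) * (1 - D * A2 u)) (at u within {U..})"
        by (intro has_vector_derivative_mult wd has_vector_derivative_diff has_vector_derivative_const
            has_vector_derivative_mult_right A2d)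
      moreover have "w u * (0 - D * (- (A1 u / (w u)\<^sup>2))) + (- s u * w u) * (1 - D * A2 u) = y' u"
        unfolding y'_def y_def using w0[of u] by (simp add: power2_eq_square field_simps)
      ultimately show ?thesis unfolding y_def[abs_def] by simp
    qed
    show "(y has_vector_derivative y' u) (at u within {U..})" by (rule yd)
    have "((\<lambda>u. - s u * y u + D * (A1 u * inverse (w u))) has_vector_derivative
       (- s u * y' u + (- of_real (exp u / 2)) * y u) + D * (A1 u * (s u / w u) + (- ((w u)\<^sup>2 * g u)) * inverse (w u))) (at u within {U..})"
      by (intro has_vector_derivative_add has_vector_derivative_mult yd has_vector_derivative_minus sd
          has_vector_derivative_mult_right A1d wid)
    moreover have "(- s u * y' u + (- of_real (exp u / 2)) * y u) + D * (A1 u * (s u / w u) + (- ((w u)\<^sup>2 * g u)) * inverse (w u))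
      = potE k E u * y u"
    proof -
      have gy: "w u * g u = y u" using geq[of u] u by (simp add: y_def)
      have "(- s u * y' u + (- of_real (exp u / 2)) * y u) + D * (A1 u * (s u / w u) + (- ((w u)\<^sup>2 * g u)) * inverse (w u))
        = ((s u)\<^sup>2 - of_real (exp u / 2)) * y u - D * (w u * g u)"
        unfolding y'_def using w0[of u] by (simp add: power2_eq_square field_simps)
      also have "\<dots> = (of_real ((log_slope k u)\<^sup>2 - exp u / 2) - D) * y u"
        unfolding gy by (simp add: s_def algebra_simps)
      finally show ?thesis unfolding D_def potE_weight .
    qed
    ultimately show "(y' has_vector_derivative potE k E u * y u) (at u within {U..})"
      unfolding y'_def[abs_def] by simp
  qed
  obtain \<psi> \<psi>' where \<psi>: "sol_on UNIV (potE k E) \<psi> \<psi>'" "\<psi> U = y U" "\<psi>' U = y' U"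
    using linear_ode_exists[OF potE_continuous, where a=U and A="y U" and B="y' U"] by blast
  have "norm (\<psi> u / of_real (weight k u) - 1) \<le> (norm D * 2 * norm z) * exp (- u)" if u: "u \<ge> U" for u
  proof -
    have "\<psi> u = y u"
      using sol_on_unique_half_line[OF sol_on_subset[OF \<psi>(1)] ysol potE_continuous \<psi>(2,3) u] by simp
    then have "\<psi> u / of_real (weight k u) - 1 = - (D * A2 u)" using w0[of u] by (simp add: y_def w_def)
    then have "norm (\<psi> u / of_real (weight k u) - 1) = norm D * norm (A2 u)" by (simp add: norm_mult)
    also have "\<dots> \<le> norm D * (2 * norm z * exp (- u))"
      using T2(3)[OF gz' u] unfolding A2_def by (intro mult_left_mono) auto
    finally show ?thesis by simp
  qed
  then show ?thesis using \<psi>(1) by blast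
qed

section \<open>Whittaker's equation in the logarithmic variable\<close>

text \<open>
  Both derivatives are given explicitly by the chain rule. In terms of \<open>X = exp u\<close>, Whittaker's equation
  times \<open>X\<^sup>2\<close> has the coefficient \<open>X\<^sup>2 / 4 + k * X - E - 1 / 4\<close>, and the factor \<open>exp (- u / 2)\<close>
  removes the first-order term and the \<open>1 / 4\<close>.
\<close>

lemma whittaker_to_schrodinger:
  assumes fd: "\<And>x. x \<in> exp ` T \<Longrightarrow> (f has_vector_derivative f' x) (at x within exp ` T)"
      "\<And>x. x \<in> exp ` T \<Longrightarrow> (f' has_vector_derivative f'' x) (at x within exp ` T)"
    and eq: "\<And>x. x \<in> exp ` T \<Longrightarrow> f'' x + (- 1/4 + (- of_real k) / of_real x + (1/4 - \<mu>\<^sup>2) / (of_real x)\<^sup>2) * f x = 0"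
    and \<mu>: "\<mu>\<^sup>2 = - E"
  shows "sol_on T (potE k E) (\<lambda>u. of_real (exp (- u / 2)) * f (exp u))
    (\<lambda>u. - (1/2) * (of_real (exp (- u / 2)) * f (exp u)) + of_real (exp (u / 2)) * f' (exp u))"
  unfolding sol_on_def
proof (intro ballI conjI)
  fix u assume u: "u \<in> T"
  then have xS: "exp u \<in> exp ` T" by simp
  define X where "X = complex_of_real (exp u)"
  define a where "a = complex_of_real (exp (- u / 2))"
  have X0: "X \<noteq> 0" by (simp add: X_def)
  have b: "complex_of_real (exp (u / 2)) = a * X"
    unfolding a_def X_def of_real_mult[symmetric] exp_add[symmetric] by simp
  have ed: "(exp has_vector_derivative exp u) (at u within T)"
    by (auto simp: has_real_derivative_iff_has_vector_derivative[symmetric] intro!: derivative_eq_intros)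
  have ad: "((\<lambda>u. complex_of_real (exp (- u / 2))) has_vector_derivative - (1/2) * a) (at u within T)"
  proof -
    have "((\<lambda>u. exp (- u / 2)) has_real_derivative - (1/2) * exp (- u / 2)) (at u within T)"
      by (auto intro!: derivative_eq_intros)
    from has_vector_derivative_of_real[OF this, where 'a=complex] show ?thesis by (simp add: a_def)
  qed
  have bd: "((\<lambda>u. complex_of_real (exp (u / 2))) has_vector_derivative (1/2) * (a * X)) (at u within T)"
  proof -
    have "((\<lambda>u. exp (u / 2)) has_real_derivative (1/2) * exp (u / 2)) (at u within T)"
      by (auto intro!: derivative_eq_intros)
    from has_vector_derivative_of_real[OF this, where 'a=complex] show ?thesis by (simp add: b[symmetric])
  qed
  have fe: "((\<lambda>u. f (exp u)) has_vector_derivative X * f' (exp u)) (at u within T)"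
    using vector_diff_chain_within[OF ed fd(1)[OF xS]] by (simp add: comp_def X_def scaleR_conv_of_real)
  have f'e: "((\<lambda>u. f' (exp u)) has_vector_derivative X * f'' (exp u)) (at u within T)"
    using vector_diff_chain_within[OF ed fd(2)[OF xS]] by (simp add: comp_def X_def scaleR_conv_of_real)
  have 1: "((\<lambda>u. of_real (exp (- u / 2)) * f (exp u)) has_vector_derivative
      - (1/2) * (a * f (exp u)) + a * X * f' (exp u)) (at u within T)"
    using has_vector_derivative_mult[OF ad fe] by (simp add: a_def algebra_simps)
  then show "((\<lambda>u. of_real (exp (- u / 2)) * f (exp u)) has_vector_derivative
      - (1/2) * (of_real (exp (- u / 2)) * f (exp u)) + of_real (exp (u / 2)) * f' (exp u)) (at u within T)"
    unfolding b a_def .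
  have 2: "((\<lambda>u. of_real (exp (u / 2)) * f' (exp u)) has_vector_derivative
      a * X * (X * f'' (exp u)) + (1/2) * (a * X) * f' (exp u)) (at u within T)"
    using has_vector_derivative_mult[OF bd f'e] unfolding b .
  have V: "potE k E u = X\<^sup>2 / 4 + of_real k * X - E"
  proof -
    have "exp (2 * u) = (exp u)\<^sup>2" by (simp add: exp_double)
    then show ?thesis by (simp add: potE_def V_pot_def X_def)
  qed
  have "f'' (exp u) = (1/4 + of_real k / X - (1/4 + E) / X\<^sup>2) * f (exp u)"
    using eq[OF xS] \<mu> unfolding X_def by (simp add: algebra_simps eq_neg_iff_add_eq_0)
  moreover have "X\<^sup>2 * (1/4 + of_real k / X - (1/4 + E) / X\<^sup>2) = X\<^sup>2 / 4 + of_real k * X - (1/4 + E)"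
    using X0 by (simp add: field_simps power2_eq_square)
  ultimately have f'': "X\<^sup>2 * f'' (exp u) = (X\<^sup>2 / 4 + of_real k * X - (1/4 + E)) * f (exp u)"
    by (metis mult.assoc)
  have "- (1/2) * (- (1/2) * (a * f (exp u)) + a * X * f' (exp u)) + (a * X * (X * f'' (exp u)) + (1/2) * (a * X) * f' (exp u))
     = a * (X\<^sup>2 * f'' (exp u)) + a * f (exp u) / 4"
    by (simp add: algebra_simps power2_eq_square)
  also have "\<dots> = potE k E u * (a * f (exp u))"
    unfolding f'' V by (simp add: field_simps)
  finally show "((\<lambda>u. - (1/2) * (of_real (exp (- u / 2)) * f (exp u)) + of_real (exp (u / 2)) * f' (exp u)) has_vector_derivative
      potE k E u * (of_real (exp (- u / 2)) * f (exp u))) (at u within T)"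
    using has_vector_derivative_add[OF has_vector_derivative_mult_right[OF 1, of "- (1/2)"] 2]
    by (simp only: a_def)
qed

lemma schrodinger_to_whittaker:
  assumes s: "sol_on T (potE k E) \<psi> \<psi>'" and \<mu>: "\<mu>\<^sup>2 = - E"
  defines "f \<equiv> \<lambda>x. of_real (exp (ln x / 2)) * \<psi> (ln x)"
  shows "\<exists>f''. has_second_deriv_on f f'' (exp ` T) \<and>
    (\<forall>x\<in>exp ` T. f'' x + (- 1/4 + (- of_real k) / of_real x + (1/4 - \<mu>\<^sup>2) / (of_real x)\<^sup>2) * f x = 0)"
proof -
  define q where "q = potE k E"
  define f' where "f' x = of_real (exp (- ln x / 2)) * (\<psi> (ln x) / 2 + \<psi>' (ln x))" for x
  define f'' where "f'' x = (q (ln x) - 1/4) / (of_real x)\<^sup>2 * f x" for x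
  have lnS: "ln ` exp ` T = T" by (auto simp: image_image)
  have D: "(f has_vector_derivative f' x) (at x within exp ` T) \<and> (f' has_vector_derivative f'' x) (at x within exp ` T)"
    if x: "x \<in> exp ` T" for x
  proof -
    have x0: "x > 0" using x by auto
    have lT: "ln x \<in> T" using x by auto
    define X where "X = complex_of_real x"
    define A where "A = complex_of_real (exp (ln x / 2))"
    define B where "B = complex_of_real (exp (- ln x / 2))"
    have X0: "X \<noteq> 0" using x0 by (simp add: X_def)
    have "exp (ln x / 2) = x * exp (- ln x / 2)"
    proof -
      have "x * exp (- ln x / 2) = exp (ln x) * exp (- ln x / 2)" using x0 by simp
      also have "\<dots> = exp (ln x / 2)" unfolding exp_add[symmetric] by simp
      finally show ?thesis by simp
    qed
    then have AB: "A = X * B" unfolding A_def B_def X_def by (metis of_real_mult)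
    have ld: "(ln has_vector_derivative 1 / x) (at x within exp ` T)"
      using x0 by (auto simp: has_real_derivative_iff_has_vector_derivative[symmetric] intro!: derivative_eq_intros)
    have Ad: "((\<lambda>x. complex_of_real (exp (ln x / 2))) has_vector_derivative B / 2) (at x within exp ` T)"
    proof -
      have "((\<lambda>x. exp (ln x / 2)) has_real_derivative exp (ln x / 2) / (2 * x)) (at x within exp ` T)"
        using x0 by (auto intro!: derivative_eq_intros)
      from has_vector_derivative_of_real[OF this, where 'a=complex] show ?thesis
        using X0 AB by (simp add: A_def[symmetric] X_def[symmetric])
    qed
    have Bd: "((\<lambda>x. complex_of_real (exp (- ln x / 2))) has_vector_derivative - B / (2 * X)) (at x within exp ` T)"
    proof -
      have "((\<lambda>x. exp (- ln x / 2)) has_real_derivative - exp (- ln x / 2) / (2 * x)) (at x within exp ` T)"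
        using x0 by (auto intro!: derivative_eq_intros)
      from has_vector_derivative_of_real[OF this, where 'a=complex] show ?thesis
        by (simp add: B_def X_def)
    qed
    have \<psi>d: "((\<lambda>x. \<psi> (ln x)) has_vector_derivative \<psi>' (ln x) / X) (at x within exp ` T)"
      using vector_diff_chain_within[OF ld, of \<psi> "\<psi>' (ln x)"] sol_onD(1)[OF s lT]
      by (simp add: lnS comp_def X_def scaleR_conv_of_real)
    have \<psi>'d: "((\<lambda>x. \<psi>' (ln x)) has_vector_derivative (q (ln x) * \<psi> (ln x)) / X) (at x within exp ` T)"
      using vector_diff_chain_within[OF ld, of \<psi>' "q (ln x) * \<psi> (ln x)"] sol_onD(2)[OF s lT]
      by (simp add: lnS comp_def X_def scaleR_conv_of_real q_def)
    have 1: "(f has_vector_derivative f' x) (at x within exp ` T)"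
    proof -
      have "A * (\<psi>' (ln x) / X) + B / 2 * \<psi> (ln x) = f' x"
        unfolding f'_def B_def[symmetric] AB using X0 by (simp add: field_simps)
      then show ?thesis using has_vector_derivative_mult[OF Ad \<psi>d] unfolding f_def A_def by simp
    qed
    have "((\<lambda>x. \<psi> (ln x) / 2 + \<psi>' (ln x)) has_vector_derivative (\<psi>' (ln x) / X) / 2 + (q (ln x) * \<psi> (ln x)) / X) (at x within exp ` T)"
      using has_vector_derivative_add[OF has_vector_derivative_mult_right[OF \<psi>d, of "1/2"] \<psi>'d] by (simp add: mult.commute[of X 2])
    from has_vector_derivative_mult[OF Bd this]
    have "(f' has_vector_derivative B * ((\<psi>' (ln x) / X) / 2 + (q (ln x) * \<psi> (ln x)) / X)
        + - B / (2 * X) * (\<psi> (ln x) / 2 + \<psi>' (ln x))) (at x within exp ` T)"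
      unfolding f'_def[abs_def] B_def .
    moreover have "B * ((\<psi>' (ln x) / X) / 2 + (q (ln x) * \<psi> (ln x)) / X)
        + - B / (2 * X) * (\<psi> (ln x) / 2 + \<psi>' (ln x)) = f'' x"
      unfolding f''_def f_def A_def[symmetric] X_def[symmetric] AB using X0 by (simp add: field_simps power2_eq_square)
    ultimately show ?thesis using 1 by simp
  qed
  show ?thesis
  proof (intro exI[of _ f''] conjI ballI)
    show "has_second_deriv_on f f'' (exp ` T)" unfolding has_second_deriv_on_def using D by blast
    fix x assume x: "x \<in> exp ` T"
    then have x0: "x > 0" by auto
    define X where "X = complex_of_real x"
    have X0: "X \<noteq> 0" using x0 by (simp add: X_def)
    have "exp (2 * ln x) = x\<^sup>2" using x0 by (simp add: exp_double)
    then have q: "q (ln x) = X\<^sup>2 / 4 + of_real k * X - E"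
      using x0 by (simp add: q_def potE_def V_pot_def X_def)
    have "(X\<^sup>2 / 4 + of_real k * X - E - 1/4) / X\<^sup>2 + (- 1/4 + (- of_real k) / X + (1/4 - - E) / X\<^sup>2) = 0"
      using X0 by (simp add: field_simps power2_eq_square)
    then have "((X\<^sup>2 / 4 + of_real k * X - E - 1/4) / X\<^sup>2 + (- 1/4 + (- of_real k) / X + (1/4 - - E) / X\<^sup>2)) * f x = 0"
      by (metis mult_zero_left)
    then show "f'' x + (- 1/4 + (- of_real k) / of_real x + (1/4 - \<mu>\<^sup>2) / (of_real x)\<^sup>2) * f x = 0"
      unfolding f''_def \<mu> X_def[symmetric] q distrib_right[symmetric] .
  qed
qed

lemma whittaker_solution_imp_schrodinger:
  assumes f: "f \<in> whittaker_solutions (exp ` T) (- of_real k) \<mu>" and \<mu>: "\<mu>\<^sup>2 = - E"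
  shows "\<exists>\<phi>'. sol_on T (potE k E) (\<lambda>u. of_real (exp (- u / 2)) * f (exp u)) \<phi>'"
proof -
  from f obtain f'' where 1: "has_second_deriv_on f f'' (exp ` T)"
    and 2: "\<forall>x\<in>exp ` T. f'' x + (- 1/4 + (- of_real k) / of_real x + (1/4 - \<mu>\<^sup>2) / (of_real x)\<^sup>2) * f x = 0"
    unfolding whittaker_solutions_def by blast
  from 1 obtain f' where 3: "\<forall>x\<in>exp ` T. (f has_vector_derivative f' x) (at x within exp ` T) \<and>
      (f' has_vector_derivative f'' x) (at x within exp ` T)"
    unfolding has_second_deriv_on_def by blast
  show ?thesis
    by (rule exI, rule whittaker_to_schrodinger[where f=f and f'=f' and f''=f'', OF _ _ _ \<mu>]) (use 2 3 in blast)+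
qed

lemma schrodinger_imp_whittaker_solution:
  assumes s: "sol_on T (potE k E) \<psi> \<psi>'" and \<mu>: "\<mu>\<^sup>2 = - E"
  shows "(\<lambda>x. if x \<in> exp ` T then of_real (exp (ln x / 2)) * \<psi> (ln x) else 0) \<in> whittaker_solutions (exp ` T) (- of_real k) \<mu>"
proof -
  define g where "g x = of_real (exp (ln x / 2)) * \<psi> (ln x)" for x
  define f where "f x = (if x \<in> exp ` T then g x else 0)" for x
  from schrodinger_to_whittaker[OF s \<mu>, folded g_def] obtain g''
    where 1: "has_second_deriv_on g g'' (exp ` T)"
    and 2: "\<forall>x\<in>exp ` T. g'' x + (- 1/4 + (- of_real k) / of_real x + (1/4 - \<mu>\<^sup>2) / (of_real x)\<^sup>2) * g x = 0"
    by blast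
  from 1 obtain g' where 3: "\<And>x. x\<in>exp ` T \<Longrightarrow> (g has_vector_derivative g' x) (at x within exp ` T)"
      "\<And>x. x\<in>exp ` T \<Longrightarrow> (g' has_vector_derivative g'' x) (at x within exp ` T)"
    unfolding has_second_deriv_on_def by blast
  have "(f has_vector_derivative g' x) (at x within exp ` T)" if "x \<in> exp ` T" for x
    by (rule has_vector_derivative_transform[OF that _ 3(1)[OF that]]) (simp add: f_def)
  then have "has_second_deriv_on f g'' (exp ` T)"
    unfolding has_second_deriv_on_def using 3(2) by blast
  moreover have "\<forall>x\<in>exp ` T. g'' x + (- 1/4 + (- of_real k) / of_real x + (1/4 - \<mu>\<^sup>2) / (of_real x)\<^sup>2) * f x = 0"
    using 2 by (simp add: f_def)
  moreover have "\<forall>x. x \<notin> exp ` T \<longrightarrow> f x = 0" by (simp add: f_def)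
  ultimately have "f \<in> whittaker_solutions (exp ` T) (- of_real k) \<mu>" unfolding whittaker_solutions_def by blast
  then show ?thesis unfolding f_def[abs_def] g_def .
qed

section \<open>Solution spaces on the half-line\<close>

text \<open>
  Functions on the half-line are represented by their extensions by zero.
\<close>

definition on_half_line :: "real \<Rightarrow> (real \<Rightarrow> complex) \<Rightarrow> real \<Rightarrow> complex" where
  "on_half_line u\<^sub>0 f u = (if u \<in> {u\<^sub>0..} then f u else 0)"

lemma schrodinger_solutions_iff:
  "\<psi> \<in> schrodinger_solutions u\<^sub>0 (V_pot k) E \<longleftrightarrow>
    (\<forall>u. u \<notin> {u\<^sub>0..} \<longrightarrow> \<psi> u = 0) \<and> (\<exists>\<psi>'. sol_on {u\<^sub>0..} (potE k E) \<psi> \<psi>')"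
proof -
  have "(\<exists>\<psi>''. has_second_deriv_on \<psi> \<psi>'' {u\<^sub>0..} \<and> (\<forall>u\<in>{u\<^sub>0..}. - \<psi>'' u + of_real (V_pot k u) * \<psi> u = E * \<psi> u))
    \<longleftrightarrow> (\<exists>\<psi>'. sol_on {u\<^sub>0..} (potE k E) \<psi> \<psi>')" (is "?L \<longleftrightarrow> ?R")
  proof
    assume ?L
    then obtain \<psi>' \<psi>'' where D: "\<And>x. x \<in> {u\<^sub>0..} \<Longrightarrow> (\<psi> has_vector_derivative \<psi>' x) (at x within {u\<^sub>0..}) \<and>
        (\<psi>' has_vector_derivative \<psi>'' x) (at x within {u\<^sub>0..})"
      and eq: "\<And>u. u \<in> {u\<^sub>0..} \<Longrightarrow> - \<psi>'' u + of_real (V_pot k u) * \<psi> u = E * \<psi> u"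
      unfolding has_second_deriv_on_def by metis
    have "\<psi>'' u = potE k E u * \<psi> u" if "u \<in> {u\<^sub>0..}" for u
      using eq[OF that] unfolding potE_def by (metis add.commute add_diff_cancel left_diff_distrib diff_conv_add_uminus minus_diff_eq minus_minus)
    then have "sol_on {u\<^sub>0..} (potE k E) \<psi> \<psi>'" unfolding sol_on_def using D by metis
    then show ?R by blast
  next
    assume ?R
    then obtain \<psi>' where s: "sol_on {u\<^sub>0..} (potE k E) \<psi> \<psi>'" by blast
    show ?L
    proof (intro exI[of _ "\<lambda>u. potE k E u * \<psi> u"] conjI ballI)
      show "has_second_deriv_on \<psi> (\<lambda>u. potE k E u * \<psi> u) {u\<^sub>0..}"
        unfolding has_second_deriv_on_def using sol_onD[OF s] by blast
    qed (simp add: potE_def algebra_simps)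
  qed
  then show ?thesis unfolding schrodinger_solutions_def by blast
qed

lemma on_half_line_solution:
  assumes "sol_on UNIV (potE k E) y y'"
  shows "on_half_line u\<^sub>0 y \<in> schrodinger_solutions u\<^sub>0 (V_pot k) E"
  unfolding schrodinger_solutions_iff
proof (intro conjI exI)
  have "sol_on {u\<^sub>0..} (potE k E) y y'" using assms by (rule sol_on_subset) auto
  then show "sol_on {u\<^sub>0..} (potE k E) (on_half_line u\<^sub>0 y) y'"
    by (rule sol_on_cong) (auto simp: on_half_line_def)
qed (auto simp: on_half_line_def)

lemma schrodinger_solutions_subspace: "cfun.subspace (schrodinger_solutions u\<^sub>0 (V_pot k) E)"
proof (rule cfun.subspaceI)
  show "0 \<in> schrodinger_solutions u\<^sub>0 (V_pot k) E"
    unfolding schrodinger_solutions_iff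
    by (auto intro!: exI[of _ "\<lambda>_. 0"] simp: sol_on_def zero_fun_def has_vector_derivative_const[unfolded])
next
  fix x y assume "x \<in> schrodinger_solutions u\<^sub>0 (V_pot k) E" "y \<in> schrodinger_solutions u\<^sub>0 (V_pot k) E"
  then show "x + y \<in> schrodinger_solutions u\<^sub>0 (V_pot k) E"
    unfolding schrodinger_solutions_iff using sol_on_combine[of "{u\<^sub>0..}" "potE k E" x _ y _ 1 1]
    by (auto simp: plus_fun_def)
next
  fix c x assume "x \<in> schrodinger_solutions u\<^sub>0 (V_pot k) E"
  then show "fscale c x \<in> schrodinger_solutions u\<^sub>0 (V_pot k) E"
    unfolding schrodinger_solutions_iff using sol_on_combine[of "{u\<^sub>0..}" "potE k E" x _ x _ c 0]
    by (auto simp: fscale_def)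
qed

text \<open>
  The solutions with initial data \<open>(1, 0)\<close> and \<open>(0, 1)\<close> at \<open>u\<^sub>0\<close> form a basis.
\<close>

lemma schrodinger_solutions_dim: "cfun.dim (schrodinger_solutions u\<^sub>0 (V_pot k) E) = 2"
proof -
  obtain y y' where y: "sol_on UNIV (potE k E) y y'" "y u\<^sub>0 = 1" "y' u\<^sub>0 = 0"
    using linear_ode_exists[OF potE_continuous] by blast
  obtain z z' where z: "sol_on UNIV (potE k E) z z'" "z u\<^sub>0 = 0" "z' u\<^sub>0 = 1"
    using linear_ode_exists[OF potE_continuous] by blast
  define b1 where "b1 = on_half_line u\<^sub>0 y"
  define b2 where "b2 = on_half_line u\<^sub>0 z"
  have b1u: "b1 u\<^sub>0 = 1" and b2u: "b2 u\<^sub>0 = 0" by (simp_all add: b1_def b2_def on_half_line_def y z)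
  have b2n: "b2 \<noteq> 0"
  proof
    assume "b2 = 0"
    then have "z u = 0" if "u \<ge> u\<^sub>0" for u using that by (metis atLeast_iff b2_def on_half_line_def zero_fun_def)
    then have "(z has_vector_derivative 0) (at u\<^sub>0 within {u\<^sub>0..})"
      using has_vector_derivative_transform[of u\<^sub>0 "{u\<^sub>0..}" z "\<lambda>_. 0" 0] has_vector_derivative_const by auto
    moreover have "(z has_vector_derivative z' u\<^sub>0) (at u\<^sub>0 within {u\<^sub>0..})"
      using sol_onD(1)[OF sol_on_subset[OF z(1)], of "{u\<^sub>0..}" u\<^sub>0] by simp
    moreover have "at u\<^sub>0 within {u\<^sub>0..} \<noteq> bot"
      by (simp add: at_within_Ici_at_right)
    ultimately have "z' u\<^sub>0 = 0" using vector_derivative_unique_within by blast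
    then show False using z by simp
  qed
  have ne: "b1 \<noteq> b2" using b1u b2u by auto
  have ind: "cfun.independent {b1, b2}"
  proof -
    have "b1 \<notin> cfun.span {b2}"
    proof
      assume "b1 \<in> cfun.span {b2}"
      then obtain c where "b1 = fscale c b2" by (auto simp: cfun.span_singleton)
      then show False using b1u b2u by (simp add: fscale_def)
    qed
    moreover have "cfun.independent {b2}" using b2n by simp
    ultimately show ?thesis using ne by (simp add: cfun.independent_insert)
  qed
  show ?thesis
  proof (rule cfun.dim_unique[where B="{b1, b2}"])
    show "{b1, b2} \<subseteq> schrodinger_solutions u\<^sub>0 (V_pot k) E"
      using on_half_line_solution y(1) z(1) by (auto simp: b1_def b2_def)
    show "card {b1, b2} = 2" using ne by simp
    show "schrodinger_solutions u\<^sub>0 (V_pot k) E \<subseteq> cfun.span {b1, b2}"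
    proof
      fix \<psi> assume "\<psi> \<in> schrodinger_solutions u\<^sub>0 (V_pot k) E"
      then obtain \<psi>' where \<psi>: "\<And>u. u \<notin> {u\<^sub>0..} \<Longrightarrow> \<psi> u = 0" "sol_on {u\<^sub>0..} (potE k E) \<psi> \<psi>'"
        unfolding schrodinger_solutions_iff by blast
      define A where "A = \<psi> u\<^sub>0"
      define B where "B = \<psi>' u\<^sub>0"
      have "sol_on UNIV (potE k E) (\<lambda>u. A * y u + B * z u) (\<lambda>u. A * y' u + B * z' u)"
        by (rule sol_on_combine[OF y(1) z(1)])
      then have c: "sol_on {u\<^sub>0..} (potE k E) (\<lambda>u. A * y u + B * z u) (\<lambda>u. A * y' u + B * z' u)"
        by (rule sol_on_subset) simp
      have "\<psi> u = A * b1 u + B * b2 u" for u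
      proof (cases "u \<ge> u\<^sub>0")
        case True
        have "\<psi> u = A * y u + B * z u \<and> \<psi>' u = A * y' u + B * z' u"
          by (rule sol_on_unique_half_line[OF \<psi>(2) c potE_continuous _ _ True])
            (simp_all add: A_def B_def y(2,3) z(2,3))
        then show ?thesis using True by (simp add: b1_def b2_def on_half_line_def)
      qed (simp add: \<psi>(1) b1_def b2_def on_half_line_def)
      then have "\<psi> = fscale A b1 + fscale B b2" by (auto simp: fscale_def fun_eq_iff)
      moreover have "fscale A b1 + fscale B b2 \<in> cfun.span {b1, b2}"
        by (intro cfun.span_add cfun.span_scale cfun.span_base) simp_all
      ultimately show "\<psi> \<in> cfun.span {b1, b2}" by simp
    qed
  qed (rule ind)
qed

lemma schrodinger_solutions_whittaker:
  assumes "\<mu>\<^sup>2 = - E"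
  shows "schrodinger_solutions u\<^sub>0 (V_pot k) E =
     {\<lambda>u. of_real (exp (- u / 2)) * f (exp u) | f. f \<in> whittaker_solutions {exp u\<^sub>0..} (- of_real k) \<mu>}"
proof -
  have img: "exp ` {u\<^sub>0..} = {exp u\<^sub>0..}"
  proof (intro set_eqI iffI)
    fix x assume x: "x \<in> {exp u\<^sub>0..}"
    have "x > 0" by (rule less_le_trans[OF exp_gt_zero[of u\<^sub>0]]) (use x in simp)
    then show "x \<in> exp ` {u\<^sub>0..}" using x by (intro image_eqI[of _ _ "ln x"]) (auto simp: ln_ge_iff)
  qed auto
  show ?thesis
  proof (intro set_eqI iffI)
    fix \<psi> assume "\<psi> \<in> schrodinger_solutions u\<^sub>0 (V_pot k) E"
    then obtain \<psi>' where \<psi>: "\<And>u. u \<notin> {u\<^sub>0..} \<Longrightarrow> \<psi> u = 0" "sol_on {u\<^sub>0..} (potE k E) \<psi> \<psi>'"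
      unfolding schrodinger_solutions_iff by blast
    define f where "f x = (if x \<in> {exp u\<^sub>0..} then of_real (exp (ln x / 2)) * \<psi> (ln x) else 0)" for x
    have "f \<in> whittaker_solutions {exp u\<^sub>0..} (- of_real k) \<mu>"
      using schrodinger_imp_whittaker_solution[OF \<psi>(2) assms] unfolding img f_def[abs_def] .
    moreover have "\<psi> = (\<lambda>u. of_real (exp (- u / 2)) * f (exp u))"
    proof
      fix u
      have "complex_of_real (exp (- u / 2)) * of_real (exp (u / 2)) = 1"
        unfolding of_real_mult[symmetric] exp_add[symmetric] by simp
      then show "\<psi> u = of_real (exp (- u / 2)) * f (exp u)"
        using \<psi>(1)[of u] by (simp add: f_def mult.assoc[symmetric])
    qed
    ultimately show "\<psi> \<in> {\<lambda>u. of_real (exp (- u / 2)) * f (exp u) | f. f \<in> whittaker_solutions {exp u\<^sub>0..} (- of_real k) \<mu>}"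
      by (intro CollectI exI[of _ f] conjI)
  next
    fix \<psi> assume "\<psi> \<in> {\<lambda>u. of_real (exp (- u / 2)) * f (exp u) | f. f \<in> whittaker_solutions {exp u\<^sub>0..} (- of_real k) \<mu>}"
    then obtain f where f: "\<psi> = (\<lambda>u. of_real (exp (- u / 2)) * f (exp u))" "f \<in> whittaker_solutions {exp u\<^sub>0..} (- of_real k) \<mu>"
      by (elim CollectE exE conjE) (rule that)
    have "\<psi> u = 0" if "u \<notin> {u\<^sub>0..}" for u
      using f(2) that by (simp add: f(1) whittaker_solutions_def)
    then show "\<psi> \<in> schrodinger_solutions u\<^sub>0 (V_pot k) E"
      unfolding schrodinger_solutions_iff f(1)
      using whittaker_solution_imp_schrodinger[OF f(2)[folded img] assms] by (simp add: f(1))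
  qed
qed

section \<open>Square-integrable solutions and the Whittaker function\<close>

lemma half_line_integrable_iff:
  fixes g :: "real \<Rightarrow> real"
  assumes "\<And>u. u \<ge> u\<^sub>0 \<Longrightarrow> g u \<ge> 0"
  shows "integrable (half_line u\<^sub>0) g \<longleftrightarrow> g integrable_on {u\<^sub>0..}"
proof -
  have "integrable (half_line u\<^sub>0) g \<longleftrightarrow> g absolutely_integrable_on {u\<^sub>0<..}"
    by (simp add: set_integrable_def integrable_restrict_space)
  also have "\<dots> \<longleftrightarrow> g integrable_on {u\<^sub>0<..}"
    by (rule absolutely_integrable_on_iff_nonneg) (use assms in auto)
  also have "\<dots> \<longleftrightarrow> g integrable_on {u\<^sub>0..}"
    by (rule integrable_spike_set_eq) (auto intro: negligible_subset[of "{u\<^sub>0}"])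
  finally show ?thesis .
qed

lemma on_half_line_L2_iff:
  assumes "continuous_on {u\<^sub>0..} f"
  shows "on_half_line u\<^sub>0 f \<in> L2 (half_line u\<^sub>0) \<longleftrightarrow> (\<lambda>u. (norm (f u))\<^sup>2) integrable_on {u\<^sub>0..}"
proof -
  have "continuous_on {u\<^sub>0<..} f" using assms by (rule continuous_on_subset) auto
  then have "continuous_on {u\<^sub>0<..} (on_half_line u\<^sub>0 f)"
    by (rule continuous_on_eq) (simp add: on_half_line_def)
  then have m: "on_half_line u\<^sub>0 f \<in> borel_measurable (half_line u\<^sub>0)"
    by (intro continuous_imp_measurable_on_sets_lebesgue) auto
  have "(\<lambda>u. (norm (on_half_line u\<^sub>0 f u))\<^sup>2) integrable_on {u\<^sub>0..} \<longleftrightarrow> (\<lambda>u. (norm (f u))\<^sup>2) integrable_on {u\<^sub>0..}"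
    by (rule integrable_cong) (simp add: on_half_line_def)
  then show ?thesis using m half_line_integrable_iff[of u\<^sub>0 "\<lambda>u. (norm (on_half_line u\<^sub>0 f u))\<^sup>2"]
    by (simp add: L2_def)
qed

lemma integrable_norm_squared_bounded:
  fixes f :: "real \<Rightarrow> complex"
  assumes c: "continuous_on {a..} f" and b: "\<And>u. u \<ge> a \<Longrightarrow> (norm (f u))\<^sup>2 \<le> C * exp (- u)"
  shows "(\<lambda>u. (norm (f u))\<^sup>2) integrable_on {a..}"
proof -
  have "(\<lambda>u. (norm (f u))\<^sup>2) absolutely_integrable_on {a..}"
  proof (rule measurable_bounded_by_integrable_imp_absolutely_integrable)
    show "(\<lambda>u. (norm (f u))\<^sup>2) \<in> borel_measurable (lebesgue_on {a..})"
      by (intro continuous_imp_measurable_on_sets_lebesgue continuous_intros c) auto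
    show "(\<lambda>u. C * exp (- u)) integrable_on {a..}"
      using integrable_on_exp_minus_to_infinity[of 1 a] by (intro integrable_on_mult_right) auto
  qed (use b in auto)
  then show ?thesis by (rule set_lebesgue_integral_eq_integral(1))
qed

lemma integrable_norm_squared_combine:
  fixes y z :: "real \<Rightarrow> complex"
  assumes c: "continuous_on {a..} y" "continuous_on {a..} z"
    and i: "(\<lambda>u. (norm (y u))\<^sup>2) integrable_on {a..}" "(\<lambda>u. (norm (z u))\<^sup>2) integrable_on {a..}"
  shows "(\<lambda>u. (norm (c * y u + d * z u))\<^sup>2) integrable_on {a..}"
proof -
  have "(\<lambda>u. (norm (c * y u + d * z u))\<^sup>2) absolutely_integrable_on {a..}"
  proof (rule measurable_bounded_by_integrable_imp_absolutely_integrable)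
    show "(\<lambda>u. (norm (c * y u + d * z u))\<^sup>2) \<in> borel_measurable (lebesgue_on {a..})"
      by (intro continuous_imp_measurable_on_sets_lebesgue continuous_intros c) auto
    show "(\<lambda>u. 2 * (norm c)\<^sup>2 * (norm (y u))\<^sup>2 + 2 * (norm d)\<^sup>2 * (norm (z u))\<^sup>2) integrable_on {a..}"
      by (intro integrable_add integrable_on_mult_right i)
    fix u assume "u \<in> {a..}"
    have "norm (c * y u + d * z u) \<le> norm c * norm (y u) + norm d * norm (z u)" by (metis norm_mult norm_triangle_ineq)
    then have "(norm (c * y u + d * z u))\<^sup>2 \<le> (norm c * norm (y u) + norm d * norm (z u))\<^sup>2" by (intro power_mono) auto
    also have "\<dots> \<le> 2 * (norm c * norm (y u))\<^sup>2 + 2 * (norm d * norm (z u))\<^sup>2"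
      using zero_le_power2[of "norm c * norm (y u) - norm d * norm (z u)"] by (simp add: power2_eq_square algebra_simps)
    finally show "norm ((norm (c * y u + d * z u))\<^sup>2) \<le> 2 * (norm c)\<^sup>2 * (norm (y u))\<^sup>2 + 2 * (norm d)\<^sup>2 * (norm (z u))\<^sup>2"
      by (simp add: power_mult_distrib)
  qed auto
  then show ?thesis by (rule set_lebesgue_integral_eq_integral(1))
qed

lemma potential_large: "\<exists>u\<^sub>1\<ge>a. \<forall>u\<ge>u\<^sub>1. V_pot k u \<ge> R"
proof (intro exI conjI allI impI)
  define u\<^sub>1 where "u\<^sub>1 = max a (4 * \<bar>k\<bar> + 4 * \<bar>R\<bar> + 4)"
  show "u\<^sub>1 \<ge> a" by (simp add: u\<^sub>1_def)
  fix u assume u: "u \<ge> u\<^sub>1"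
  have "u \<ge> 4 * \<bar>k\<bar> + 4 * \<bar>R\<bar> + 4" using u by (simp add: u\<^sub>1_def)
  with exp_ge_add_one_self[of u] have e4: "exp u \<ge> 5 + 4 * \<bar>k\<bar> + 4 * \<bar>R\<bar>" by linarith
  have e: "exp u / 4 + k \<ge> \<bar>R\<bar>" using e4 by linarith
  have e1: "exp u \<ge> 1" using e4 by linarith
  have "\<bar>R\<bar> * 1 \<le> (exp u / 4 + k) * exp u" using e e1 by (intro mult_mono) auto
  also have "\<dots> = V_pot k u" using exp_double[of u] by (simp add: V_pot_def power2_eq_square algebra_simps)
  finally show "V_pot k u \<ge> R" by simp
qed

lemma integrable_norm_squared_subset:
  fixes y :: "real \<Rightarrow> complex"
  assumes "(\<lambda>u. (norm (y u))\<^sup>2) integrable_on {a..}" "a \<le> b"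
  shows "(\<lambda>u. (norm (y u))\<^sup>2) integrable_on {b..}"
proof -
  have "(\<lambda>u. (norm (y u))\<^sup>2) absolutely_integrable_on {a..}"
    using assms(1) by (subst absolutely_integrable_on_iff_nonneg) auto
  then have "(\<lambda>u. (norm (y u))\<^sup>2) absolutely_integrable_on {b..}"
    by (rule set_integrable_subset) (use assms in auto)
  then show ?thesis by (rule set_lebesgue_integral_eq_integral(1))
qed

text \<open>
  With a nonzero Wronskian, some combination has value and derivative \<open>1\<close> at a point beyond which the
  potential exceeds \<open>Re E\<close>; it is square-integrable and yet increases there.
\<close>

theorem square_integrable_wronskian_zero:
  assumes y: "sol_on {a..} (potE k E) y y'" and z: "sol_on {a..} (potE k E) z z'"
    and iy: "(\<lambda>u. (norm (y u))\<^sup>2) integrable_on {a..}" and iz: "(\<lambda>u. (norm (z u))\<^sup>2) integrable_on {a..}"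
    and u: "u \<ge> a"
  shows "y u * z' u - y' u * z u = 0"
proof (rule ccontr)
  assume W0: "y u * z' u - y' u * z u \<noteq> 0"
  obtain b where b: "b \<ge> a" "\<And>u. u \<ge> b \<Longrightarrow> V_pot k u \<ge> Re E" using potential_large by blast
  define W where "W = y b * z' b - y' b * z b"
  have W: "W \<noteq> 0" using wronskian_constant[OF y z convex_real_interval(1), of u b] W0 u b by (simp add: W_def)
  \<comment> \<open>Cramer's rule for the initial data \<open>(1, 1)\<close> at \<open>b\<close>.\<close>
  define c where "c = (z' b - z b) / W"
  define d where "d = (y b - y' b) / W"
  have s: "sol_on {b..} (potE k E) (\<lambda>u. c * y u + d * z u) (\<lambda>u. c * y' u + d * z' u)"
    by (rule sol_on_subset[OF sol_on_combine[OF y z]]) (use b in auto)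
  have i: "(\<lambda>u. (norm (c * y u + d * z u))\<^sup>2) integrable_on {b..}"
    by (rule integrable_norm_squared_subset[OF integrable_norm_squared_combine[OF sol_on_continuous(1)[OF y] sol_on_continuous(1)[OF z] iy iz] b(1)])
  have 1: "c * y b + d * z b = 1"
  proof -
    have "c * y b + d * z b = W / W" unfolding c_def d_def by (simp add: W_def diff_divide_distrib[symmetric] add_divide_distrib[symmetric] algebra_simps)
    then show ?thesis using W by simp
  qed
  have 2: "c * y' b + d * z' b = 1"
  proof -
    have "c * y' b + d * z' b = W / W" unfolding c_def d_def by (simp add: W_def diff_divide_distrib[symmetric] add_divide_distrib[symmetric] algebra_simps)
    then show ?thesis using W by simp
  qed
  have "(c * y b + d * z b) \<bullet> (c * y' b + d * z' b) + 0 * (norm (c * y b + d * z b))\<^sup>2 \<le> 0"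
    by (rule square_integrable_solution_decays[OF s _ _ i]) (use b in \<open>auto simp: potE_def\<close>)
  then show False unfolding 1 2 by simp
qed

lemma wronskian_zero_proportional:
  fixes y y' z z' :: complex
  assumes "y * z' - y' * z = 0" "z \<noteq> 0 \<or> z' \<noteq> 0"
  shows "\<exists>c. y = c * z \<and> y' = c * z'"
proof (cases "z = 0")
  case True
  then show ?thesis using assms by (intro exI[of _ "y' / z'"]) auto
next
  case False
  then show ?thesis using assms by (intro exI[of _ "y / z"]) (auto simp: field_simps)
qed

text \<open>
  The solution with the asymptotics of the Whittaker function, in the variable \<open>u = ln x\<close>; the remainder
  \<open>O(1 / x)\<close> is \<open>O(exp (- u))\<close>.
\<close>

definition is_recessive :: "real \<Rightarrow> complex \<Rightarrow> (real \<Rightarrow> complex) \<Rightarrow> (real \<Rightarrow> complex) \<Rightarrow> bool" where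
  "is_recessive k E \<psi> \<psi>' \<longleftrightarrow> sol_on UNIV (potE k E) \<psi> \<psi>' \<and>
     (\<exists>C U. \<forall>u\<ge>U. norm (\<psi> u / of_real (weight k u) - 1) \<le> C * exp (- u))"

lemma recessive_exists: "\<exists>\<psi> \<psi>'. is_recessive k E \<psi> \<psi>'"
  unfolding is_recessive_def using recessive_solution_exists by blast

lemma recessive_sol: "is_recessive k E \<psi> \<psi>' \<Longrightarrow> sol_on S (potE k E) \<psi> \<psi>'"
  unfolding is_recessive_def using sol_on_subset by blast

lemma recessive_ratio_tendsto_1:
  assumes "is_recessive k E \<psi> \<psi>'"
  shows "((\<lambda>u. \<psi> u / of_real (weight k u)) \<longlongrightarrow> 1) at_top"
proof -
  obtain C U where C: "\<And>u. u \<ge> U \<Longrightarrow> norm (\<psi> u / of_real (weight k u) - 1) \<le> C * exp (- u)"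
    using assms unfolding is_recessive_def by blast
  have "((\<lambda>u. \<psi> u / of_real (weight k u) - 1) \<longlongrightarrow> 0) at_top"
  proof (rule Lim_null_comparison)
    show "\<forall>\<^sub>F u in at_top. norm (\<psi> u / of_real (weight k u) - 1) \<le> C * exp (- u)"
      using eventually_ge_at_top[of U] by eventually_elim (rule C)
    show "((\<lambda>u. C * exp (- u)) \<longlongrightarrow> 0) at_top"
      using tendsto_mult_left[OF exp_minus_tendsto_0, of C] by simp
  qed
  then show ?thesis by (simp add: LIM_zero_iff)
qed

lemma recessive_bounds:
  assumes "is_recessive k E \<psi> \<psi>'"
  shows "\<exists>C>0. \<forall>u\<ge>a. norm (\<psi> u) \<le> C * weight k u" "\<exists>U\<ge>a. \<forall>u\<ge>U. norm (\<psi> u) \<ge> weight k u / 2"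
proof -
  define r where "r u = norm (\<psi> u / of_real (weight k u))" for u
  have r: "norm (\<psi> u) = r u * weight k u" for u
    unfolding r_def by (simp add: norm_divide abs_of_pos[OF weight_pos(1)])
  have "(r \<longlongrightarrow> norm (1::complex)) at_top"
    unfolding r_def[abs_def] by (intro tendsto_intros recessive_ratio_tendsto_1[OF assms])
  then have "\<forall>\<^sub>F u in at_top. dist (r u) 1 < 1 / 2" using tendstoD[of r 1 at_top "1/2"] by simp
  then obtain U0 where U0: "\<And>u. u \<ge> U0 \<Longrightarrow> dist (r u) 1 < 1 / 2" by (auto simp: eventually_at_top_linorder)
  define U where "U = max a U0"
  have U': "\<bar>r u - 1\<bar> < 1 / 2" if "u \<ge> U" for u
    using U0[of u] that unfolding U_def dist_real_def by simp
  have U: "r u \<le> 2" "r u \<ge> 1 / 2" if "u \<ge> U" for u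
    using U'[OF that] unfolding abs_less_iff by linarith+
  show "\<exists>U\<ge>a. \<forall>u\<ge>U. norm (\<psi> u) \<ge> weight k u / 2"
  proof (intro exI[of _ U] conjI allI impI)
    fix u assume "u \<ge> U"
    then have "1 / 2 * weight k u \<le> r u * weight k u" using U by (intro mult_right_mono) (auto simp: less_imp_le)
    then show "norm (\<psi> u) \<ge> weight k u / 2" unfolding r by simp
  qed (simp add: U_def)
  have rc: "continuous_on {a..U} r"
    unfolding r_def[abs_def]
    by (intro continuous_intros sol_on_continuous(1)[OF recessive_sol[OF assms]] weight_continuous) simp
  then have "bounded (r ` {a..U})" by (intro compact_imp_bounded compact_continuous_image) auto
  then obtain B where B: "\<And>u. u \<in> {a..U} \<Longrightarrow> norm (r u) \<le> B" unfolding bounded_iff by (metis imageI)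
  show "\<exists>C>0. \<forall>u\<ge>a. norm (\<psi> u) \<le> C * weight k u"
  proof (intro exI[of _ "\<bar>B\<bar> + 2"] conjI allI impI)
    fix u assume u: "u \<ge> a"
    have "r u \<le> \<bar>B\<bar> + 2"
    proof (cases "u \<le> U")
      case True
      then show ?thesis using B[of u] u by auto
    next
      case False
      then show ?thesis using U(1)[of u] by simp
    qed
    then have "r u * weight k u \<le> (\<bar>B\<bar> + 2) * weight k u" by (intro mult_right_mono) (auto simp: less_imp_le)
    then show "norm (\<psi> u) \<le> (\<bar>B\<bar> + 2) * weight k u" unfolding r .
  qed simp
qed

lemma recessive_square_integrable:
  assumes "is_recessive k E \<psi> \<psi>'"
  shows "(\<lambda>u. (norm (\<psi> u))\<^sup>2) integrable_on {a..}"
proof -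
  obtain C where C: "C > 0" "\<And>u. u \<ge> a \<Longrightarrow> norm (\<psi> u) \<le> C * weight k u" using recessive_bounds(1)[OF assms] by blast
  obtain B where B: "\<And>u. u \<ge> a \<Longrightarrow> (weight k u)\<^sup>2 \<le> B * exp (- u)" using weight_square_bound by blast
  show ?thesis
  proof (rule integrable_norm_squared_bounded)
    show "continuous_on {a..} \<psi>" by (rule sol_on_continuous(1)[OF recessive_sol[OF assms]])
    fix u assume u: "u \<ge> a"
    have "(norm (\<psi> u))\<^sup>2 \<le> (C * weight k u)\<^sup>2" using C(2)[OF u] by (intro power_mono) auto
    also have "\<dots> = C\<^sup>2 * (weight k u)\<^sup>2" by (simp add: power_mult_distrib)
    also have "\<dots> \<le> C\<^sup>2 * (B * exp (- u))" using B[OF u] by (intro mult_left_mono) auto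
    finally show "(norm (\<psi> u))\<^sup>2 \<le> (C\<^sup>2 * B) * exp (- u)" by simp
  qed
qed

lemma recessive_nontrivial:
  assumes "is_recessive k E \<psi> \<psi>'"
  shows "\<psi> a \<noteq> 0 \<or> \<psi>' a \<noteq> 0"
proof (rule ccontr)
  assume "\<not> ?thesis"
  then have 0: "\<psi> a = 0" "\<psi>' a = 0" by auto
  obtain U where U: "U \<ge> a" "norm (\<psi> U) \<ge> weight k U / 2" using recessive_bounds(2)[OF assms] by blast
  have "\<psi> U = 0"
    using sol_on_zero_forward[OF U(1) recessive_sol[OF assms] potE_continuous 0] by simp
  then show False using U(2) weight_pos(1)[of k U] by simp
qed

text \<open>
  The limit point property in the form used throughout: square-integrability alone determines a solution
  up to a factor.
\<close>

theorem square_integrable_multiple_of_recessive: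
  assumes \<psi>: "is_recessive k E \<psi> \<psi>'" and y: "sol_on {a..} (potE k E) y y'"
    and iy: "(\<lambda>u. (norm (y u))\<^sup>2) integrable_on {a..}"
  shows "\<exists>c. \<forall>u\<ge>a. y u = c * \<psi> u \<and> y' u = c * \<psi>' u"
proof -
  have s: "sol_on {a..} (potE k E) \<psi> \<psi>'" by (rule recessive_sol[OF \<psi>])
  have "y a * \<psi>' a - y' a * \<psi> a = 0"
    by (rule square_integrable_wronskian_zero[OF y s iy recessive_square_integrable[OF \<psi>]]) simp
  from wronskian_zero_proportional[OF this recessive_nontrivial[OF \<psi>]]
  obtain c where c: "y a = c * \<psi> a" "y' a = c * \<psi>' a" by blast
  have "sol_on {a..} (potE k E) (\<lambda>u. c * \<psi> u + 0 * \<psi> u) (\<lambda>u. c * \<psi>' u + 0 * \<psi>' u)" by (rule sol_on_combine[OF s s])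
  then have "sol_on {a..} (potE k E) (\<lambda>u. c * \<psi> u) (\<lambda>u. c * \<psi>' u)" by simp
  from sol_on_unique_half_line[OF y this potE_continuous c] show ?thesis by blast
qed

text \<open>
  Another recessive solution is a multiple, and both ratios to the weight tend to \<open>1\<close>.
\<close>

lemma recessive_unique:
  assumes \<psi>: "is_recessive k E \<psi> \<psi>'" and \<phi>: "is_recessive k E \<phi> \<phi>'"
  shows "\<phi> = \<psi>"
proof
  fix a
  obtain c where c: "\<And>u. u \<ge> a \<Longrightarrow> \<phi> u = c * \<psi> u"
    using square_integrable_multiple_of_recessive[OF \<psi> recessive_sol[OF \<phi>] recessive_square_integrable[OF \<phi>]] by blast
  have "((\<lambda>u. c * (\<psi> u / of_real (weight k u))) \<longlongrightarrow> c * 1) at_top"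
    by (intro tendsto_intros recessive_ratio_tendsto_1[OF \<psi>])
  moreover have "\<forall>\<^sub>F u in at_top. c * (\<psi> u / of_real (weight k u)) = \<phi> u / of_real (weight k u)"
    using eventually_ge_at_top[of a] by eventually_elim (simp add: c)
  ultimately have "((\<lambda>u. \<phi> u / of_real (weight k u)) \<longlongrightarrow> c * 1) at_top" by (rule Lim_transform_eventually)
  then have "((\<lambda>u. \<phi> u / of_real (weight k u)) \<longlongrightarrow> c) at_top" by simp
  then have "c = 1" using recessive_ratio_tendsto_1[OF \<phi>] tendsto_unique[OF trivial_limit_at_top_linorder] by blast
  then show "\<phi> a = \<psi> a" using c[of a] by simp
qed

lemma whittaker_ratio:
  fixes f :: "real \<Rightarrow> complex"
  assumes "x > 0"
  shows "f x / (of_real (exp (- x / 2)) * of_real x powr (- of_real k))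
     = of_real (exp (- ln x / 2)) * f x / of_real (weight k (ln x))"
proof -
  have "complex_of_real x powr (- of_real k) = of_real (x powr (- k))"
    using powr_of_real[of x "- k"] assms by simp
  moreover have "weight k (ln x) = exp (- ln x / 2) * (exp (- x / 2) * x powr (- k))"
    using assms by (simp add: weight_def powr_def exp_add[symmetric] exp_diff[symmetric] algebra_simps)
  ultimately show ?thesis by simp
qed

text \<open>
  Whittaker solutions on \<open>{0<..}\<close> with the required asymptotics correspond to recessive solutions on the
  line, so existence and uniqueness of the latter show that the description in \<open>whittaker_W_def\<close>
  determines a function. The recessive solution depends on \<open>E = - \<mu>\<^sup>2\<close> only, which explains the
  symmetry in \<open>\<mu>\<close>.
\<close>

theorem whittaker_W_recessive:
  assumes \<psi>: "is_recessive k E \<psi> \<psi>'" and \<mu>: "\<mu>\<^sup>2 = - E"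
  shows "of_real (exp (- u / 2)) * whittaker_W (- of_real k) \<mu> (exp u) = \<psi> u"
proof -
  have img: "exp ` UNIV = {0::real<..}"
  proof (intro set_eqI iffI)
    fix x :: real assume "x \<in> {0<..}"
    then show "x \<in> exp ` UNIV" by (intro image_eqI[of _ exp "ln x"]) auto
  qed auto
  define P where "P f \<longleftrightarrow> f \<in> whittaker_solutions {0<..} (- of_real k) \<mu> \<and>
        (\<lambda>x. f x / (of_real (exp (- x / 2)) * of_real x powr (- of_real k)) - 1)
          \<in> O[at_top](\<lambda>x. 1 / of_real x)" for f :: "real \<Rightarrow> complex"
  define f where "f x = (if x \<in> {0<..} then of_real (exp (ln x / 2)) * \<psi> (ln x) else 0)" for x
  have ee: "complex_of_real (exp (- v / 2)) * of_real (exp (v / 2)) = 1" for v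
    unfolding of_real_mult[symmetric] exp_add[symmetric] by simp
  have Pf: "P f"
    unfolding P_def
  proof
    show "f \<in> whittaker_solutions {0<..} (- of_real k) \<mu>"
      using schrodinger_imp_whittaker_solution[OF recessive_sol[OF \<psi>, of UNIV] \<mu>] unfolding img f_def[abs_def] .
    obtain C U where C: "\<And>u. u \<ge> U \<Longrightarrow> norm (\<psi> u / of_real (weight k u) - 1) \<le> C * exp (- u)"
      using \<psi> unfolding is_recessive_def by blast
    show "(\<lambda>x. f x / (of_real (exp (- x / 2)) * of_real x powr (- of_real k)) - 1) \<in> O[at_top](\<lambda>x. 1 / of_real x)"
    proof (rule landau_o.bigI)
      show "\<bar>C\<bar> + 1 > 0" by simp
      show "\<forall>\<^sub>F x in at_top. norm (f x / (of_real (exp (- x / 2)) * of_real x powr (- of_real k)) - 1)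
          \<le> (\<bar>C\<bar> + 1) * norm (1 / complex_of_real x)"
        using eventually_ge_at_top[of "exp U"]
      proof eventually_elim
        fix x assume x: "x \<ge> exp U"
        have x0: "x > 0" by (rule less_le_trans[OF exp_gt_zero x])
        have lx: "ln x \<ge> U" using x x0 by (simp add: ln_ge_iff)
        have "f x / (of_real (exp (- x / 2)) * of_real x powr (- of_real k)) = \<psi> (ln x) / of_real (weight k (ln x))"
          unfolding whittaker_ratio[OF x0] using x0 ee[of "ln x"] by (simp add: f_def mult.assoc[symmetric])
        then have "norm (f x / (of_real (exp (- x / 2)) * of_real x powr (- of_real k)) - 1) \<le> C * exp (- ln x)"
          using C[OF lx] by simp
        also have "\<dots> = C * (1 / x)" using x0 by (simp add: exp_minus field_simps)
        also have "\<dots> \<le> (\<bar>C\<bar> + 1) * (1 / x)" using x0 by (intro mult_right_mono) auto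
        also have "\<dots> = (\<bar>C\<bar> + 1) * norm (1 / complex_of_real x)" using x0 by (simp add: norm_divide)
        finally show "norm (f x / (of_real (exp (- x / 2)) * of_real x powr (- of_real k)) - 1)
          \<le> (\<bar>C\<bar> + 1) * norm (1 / complex_of_real x)" .
      qed
    qed
  qed
  have Puniq: "h = f" if h: "P h" for h
  proof -
    have hs: "h \<in> whittaker_solutions (exp ` UNIV) (- of_real k) \<mu>" using h unfolding P_def img by blast
    have h0: "h x = 0" if "x \<notin> {0<..}" for x using hs that unfolding whittaker_solutions_def img by blast
    define \<phi> where "\<phi> u = of_real (exp (- u / 2)) * h (exp u)" for u
    obtain \<phi>' where s: "sol_on UNIV (potE k E) \<phi> \<phi>'"
      using whittaker_solution_imp_schrodinger[OF hs \<mu>] unfolding \<phi>_def[abs_def] by blast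
    obtain C where C: "C > 0" "\<forall>\<^sub>F x in at_top. norm (h x / (of_real (exp (- x / 2)) * of_real x powr (- of_real k)) - 1)
          \<le> C * norm (1 / complex_of_real x)"
      using h unfolding P_def by (auto elim: landau_o.bigE)
    obtain X where X: "\<And>x. x \<ge> X \<Longrightarrow> norm (h x / (of_real (exp (- x / 2)) * of_real x powr (- of_real k)) - 1)
          \<le> C * norm (1 / complex_of_real x)"
      using C(2) unfolding eventually_at_top_linorder by blast
    have "norm (\<phi> u / of_real (weight k u) - 1) \<le> C * exp (- u)" if u: "u \<ge> X" for u
    proof -
      \<comment> \<open>The bound for \<open>x \<ge> X\<close> is available at \<open>x = exp u\<close> as soon as \<open>u \<ge> X\<close>.\<close>
      have "exp u \<ge> X" using exp_ge_add_one_self[of u] u by linarith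
      from X[OF this] show ?thesis
        unfolding whittaker_ratio[OF exp_gt_zero] by (simp add: \<phi>_def norm_divide exp_minus field_simps)
    qed
    then have "is_recessive k E \<phi> \<phi>'" unfolding is_recessive_def using s by blast
    from recessive_unique[OF \<psi> this] have eq: "\<phi> = \<psi>" .
    show "h = f"
    proof
      fix x
      show "h x = f x"
      proof (cases "x > 0")
        case True
        have "\<psi> (ln x) = of_real (exp (- ln x / 2)) * h x" using True by (simp add: eq[symmetric] \<phi>_def)
        then have "f x = (of_real (exp (- ln x / 2)) * of_real (exp (ln x / 2))) * h x" using True by (simp add: f_def)
        then show ?thesis unfolding ee by simp
      qed (simp add: h0 f_def)
    qed
  qed
  have "whittaker_W (- of_real k) \<mu> = (THE f. P f)" unfolding whittaker_W_def P_def ..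
  also have "\<dots> = f" by (rule the_equality[of P f, OF Pf Puniq])
  finally have "whittaker_W (- of_real k) \<mu> = f" .
  then show ?thesis using ee[of u] by (simp add: f_def mult.assoc[symmetric])
qed

theorem square_integrable_solutions_span:
  assumes \<psi>: "is_recessive k E \<psi> \<psi>'"
  shows "schrodinger_solutions u\<^sub>0 (V_pot k) E \<inter> L2 (half_line u\<^sub>0) = cfun.span {on_half_line u\<^sub>0 \<psi>}"
    "on_half_line u\<^sub>0 \<psi> \<noteq> 0"
proof -
  show "on_half_line u\<^sub>0 \<psi> \<noteq> 0"
  proof
    assume "on_half_line u\<^sub>0 \<psi> = 0"
    then have "\<psi> u = 0" if "u \<ge> u\<^sub>0" for u using that by (metis atLeast_iff on_half_line_def zero_fun_def)
    then show False using recessive_bounds(2)[OF \<psi>, of u\<^sub>0] weight_pos(1)[of k]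
      by (metis norm_zero order_refl half_gt_zero not_less)
  qed
  show "schrodinger_solutions u\<^sub>0 (V_pot k) E \<inter> L2 (half_line u\<^sub>0) = cfun.span {on_half_line u\<^sub>0 \<psi>}"
  proof (intro set_eqI iffI)
    fix \<phi> assume "\<phi> \<in> schrodinger_solutions u\<^sub>0 (V_pot k) E \<inter> L2 (half_line u\<^sub>0)"
    then have "\<phi> \<in> schrodinger_solutions u\<^sub>0 (V_pot k) E" and L: "\<phi> \<in> L2 (half_line u\<^sub>0)" by simp_all
    then obtain \<phi>' where \<phi>: "\<And>u. u \<notin> {u\<^sub>0..} \<Longrightarrow> \<phi> u = 0" "sol_on {u\<^sub>0..} (potE k E) \<phi> \<phi>'"
      unfolding schrodinger_solutions_iff by blast
    have "on_half_line u\<^sub>0 \<phi> = \<phi>" using \<phi>(1) by (auto simp: on_half_line_def)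
    then have "(\<lambda>u. (norm (\<phi> u))\<^sup>2) integrable_on {u\<^sub>0..}"
      using L on_half_line_L2_iff[OF sol_on_continuous(1)[OF \<phi>(2)]] by simp
    from square_integrable_multiple_of_recessive[OF \<psi> \<phi>(2) this]
    obtain c where "\<forall>u\<ge>u\<^sub>0. \<phi> u = c * \<psi> u \<and> \<phi>' u = c * \<psi>' u" ..
    then have "\<phi> = fscale c (on_half_line u\<^sub>0 \<psi>)" using \<phi>(1) by (auto simp: fscale_def on_half_line_def fun_eq_iff)
    then show "\<phi> \<in> cfun.span {on_half_line u\<^sub>0 \<psi>}" by (simp add: cfun.span_scale cfun.span_base)
  next
    fix \<phi> assume "\<phi> \<in> cfun.span {on_half_line u\<^sub>0 \<psi>}"
    then obtain c where c: "\<phi> = fscale c (on_half_line u\<^sub>0 \<psi>)" by (auto simp: cfun.span_singleton)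
    then have e: "\<phi> = on_half_line u\<^sub>0 (\<lambda>u. c * \<psi> u + 0 * \<psi> u)" by (auto simp: fscale_def on_half_line_def)
    have s: "sol_on S (potE k E) \<psi> \<psi>'" for S by (rule recessive_sol[OF \<psi>])
    note i = recessive_square_integrable[OF \<psi>]
    have "\<phi> \<in> schrodinger_solutions u\<^sub>0 (V_pot k) E"
      unfolding e by (rule on_half_line_solution[OF sol_on_combine[OF s s]])
    moreover have "\<phi> \<in> L2 (half_line u\<^sub>0)"
      unfolding e
      by (subst on_half_line_L2_iff[OF sol_on_continuous(1)[OF sol_on_combine[OF s s]]])
        (rule integrable_norm_squared_combine[OF sol_on_continuous(1)[OF s] sol_on_continuous(1)[OF s] i i])
    ultimately show "\<phi> \<in> schrodinger_solutions u\<^sub>0 (V_pot k) E \<inter> L2 (half_line u\<^sub>0)" by blast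
  qed
qed

theorem limit_point_type_V_pot: "limit_point_type u\<^sub>0 (V_pot k)"
  unfolding limit_point_type_def
proof (intro conjI allI impI)
  show "continuous_on {u\<^sub>0..} (V_pot k)" unfolding V_pot_def[abs_def] by (intro continuous_intros)
  fix E :: complex
  obtain \<psi> \<psi>' where \<psi>: "is_recessive k E \<psi> \<psi>'" using recessive_exists by blast
  note S = square_integrable_solutions_span[OF \<psi>, of u\<^sub>0]
  show "\<exists>\<psi>\<in>schrodinger_solutions u\<^sub>0 (V_pot k) E \<inter> L2 (half_line u\<^sub>0). \<psi> \<noteq> 0 \<and>
      (\<forall>\<phi>\<in>schrodinger_solutions u\<^sub>0 (V_pot k) E \<inter> L2 (half_line u\<^sub>0). \<exists>c. \<phi> = fscale c \<psi>)"
    unfolding S(1)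
  proof (intro bexI[of _ "on_half_line u\<^sub>0 \<psi>"] conjI ballI S(2))
    show "on_half_line u\<^sub>0 \<psi> \<in> cfun.span {on_half_line u\<^sub>0 \<psi>}" by (rule cfun.span_base) simp
    fix \<phi> assume "\<phi> \<in> cfun.span {on_half_line u\<^sub>0 \<psi>}"
    then show "\<exists>c. \<phi> = fscale c (on_half_line u\<^sub>0 \<psi>)" by (auto simp: cfun.span_singleton)
  qed
qed

theorem square_integrable_solutions:
  "cfun.subspace (schrodinger_solutions u\<^sub>0 (V_pot k) E \<inter> L2 (half_line u\<^sub>0))"
  "cfun.dim (schrodinger_solutions u\<^sub>0 (V_pot k) E \<inter> L2 (half_line u\<^sub>0)) = 1"
  "E = z\<^sup>2 \<Longrightarrow> of_real (exp (- u / 2)) * whittaker_W (- of_real k) (\<i> * z) (exp u) =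
     of_real (exp (- u / 2)) * whittaker_W (- of_real k) (- \<i> * z) (exp u)"
  "E = z\<^sup>2 \<Longrightarrow> schrodinger_solutions u\<^sub>0 (V_pot k) E \<inter> L2 (half_line u\<^sub>0) =
     cfun.span {\<lambda>u. if u \<in> {u\<^sub>0..} then of_real (exp (- u / 2)) * whittaker_W (- of_real k) (\<i> * z) (exp u) else 0}"
proof -
  obtain \<psi> \<psi>' where \<psi>: "is_recessive k E \<psi> \<psi>'" using recessive_exists by blast
  note S = square_integrable_solutions_span[OF \<psi>, of u\<^sub>0]
  show "cfun.subspace (schrodinger_solutions u\<^sub>0 (V_pot k) E \<inter> L2 (half_line u\<^sub>0))"
    unfolding S(1) by (rule cfun.subspace_span)
  have "cfun.independent {on_half_line u\<^sub>0 \<psi>}" using S(2) by simp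
  then show "cfun.dim (schrodinger_solutions u\<^sub>0 (V_pot k) E \<inter> L2 (half_line u\<^sub>0)) = 1"
    unfolding S(1) using cfun.dim_span_eq_card_independent by fastforce
  assume E: "E = z\<^sup>2"
  have "(\<i> * z)\<^sup>2 = - E" "(- \<i> * z)\<^sup>2 = - E" using E by (simp_all add: power_mult_distrib)
  note W = this[THEN whittaker_W_recessive[OF \<psi>]]
  show "of_real (exp (- u / 2)) * whittaker_W (- of_real k) (\<i> * z) (exp u) =
     of_real (exp (- u / 2)) * whittaker_W (- of_real k) (- \<i> * z) (exp u)" unfolding W ..
  show "schrodinger_solutions u\<^sub>0 (V_pot k) E \<inter> L2 (half_line u\<^sub>0) =
     cfun.span {\<lambda>u. if u \<in> {u\<^sub>0..} then of_real (exp (- u / 2)) * whittaker_W (- of_real k) (\<i> * z) (exp u) else 0}"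
    unfolding W S(1) on_half_line_def[abs_def] ..
qed

section \<open>Square-integrable functions\<close>

lemma L2D:
  assumes "f \<in> L2 M"
  shows "f \<in> borel_measurable M" "integrable M (\<lambda>x. (norm (f x))\<^sup>2)"
  using assms by (auto simp: L2_def)

lemma L2_norm_product_integrable:
  assumes f: "f \<in> L2 M" and g: "g \<in> L2 M"
  shows "integrable M (\<lambda>x. norm (f x) * norm (g x))"
proof (rule Bochner_Integration.integrable_bound)
  show "integrable M (\<lambda>x. (norm (f x))\<^sup>2 + (norm (g x))\<^sup>2)" using L2D(2)[OF f] L2D(2)[OF g] by (rule Bochner_Integration.integrable_add)
  show "(\<lambda>x. norm (f x) * norm (g x)) \<in> borel_measurable M" using L2D(1)[OF f] L2D(1)[OF g] by measurable
  have "norm (norm (f x) * norm (g x)) \<le> norm ((norm (f x))\<^sup>2 + (norm (g x))\<^sup>2)" for x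
  proof -
    have "2 * (norm (f x) * norm (g x)) \<le> (norm (f x))\<^sup>2 + (norm (g x))\<^sup>2"
      using sum_squares_bound[of "norm (f x)" "norm (g x)"] by (simp add: mult.assoc)
    moreover have "0 \<le> norm (f x) * norm (g x)" by simp
    ultimately have "norm (f x) * norm (g x) \<le> (norm (f x))\<^sup>2 + (norm (g x))\<^sup>2" by linarith
    then show ?thesis by (simp add: add_nonneg_nonneg)
  qed
  then show "AE x in M. norm (norm (f x) * norm (g x)) \<le> norm ((norm (f x))\<^sup>2 + (norm (g x))\<^sup>2)" by simp
qed

lemma L2_inner_integrable:
  assumes f: "f \<in> L2 M" and g: "g \<in> L2 M"
  shows "integrable M (\<lambda>x. f x * cnj (g x))" "integrable M (\<lambda>x. f x * g x)"
proof -
  have m: "f \<in> borel_measurable M" "g \<in> borel_measurable M" using f g by (auto dest: L2D)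
  then have "(\<lambda>x. f x * cnj (g x)) \<in> borel_measurable M" "(\<lambda>x. f x * g x) \<in> borel_measurable M"
    using borel_measurable_continuous_onI[OF continuous_on_cnj[OF continuous_on_id]] by measurable
  then show "integrable M (\<lambda>x. f x * cnj (g x))" "integrable M (\<lambda>x. f x * g x)"
    by (auto intro!: Bochner_Integration.integrable_bound[OF L2_norm_product_integrable[OF f g]] simp: norm_mult)
qed

lemma L2_combine:
  assumes f: "f \<in> L2 M" and g: "g \<in> L2 M"
  shows "(\<lambda>x. c * f x + d * g x) \<in> L2 M"
proof -
  have m [measurable]: "f \<in> borel_measurable M" "g \<in> borel_measurable M" using f g by (auto dest: L2D)
  have "integrable M (\<lambda>x. (norm (c * f x + d * g x))\<^sup>2)"
  proof (rule Bochner_Integration.integrable_bound)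
    show "integrable M (\<lambda>x. 2 * (norm c)\<^sup>2 * (norm (f x))\<^sup>2 + 2 * (norm d)\<^sup>2 * (norm (g x))\<^sup>2)"
      using L2D(2)[OF f] L2D(2)[OF g] by (intro Bochner_Integration.integrable_add integrable_mult_right)
    show "(\<lambda>x. (norm (c * f x + d * g x))\<^sup>2) \<in> borel_measurable M" by measurable
    have "norm ((norm (c * f x + d * g x))\<^sup>2) \<le> norm (2 * (norm c)\<^sup>2 * (norm (f x))\<^sup>2 + 2 * (norm d)\<^sup>2 * (norm (g x))\<^sup>2)" for x
    proof -
      have "norm (c * f x + d * g x) \<le> norm c * norm (f x) + norm d * norm (g x)" by (metis norm_mult norm_triangle_ineq)
      then have "(norm (c * f x + d * g x))\<^sup>2 \<le> (norm c * norm (f x) + norm d * norm (g x))\<^sup>2" by (intro power_mono) auto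
      also have "\<dots> \<le> 2 * (norm c * norm (f x))\<^sup>2 + 2 * (norm d * norm (g x))\<^sup>2"
        using zero_le_power2[of "norm c * norm (f x) - norm d * norm (g x)"] by (simp add: power2_eq_square algebra_simps)
      finally show ?thesis by (simp add: power_mult_distrib)
    qed
    then show "AE x in M. norm ((norm (c * f x + d * g x))\<^sup>2) \<le> norm (2 * (norm c)\<^sup>2 * (norm (f x))\<^sup>2 + 2 * (norm d)\<^sup>2 * (norm (g x))\<^sup>2)"
      by simp
  qed
  moreover have "(\<lambda>x. c * f x + d * g x) \<in> borel_measurable M" by measurable
  ultimately show ?thesis by (simp add: L2_def)
qed

lemma L2_cnj: "f \<in> L2 M \<Longrightarrow> (\<lambda>x. cnj (f x)) \<in> L2 M"
  unfolding L2_def using borel_measurable_continuous_onI[OF continuous_on_cnj[OF continuous_on_id]]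
  by (auto intro: measurable_compose)

lemma L2_scale: "f \<in> L2 M \<Longrightarrow> (\<lambda>x. c * f x) \<in> L2 M"
  using L2_combine[of f M f c 0] by simp

lemma L2_inner_combine_left:
  assumes "f \<in> L2 M" "g \<in> L2 M" "h \<in> L2 M"
  shows "L2_inner M (\<lambda>x. c * f x + d * g x) h = c * L2_inner M f h + d * L2_inner M g h"
proof -
  have "L2_inner M (\<lambda>x. c * f x + d * g x) h = (\<integral>x. c * (f x * cnj (h x)) + d * (g x * cnj (h x)) \<partial>M)"
    unfolding L2_inner_def by (simp add: algebra_simps)
  then show ?thesis unfolding L2_inner_def
    using L2_inner_integrable(1)[OF assms(1,3)] L2_inner_integrable(1)[OF assms(2,3)] by simp
qed

lemma L2_inner_commute: "L2_inner M g f = cnj (L2_inner M f g)"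
  unfolding L2_inner_def by (subst Bochner_Integration.integral_cnj[symmetric]) (simp add: mult.commute del: Bochner_Integration.integral_cnj)

lemma L2_inner_combine_right:
  assumes "f \<in> L2 M" "g \<in> L2 M" "h \<in> L2 M"
  shows "L2_inner M h (\<lambda>x. c * f x + d * g x) = cnj c * L2_inner M h f + cnj d * L2_inner M h g"
  unfolding L2_inner_commute[of M h] L2_inner_combine_left[OF assms] by simp

lemma L2_inner_cong_AE:
  assumes "AE x in M. f x = f' x" "AE x in M. g x = g' x"
    and "f \<in> L2 M" "f' \<in> L2 M" "g \<in> L2 M" "g' \<in> L2 M"
  shows "L2_inner M f g = L2_inner M f' g'"
  unfolding L2_inner_def
proof (rule integral_cong_AE)
  show "(\<lambda>x. f x * cnj (g x)) \<in> borel_measurable M" "(\<lambda>x. f' x * cnj (g' x)) \<in> borel_measurable M"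
    by (rule borel_measurable_integrable[OF L2_inner_integrable(1)[OF assms(3,5)]],
        rule borel_measurable_integrable[OF L2_inner_integrable(1)[OF assms(4,6)]])
  show "AE x in M. f x * cnj (g x) = f' x * cnj (g' x)" using assms(1,2) by eventually_elim simp
qed

lemma L2_inner_self: "L2_inner M f f = of_real (\<integral>x. (norm (f x))\<^sup>2 \<partial>M)"
  unfolding L2_inner_def complex_norm_square[symmetric] by (rule integral_complex_of_real)

lemma L2_norm_zero_AE:
  assumes "f \<in> L2 M"
  shows "(\<integral>x. (norm (f x))\<^sup>2 \<partial>M) = 0 \<longleftrightarrow> (AE x in M. f x = 0)"
  using integral_nonneg_eq_0_iff_AE[OF L2D(2)[OF assms]] by simp

text \<open>
  The square of \<open>norm f - t * norm g\<close> has a nonnegative integral for every real \<open>t\<close>.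
\<close>

lemma L2_Cauchy_Schwarz:
  assumes f: "f \<in> L2 M" and g: "g \<in> L2 M"
  shows "(\<integral>x. norm (f x) * norm (g x) \<partial>M)\<^sup>2 \<le> (\<integral>x. (norm (f x))\<^sup>2 \<partial>M) * (\<integral>x. (norm (g x))\<^sup>2 \<partial>M)"
proof -
  define a where "a = (\<integral>x. (norm (f x))\<^sup>2 \<partial>M)"
  define b where "b = (\<integral>x. (norm (g x))\<^sup>2 \<partial>M)"
  define c where "c = (\<integral>x. norm (f x) * norm (g x) \<partial>M)"
  note i = L2D(2)[OF f] L2D(2)[OF g] L2_norm_product_integrable[OF f g]
  have q: "0 \<le> a - 2 * t * c + t\<^sup>2 * b" for t
  proof -
    have "0 \<le> (\<integral>x. (norm (f x) - t * norm (g x))\<^sup>2 \<partial>M)" by (rule integral_nonneg_AE) simp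
    also have "\<dots> = (\<integral>x. (norm (f x))\<^sup>2 - 2 * t * (norm (f x) * norm (g x)) + t\<^sup>2 * (norm (g x))\<^sup>2 \<partial>M)"
      by (simp add: power2_eq_square algebra_simps)
    also have "\<dots> = a - 2 * t * c + t\<^sup>2 * b" unfolding a_def b_def c_def using i by simp
    finally show ?thesis .
  qed
  have a0: "a \<ge> 0" and b0: "b \<ge> 0" and c0: "c \<ge> 0" unfolding a_def b_def c_def by (auto intro!: integral_nonneg_AE)
  show ?thesis
  \<comment> \<open>For \<open>b = 0\<close> the nonnegative function of \<open>t\<close> is affine, hence constant; otherwise it is minimal at \<open>t = c / b\<close>.\<close>
  proof (cases "b = 0")
    case True
    have "c = 0"
    proof (rule ccontr)
      assume "c \<noteq> 0"
      then have "0 \<le> a - 2 * ((a + 1) / (2 * c)) * c" using q[of "(a + 1) / (2 * c)"] True by simp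
      then show False using \<open>c \<noteq> 0\<close> by (simp add: field_simps)
    qed
    then show ?thesis using a0 b0 unfolding a_def b_def c_def by simp
  next
    case False
    have "0 \<le> a - 2 * (c / b) * c + (c / b)\<^sup>2 * b" by (rule q)
    also have "\<dots> = a - c\<^sup>2 / b" using False by (simp add: field_simps power2_eq_square)
    finally have "c\<^sup>2 \<le> a * b" using False b0 by (simp add: field_simps)
    then show ?thesis unfolding a_def b_def c_def .
  qed
qed

text \<open>
  Induction on the orthonormal family: removing from \<open>w\<close> its component along one member does not
  change the other coefficients and lowers the norm by the square of that coefficient.
\<close>

lemma L2_bessel:
  assumes "finite F" "w \<in> L2 M"
    and "\<And>i. i \<in> F \<Longrightarrow> e i \<in> L2 M"
    and "\<And>i. i \<in> F \<Longrightarrow> L2_inner M (e i) (e i) = 1"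
    and "\<And>i j. i \<in> F \<Longrightarrow> j \<in> F \<Longrightarrow> i \<noteq> j \<Longrightarrow> L2_inner M (e i) (e j) = 0"
  shows "(\<Sum>i\<in>F. (norm (L2_inner M w (e i)))\<^sup>2) \<le> (\<integral>x. (norm (w x))\<^sup>2 \<partial>M)"
  using assms
proof (induction F arbitrary: w rule: finite_induct)
  case empty
  then show ?case by (auto intro!: integral_nonneg_AE)
next
  case (insert j F)
  define c where "c = L2_inner M w (e j)"
  define w' where "w' x = 1 * w x + (- c) * e j x" for x
  have ej: "e j \<in> L2 M" using insert by simp
  have w': "w' \<in> L2 M" unfolding w'_def by (rule L2_combine) (use insert in auto)
  have i: "L2_inner M w' (e i) = L2_inner M w (e i) - c * L2_inner M (e j) (e i)" if "i \<in> insert j F" for i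
    unfolding w'_def using that insert.prems by (subst L2_inner_combine_left) auto
  have "L2_inner M w' (e i) = L2_inner M w (e i)" if "i \<in> F" for i
    using i[of i] that insert.prems(4)[of j i] insert.hyps by auto
  then have "(\<Sum>i\<in>F. (norm (L2_inner M w (e i)))\<^sup>2) = (\<Sum>i\<in>F. (norm (L2_inner M w' (e i)))\<^sup>2)" by simp
  also have "\<dots> \<le> (\<integral>x. (norm (w' x))\<^sup>2 \<partial>M)" using insert.prems by (intro insert.IH w') auto
  also have "\<dots> = (\<integral>x. (norm (w x))\<^sup>2 \<partial>M) - (norm c)\<^sup>2"
  proof -
    have "L2_inner M w' w' = 1 * L2_inner M w w' + (- c) * L2_inner M (e j) w'"
      unfolding w'_def[abs_def] by (rule L2_inner_combine_left) (use insert.prems ej w'[unfolded w'_def[abs_def]] in auto)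
    also have "L2_inner M (e j) w' = 0"
      using i[of j] insert.prems(3)[of j] unfolding L2_inner_commute[of M "e j" w'] by (simp add: c_def)
    also have "L2_inner M w w' = 1 * L2_inner M w w + cnj (- c) * c"
      unfolding w'_def[abs_def] c_def using L2_inner_combine_right[OF insert.prems(1) ej insert.prems(1), of 1 "- c"] by (simp add: c_def)
    finally have "of_real (\<integral>x. (norm (w' x))\<^sup>2 \<partial>M) = of_real (\<integral>x. (norm (w x))\<^sup>2 \<partial>M) - c * cnj c"
      unfolding L2_inner_self by (simp add: mult.commute)
    also have "\<dots> = complex_of_real ((\<integral>x. (norm (w x))\<^sup>2 \<partial>M) - (norm c)\<^sup>2)" by (simp add: complex_norm_square[symmetric])
    finally show ?thesis unfolding of_real_eq_iff .
  qed
  finally show ?case using insert.hyps by (simp add: c_def)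
qed

section \<open>Almost everywhere statements on a half-line\<close>

lemma AE_half_line_iff:
  "(AE u in half_line u\<^sub>0. P u) \<longleftrightarrow> negligible {u. u > u\<^sub>0 \<and> \<not> P u}"
proof -
  have "(AE u in half_line u\<^sub>0. P u) \<longleftrightarrow> (AE u in lebesgue. u \<in> {u\<^sub>0<..} \<longrightarrow> P u)"
    by (rule AE_restrict_space_iff) simp
  also have "\<dots> \<longleftrightarrow> {u. u > u\<^sub>0 \<and> \<not> P u} \<in> null_sets lebesgue"
  proof
    assume "AE u in lebesgue. u \<in> {u\<^sub>0<..} \<longrightarrow> P u"
    then obtain N where "N \<in> null_sets lebesgue" "{u \<in> space lebesgue. \<not> (u \<in> {u\<^sub>0<..} \<longrightarrow> P u)} \<subseteq> N"
      unfolding eventually_ae_filter by blast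
    moreover have "{u \<in> space lebesgue. \<not> (u \<in> {u\<^sub>0<..} \<longrightarrow> P u)} = {u. u > u\<^sub>0 \<and> \<not> P u}" by auto
    ultimately show "{u. u > u\<^sub>0 \<and> \<not> P u} \<in> null_sets lebesgue"
      using negligible_subset by (metis negligible_iff_null_sets)
  next
    assume "{u. u > u\<^sub>0 \<and> \<not> P u} \<in> null_sets lebesgue"
    then show "AE u in lebesgue. u \<in> {u\<^sub>0<..} \<longrightarrow> P u"
      unfolding eventually_ae_filter by (intro bexI[of _ "{u. u > u\<^sub>0 \<and> \<not> P u}"]) auto
  qed
  finally show ?thesis by (simp add: negligible_iff_null_sets)
qed

lemma AE_half_line_continuous_zero:
  fixes f :: "real \<Rightarrow> complex"
  assumes c: "continuous_on {u\<^sub>0..} f" and ae: "AE u in half_line u\<^sub>0. f u = 0" and u: "u \<ge> u\<^sub>0"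
  shows "f u = 0"
proof (rule ccontr)
  assume "f u \<noteq> 0"
  then obtain d where d: "d > 0" "\<And>v. v \<in> {u\<^sub>0..} \<Longrightarrow> dist v u < d \<Longrightarrow> dist (f v) (f u) < norm (f u)"
    using c u unfolding continuous_on_iff by (metis atLeast_iff zero_less_norm_iff)
  have "{u<..<u + d} \<subseteq> {u. u > u\<^sub>0 \<and> \<not> f u = 0}"
  proof
    fix v assume v: "v \<in> {u<..<u + d}"
    then have "dist (f v) (f u) < norm (f u)" using u by (intro d) (auto simp: dist_real_def)
    then show "v \<in> {u. u > u\<^sub>0 \<and> \<not> f u = 0}" using v u by (auto simp: dist_norm)
  qed
  moreover have "negligible {u. u > u\<^sub>0 \<and> \<not> f u = 0}" using ae unfolding AE_half_line_iff .
  ultimately have "negligible {u<..<u + d}" by (rule negligible_subset[rotated])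
  then show False using d(1) negligible_interval(2)[of u "u + d"] by (simp add: box_real)
qed

text \<open>
  By the fundamental theorem the function is the integral of its derivative, and the indefinite integral
  of a continuous function is differentiable everywhere.
\<close>

lemma locally_abs_continuous_C1:
  assumes ac: "\<And>b. b \<ge> u\<^sub>0 \<Longrightarrow> abs_continuous_on u\<^sub>0 b f" and c: "continuous_on {u\<^sub>0..} f'"
    and ae: "AE u in half_line u\<^sub>0. (f has_vector_derivative f' u) (at u)" and u: "u \<ge> u\<^sub>0"
  shows "(f has_vector_derivative f' u) (at u within {u\<^sub>0..})"
proof -
  define N where "N = insert u\<^sub>0 {u. u > u\<^sub>0 \<and> \<not> (f has_vector_derivative f' u) (at u)}"
  have N: "negligible N" using ae unfolding AE_half_line_iff N_def by (simp add: negligible_insert)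
  have I: "(f' has_integral (f b - f u\<^sub>0)) {u\<^sub>0..b}" if "b \<ge> u\<^sub>0" for b
  proof (rule abs_continuous_on_has_integral[OF that ac[OF that] N])
    fix x assume "x \<in> {u\<^sub>0..b} - N"
    then have "(f has_vector_derivative f' x) (at x)" by (auto simp: N_def)
    then show "(f has_vector_derivative f' x) (at x within {u\<^sub>0..b})" by (rule has_vector_derivative_at_within)
  qed
  have "continuous_on {u\<^sub>0..u + 1} f'" using c by (rule continuous_on_subset) auto
  then have "((\<lambda>x. integral {u\<^sub>0..x} f') has_vector_derivative f' u) (at u within {u\<^sub>0..u + 1})"
    by (rule integral_has_vector_derivative) (use u in auto)
  then have "((\<lambda>x. f u\<^sub>0 + integral {u\<^sub>0..x} f') has_vector_derivative f' u) (at u within {u\<^sub>0..u + 1})"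
    using has_vector_derivative_add[OF has_vector_derivative_const] by fastforce
  then have "(f has_vector_derivative f' u) (at u within {u\<^sub>0..u + 1})"
    by (rule has_vector_derivative_transform[rotated 2]) (use u integral_unique[OF I] in auto)
  moreover have "at u within {u\<^sub>0..u + 1} = at u within {u\<^sub>0..}"
    by (rule at_within_nhd[of _ "{u - 1<..<u + 1}"]) auto
  ultimately show ?thesis by simp
qed

lemma locally_integrable_derivative:
  fixes g :: "real \<Rightarrow> complex"
  assumes g: "\<And>b. b \<ge> u\<^sub>0 \<Longrightarrow> g absolutely_integrable_on {u\<^sub>0..b}"
  shows "AE u in half_line u\<^sub>0. ((\<lambda>u. integral {u\<^sub>0..u} g) has_vector_derivative g u) (at u)"
proof -
  have "\<exists>N. negligible N \<and> (\<forall>x\<in>{u\<^sub>0<..<u\<^sub>0 + real n} - N. ((\<lambda>u. integral {u\<^sub>0..u} g) has_vector_derivative g x) (at x))" for n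
  proof -
    have "g integrable_on {u\<^sub>0..u\<^sub>0 + real n}" using g[of "u\<^sub>0 + real n"] by (simp add: absolutely_integrable_on_def)
    from indefinite_integral_differentiable_ae[OF this] show ?thesis by metis
  qed
  then obtain N where N: "\<And>n. negligible (N n)"
    "\<And>n x. x \<in> {u\<^sub>0<..<u\<^sub>0 + real n} - N n \<Longrightarrow> ((\<lambda>u. integral {u\<^sub>0..u} g) has_vector_derivative g x) (at x)"
    by metis
  have "{u. u > u\<^sub>0 \<and> \<not> ((\<lambda>u. integral {u\<^sub>0..u} g) has_vector_derivative g u) (at u)} \<subseteq> (\<Union>n. N n)"
  proof
    fix u assume u: "u \<in> {u. u > u\<^sub>0 \<and> \<not> ((\<lambda>u. integral {u\<^sub>0..u} g) has_vector_derivative g u) (at u)}"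
    obtain n where "u - u\<^sub>0 < real n" using reals_Archimedean2 by blast
    then have "u \<in> {u\<^sub>0<..<u\<^sub>0 + real n}" using u by auto
    then show "u \<in> (\<Union>n. N n)" using N(2) u by blast
  qed
  then show ?thesis unfolding AE_half_line_iff
    by (rule negligible_subset[rotated]) (rule negligible_Union_nat[OF N(1)])
qed

section \<open>Growth of arbitrary solutions\<close>

lemma log_slope_large: "\<exists>U\<ge>a. \<forall>u\<ge>U. log_slope k u \<ge> R"
proof (intro exI[of _ "max a (2 * \<bar>R\<bar> + 2 * \<bar>k\<bar>)"] conjI allI impI)
  fix u assume "u \<ge> max a (2 * \<bar>R\<bar> + 2 * \<bar>k\<bar>)"
  then have "u \<ge> 2 * \<bar>R\<bar> + 2 * \<bar>k\<bar>" by simp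
  moreover have "exp u \<ge> 1 + u" by (rule exp_ge_add_one_self)
  ultimately show "log_slope k u \<ge> R" unfolding log_slope_def by linarith
qed simp

lemma continuous_bounded_Icc:
  fixes f :: "real \<Rightarrow> real"
  assumes "continuous_on {a..b} f"
  shows "\<exists>B>0. \<forall>u\<in>{a..b}. \<bar>f u\<bar> \<le> B"
proof -
  have "bounded (f ` {a..b})" using assms by (auto intro: compact_imp_bounded compact_continuous_image)
  then obtain B where "\<And>u. u \<in> {a..b} \<Longrightarrow> \<bar>f u\<bar> \<le> B" unfolding bounded_iff by (metis imageI real_norm_def)
  then have "\<bar>f u\<bar> \<le> \<bar>B\<bar> + 1" if "u \<in> {a..b}" for u using that by fastforce
  then show ?thesis by (intro exI[of _ "\<bar>B\<bar> + 1"]) auto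
qed

lemma weight_bounded: "\<exists>B>0. \<forall>u\<ge>a. (weight k u)\<^sup>2 \<le> B * exp (- u)"
proof -
  obtain C where C: "\<And>u. u \<ge> a \<Longrightarrow> (weight k u)\<^sup>2 \<le> C * exp (- u)" using weight_square_bound by blast
  have "(weight k u)\<^sup>2 \<le> (\<bar>C\<bar> + 1) * exp (- u)" if "u \<ge> a" for u
    by (rule order_trans[OF C[OF that]], rule mult_right_mono) auto
  then show ?thesis by (intro exI[of _ "\<bar>C\<bar> + 1"]) auto
qed

lemma inverse_weight_square_deriv:
  "((\<lambda>u. inverse ((weight k u)\<^sup>2)) has_real_derivative 2 * log_slope k u * inverse ((weight k u)\<^sup>2)) (at u within S)"
proof -
  have "((\<lambda>u. inverse ((weight k u)\<^sup>2)) has_real_derivative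
     - (inverse ((weight k u)\<^sup>2) * (2 * (weight k u) * (- log_slope k u * weight k u)) * inverse ((weight k u)\<^sup>2))) (at u within S)"
    unfolding power2_eq_square
    by (rule DERIV_inverse') (auto intro!: derivative_eq_intros weight_deriv)
  then show ?thesis by (rule DERIV_cong) (simp add: power2_eq_square field_simps)
qed

text \<open>
  The Wronskian with the recessive solution is constant, so the derivative of \<open>\<phi> / \<psi>\<close> is a constant
  over \<open>\<psi>\<^sup>2\<close>. Its integral is \<open>O(1 / weight\<^sup>2)\<close>, because \<open>1 / weight\<^sup>2\<close> grows faster than
  exponentially. Hence \<open>\<phi> = O(1 / weight)\<close>.
\<close>

theorem solution_growth:
  assumes \<psi>: "is_recessive k E \<psi> \<psi>'" and \<phi>: "sol_on UNIV (potE k E) \<phi> \<phi>'"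
  shows "\<exists>C>0. \<forall>u\<ge>a. norm (\<phi> u) * weight k u \<le> C"
proof -
  obtain U1 where U1: "U1 \<ge> a" "\<And>u. u \<ge> U1 \<Longrightarrow> norm (\<psi> u) \<ge> weight k u / 2" using recessive_bounds(2)[OF \<psi>] by blast
  obtain U where U: "U \<ge> U1" "\<And>u. u \<ge> U \<Longrightarrow> log_slope k u \<ge> 1 / 2" using log_slope_large by blast
  obtain C1 where C1: "C1 > 0" "\<And>u. u \<ge> a \<Longrightarrow> norm (\<psi> u) \<le> C1 * weight k u" using recessive_bounds(1)[OF \<psi>] by blast
  obtain B where B: "B > 0" "\<And>u. u \<ge> U \<Longrightarrow> (weight k u)\<^sup>2 \<le> B * exp (- u)" using weight_bounded by blast
  have \<psi>s: "sol_on UNIV (potE k E) \<psi> \<psi>'" by (rule recessive_sol[OF \<psi>])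
  have \<psi>0: "\<psi> u \<noteq> 0" if "u \<ge> U" for u
  proof -
    have "weight k u / 2 \<le> norm (\<psi> u)" using U1(2)[of u] U(1) that by simp
    moreover have "0 < weight k u / 2" by simp
    ultimately have "0 < norm (\<psi> u)" by linarith
    then show ?thesis by simp
  qed
  define w where "w = \<phi>' U * \<psi> U - \<phi> U * \<psi>' U"
  have w: "\<phi>' u * \<psi> u - \<phi> u * \<psi>' u = w" for u
    using wronskian_constant[OF \<phi> \<psi>s convex_UNIV, of u U] by (simp add: w_def algebra_simps)
  define r where "r u = \<phi> u * inverse (\<psi> u)" for u
  have rd: "(r has_vector_derivative w / (\<psi> u)\<^sup>2) (at u)" if u: "u \<ge> U" for u
  proof -
    have "((inverse \<circ> \<psi>) has_vector_derivative \<psi>' u * - (inverse (\<psi> u) ^ Suc (Suc 0))) (at u)"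
    proof (rule field_vector_diff_chain_at[where f=\<psi> and g=inverse and f'="\<psi>' u" and g'="- (inverse (\<psi> u) ^ Suc (Suc 0))"])
      show "(\<psi> has_vector_derivative \<psi>' u) (at u)" using sol_onD(1)[OF \<psi>s, of u] by simp
      show "DERIV inverse (\<psi> u) :> - (inverse (\<psi> u) ^ Suc (Suc 0))" by (rule DERIV_inverse[OF \<psi>0[OF u]])
    qed
    then have "((\<lambda>u. inverse (\<psi> u)) has_vector_derivative - \<psi>' u / (\<psi> u)\<^sup>2) (at u)"
      by (simp add: comp_def power2_eq_square divide_inverse)
    from has_vector_derivative_mult[OF _ this, of \<phi> "\<phi>' u"]
    have "(r has_vector_derivative \<phi> u * (- \<psi>' u / (\<psi> u)\<^sup>2) + \<phi>' u * inverse (\<psi> u)) (at u)"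
      unfolding r_def[abs_def] using sol_onD(1)[OF \<phi>, of u] by simp
    moreover have "\<phi> u * (- \<psi>' u / (\<psi> u)\<^sup>2) + \<phi>' u * inverse (\<psi> u) = w / (\<psi> u)\<^sup>2"
      unfolding w[of u, symmetric] using \<psi>0[OF u] by (simp add: field_simps power2_eq_square)
    ultimately show ?thesis by simp
  qed
  have rb: "norm (r b - r U) \<le> 4 * norm w * inverse ((weight k b)\<^sup>2) - 4 * norm w * inverse ((weight k U)\<^sup>2)" if b: "b > U" for b
  proof (rule differentiable_bound_general[OF b, where \<phi>'="\<lambda>u. 4 * norm w * (2 * log_slope k u * inverse ((weight k u)\<^sup>2))" and f'="\<lambda>u. w / (\<psi> u)\<^sup>2"])
    show "continuous_on {U..b} r"
      using rd by (auto intro!: continuous_at_imp_continuous_on has_vector_derivative_continuous)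
    show "continuous_on {U..b} (\<lambda>u. 4 * norm w * inverse ((weight k u)\<^sup>2))"
      by (intro continuous_intros weight_continuous) simp
    fix x assume x: "U < x" "x < b"
    show "(r has_vector_derivative w / (\<psi> x)\<^sup>2) (at x)" using rd x by simp
    show "((\<lambda>u. 4 * norm w * inverse ((weight k u)\<^sup>2)) has_vector_derivative 4 * norm w * (2 * log_slope k x * inverse ((weight k x)\<^sup>2))) (at x)"
      unfolding has_real_derivative_iff_has_vector_derivative[symmetric] by (rule DERIV_cmult[OF inverse_weight_square_deriv])
    have "(weight k x / 2)\<^sup>2 \<le> (norm (\<psi> x))\<^sup>2" using U1(2)[of x] U x by (intro power_mono) (auto simp: less_imp_le)
    then have "inverse ((norm (\<psi> x))\<^sup>2) \<le> inverse ((weight k x / 2)\<^sup>2)" by (rule le_imp_inverse_le) simp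
    moreover have "inverse ((weight k x / 2)\<^sup>2) = 4 * inverse ((weight k x)\<^sup>2)"
      by (simp add: power_divide field_simps)
    ultimately have "inverse ((norm (\<psi> x))\<^sup>2) \<le> 4 * inverse ((weight k x)\<^sup>2) * 1" by linarith
    then have "norm w * inverse ((norm (\<psi> x))\<^sup>2) \<le> norm w * (4 * inverse ((weight k x)\<^sup>2) * 1)"
      by (rule mult_left_mono) simp
    also have "\<dots> \<le> norm w * (4 * inverse ((weight k x)\<^sup>2) * (2 * log_slope k x))"
      using U(2)[of x] x by (intro mult_left_mono) auto
    finally show "norm (w / (\<psi> x)\<^sup>2) \<le> 4 * norm w * (2 * log_slope k x * inverse ((weight k x)\<^sup>2))"
      unfolding divide_inverse norm_mult norm_inverse norm_power by (simp add: algebra_simps)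
  qed
  define D where "D = norm (r U) * (B * exp (- U)) + 4 * norm w"
  have far: "norm (\<phi> b) * weight k b \<le> C1 * D" if b: "b > U" for b
  proof -
    have wb: "(weight k b)\<^sup>2 \<le> B * exp (- U)"
    proof -
      have "(weight k b)\<^sup>2 \<le> B * exp (- b)" using B(2) b by simp
      also have "\<dots> \<le> B * exp (- U)" using B(1) b by (intro mult_left_mono) auto
      finally show ?thesis .
    qed
    have "norm (r b) \<le> norm (r U) + norm (r b - r U)" by (metis norm_triangle_sub add.commute norm_minus_commute)
    also have "\<dots> \<le> norm (r U) + 4 * norm w * inverse ((weight k b)\<^sup>2)"
    proof -
      have "0 \<le> 4 * norm w * inverse ((weight k U)\<^sup>2)" by simp
      then show ?thesis using rb[OF b] by linarith
    qed
    finally have "norm (r b) * (weight k b)\<^sup>2 \<le> (norm (r U) + 4 * norm w * inverse ((weight k b)\<^sup>2)) * (weight k b)\<^sup>2"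
      by (intro mult_right_mono) auto
    also have "\<dots> = norm (r U) * (weight k b)\<^sup>2 + 4 * norm w" by (simp add: distrib_right)
    also have "\<dots> \<le> D" unfolding D_def using wb by (intro add_right_mono mult_left_mono) auto
    finally have *: "norm (r b) * (weight k b)\<^sup>2 \<le> D" .
    have "norm (\<phi> b) = norm (r b) * norm (\<psi> b)" unfolding norm_mult[symmetric] r_def using \<psi>0[of b] b by (simp add: mult.assoc)
    also have "\<dots> \<le> norm (r b) * (C1 * weight k b)" using C1(2)[of b] U U1 b by (intro mult_left_mono) auto
    finally have "norm (\<phi> b) * weight k b \<le> (norm (r b) * (C1 * weight k b)) * weight k b"
      by (rule mult_right_mono) (simp add: less_imp_le)
    also have "\<dots> = C1 * (norm (r b) * (weight k b)\<^sup>2)" by (simp add: power2_eq_square)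
    also have "\<dots> \<le> C1 * D" using * C1(1) by (intro mult_left_mono) auto
    finally show ?thesis .
  qed
  have "continuous_on {a..U} (\<lambda>u. norm (\<phi> u) * weight k u)"
    by (intro continuous_intros weight_continuous sol_on_continuous(1)[OF sol_on_subset[OF \<phi>]]) auto
  then obtain B2 where B2: "B2 > 0" "\<forall>u\<in>{a..U}. \<bar>norm (\<phi> u) * weight k u\<bar> \<le> B2" using continuous_bounded_Icc by blast
  show ?thesis
  proof (intro exI[of _ "B2 + \<bar>C1 * D\<bar>"] conjI allI impI)
    show "B2 + \<bar>C1 * D\<bar> > 0" using B2(1) by simp
    fix u assume u: "u \<ge> a"
    show "norm (\<phi> u) * weight k u \<le> B2 + \<bar>C1 * D\<bar>"
    proof (cases "u \<le> U")
      case True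
      then have "\<bar>norm (\<phi> u) * weight k u\<bar> \<le> B2" using B2(2) u by simp
      then show ?thesis by linarith
    next
      case False
      then show ?thesis using far[of u] B2(1) by simp
    qed
  qed
qed

section \<open>Integrals over the half-line\<close>

lemma half_line_initial_segment:
  fixes g :: "real \<Rightarrow> 'a::euclidean_space"
  assumes i: "integrable (half_line u\<^sub>0) (\<lambda>v. if v \<le> u then g v else 0)"
  shows "g absolutely_integrable_on {u\<^sub>0..u}"
    "(\<integral>v. (if v \<le> u then g v else 0) \<partial>half_line u\<^sub>0) = integral {u\<^sub>0..u} g"
proof -
  have eq: "{v. v \<le> u} \<inter> {u\<^sub>0<..} = {u\<^sub>0<..u}" by auto
  have "(\<lambda>v. indicator {u\<^sub>0<..} v *\<^sub>R (if v \<le> u then g v else 0)) = (\<lambda>v. indicator {u\<^sub>0<..u} v *\<^sub>R g v)"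
    by (auto simp: fun_eq_iff indicator_def)
  then have "g absolutely_integrable_on {u\<^sub>0<..u}"
    using i by (simp add: set_integrable_def integrable_restrict_space)
  then show "g absolutely_integrable_on {u\<^sub>0..u}"
    by (rule absolutely_integrable_spike_set[OF _ negligible_subset[of "{u\<^sub>0}"] negligible_subset[of "{u\<^sub>0}"]]) auto
  have "(\<integral>v. (if v \<le> u then g v else 0) \<partial>half_line u\<^sub>0) = integral {u\<^sub>0<..} (\<lambda>v. if v \<in> {v. v \<le> u} then g v else 0)"
    using lebesgue_integral_eq_integral[OF i] by simp
  also have "\<dots> = integral {u\<^sub>0<..u} g" unfolding integral_restrict_Int eq ..
  also have "\<dots> = integral {u\<^sub>0..u} g"
    by (rule integral_spike_set) (auto intro: negligible_subset[of "{u\<^sub>0}"])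
  finally show "(\<integral>v. (if v \<le> u then g v else 0) \<partial>half_line u\<^sub>0) = integral {u\<^sub>0..u} g" .
qed

lemma continuous_half_line_measurable:
  assumes "continuous_on {u\<^sub>0..} f"
  shows "f \<in> borel_measurable (half_line u\<^sub>0)"
  by (rule continuous_imp_measurable_on_sets_lebesgue[OF continuous_on_subset[OF assms]]) auto

lemma continuous_half_line_L2:
  assumes "continuous_on {u\<^sub>0..} f" "(\<lambda>u. (norm (f u))\<^sup>2) integrable_on {u\<^sub>0..}"
  shows "f \<in> L2 (half_line u\<^sub>0)"
  using assms half_line_integrable_iff[of u\<^sub>0 "\<lambda>u. (norm (f u))\<^sup>2"] continuous_half_line_measurable[OF assms(1)]
  by (simp add: L2_def)

lemma id_half_line_measurable [measurable]: "(\<lambda>v. v) \<in> borel_measurable (half_line u\<^sub>0)"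
  by (rule continuous_half_line_measurable) (intro continuous_intros)

text \<open>
  The functions \<open>\<phi>\<close> and \<open>\<psi>\<close> enter the Green kernel restricted to \<open>{..u}\<close>; restrictions of continuous
  functions to a bounded interval are square-integrable.
\<close>

lemma truncated_L2:
  fixes f :: "real \<Rightarrow> complex"
  assumes c: "continuous_on {u\<^sub>0..} f"
  shows "(\<lambda>v. if v \<le> u then f v else 0) \<in> L2 (half_line u\<^sub>0)"
    "(\<integral>v. (norm (if v \<le> u then f v else 0))\<^sup>2 \<partial>half_line u\<^sub>0) = integral {u\<^sub>0..u} (\<lambda>v. (norm (f v))\<^sup>2)"
proof -
  have [measurable]: "f \<in> borel_measurable (half_line u\<^sub>0)" by (rule continuous_half_line_measurable[OF c])
  have m: "(\<lambda>v. if v \<le> u then f v else 0) \<in> borel_measurable (half_line u\<^sub>0)" by measurable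
  have e: "(norm (if v \<le> u then f v else 0))\<^sup>2 = (if v \<le> u then (norm (f v))\<^sup>2 else 0)" for v by simp
  have "(\<lambda>v. (norm (f v))\<^sup>2) integrable_on {u\<^sub>0..u}"
    by (intro integrable_continuous_interval continuous_intros continuous_on_subset[OF c]) auto
  moreover have "{v. v \<le> u} \<inter> {u\<^sub>0..} = {u\<^sub>0..u}" by auto
  ultimately have "(\<lambda>v. if v \<in> {v. v \<le> u} then (norm (f v))\<^sup>2 else 0) integrable_on {u\<^sub>0..}"
    unfolding integrable_restrict_Int by simp
  then have i: "integrable (half_line u\<^sub>0) (\<lambda>v. if v \<le> u then (norm (f v))\<^sup>2 else 0)"
    by (subst half_line_integrable_iff) auto
  then show "(\<lambda>v. if v \<le> u then f v else 0) \<in> L2 (half_line u\<^sub>0)" using m by (simp add: L2_def e)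
  show "(\<integral>v. (norm (if v \<le> u then f v else 0))\<^sup>2 \<partial>half_line u\<^sub>0) = integral {u\<^sub>0..u} (\<lambda>v. (norm (f v))\<^sup>2)"
    unfolding e by (rule half_line_initial_segment(2)[OF i])
qed

lemma integral_half_line_le:
  fixes f :: "real \<Rightarrow> real"
  assumes i: "f integrable_on {a..}" and f0: "\<And>u. u \<ge> a \<Longrightarrow> f u \<ge> 0"
    and le: "\<And>b. b \<ge> a \<Longrightarrow> integral {a..b} f \<le> B"
  shows "integral {a..} f \<le> B"
proof -
  have ai: "f absolutely_integrable_on {a..}" using i f0 by (subst absolutely_integrable_on_iff_nonneg) auto
  have "((\<lambda>b. set_lebesgue_integral lebesgue {a..b} f) \<longlongrightarrow> set_lebesgue_integral lebesgue {a..} f) at_top"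
    by (rule tendsto_set_lebesgue_integral_at_top) (use ai in auto)
  moreover have "\<forall>\<^sub>F b in at_top. set_lebesgue_integral lebesgue {a..b} f \<le> B"
    using eventually_ge_at_top[of a]
  proof eventually_elim
    fix b assume b: "b \<ge> a"
    have "f absolutely_integrable_on {a..b}" by (rule set_integrable_subset[OF ai]) auto
    then show "set_lebesgue_integral lebesgue {a..b} f \<le> B" using le[OF b] by (simp add: set_lebesgue_integral_eq_integral(2))
  qed
  ultimately have "set_lebesgue_integral lebesgue {a..} f \<le> B"
    by (rule tendsto_upperbound) simp
  then show ?thesis using ai by (simp add: set_lebesgue_integral_eq_integral(2))
qed

section \<open>Square integrals of the two factors of Green's function\<close>

text \<open>
  The function \<open>exp (- u) / weight\<^sup>2\<close> has derivative at least \<open>1 / (2 * weight\<^sup>2)\<close> near infinity,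
  so a multiple of it, plus a constant, dominates the integral of \<open>1 / weight\<^sup>2\<close>. This gains the factor
  \<open>exp (- u)\<close> over the pointwise bound.
\<close>

lemma growing_factor_bound:
  fixes \<phi> :: "real \<Rightarrow> complex"
  assumes \<phi>: "continuous_on {a..} \<phi>" and C: "C > 0" "\<And>u. u \<ge> a \<Longrightarrow> norm (\<phi> u) * weight k u \<le> C"
  shows "\<exists>K>0. \<forall>u\<ge>a. integral {a..u} (\<lambda>v. (norm (\<phi> v))\<^sup>2) * (weight k u)\<^sup>2 \<le> K * exp (- u)"
proof -
  define A where "A u = integral {a..u} (\<lambda>v. (norm (\<phi> v))\<^sup>2)" for u
  define R where "R u = exp (- u) * inverse ((weight k u)\<^sup>2)" for u
  obtain U where U: "U \<ge> a" "\<And>u. u \<ge> U \<Longrightarrow> log_slope k u \<ge> 1 + \<bar>k\<bar>" using log_slope_large by blast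
  obtain B where B: "B > 0" "\<And>u. u \<ge> a \<Longrightarrow> (weight k u)\<^sup>2 \<le> B * exp (- u)" using weight_bounded by blast
  have RB: "1 \<le> B * R u" if "u \<ge> a" for u
  proof -
    have "inverse ((weight k u)\<^sup>2) * (weight k u)\<^sup>2 \<le> inverse ((weight k u)\<^sup>2) * (B * exp (- u))"
      using B(2)[OF that] by (intro mult_left_mono) auto
    then show ?thesis by (simp add: R_def algebra_simps)
  qed
  have R0: "R u \<ge> 0" for u by (simp add: R_def)
  have Rd: "(R has_real_derivative (2 * log_slope k u - 1) * R u) (at u within S)" for u S
  proof -
    have e: "((\<lambda>u. exp (- u)) has_real_derivative - exp (- u)) (at u within S)" by (auto intro!: derivative_eq_intros)
    show ?thesis unfolding R_def[abs_def]
      by (rule DERIV_cong[OF DERIV_mult[OF e inverse_weight_square_deriv]]) (simp add: algebra_simps)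
  qed
  have c: "continuous_on {a..b} (\<lambda>v. (norm (\<phi> v))\<^sup>2)" for b by (intro continuous_intros continuous_on_subset[OF \<phi>]) auto
  have Ad: "(A has_real_derivative (norm (\<phi> u))\<^sup>2) (at u within {x..y})" if "u \<in> {x..y}" "x \<ge> a" for u x y
  proof -
    have "(A has_real_derivative (norm (\<phi> u))\<^sup>2) (at u within {a..y})"
      unfolding A_def[abs_def] by (rule integral_has_real_derivative[OF c]) (use that in auto)
    then show ?thesis by (rule DERIV_subset) (use that in auto)
  qed
  have A0: "A u \<ge> 0" for u unfolding A_def by (rule integral_nonneg) (auto intro: integrable_continuous_interval c)
  have Amono: "A u \<le> A v" if "a \<le> u" "u \<le> v" for u v
    by (rule nondecreasing_from_deriv[OF that(2), where f=A]) (use Ad that in auto)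
  have slope: "inverse ((weight k u)\<^sup>2) \<le> 2 * ((2 * log_slope k u - 1) * R u)" if u: "u \<ge> U" for u
  proof -
    have "exp u / 2 \<le> 2 * log_slope k u - 1"
    proof -
      have "log_slope k u = 1 / 2 + k + exp u / 2" by (simp add: log_slope_def)
      then show ?thesis using U(2)[OF u] by linarith
    qed
    then have "exp u / 2 * (2 * R u) \<le> (2 * log_slope k u - 1) * (2 * R u)" using R0 by (intro mult_right_mono) auto
    moreover have "exp u / 2 * (2 * R u) = inverse ((weight k u)\<^sup>2)" by (simp add: R_def exp_minus)
    ultimately show ?thesis by (simp add: algebra_simps)
  qed
  have far: "A u \<le> A U + 2 * C\<^sup>2 * R u" if u: "u \<ge> U" for u
  proof -
    define g where "g u = 2 * C\<^sup>2 * R u - A u" for u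
    have "g U \<le> g u"
    proof (rule nondecreasing_from_deriv[OF u, where f=g and f'="\<lambda>u. 2 * C\<^sup>2 * ((2 * log_slope k u - 1) * R u) - (norm (\<phi> u))\<^sup>2"])
      fix x assume x: "x \<in> {U..u}"
      show "(g has_real_derivative 2 * C\<^sup>2 * ((2 * log_slope k x - 1) * R x) - (norm (\<phi> x))\<^sup>2) (at x within {U..u})"
        unfolding g_def[abs_def] by (rule DERIV_diff[OF DERIV_cmult[OF Rd] Ad[OF x U(1)]])
      have "(norm (\<phi> x) * weight k x)\<^sup>2 \<le> C\<^sup>2" using C(2)[of x] x U by (intro power_mono) (auto simp: less_imp_le)
      then have "(norm (\<phi> x) * weight k x)\<^sup>2 * inverse ((weight k x)\<^sup>2) \<le> C\<^sup>2 * inverse ((weight k x)\<^sup>2)"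
        by (rule mult_right_mono) simp
      then have "(norm (\<phi> x))\<^sup>2 \<le> C\<^sup>2 * inverse ((weight k x)\<^sup>2)" by (simp add: power_mult_distrib mult.assoc)
      also have "\<dots> \<le> C\<^sup>2 * (2 * ((2 * log_slope k x - 1) * R x))" using slope[of x] x by (intro mult_left_mono) auto
      finally show "0 \<le> 2 * C\<^sup>2 * ((2 * log_slope k x - 1) * R x) - (norm (\<phi> x))\<^sup>2" by simp
    qed
    moreover have "0 \<le> 2 * C\<^sup>2 * R U" using R0 by simp
    ultimately show ?thesis unfolding g_def by linarith
  qed
  show ?thesis
  proof (intro exI[of _ "A U * B + 2 * C\<^sup>2"] conjI allI impI)
    show "A U * B + 2 * C\<^sup>2 > 0" using A0[of U] B(1) C(1) by (simp add: add_nonneg_pos)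
    fix u assume u: "u \<ge> a"
    have "A U * 1 \<le> A U * (B * R u)" using RB[OF u] A0 by (intro mult_left_mono) auto
    moreover have "A u \<le> A U + 2 * C\<^sup>2 * R u"
    proof (cases "u \<ge> U")
      case False
      then have "A u \<le> A U" using Amono[of u U] u by simp
      then show ?thesis using R0[of u] by (simp add: add_increasing2)
    qed (rule far)
    ultimately have "A u \<le> (A U * B + 2 * C\<^sup>2) * R u" by (simp add: algebra_simps)
    then have "A u * (weight k u)\<^sup>2 \<le> ((A U * B + 2 * C\<^sup>2) * R u) * (weight k u)\<^sup>2" by (rule mult_right_mono) simp
    also have "\<dots> = (A U * B + 2 * C\<^sup>2) * exp (- u)" by (simp add: R_def)
    finally show "integral {a..u} (\<lambda>v. (norm (\<phi> v))\<^sup>2) * (weight k u)\<^sup>2 \<le> (A U * B + 2 * C\<^sup>2) * exp (- u)"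
      unfolding A_def .
  qed
qed

text \<open>
  Near infinity \<open>weight_tail\<close> is the majorant; on the remaining compact interval continuity suffices.
\<close>

lemma decaying_factor_bound:
  fixes \<psi> :: "real \<Rightarrow> complex"
  assumes \<psi>: "continuous_on {a..} \<psi>" and i: "(\<lambda>u. (norm (\<psi> u))\<^sup>2) integrable_on {a..}"
    and C: "C > 0" "\<And>u. u \<ge> a \<Longrightarrow> norm (\<psi> u) \<le> C * weight k u"
  shows "\<exists>K>0. \<forall>u\<ge>a. integral {u..} (\<lambda>v. (norm (\<psi> v))\<^sup>2) \<le> K * exp (- u) * (weight k u)\<^sup>2"
proof -
  define N where "N v = (norm (\<psi> v))\<^sup>2" for v
  obtain U where U: "U \<ge> a" "\<And>u. u \<ge> U \<Longrightarrow> log_slope k u \<ge> 2 + 2 * \<bar>k\<bar>" using log_slope_large by blast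
  have Ni: "N integrable_on {u..}" if "u \<ge> a" for u
    unfolding N_def using integrable_norm_squared_subset[OF i that] .
  have far: "integral {u..} N \<le> C\<^sup>2 * weight_tail k u" if u: "u \<ge> U" for u
  proof (rule integral_half_line_le)
    show "N integrable_on {u..}" using Ni u U by simp
    fix b assume b: "b \<ge> u"
    have c: "continuous_on {u..b} N" unfolding N_def[abs_def]
      by (intro continuous_intros continuous_on_subset[OF \<psi>]) (use u U in auto)
    define g where "g x = - (C\<^sup>2 * weight_tail k x) - integral {u..x} N" for x
    have "g u \<le> g b"
    proof (rule nondecreasing_from_deriv[OF b, where f=g and f'="\<lambda>x. - (C\<^sup>2 * (- (4 * exp (- x) * (1 + k) + 2) * (weight k x)\<^sup>2)) - N x"])
      fix x assume x: "x \<in> {u..b}"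
      show "(g has_real_derivative - (C\<^sup>2 * (- (4 * exp (- x) * (1 + k) + 2) * (weight k x)\<^sup>2)) - N x) (at x within {u..b})"
        unfolding g_def[abs_def]
        by (intro DERIV_diff DERIV_minus DERIV_cmult DERIV_subset[OF weight_tail_deriv] integral_has_real_derivative[OF c x]) simp
      have "1 \<le> 4 * exp (- x) * (1 + k) + 2"
      proof -
        have "1 / 2 + k + exp x / 2 \<ge> 2 + 2 * \<bar>k\<bar>" using U(2)[of x] x u by (simp add: log_slope_def)
        then have "exp x + 4 + 4 * k \<ge> 0" by linarith
        then have "exp (- x) * (exp x + 4 + 4 * k) \<ge> 0" by simp
        moreover have "exp (- x) * (exp x + 4 + 4 * k) = 1 + 4 * exp (- x) * (1 + k)"
          by (simp add: algebra_simps exp_minus)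
        ultimately show ?thesis by linarith
      qed
      then have "1 * (weight k x)\<^sup>2 \<le> (4 * exp (- x) * (1 + k) + 2) * (weight k x)\<^sup>2" by (intro mult_right_mono) auto
      then have "C\<^sup>2 * (weight k x)\<^sup>2 \<le> C\<^sup>2 * ((4 * exp (- x) * (1 + k) + 2) * (weight k x)\<^sup>2)" by (intro mult_left_mono) auto
      moreover have "N x \<le> (C * weight k x)\<^sup>2" unfolding N_def using C(2)[of x] x u U by (intro power_mono) auto
      moreover have "- (C\<^sup>2 * (- (4 * exp (- x) * (1 + k) + 2) * (weight k x)\<^sup>2)) = C\<^sup>2 * ((4 * exp (- x) * (1 + k) + 2) * (weight k x)\<^sup>2)"
        by (simp only: mult_minus_left mult_minus_right minus_minus)
      ultimately show "0 \<le> - (C\<^sup>2 * (- (4 * exp (- x) * (1 + k) + 2) * (weight k x)\<^sup>2)) - N x"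
        unfolding power_mult_distrib by linarith
    qed
    moreover have "0 \<le> C\<^sup>2 * weight_tail k b" by (simp add: weight_tail_def)
    ultimately show "integral {u..b} N \<le> C\<^sup>2 * weight_tail k u" by (simp add: g_def)
  qed (simp add: N_def)
  define J where "J = integral {a..} N"
  have J0: "J \<ge> 0" unfolding J_def by (rule integral_nonneg) (auto simp: Ni N_def)
  have "continuous_on {a..U} (\<lambda>u. exp u * inverse ((weight k u)\<^sup>2))"
    by (intro continuous_intros weight_continuous) simp
  then obtain B where B: "B > 0" "\<forall>u\<in>{a..U}. \<bar>exp u * inverse ((weight k u)\<^sup>2)\<bar> \<le> B" using continuous_bounded_Icc by blast
  show ?thesis
  proof (intro exI[of _ "2 * C\<^sup>2 + J * B"] conjI allI impI)
    show "2 * C\<^sup>2 + J * B > 0" using C(1) J0 B(1) by (simp add: add_pos_nonneg)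
    fix u assume u: "u \<ge> a"
    define X where "X = exp (- u) * (weight k u)\<^sup>2"
    have X0: "X \<ge> 0" by (simp add: X_def)
    have "integral {u..} N \<le> (2 * C\<^sup>2 + J * B) * X"
    proof (cases "u \<ge> U")
      case True
      have "C\<^sup>2 * weight_tail k u = 2 * C\<^sup>2 * X" by (simp add: weight_tail_def X_def)
      then have "integral {u..} N \<le> 2 * C\<^sup>2 * X" using far[OF True] by linarith
      moreover have "0 \<le> J * B * X" using J0 B(1) X0 by simp
      ultimately show ?thesis by (simp add: distrib_right)
    next
      case False
      have "integral {u..} N \<le> J" unfolding J_def using u by (intro integral_subset_le Ni) (auto simp: N_def)
      moreover have "J * 1 \<le> J * (B * X)"
      proof (rule mult_left_mono[OF _ J0])
        have "exp u * inverse ((weight k u)\<^sup>2) \<le> B" using B(2) u False by (auto dest: bspec[of _ _ u])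
        then have "exp u * inverse ((weight k u)\<^sup>2) * X \<le> B * X" using X0 by (rule mult_right_mono)
        then show "1 \<le> B * X" by (simp add: X_def exp_minus field_simps)
      qed
      moreover have "0 \<le> 2 * C\<^sup>2 * X" using X0 by simp
      ultimately show ?thesis by (simp add: algebra_simps)
    qed
    then show "integral {u..} (\<lambda>v. (norm (\<psi> v))\<^sup>2) \<le> (2 * C\<^sup>2 + J * B) * exp (- u) * (weight k u)\<^sup>2"
      by (simp add: X_def N_def[abs_def] mult.assoc)
  qed
qed

section \<open>The operator and its Green function\<close>

lemma continuous_on_half_lineI:
  assumes "\<And>b. b \<ge> a \<Longrightarrow> continuous_on {a..b::real} f"
  shows "continuous_on {a..} f"
  unfolding continuous_on_eq_continuous_within
proof
  fix u assume u: "u \<in> {a..}"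
  have "continuous (at u within {a..u + 1}) f"
    using assms[of "u + 1"] u by (auto simp: continuous_on_eq_continuous_within)
  moreover have "at u within {a..u + 1} = at u within {a..}"
    by (rule at_within_nhd[of _ "{u - 1<..<u + 1}"]) auto
  ultimately show "continuous (at u within {a..}) f" by simp
qed

text \<open>
  The regularity part of the domain of \<open>schrodinger_operator\<close>.
\<close>

definition C1_representative :: "real \<Rightarrow> (real \<Rightarrow> complex) \<Rightarrow> (real \<Rightarrow> complex) \<Rightarrow> (real \<Rightarrow> complex) \<Rightarrow> bool" where
  "C1_representative u\<^sub>0 F F' F'' \<longleftrightarrow>
     (\<forall>u\<in>{u\<^sub>0..}. (F has_vector_derivative F' u) (at u within {u\<^sub>0..})) \<and>
     continuous_on {u\<^sub>0..} F' \<and> (\<forall>b\<ge>u\<^sub>0. abs_continuous_on u\<^sub>0 b F') \<and>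
     (AE u in half_line u\<^sub>0. (F' has_vector_derivative F'' u) (at u))"

definition boundary_form :: "real \<Rightarrow> real \<Rightarrow> (real \<Rightarrow> complex) \<Rightarrow> (real \<Rightarrow> complex) \<Rightarrow> complex" where
  "boundary_form u\<^sub>0 \<alpha> F F' = of_real (cos \<alpha>) * F u\<^sub>0 + of_real (sin \<alpha>) * F' u\<^sub>0"

lemma schrodinger_operator_iff:
  "(f, g) \<in> schrodinger_operator u\<^sub>0 \<alpha> V \<longleftrightarrow> f \<in> L2 (half_line u\<^sub>0) \<and> g \<in> L2 (half_line u\<^sub>0) \<and>
     (\<exists>F F' F''. C1_representative u\<^sub>0 F F' F'' \<and> boundary_form u\<^sub>0 \<alpha> F F' = 0 \<and>
        (AE u in half_line u\<^sub>0. f u = F u) \<and>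
        (AE u in half_line u\<^sub>0. g u = - F'' u + of_real (V u) * F u))"
  unfolding schrodinger_operator_def C1_representative_def boundary_form_def by auto

lemma C1_representative_continuous:
  assumes "C1_representative u\<^sub>0 F F' F''"
  shows "continuous_on {u\<^sub>0..} F" "continuous_on {u\<^sub>0..} F'"
proof -
  show "continuous_on {u\<^sub>0..} F" unfolding continuous_on_eq_continuous_within
    using assms has_vector_derivative_continuous unfolding C1_representative_def by blast
  show "continuous_on {u\<^sub>0..} F'" using assms unfolding C1_representative_def by blast
qed

lemma C1_representative_diff:
  assumes "C1_representative u\<^sub>0 F F' F''" "C1_representative u\<^sub>0 G G' G''"
  shows "C1_representative u\<^sub>0 (\<lambda>u. F u - G u) (\<lambda>u. F' u - G' u) (\<lambda>u. F'' u - G'' u)"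
  unfolding C1_representative_def
proof (intro conjI ballI allI impI)
  show "((\<lambda>u. F u - G u) has_vector_derivative F' u - G' u) (at u within {u\<^sub>0..})" if "u \<in> {u\<^sub>0..}" for u
    using assms that unfolding C1_representative_def by (intro has_vector_derivative_diff) blast+
  show "continuous_on {u\<^sub>0..} (\<lambda>u. F' u - G' u)"
    by (intro continuous_intros C1_representative_continuous(2)[OF assms(1)] C1_representative_continuous(2)[OF assms(2)])
  show "abs_continuous_on u\<^sub>0 b (\<lambda>u. F' u - G' u)" if "b \<ge> u\<^sub>0" for b
    using abs_continuous_on_linear_combination[of u\<^sub>0 b F' G' 1 "-1"] assms that unfolding C1_representative_def by simp
  have "AE u in half_line u\<^sub>0. (F' has_vector_derivative F'' u) (at u)" "AE u in half_line u\<^sub>0. (G' has_vector_derivative G'' u) (at u)"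
    using assms unfolding C1_representative_def by blast+
  then show "AE u in half_line u\<^sub>0. ((\<lambda>u. F' u - G' u) has_vector_derivative F'' u - G'' u) (at u)"
    by eventually_elim (rule has_vector_derivative_diff)
qed

text \<open>
  An equation with continuous coefficients that holds almost everywhere holds everywhere, because \<open>F'\<close>
  is the integral of its derivative.
\<close>

lemma C1_representative_classical:
  assumes r: "C1_representative u\<^sub>0 F F' F''" and eq: "AE u in half_line u\<^sub>0. F'' u = potE k E u * F u"
  shows "sol_on {u\<^sub>0..} (potE k E) F F'"
proof -
  have ae: "AE u in half_line u\<^sub>0. (F' has_vector_derivative potE k E u * F u) (at u)"
    using eq r[unfolded C1_representative_def, THEN conjunct2, THEN conjunct2, THEN conjunct2] by eventually_elim simp
  have c: "continuous_on {u\<^sub>0..} (\<lambda>u. potE k E u * F u)"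
    by (intro continuous_intros potE_continuous C1_representative_continuous(1)[OF r])
  show ?thesis unfolding sol_on_def
  proof (intro ballI conjI)
    fix u assume u: "u \<in> {u\<^sub>0..}"
    show "(F has_vector_derivative F' u) (at u within {u\<^sub>0..})" using r u unfolding C1_representative_def by blast
    show "(F' has_vector_derivative potE k E u * F u) (at u within {u\<^sub>0..})"
      by (rule locally_abs_continuous_C1[OF _ c ae]) (use r u in \<open>auto simp: C1_representative_def\<close>)
  qed
qed

lemma weak_solution_multiple_of_recessive:
  assumes r: "C1_representative u\<^sub>0 F F' F''" and eq: "AE u in half_line u\<^sub>0. F'' u = potE k E u * F u"
    and F: "F \<in> L2 (half_line u\<^sub>0)" and \<psi>: "is_recessive k E \<psi> \<psi>'"
  shows "\<exists>c. \<forall>u\<ge>u\<^sub>0. F u = c * \<psi> u \<and> F' u = c * \<psi>' u"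
proof (rule square_integrable_multiple_of_recessive[OF \<psi> C1_representative_classical[OF r eq]])
  show "(\<lambda>u. (norm (F u))\<^sup>2) integrable_on {u\<^sub>0..}"
    using L2D(2)[OF F] half_line_integrable_iff[of u\<^sub>0 "\<lambda>u. (norm (F u))\<^sup>2"] by simp
qed

lemma sol_on_C1_representative:
  assumes "sol_on UNIV (potE k E) y y'"
  shows "C1_representative u\<^sub>0 y y' (\<lambda>u. potE k E u * y u)"
proof -
  have s: "sol_on S (potE k E) y y'" for S using assms by (rule sol_on_subset) simp
  show ?thesis unfolding C1_representative_def
  proof (intro conjI ballI allI impI)
    show "continuous_on {u\<^sub>0..} y'" by (rule sol_on_continuous(2)[OF s])
    show "abs_continuous_on u\<^sub>0 b y'" for b
      by (rule abs_continuous_on_C1[where f'="\<lambda>u. potE k E u * y u"])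
        (auto intro: sol_onD(2)[OF s] intro!: continuous_intros potE_continuous sol_on_continuous(1)[OF s])
  qed (use sol_onD[OF s] sol_onD(2)[OF assms] in auto)
qed

lemma L2_cong_continuous:
  assumes c: "continuous_on {u\<^sub>0..} F" and f: "f \<in> L2 (half_line u\<^sub>0)" and ae: "AE u in half_line u\<^sub>0. f u = F u"
  shows "F \<in> L2 (half_line u\<^sub>0)"
proof -
  have m [measurable]: "F \<in> borel_measurable (half_line u\<^sub>0)" by (rule continuous_half_line_measurable[OF c])
  have "integrable (half_line u\<^sub>0) (\<lambda>u. (norm (F u))\<^sup>2)"
  proof (rule integrable_cong_AE_imp[OF L2D(2)[OF f]])
    show "(\<lambda>u. (norm (F u))\<^sup>2) \<in> borel_measurable (half_line u\<^sub>0)" by measurable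
    show "AE u in half_line u\<^sub>0. (norm (f u))\<^sup>2 = (norm (F u))\<^sup>2" using ae by eventually_elim simp
  qed
  then show ?thesis using m by (simp add: L2_def)
qed

lemma recessive_L2: "is_recessive k E \<psi> \<psi>' \<Longrightarrow> \<psi> \<in> L2 (half_line u\<^sub>0)"
  by (rule continuous_half_line_L2[OF sol_on_continuous(1)[OF recessive_sol] recessive_square_integrable])

text \<open>
  The initial data of \<open>\<phi>\<close> satisfy the boundary condition, the solution \<open>\<psi>\<close> is square-integrable, and
  the last assumption says that the two are independent: \<open>E\<close> is not an eigenvalue.
\<close>

locale green_function =
  fixes k u\<^sub>0 \<alpha> :: real and E :: complex and \<psi> \<psi>' \<phi> \<phi>' :: "real \<Rightarrow> complex"
  assumes rec: "is_recessive k E \<psi> \<psi>'"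
    and \<phi>s: "sol_on UNIV (potE k E) \<phi> \<phi>'"
    and \<phi>0: "\<phi> u\<^sub>0 = of_real (sin \<alpha>)" "\<phi>' u\<^sub>0 = - of_real (cos \<alpha>)"
    and nz: "boundary_form u\<^sub>0 \<alpha> \<psi> \<psi>' \<noteq> 0"
begin

abbreviation M where "M \<equiv> half_line u\<^sub>0"

definition w where "w = - boundary_form u\<^sub>0 \<alpha> \<psi> \<psi>'"

lemma w0: "w \<noteq> 0" using nz by (simp add: w_def)

lemma wronskian: "\<phi>' u * \<psi> u - \<phi> u * \<psi>' u = w"
  using wronskian_constant[OF \<phi>s recessive_sol[OF rec] convex_UNIV, of u u\<^sub>0] \<phi>0
  by (simp add: w_def boundary_form_def algebra_simps)

text \<open>
  The Green kernel: below the diagonal \<open>\<psi> u * \<phi> v\<close>, above it \<open>\<phi> u * \<psi> v\<close>, normalized by the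
  Wronskian so that the derivative jumps by \<open>- 1\<close> across the diagonal.
\<close>

definition kern where "kern u v = (if v \<le> u then \<psi> u * \<phi> v else \<phi> u * \<psi> v) / w"

lemma kern_symmetric: "kern u v = kern v u"
  by (cases u v rule: linorder_cases) (auto simp: kern_def)

lemma \<phi>_continuous: "continuous_on S \<phi>" "continuous_on S \<phi>'"
  using sol_on_continuous[OF sol_on_subset[OF \<phi>s subset_UNIV]] by auto

lemma \<psi>_continuous: "continuous_on S \<psi>" "continuous_on S \<psi>'"
  using sol_on_continuous[OF recessive_sol[OF rec]] by auto

lemma \<psi>_L2: "\<psi> \<in> L2 M"
  by (rule recessive_L2[OF rec])

text \<open>
  The two halves as square-integrable functions; the part of \<open>\<psi>\<close> beyond \<open>u\<close> is written as a difference
  so that the lemmas on truncations and linear combinations apply.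
\<close>

lemma kern_split:
  "kern u v = \<psi> u / w * (if v \<le> u then \<phi> v else 0) + \<phi> u / w * (1 * \<psi> v + (- 1) * (if v \<le> u then \<psi> v else 0))"
  by (simp add: kern_def)

lemma \<psi>_rest_L2: "(\<lambda>v. 1 * \<psi> v + (- 1) * (if v \<le> u then \<psi> v else 0)) \<in> L2 M"
  by (rule L2_combine[OF \<psi>_L2 truncated_L2(1)[OF \<psi>_continuous(1)]])

lemma kern_L2: "kern u \<in> L2 M"
  unfolding kern_split[abs_def]
  by (rule L2_combine[OF truncated_L2(1)[OF \<phi>_continuous(1)] \<psi>_rest_L2])

text \<open>
  In each half, a factor at \<open>u\<close> and the integral of the other one over \<open>v\<close> have opposite powers of the
  weight; these cancel and the gained \<open>exp (- u)\<close> remains. In particular the kernel is of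
  Hilbert-Schmidt type.
\<close>

lemma kern_bound: "\<exists>K>0. \<forall>u\<ge>u\<^sub>0. (\<integral>v. (norm (kern u v))\<^sup>2 \<partial>M) \<le> K * exp (- u)"
proof -
  obtain C1 where C1: "C1 > 0" "\<And>u. u \<ge> u\<^sub>0 \<Longrightarrow> norm (\<psi> u) \<le> C1 * weight k u" using recessive_bounds(1)[OF rec] by blast
  obtain C2 where C2: "C2 > 0" "\<And>u. u \<ge> u\<^sub>0 \<Longrightarrow> norm (\<phi> u) * weight k u \<le> C2" using solution_growth[OF rec \<phi>s] by blast
  obtain K1 where K1: "K1 > 0" "\<And>u. u \<ge> u\<^sub>0 \<Longrightarrow> integral {u\<^sub>0..u} (\<lambda>v. (norm (\<phi> v))\<^sup>2) * (weight k u)\<^sup>2 \<le> K1 * exp (- u)"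
    using growing_factor_bound[OF \<phi>_continuous(1) C2] by blast
  obtain K2 where K2: "K2 > 0" "\<And>u. u \<ge> u\<^sub>0 \<Longrightarrow> integral {u..} (\<lambda>v. (norm (\<psi> v))\<^sup>2) \<le> K2 * exp (- u) * (weight k u)\<^sup>2"
    using decaying_factor_bound[OF \<psi>_continuous(1) recessive_square_integrable[OF rec] C1] by blast
  define n where "n = (norm w)\<^sup>2"
  have n0: "n > 0" using w0 by (simp add: n_def)
  show ?thesis
  proof (intro exI[of _ "(C1\<^sup>2 * K1 + C2\<^sup>2 * K2) / n"] conjI allI impI)
    show "(C1\<^sup>2 * K1 + C2\<^sup>2 * K2) / n > 0" using n0 C1(1) C2(1) K1(1) K2(1) by (simp add: add_pos_pos)
    fix u assume u: "u \<ge> u\<^sub>0"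
    define A where "A = integral {u\<^sub>0..u} (\<lambda>v. (norm (\<phi> v))\<^sup>2)"
    define B where "B = integral {u..} (\<lambda>v. (norm (\<psi> v))\<^sup>2)"
    have B_eq: "(\<integral>v. (norm (1 * \<psi> v + (- 1) * (if v \<le> u then \<psi> v else 0)))\<^sup>2 \<partial>M) = B"
    proof -
      have "(\<integral>v. (norm (1 * \<psi> v + (- 1) * (if v \<le> u then \<psi> v else 0)))\<^sup>2 \<partial>M)
        = integral {u\<^sub>0<..} (\<lambda>v. (norm (1 * \<psi> v + (- 1) * (if v \<le> u then \<psi> v else 0)))\<^sup>2)"
        by (rule lebesgue_integral_eq_integral[OF L2D(2)[OF \<psi>_rest_L2]]) simp
      also have "\<dots> = integral {u\<^sub>0<..} (\<lambda>v. if v \<in> {u<..} then (norm (\<psi> v))\<^sup>2 else 0)"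
        by (rule integral_cong) auto
      also have "\<dots> = integral ({u<..} \<inter> {u\<^sub>0<..}) (\<lambda>v. (norm (\<psi> v))\<^sup>2)" by (rule integral_restrict_Int)
      also have "{u<..} \<inter> {u\<^sub>0<..} = {u<..}" using u by auto
      also have "integral {u<..} (\<lambda>v. (norm (\<psi> v))\<^sup>2) = B"
        unfolding B_def by (rule integral_spike_set) (auto intro: negligible_subset[of "{u}"])
      finally show ?thesis .
    qed
    have i1: "integrable M (\<lambda>v. (norm (if v \<le> u then \<phi> v else 0))\<^sup>2)" by (rule L2D(2)[OF truncated_L2(1)[OF \<phi>_continuous(1)]])
    have i2: "integrable M (\<lambda>v. (norm (1 * \<psi> v + (- 1) * (if v \<le> u then \<psi> v else 0)))\<^sup>2)" by (rule L2D(2)[OF \<psi>_rest_L2])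
    have "(norm (kern u v))\<^sup>2 = (norm (\<psi> u))\<^sup>2 / n * (norm (if v \<le> u then \<phi> v else 0))\<^sup>2
       + (norm (\<phi> u))\<^sup>2 / n * (norm (1 * \<psi> v + (- 1) * (if v \<le> u then \<psi> v else 0)))\<^sup>2" for v
      by (simp add: kern_def n_def norm_divide norm_mult power_divide power_mult_distrib)
    then have "(\<integral>v. (norm (kern u v))\<^sup>2 \<partial>M) = (norm (\<psi> u))\<^sup>2 / n * A + (norm (\<phi> u))\<^sup>2 / n * B"
      using i1 i2 B_eq truncated_L2(2)[OF \<phi>_continuous(1), of u\<^sub>0 u]
      by (simp only: Bochner_Integration.integral_add integrable_mult_right integral_mult_right_zero A_def)
    also have "\<dots> = ((norm (\<psi> u))\<^sup>2 * A + (norm (\<phi> u))\<^sup>2 * B) / n" by (simp add: add_divide_distrib)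
    also have "\<dots> \<le> ((C1\<^sup>2 * K1 + C2\<^sup>2 * K2) * exp (- u)) / n"
    proof (intro divide_right_mono)
      have A0: "A \<ge> 0" unfolding A_def
        by (rule integral_nonneg) (auto intro!: integrable_continuous_interval continuous_intros \<phi>_continuous)
      have "(norm (\<psi> u))\<^sup>2 \<le> (C1 * weight k u)\<^sup>2" using C1(2)[OF u] by (intro power_mono) auto
      then have "(norm (\<psi> u))\<^sup>2 * A \<le> (C1 * weight k u)\<^sup>2 * A" using A0 by (rule mult_right_mono)
      also have "\<dots> = C1\<^sup>2 * (A * (weight k u)\<^sup>2)" by (simp add: power_mult_distrib)
      also have "\<dots> \<le> C1\<^sup>2 * (K1 * exp (- u))" using K1(2)[OF u] unfolding A_def by (intro mult_left_mono) auto
      finally have 1: "(norm (\<psi> u))\<^sup>2 * A \<le> C1\<^sup>2 * K1 * exp (- u)" by simp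
      have "(norm (\<phi> u))\<^sup>2 * B \<le> (norm (\<phi> u))\<^sup>2 * (K2 * exp (- u) * (weight k u)\<^sup>2)"
        using K2(2)[OF u] unfolding B_def by (intro mult_left_mono) auto
      also have "\<dots> = (norm (\<phi> u) * weight k u)\<^sup>2 * (K2 * exp (- u))" by (simp add: power_mult_distrib)
      also have "\<dots> \<le> C2\<^sup>2 * (K2 * exp (- u))"
        using C2(2)[OF u] K2(1) by (intro mult_right_mono power_mono) (auto simp: less_imp_le)
      finally have 2: "(norm (\<phi> u))\<^sup>2 * B \<le> C2\<^sup>2 * K2 * exp (- u)" by simp
      show "(norm (\<psi> u))\<^sup>2 * A + (norm (\<phi> u))\<^sup>2 * B \<le> (C1\<^sup>2 * K1 + C2\<^sup>2 * K2) * exp (- u)"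
        using 1 2 by (simp add: distrib_right)
    qed (use n0 in simp)
    finally show "(\<integral>v. (norm (kern u v))\<^sup>2 \<partial>M) \<le> (C1\<^sup>2 * K1 + C2\<^sup>2 * K2) / n * exp (- u)" by simp
  qed
qed

text \<open>
  Variation of constants: the solution of \<open>(H - E) f = h\<close> is a combination of \<open>\<psi>\<close> and \<open>\<phi>\<close> with these
  coefficients. The upper one is the integral of \<open>\<psi> * h\<close> over \<open>{u..}\<close>, written through the integral
  over \<open>{u\<^sub>0..u}\<close> because that one is an indefinite integral.
\<close>

definition lower_part where "lower_part h u = integral {u\<^sub>0..u} (\<lambda>v. \<phi> v * h v)"
definition upper_part where "upper_part h u = (\<integral>v. \<psi> v * h v \<partial>M) - integral {u\<^sub>0..u} (\<lambda>v. \<psi> v * h v)"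
definition sol where "sol h u = (\<psi> u * lower_part h u + \<phi> u * upper_part h u) / w"
definition sol' where "sol' h u = (\<psi>' u * lower_part h u + \<phi>' u * upper_part h u) / w"

lemma parts:
  assumes h: "h \<in> L2 M"
  shows "(\<lambda>v. \<phi> v * h v) absolutely_integrable_on {u\<^sub>0..u}" "(\<lambda>v. \<psi> v * h v) absolutely_integrable_on {u\<^sub>0..u}"
    "(\<integral>v. (if v \<le> u then \<phi> v else 0) * h v \<partial>M) = lower_part h u"
    "(\<integral>v. (1 * \<psi> v + (- 1) * (if v \<le> u then \<psi> v else 0)) * h v \<partial>M) = upper_part h u"
proof -
  have e: "(if v \<le> u then f v else 0) * h v = (if v \<le> u then f v * h v else 0)" for f v by simp
  have i1: "integrable M (\<lambda>v. if v \<le> u then \<phi> v * h v else 0)"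
    using L2_inner_integrable(2)[OF truncated_L2(1)[OF \<phi>_continuous(1), where u=u] h] by (simp only: e)
  have i2: "integrable M (\<lambda>v. if v \<le> u then \<psi> v * h v else 0)"
    using L2_inner_integrable(2)[OF truncated_L2(1)[OF \<psi>_continuous(1), where u=u] h] by (simp only: e)
  show "(\<lambda>v. \<phi> v * h v) absolutely_integrable_on {u\<^sub>0..u}" "(\<lambda>v. \<psi> v * h v) absolutely_integrable_on {u\<^sub>0..u}"
    by (rule half_line_initial_segment(1)[OF i1] half_line_initial_segment(1)[OF i2])+
  show "(\<integral>v. (if v \<le> u then \<phi> v else 0) * h v \<partial>M) = lower_part h u"
    unfolding e lower_part_def by (rule half_line_initial_segment(2)[OF i1])
  have "(1 * \<psi> v + (- 1) * (if v \<le> u then \<psi> v else 0)) * h v = \<psi> v * h v - (if v \<le> u then \<psi> v * h v else 0)" for v by simp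
  then have "(\<integral>v. (1 * \<psi> v + (- 1) * (if v \<le> u then \<psi> v else 0)) * h v \<partial>M)
     = (\<integral>v. \<psi> v * h v \<partial>M) - (\<integral>v. (if v \<le> u then \<psi> v * h v else 0) \<partial>M)"
    using Bochner_Integration.integral_diff[OF L2_inner_integrable(2)[OF \<psi>_L2 h] i2] by simp
  then show "(\<integral>v. (1 * \<psi> v + (- 1) * (if v \<le> u then \<psi> v else 0)) * h v \<partial>M) = upper_part h u"
    unfolding upper_part_def half_line_initial_segment(2)[OF i2] .
qed

lemma sol_kernel:
  assumes h: "h \<in> L2 M"
  shows "sol h u = (\<integral>v. kern u v * h v \<partial>M)"
proof -
  have "(\<integral>v. kern u v * h v \<partial>M) = (\<integral>v. \<psi> u / w * ((if v \<le> u then \<phi> v else 0) * h v)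
      + \<phi> u / w * ((1 * \<psi> v + (- 1) * (if v \<le> u then \<psi> v else 0)) * h v) \<partial>M)"
    by (rule Bochner_Integration.integral_cong[OF refl]) (simp add: kern_def)
  also have "\<dots> = \<psi> u / w * lower_part h u + \<phi> u / w * upper_part h u"
    using L2_inner_integrable(2)[OF truncated_L2(1)[OF \<phi>_continuous(1)] h, of u] L2_inner_integrable(2)[OF \<psi>_rest_L2 h, of u]
    by (simp only: Bochner_Integration.integral_add integrable_mult_right integral_mult_right_zero parts[OF h])
  finally show ?thesis by (simp add: sol_def add_divide_distrib)
qed

lemma sol_pointwise_bound:
  assumes h: "h \<in> L2 M"
  shows "(norm (sol h u))\<^sup>2 \<le> (\<integral>v. (norm (kern u v))\<^sup>2 \<partial>M) * (\<integral>v. (norm (h v))\<^sup>2 \<partial>M)"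
proof -
  have "norm (sol h u) \<le> (\<integral>v. norm (kern u v * h v) \<partial>M)" unfolding sol_kernel[OF h] by (rule integral_norm_bound)
  then have "norm (sol h u) \<le> (\<integral>v. norm (kern u v) * norm (h v) \<partial>M)" by (simp add: norm_mult)
  then have "(norm (sol h u))\<^sup>2 \<le> (\<integral>v. norm (kern u v) * norm (h v) \<partial>M)\<^sup>2" by (rule power_mono) simp
  also have "\<dots> \<le> (\<integral>v. (norm (kern u v))\<^sup>2 \<partial>M) * (\<integral>v. (norm (h v))\<^sup>2 \<partial>M)" by (rule L2_Cauchy_Schwarz[OF kern_L2 h])
  finally show ?thesis .
qed

lemma parts_regular:
  assumes h: "h \<in> L2 M"
  shows "abs_continuous_on u\<^sub>0 b (lower_part h)" "abs_continuous_on u\<^sub>0 b (upper_part h)"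
    "continuous_on {u\<^sub>0..} (lower_part h)" "continuous_on {u\<^sub>0..} (upper_part h)"
    "AE u in M. (lower_part h has_vector_derivative \<phi> u * h u) (at u)"
    "AE u in M. (upper_part h has_vector_derivative - (\<psi> u * h u)) (at u)"
proof -
  have ac: "abs_continuous_on u\<^sub>0 b (\<lambda>u. integral {u\<^sub>0..u} (\<lambda>v. \<phi> v * h v))"
    "abs_continuous_on u\<^sub>0 b (\<lambda>u. integral {u\<^sub>0..u} (\<lambda>v. \<psi> v * h v))" for b
    by (rule abs_continuous_on_indefinite_integral[OF parts(1)[OF h]] abs_continuous_on_indefinite_integral[OF parts(2)[OF h]])+
  show "abs_continuous_on u\<^sub>0 b (lower_part h)" using ac(1) unfolding lower_part_def[abs_def] .
  have "abs_continuous_on u\<^sub>0 b (\<lambda>u. 1 * (\<integral>v. \<psi> v * h v \<partial>M) + (- 1) * integral {u\<^sub>0..u} (\<lambda>v. \<psi> v * h v))"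
    by (rule abs_continuous_on_linear_combination[OF _ ac(2)]) (rule abs_continuous_on_lipschitz[of _ _ _ 0], simp)
  then show "abs_continuous_on u\<^sub>0 b (upper_part h)" unfolding upper_part_def[abs_def] by simp
  have "(\<lambda>v. \<phi> v * h v) integrable_on {u\<^sub>0..b}" "(\<lambda>v. \<psi> v * h v) integrable_on {u\<^sub>0..b}" for b
    using parts(1,2)[OF h, of b] by (auto intro: set_lebesgue_integral_eq_integral(1))
  then have c: "continuous_on {u\<^sub>0..} (\<lambda>u. integral {u\<^sub>0..u} (\<lambda>v. \<phi> v * h v))" "continuous_on {u\<^sub>0..} (\<lambda>u. integral {u\<^sub>0..u} (\<lambda>v. \<psi> v * h v))"
    by (auto intro!: continuous_on_half_lineI indefinite_integral_continuous_1)
  show "continuous_on {u\<^sub>0..} (lower_part h)" using c(1) unfolding lower_part_def[abs_def] .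
  show "continuous_on {u\<^sub>0..} (upper_part h)" unfolding upper_part_def[abs_def] by (intro continuous_intros c(2))
  have d: "AE u in M. ((\<lambda>u. integral {u\<^sub>0..u} (\<lambda>v. \<phi> v * h v)) has_vector_derivative \<phi> u * h u) (at u)"
    "AE u in M. ((\<lambda>u. integral {u\<^sub>0..u} (\<lambda>v. \<psi> v * h v)) has_vector_derivative \<psi> u * h u) (at u)"
    by (rule locally_integrable_derivative[OF parts(1)[OF h]] locally_integrable_derivative[OF parts(2)[OF h]])+
  show "AE u in M. (lower_part h has_vector_derivative \<phi> u * h u) (at u)" using d(1) unfolding lower_part_def[abs_def] .
  show "AE u in M. (upper_part h has_vector_derivative - (\<psi> u * h u)) (at u)"
    using d(2)
  proof eventually_elim
    case (elim u)
    then show ?case unfolding upper_part_def[abs_def]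
      using has_vector_derivative_diff[OF has_vector_derivative_const elim] by simp
  qed
qed

text \<open>
  The coefficients are absolutely continuous, with derivatives \<open>\<phi> * h\<close> and \<open>- \<psi> * h\<close> almost everywhere.
  In the first derivative these terms cancel, so \<open>sol'\<close> is continuous; in the second they combine to the
  Wronskian and give \<open>- h\<close>.
\<close>

lemma sol_C1:
  assumes h: "h \<in> L2 M"
  shows "C1_representative u\<^sub>0 (sol h) (sol' h) (\<lambda>u. potE k E u * sol h u - h u)"
proof -
  note pr = parts_regular[OF h]
  have rs: "sol_on S (potE k E) \<psi> \<psi>'" for S by (rule recessive_sol[OF rec])
  have ps: "sol_on S (potE k E) \<phi> \<phi>'" for S by (rule sol_on_subset[OF \<phi>s subset_UNIV])
  have qc: "continuous_on S (\<lambda>u. potE k E u * \<psi> u)" "continuous_on S (\<lambda>u. potE k E u * \<phi> u)" for S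
    by (intro continuous_intros potE_continuous \<psi>_continuous \<phi>_continuous)+
  have ac: "abs_continuous_on u\<^sub>0 b \<psi>" "abs_continuous_on u\<^sub>0 b \<phi>" "abs_continuous_on u\<^sub>0 b \<psi>'" "abs_continuous_on u\<^sub>0 b \<phi>'" for b
    by (rule abs_continuous_on_C1[OF sol_onD(1)[OF rs] \<psi>_continuous(2)] abs_continuous_on_C1[OF sol_onD(1)[OF ps] \<phi>_continuous(2)]
        abs_continuous_on_C1[OF sol_onD(2)[OF rs] qc(1)] abs_continuous_on_C1[OF sol_onD(2)[OF ps] qc(2)]; assumption)+
  have cp: "continuous_on {u\<^sub>0..b} (lower_part h)" "continuous_on {u\<^sub>0..b} (upper_part h)" for b
    using pr(3,4) by (auto intro: continuous_on_subset)
  have sol_alt: "sol h = (\<lambda>u. 1 / w * (\<psi> u * lower_part h u) + 1 / w * (\<phi> u * upper_part h u))"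
    by (simp add: sol_def fun_eq_iff add_divide_distrib)
  have sol'_alt: "sol' h = (\<lambda>u. 1 / w * (\<psi>' u * lower_part h u) + 1 / w * (\<phi>' u * upper_part h u))"
    by (simp add: sol'_def fun_eq_iff add_divide_distrib)
  have acs: "abs_continuous_on u\<^sub>0 b (sol h)" "abs_continuous_on u\<^sub>0 b (sol' h)" for b
    unfolding sol_alt sol'_alt
    by (intro abs_continuous_on_linear_combination abs_continuous_on_mult ac pr cp \<psi>_continuous \<phi>_continuous)+
  have cs': "continuous_on {u\<^sub>0..} (sol' h)"
    unfolding sol'_alt by (intro continuous_intros pr \<psi>_continuous \<phi>_continuous)
  have ae: "AE u in M. (sol h has_vector_derivative sol' h u) (at u) \<and>
     (sol' h has_vector_derivative potE k E u * sol h u - h u) (at u)"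
    using pr(5,6)
  proof eventually_elim
    case (elim u)
    have "(sol h has_vector_derivative 1 / w * (\<psi> u * (\<phi> u * h u) + \<psi>' u * lower_part h u)
        + 1 / w * (\<phi> u * (- (\<psi> u * h u)) + \<phi>' u * upper_part h u)) (at u)"
      unfolding sol_alt using sol_onD(1)[OF rs[of UNIV], of u] sol_onD(1)[OF ps[of UNIV], of u] elim
      by (intro has_vector_derivative_add has_vector_derivative_mult_right has_vector_derivative_mult) auto
    moreover have "1 / w * (\<psi> u * (\<phi> u * h u) + \<psi>' u * lower_part h u) + 1 / w * (\<phi> u * (- (\<psi> u * h u)) + \<phi>' u * upper_part h u) = sol' h u"
      using w0 by (simp add: sol'_def field_simps)
    moreover have "(sol' h has_vector_derivative 1 / w * (\<psi>' u * (\<phi> u * h u) + (potE k E u * \<psi> u) * lower_part h u)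
        + 1 / w * (\<phi>' u * (- (\<psi> u * h u)) + (potE k E u * \<phi> u) * upper_part h u)) (at u)"
      unfolding sol'_alt using sol_onD(2)[OF rs[of UNIV], of u] sol_onD(2)[OF ps[of UNIV], of u] elim
      by (intro has_vector_derivative_add has_vector_derivative_mult_right has_vector_derivative_mult) auto
    moreover have "1 / w * (\<psi>' u * (\<phi> u * h u) + (potE k E u * \<psi> u) * lower_part h u)
        + 1 / w * (\<phi>' u * (- (\<psi> u * h u)) + (potE k E u * \<phi> u) * upper_part h u) = potE k E u * sol h u - h u"
    proof -
      have "1 / w * (\<psi>' u * (\<phi> u * h u) + (potE k E u * \<psi> u) * lower_part h u)
        + 1 / w * (\<phi>' u * (- (\<psi> u * h u)) + (potE k E u * \<phi> u) * upper_part h u)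
        = potE k E u * sol h u - (\<phi>' u * \<psi> u - \<phi> u * \<psi>' u) * h u / w"
        using w0 by (simp add: sol_def field_simps)
      then show ?thesis unfolding wronskian using w0 by simp
    qed
    ultimately show ?case by simp
  qed
  have ae1: "AE u in M. (sol h has_vector_derivative sol' h u) (at u)" using ae by eventually_elim simp
  have ae2: "AE u in M. (sol' h has_vector_derivative potE k E u * sol h u - h u) (at u)" using ae by eventually_elim simp
  show ?thesis unfolding C1_representative_def
    using locally_abs_continuous_C1[OF acs(1) cs' ae1] cs' acs(2) ae2 by auto
qed

lemma sol_boundary: "boundary_form u\<^sub>0 \<alpha> (sol h) (sol' h) = 0"
  by (simp add: boundary_form_def sol_def sol'_def lower_part_def \<phi>0)

text \<open>
  Cauchy-Schwarz bounds \<open>sol h\<close> pointwise by the kernel bound, which is integrable in \<open>u\<close>.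
\<close>

lemma sol_L2_bound: "\<exists>K>0. \<forall>h\<in>L2 M. sol h \<in> L2 M \<and> (\<integral>u. (norm (sol h u))\<^sup>2 \<partial>M) \<le> K * (\<integral>v. (norm (h v))\<^sup>2 \<partial>M)"
proof -
  obtain K where K: "K > 0" "\<And>u. u \<ge> u\<^sub>0 \<Longrightarrow> (\<integral>v. (norm (kern u v))\<^sup>2 \<partial>M) \<le> K * exp (- u)" using kern_bound by blast
  have ei: "integrable M (\<lambda>u. exp (- u))"
    using integrable_on_exp_minus_to_infinity[of 1 u\<^sub>0] by (subst half_line_integrable_iff) auto
  define K1 where "K1 = (\<integral>u. exp (- u) \<partial>M)"
  have K1: "K1 \<ge> 0" unfolding K1_def by (rule integral_nonneg_AE) simp
  have main: "sol h \<in> L2 M \<and> (\<integral>u. (norm (sol h u))\<^sup>2 \<partial>M) \<le> (K * K1 + 1) * (\<integral>v. (norm (h v))\<^sup>2 \<partial>M)" if h: "h \<in> L2 M" for h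
  proof -
    define n where "n = (\<integral>v. (norm (h v))\<^sup>2 \<partial>M)"
    have n0: "n \<ge> 0" unfolding n_def by (rule integral_nonneg_AE) simp
    have b: "(norm (sol h u))\<^sup>2 \<le> K * n * exp (- u)" if "u \<ge> u\<^sub>0" for u
    proof -
      have "(norm (sol h u))\<^sup>2 \<le> (\<integral>v. (norm (kern u v))\<^sup>2 \<partial>M) * n" unfolding n_def by (rule sol_pointwise_bound[OF h])
      also have "\<dots> \<le> (K * exp (- u)) * n" using K(2)[OF that] n0 by (rule mult_right_mono)
      finally show ?thesis by (simp add: algebra_simps)
    qed
    have c: "continuous_on {u\<^sub>0..} (sol h)" by (rule C1_representative_continuous(1)[OF sol_C1[OF h]])
    have L: "sol h \<in> L2 M" by (rule continuous_half_line_L2[OF c integrable_norm_squared_bounded[OF c b]])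
    have "(\<integral>u. (norm (sol h u))\<^sup>2 \<partial>M) \<le> (\<integral>u. K * n * exp (- u) \<partial>M)"
    proof (rule integral_mono_AE[OF L2D(2)[OF L]])
      show "integrable M (\<lambda>u. K * n * exp (- u))" using ei by (rule integrable_mult_right)
      show "AE u in M. (norm (sol h u))\<^sup>2 \<le> K * n * exp (- u)"
        by (rule AE_I2) (use b in simp)
    qed
    also have "\<dots> = K * K1 * n" using ei by (simp add: K1_def)
    also have "\<dots> \<le> (K * K1 + 1) * n" using n0 by (intro mult_right_mono) auto
    finally show ?thesis using L unfolding n_def by simp
  qed
  show ?thesis using main K(1) K1 by (intro exI[of _ "K * K1 + 1"]) (auto simp: add_nonneg_pos)
qed

lemma sol_L2: "h \<in> L2 M \<Longrightarrow> sol h \<in> L2 M"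
  using sol_L2_bound by blast

lemma sol_in_operator:
  assumes h: "h \<in> L2 M"
  shows "(sol h, (\<lambda>u. 1 * h u + E * sol h u)) \<in> schrodinger_operator u\<^sub>0 \<alpha> (V_pot k)"
  unfolding schrodinger_operator_iff
proof (intro conjI exI)
  show "C1_representative u\<^sub>0 (sol h) (sol' h) (\<lambda>u. potE k E u * sol h u - h u)" by (rule sol_C1[OF h])
  show "AE u in M. 1 * h u + E * sol h u = - (potE k E u * sol h u - h u) + of_real (V_pot k u) * sol h u"
    by (simp add: potE_def algebra_simps)
  show "(\<lambda>u. 1 * h u + E * sol h u) \<in> L2 M" by (rule L2_combine[OF h sol_L2[OF h]])
qed (simp_all add: sol_L2[OF h] sol_boundary)

text \<open>
  The difference of \<open>f\<close> and \<open>sol\<close> is a square-integrable solution of the homogeneous equation, so a multiple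
  of \<open>\<psi>\<close>; it satisfies the boundary condition, which \<open>\<psi>\<close> does not.
\<close>

lemma operator_eq_sol:
  assumes fg: "(f, g) \<in> schrodinger_operator u\<^sub>0 \<alpha> (V_pot k)"
  shows "AE u in M. f u = sol (\<lambda>u. 1 * g u + (- E) * f u) u"
proof -
  define h where "h = (\<lambda>u. 1 * g u + (- E) * f u)"
  obtain F F' F'' where F: "C1_representative u\<^sub>0 F F' F''" "boundary_form u\<^sub>0 \<alpha> F F' = 0"
     "AE u in M. f u = F u" "AE u in M. g u = - F'' u + of_real (V_pot k u) * F u"
     and L: "f \<in> L2 M" "g \<in> L2 M"
    using fg unfolding schrodinger_operator_iff by blast
  have h: "h \<in> L2 M" unfolding h_def by (rule L2_combine[OF L(2,1)])
  define D where "D u = F u - sol h u" for u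
  define D' where "D' u = F' u - sol' h u" for u
  have r: "C1_representative u\<^sub>0 D D' (\<lambda>u. F'' u - (potE k E u * sol h u - h u))"
    unfolding D_def[abs_def] D'_def[abs_def] by (rule C1_representative_diff[OF F(1) sol_C1[OF h]])
  have eq: "AE u in M. F'' u - (potE k E u * sol h u - h u) = potE k E u * D u"
    using F(3,4)
  proof eventually_elim
    case (elim u)
    have "F'' u = of_real (V_pot k u) * F u - g u" using elim(2) by (simp add: algebra_simps)
    then show ?case using elim(1) by (simp add: h_def D_def potE_def algebra_simps)
  qed
  have FL: "F \<in> L2 M" by (rule L2_cong_continuous[OF C1_representative_continuous(1)[OF F(1)] L(1) F(3)])
  have "D \<in> L2 M" using L2_combine[OF FL sol_L2[OF h], of 1 "- 1"] by (simp add: D_def[abs_def])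
  from weak_solution_multiple_of_recessive[OF r eq this rec]
  obtain c where c: "\<And>u. u \<ge> u\<^sub>0 \<Longrightarrow> D u = c * \<psi> u \<and> D' u = c * \<psi>' u" by blast
  have "boundary_form u\<^sub>0 \<alpha> D D' = boundary_form u\<^sub>0 \<alpha> F F' - boundary_form u\<^sub>0 \<alpha> (sol h) (sol' h)"
    by (simp add: boundary_form_def D_def D'_def algebra_simps)
  then have "boundary_form u\<^sub>0 \<alpha> D D' = 0" using F(2) sol_boundary by simp
  moreover have "boundary_form u\<^sub>0 \<alpha> D D' = c * boundary_form u\<^sub>0 \<alpha> \<psi> \<psi>'"
    using c[of u\<^sub>0] by (simp add: boundary_form_def algebra_simps)
  ultimately have "c = 0" using nz by simp
  then have "F u = sol h u" if "u > u\<^sub>0" for u using c[of u] that by (simp add: D_def)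
  then have "AE u in M. F u = sol h u" by (intro AE_I2) simp
  then show ?thesis using F(3) unfolding h_def[symmetric] by eventually_elim simp
qed

lemma in_resolvent_set: "E \<in> resolvent_set M (schrodinger_operator u\<^sub>0 \<alpha> (V_pot k))"
  unfolding resolvent_set_def
proof (intro CollectI conjI ballI)
  fix h assume h: "h \<in> L2 M"
  show "\<exists>(f, Af)\<in>schrodinger_operator u\<^sub>0 \<alpha> (V_pot k). AE x in M. Af x - E * f x = h x"
    by (rule bexI[OF _ sol_in_operator[OF h]]) simp
next
  obtain K where K: "K > 0" "\<And>h. h \<in> L2 M \<Longrightarrow> (\<integral>u. (norm (sol h u))\<^sup>2 \<partial>M) \<le> K * (\<integral>v. (norm (h v))\<^sup>2 \<partial>M)"
    using sol_L2_bound by blast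
  have "L2_norm M f \<le> sqrt K * L2_norm M (\<lambda>x. Af x - E * f x)" if fA: "(f, Af) \<in> schrodinger_operator u\<^sub>0 \<alpha> (V_pot k)" for f Af
  proof -
    have L: "f \<in> L2 M" "Af \<in> L2 M" using fA unfolding schrodinger_operator_iff by blast+
    define h where "h = (\<lambda>u. 1 * Af u + (- E) * f u)"
    have h: "h \<in> L2 M" unfolding h_def by (rule L2_combine[OF L(2,1)])
    have ae: "AE u in M. f u = sol h u" using operator_eq_sol[OF fA] unfolding h_def .
    have "(\<integral>u. (norm (f u))\<^sup>2 \<partial>M) = (\<integral>u. (norm (sol h u))\<^sup>2 \<partial>M)"
    proof (rule integral_cong_AE)
      show "(\<lambda>u. (norm (f u))\<^sup>2) \<in> borel_measurable M" "(\<lambda>u. (norm (sol h u))\<^sup>2) \<in> borel_measurable M"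
        by (rule borel_measurable_integrable[OF L2D(2)[OF L(1)]] borel_measurable_integrable[OF L2D(2)[OF sol_L2[OF h]]])+
      show "AE u in M. (norm (f u))\<^sup>2 = (norm (sol h u))\<^sup>2" using ae by eventually_elim simp
    qed
    also have "\<dots> \<le> K * (\<integral>v. (norm (h v))\<^sup>2 \<partial>M)" by (rule K(2)[OF h])
    finally have "sqrt (\<integral>u. (norm (f u))\<^sup>2 \<partial>M) \<le> sqrt (K * (\<integral>v. (norm (h v))\<^sup>2 \<partial>M))" by (rule real_sqrt_le_mono)
    then show ?thesis by (simp add: L2_norm_def real_sqrt_mult h_def)
  qed
  then show "\<exists>C. \<forall>(f, Af)\<in>schrodinger_operator u\<^sub>0 \<alpha> (V_pot k). L2_norm M f \<le> C * L2_norm M (\<lambda>x. Af x - E * f x)" by blast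
qed

end

section \<open>Density of the domain\<close>

text \<open>
  A measurable function is an almost everywhere limit of continuous ones, which are cut off at the
  bound \<open>B\<close> to allow dominated convergence; a continuous function on a compact interval is then
  approximated uniformly by a polynomial.
\<close>

lemma bounded_polynomial_approximation:
  fixes h :: "real \<Rightarrow> complex"
  assumes h: "h \<in> borel_measurable (half_line u\<^sub>0)" and B: "\<And>v. norm (h v) \<le> B" and \<delta>: "\<delta> > 0" and b: "b \<ge> u\<^sub>0"
  shows "\<exists>p. polynomial_function p \<and> integrable (half_line u\<^sub>0) (\<lambda>v. if v \<le> b then (norm (h v - p v))\<^sup>2 else 0) \<and>
    (\<integral>v. (if v \<le> b then (norm (h v - p v))\<^sup>2 else 0) \<partial>half_line u\<^sub>0) < \<delta>"
proof -
  let ?M = "half_line u\<^sub>0"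
  note [measurable] = h
  have B0: "B \<ge> 0" using B[of 0] norm_ge_zero order_trans by blast
  have const: "integrable ?M (\<lambda>v. if v \<le> b then c\<^sup>2 else 0)" "(\<integral>v. (if v \<le> b then c\<^sup>2 else 0) \<partial>?M) = c\<^sup>2 * (b - u\<^sub>0)" for c :: real
  proof -
    have e: "(norm (if v \<le> b then complex_of_real c else 0))\<^sup>2 = (if v \<le> b then c\<^sup>2 else 0)" for v by simp
    have cc: "continuous_on {u\<^sub>0..} (\<lambda>_. complex_of_real c)" by (rule continuous_on_const)
    show "integrable ?M (\<lambda>v. if v \<le> b then c\<^sup>2 else 0)" using L2D(2)[OF truncated_L2(1)[OF cc, where u=b]] by (simp only: e)
    show "(\<integral>v. (if v \<le> b then c\<^sup>2 else 0) \<partial>?M) = c\<^sup>2 * (b - u\<^sub>0)"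
      using truncated_L2(2)[OF cc, where u=b] b by (simp only: e) simp
  qed
  have "h measurable_on {u\<^sub>0<..}" using h measurable_on_iff_borel_measurable[of "{u\<^sub>0<..}" h] by simp
  then obtain N g where N: "negligible N" and g: "\<And>n::nat. continuous_on UNIV (g n)"
    and lim: "\<And>x. x \<notin> N \<Longrightarrow> (\<lambda>n. g n x) \<longlonglongrightarrow> (if x \<in> {u\<^sub>0<..} then h x else 0)"
    unfolding measurable_on_def by blast
  \<comment> \<open>The radial retraction onto the ball of radius \<open>B\<close>, which fixes the values of \<open>h\<close>.\<close>
  define c where "c z = (B / max B (norm z)) *\<^sub>R z" for z :: complex
  have Bpos: "B > 0 \<or> B = 0" using B0 by auto
  define C where "C z = (if B = 0 then 0 else c z)" for z
  have Cc: "continuous_on UNIV C"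
  proof (cases "B = 0")
    case False
    have "continuous_on UNIV c" unfolding c_def using False B0 by (intro continuous_intros) (auto simp: max_def)
    then show ?thesis using False by (simp add: C_def[abs_def])
  qed (simp add: C_def[abs_def])
  have Cb: "norm (C z) \<le> B" for z
    using B0 by (auto simp: C_def c_def max_def divide_simps)
  have Ch: "C (h v) = h v" for v
    using B[of v] B0 by (auto simp: C_def c_def max_def)
  have Cg: "continuous_on S (\<lambda>v. C (g n v))" for n S
    by (rule continuous_on_subset[OF continuous_on_compose2[OF Cc g]]) auto
  have [measurable]: "(\<lambda>v. C (g n v)) \<in> borel_measurable ?M" for n
    by (rule continuous_half_line_measurable[OF Cg])
  define G where "G n v = (if v \<le> b then (norm (h v - C (g n v)))\<^sup>2 else 0)" for n v
  have "(\<lambda>n. \<integral>v. G n v \<partial>?M) \<longlonglongrightarrow> (\<integral>v. 0 \<partial>?M)"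
  proof (rule integral_dominated_convergence[where w="\<lambda>v. if v \<le> b then (2 * B)\<^sup>2 else 0"])
    show "G n \<in> borel_measurable ?M" for n unfolding G_def by measurable
    show "integrable ?M (\<lambda>v. if v \<le> b then (2 * B)\<^sup>2 else 0)" by (rule const)
    show "AE v in ?M. norm (G n v) \<le> (if v \<le> b then (2 * B)\<^sup>2 else 0)" for n
    proof (rule AE_I2)
      fix v
      have "norm (h v - C (g n v)) \<le> 2 * B" using norm_triangle_ineq4[of "h v" "C (g n v)"] B[of v] Cb[of "g n v"] by linarith
      then have "(norm (h v - C (g n v)))\<^sup>2 \<le> (2 * B)\<^sup>2" by (rule power_mono) simp
      then show "norm (G n v) \<le> (if v \<le> b then (2 * B)\<^sup>2 else 0)" by (simp add: G_def)
    qed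
    show "AE v in ?M. (\<lambda>n. G n v) \<longlonglongrightarrow> 0"
      unfolding AE_half_line_iff
    proof (rule negligible_subset[OF N], rule subsetI, rule ccontr)
      fix v assume v: "v \<in> {v. v > u\<^sub>0 \<and> \<not> (\<lambda>n. G n v) \<longlonglongrightarrow> 0}" and "v \<notin> N"
      then have "(\<lambda>n. g n v) \<longlonglongrightarrow> h v" using lim[of v] by simp
      then have "(\<lambda>n. C (g n v)) \<longlonglongrightarrow> C (h v)"
        using Cc by (metis UNIV_I continuous_on_eq_continuous_at isCont_tendsto_compose open_UNIV)
      then have "(\<lambda>n. (norm (h v - C (g n v)))\<^sup>2) \<longlonglongrightarrow> (norm (h v - C (h v)))\<^sup>2" by (intro tendsto_intros)
      then have "(\<lambda>n. (norm (h v - C (g n v)))\<^sup>2) \<longlonglongrightarrow> 0" by (simp add: Ch)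
      then have "(\<lambda>n. G n v) \<longlonglongrightarrow> 0" unfolding G_def by (cases "v \<le> b") auto
      then show False using v by simp
    qed
  qed simp
  then have "(\<lambda>n. \<integral>v. G n v \<partial>?M) \<longlonglongrightarrow> 0" by simp
  then have "\<forall>\<^sub>F n in sequentially. (\<integral>v. G n v \<partial>?M) < \<delta> / 4" using \<delta> by (intro order_tendstoD) auto
  then obtain n where n: "(\<integral>v. G n v \<partial>?M) < \<delta> / 4" by (auto simp: eventually_sequentially)
  have Gi: "integrable ?M (G n)"
  proof (rule Bochner_Integration.integrable_bound[OF const(1)[of "2 * B"]])
    show "G n \<in> borel_measurable ?M" unfolding G_def by measurable
    show "AE v in ?M. norm (G n v) \<le> norm (if v \<le> b then (2 * B)\<^sup>2 else 0)"
    proof (rule AE_I2)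
      fix v
      have "norm (h v - C (g n v)) \<le> 2 * B" using norm_triangle_ineq4[of "h v" "C (g n v)"] B[of v] Cb[of "g n v"] by linarith
      then have "(norm (h v - C (g n v)))\<^sup>2 \<le> (2 * B)\<^sup>2" by (rule power_mono) simp
      then show "norm (G n v) \<le> norm (if v \<le> b then (2 * B)\<^sup>2 else 0)" by (simp add: G_def)
    qed
  qed
  define \<eta> where "\<eta> = sqrt (\<delta> / (4 * (b - u\<^sub>0 + 1)))"
  have \<eta>0: "\<eta> > 0" using \<delta> b by (simp add: \<eta>_def)
  have \<eta>2: "\<eta>\<^sup>2 * (b - u\<^sub>0) \<le> \<delta> / 4"
  proof -
    have "\<eta>\<^sup>2 = \<delta> / (4 * (b - u\<^sub>0 + 1))" using \<delta> b by (simp add: \<eta>_def)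
    then have "\<eta>\<^sup>2 * (b - u\<^sub>0 + 1) = \<delta> / 4" using b by (simp add: field_simps)
    moreover have "\<eta>\<^sup>2 * (b - u\<^sub>0) \<le> \<eta>\<^sup>2 * (b - u\<^sub>0 + 1)" by (intro mult_left_mono) auto
    ultimately show ?thesis by simp
  qed
  obtain p where p: "polynomial_function p" "\<And>x. x \<in> {u\<^sub>0..b} \<Longrightarrow> norm (C (g n x) - p x) < \<eta>"
    using Stone_Weierstrass_polynomial_function[of "{u\<^sub>0..b}" "\<lambda>v. C (g n v)" \<eta>] Cg \<eta>0 by auto
  have [measurable]: "p \<in> borel_measurable ?M"
    by (rule continuous_half_line_measurable) (rule continuous_on_polymonial_function[OF p(1)])
  have pw: "(if v \<le> b then (norm (h v - p v))\<^sup>2 else 0) \<le> 2 * G n v + 2 * (if v \<le> b then \<eta>\<^sup>2 else 0)" if "v > u\<^sub>0" for v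
  proof (cases "v \<le> b")
    case True
    have "norm (C (g n v) - p v) \<le> \<eta>" using p(2)[of v] True that by simp
    then have 1: "(norm (C (g n v) - p v))\<^sup>2 \<le> \<eta>\<^sup>2" by (rule power_mono) simp
    have "norm (h v - p v) \<le> norm (h v - C (g n v)) + norm (C (g n v) - p v)"
      using norm_triangle_ineq[of "h v - C (g n v)" "C (g n v) - p v"] by simp
    then have "(norm (h v - p v))\<^sup>2 \<le> (norm (h v - C (g n v)) + norm (C (g n v) - p v))\<^sup>2" by (rule power_mono) simp
    also have "\<dots> \<le> 2 * (norm (h v - C (g n v)))\<^sup>2 + 2 * (norm (C (g n v) - p v))\<^sup>2"
      using zero_le_power2[of "norm (h v - C (g n v)) - norm (C (g n v) - p v)"] by (simp add: power2_eq_square algebra_simps)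
    finally show ?thesis using 1 True by (simp add: G_def)
  qed (simp add: G_def)
  have bi: "integrable ?M (\<lambda>v. 2 * G n v + 2 * (if v \<le> b then \<eta>\<^sup>2 else 0))"
    by (intro Bochner_Integration.integrable_add integrable_mult_right Gi const)
  have i: "integrable ?M (\<lambda>v. if v \<le> b then (norm (h v - p v))\<^sup>2 else 0)"
  proof (rule Bochner_Integration.integrable_bound[OF bi])
    show "AE v in ?M. norm (if v \<le> b then (norm (h v - p v))\<^sup>2 else 0) \<le> norm (2 * G n v + 2 * (if v \<le> b then \<eta>\<^sup>2 else 0))"
    proof (rule AE_I2)
      fix v assume "v \<in> space ?M"
      then have le: "(if v \<le> b then (norm (h v - p v))\<^sup>2 else 0) \<le> 2 * G n v + 2 * (if v \<le> b then \<eta>\<^sup>2 else 0)"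
        using pw[of v] by simp
      have "0 \<le> (if v \<le> b then (norm (h v - p v))\<^sup>2 else 0)" by simp
      then show "norm (if v \<le> b then (norm (h v - p v))\<^sup>2 else 0) \<le> norm (2 * G n v + 2 * (if v \<le> b then \<eta>\<^sup>2 else 0))"
        using le unfolding real_norm_def by linarith
    qed
  qed measurable
  have "(\<integral>v. (if v \<le> b then (norm (h v - p v))\<^sup>2 else 0) \<partial>?M) \<le> (\<integral>v. 2 * G n v + 2 * (if v \<le> b then \<eta>\<^sup>2 else 0) \<partial>?M)"
    by (rule integral_mono_AE[OF i bi], rule AE_I2) (use pw in auto)
  also have "\<dots> = 2 * (\<integral>v. G n v \<partial>?M) + 2 * (\<eta>\<^sup>2 * (b - u\<^sub>0))"
    using Gi const[of \<eta>] by simp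
  also have "\<dots> < \<delta>" using n \<eta>2 by linarith
  finally show ?thesis using p(1) i by blast
qed

lemma max_power_deriv:
  "((\<lambda>x. (max 0 (b - x)) ^ Suc (Suc n)) has_real_derivative - (real (Suc (Suc n)) * (max 0 (b - x)) ^ Suc n)) (at x)"
proof -
  have P: "((\<lambda>y::real. (max 0 y) ^ Suc (Suc n)) has_real_derivative real (Suc (Suc n)) * (max 0 y) ^ Suc n) (at y)" for y :: real
  proof (rule linorder_cases[of y 0])
    assume y: "y < 0"
    have "((\<lambda>y::real. 0) has_real_derivative 0) (at y)" by simp
    then have "((\<lambda>y::real. (max 0 y) ^ Suc (Suc n)) has_real_derivative 0) (at y)"
      by (rule has_field_derivative_transform_within_open[where S="{..<0}"]) (use y in auto)
    then show ?thesis using y by simp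
  next
    assume y: "y > 0"
    have "((\<lambda>y::real. y ^ Suc (Suc n)) has_real_derivative real (Suc (Suc n)) * y ^ Suc n) (at y)"
      using DERIV_pow[of "Suc (Suc n)" y UNIV] by simp
    then have "((\<lambda>y::real. (max 0 y) ^ Suc (Suc n)) has_real_derivative real (Suc (Suc n)) * y ^ Suc n) (at y)"
      by (rule has_field_derivative_transform_within_open[where S="{0<..}"]) (use y in auto)
    then show ?thesis using y by (simp add: max_def)
  next
    assume y: "y = 0"
    have "((\<lambda>h::real. ((max 0 (0 + h)) ^ Suc (Suc n) - (max 0 0) ^ Suc (Suc n)) / h) \<longlongrightarrow> 0) (at 0)"
    proof (rule Lim_null_comparison)
      show "\<forall>\<^sub>F h::real in at 0. norm (((max 0 (0 + h)) ^ Suc (Suc n) - (max 0 0) ^ Suc (Suc n)) / h) \<le> \<bar>h\<bar> ^ Suc n"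
      proof (rule always_eventually, rule allI)
        fix h :: real
        show "norm (((max 0 (0 + h)) ^ Suc (Suc n) - (max 0 0) ^ Suc (Suc n)) / h) \<le> \<bar>h\<bar> ^ Suc n"
        proof (cases "h > 0")
          case True
          then show ?thesis by (simp add: max_def)
        next
          case False
          then have "max 0 (0 + h) = 0" by simp
          then have "((max 0 (0 + h)) ^ Suc (Suc n) - (max 0 0) ^ Suc (Suc n)) / h = 0" by simp
          then show ?thesis by (simp only: norm_zero zero_le_power abs_ge_zero)
        qed
      qed
      have "((\<lambda>h::real. \<bar>h\<bar> ^ Suc n) \<longlongrightarrow> \<bar>0\<bar> ^ Suc n) (at 0)" by (intro tendsto_intros)
      then show "((\<lambda>h::real. \<bar>h\<bar> ^ Suc n) \<longlongrightarrow> 0) (at 0)" by simp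
    qed
    then show ?thesis unfolding y DERIV_def by simp
  qed
  have "((\<lambda>x. b - x) has_real_derivative - 1) (at x)" by (auto intro!: derivative_eq_intros)
  from DERIV_chain2[OF P this] show ?thesis by simp
qed

text \<open>
  Third powers make it twice continuously differentiable with vanishing value and derivative at \<open>a\<close>, so
  its multiples satisfy every boundary condition there. Being a polynomial on \<open>{a..b}\<close> with an
  elementary derivative, it is easier to handle than a smooth bump function.
\<close>

definition bump :: "real \<Rightarrow> real \<Rightarrow> real \<Rightarrow> real" where
  "bump a b u = (max 0 (b - u)) ^ 3 * (u - a) ^ 3"

lemma bump_C2:
  "\<exists>B1 B2. (\<forall>u. (bump a b has_real_derivative B1 u) (at u)) \<and> (\<forall>u. (B1 has_real_derivative B2 u) (at u)) \<and>
     continuous_on UNIV B2 \<and> B1 a = 0 \<and> (\<forall>u\<ge>b. B1 u = 0 \<and> B2 u = 0)"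
proof -
  define m where "m u = max 0 (b - u)" for u
  have d3: "((\<lambda>u. m u ^ 3) has_real_derivative - (3 * m u ^ 2)) (at u)" for u
    using max_power_deriv[of b 1 u] by (simp add: m_def numeral_3_eq_3 numeral_2_eq_2)
  have d2: "((\<lambda>u. m u ^ 2) has_real_derivative - (2 * m u)) (at u)" for u
    using max_power_deriv[of b 0 u] by (simp add: m_def numeral_2_eq_2)
  define B1 where "B1 u = m u ^ 3 * (3 * (u - a) ^ 2) + - (3 * m u ^ 2) * (u - a) ^ 3" for u
  define B2 where "B2 u = (m u ^ 3 * (6 * (u - a)) + - (3 * m u ^ 2) * (3 * (u - a) ^ 2))
     + (- (3 * m u ^ 2) * (3 * (u - a) ^ 2) + - (3 * - (2 * m u)) * (u - a) ^ 3)" for u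
  have e3: "((\<lambda>u. (u - a) ^ 3) has_real_derivative 3 * (u - a) ^ 2) (at u)" for u by (auto intro!: derivative_eq_intros)
  have e2: "((\<lambda>u. 3 * (u - a) ^ 2) has_real_derivative 6 * (u - a)) (at u)" for u by (auto intro!: derivative_eq_intros)
  have "(bump a b has_real_derivative B1 u) (at u)" for u
    unfolding bump_def[abs_def] m_def[symmetric] B1_def
    by (rule DERIV_cong[OF DERIV_mult[OF d3 e3]]) (simp add: algebra_simps)
  moreover have "(B1 has_real_derivative B2 u) (at u)" for u
    unfolding B1_def[abs_def] B2_def
    by (rule DERIV_cong[OF DERIV_add[OF DERIV_mult[OF d3 e2] DERIV_mult[OF DERIV_minus[OF DERIV_cmult[OF d2]] e3]]]) (simp add: algebra_simps)
  moreover have "continuous_on UNIV B2" unfolding B2_def[abs_def] m_def by (intro continuous_intros)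
  moreover have "B1 a = 0" by (simp add: B1_def)
  moreover have "B1 u = 0 \<and> B2 u = 0" if "u \<ge> b" for u using that by (simp add: B1_def B2_def m_def)
  ultimately show ?thesis by blast
qed

lemma bump_polynomial_in_domain:
  assumes p: "polynomial_function p"
  shows "(\<lambda>u. of_real (bump u\<^sub>0 b u) * p u) \<in> Domain (schrodinger_operator u\<^sub>0 \<alpha> (V_pot k))"
proof -
  obtain B1 B2 where B: "\<And>u. (bump u\<^sub>0 b has_real_derivative B1 u) (at u)" "\<And>u. (B1 has_real_derivative B2 u) (at u)"
     "continuous_on UNIV B2" "B1 u\<^sub>0 = 0" "\<And>u. u \<ge> b \<Longrightarrow> B1 u = 0 \<and> B2 u = 0"
    using bump_C2 by metis
  obtain p1 where p1: "polynomial_function p1" "\<And>x. (p has_vector_derivative p1 x) (at x)"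
    using has_vector_derivative_polynomial_function[OF p] by blast
  obtain p2 where p2: "polynomial_function p2" "\<And>x. (p1 has_vector_derivative p2 x) (at x)"
    using has_vector_derivative_polynomial_function[OF p1(1)] by blast
  define \<Omega> where "\<Omega> u = complex_of_real (bump u\<^sub>0 b u)" for u
  define \<Omega>1 where "\<Omega>1 u = complex_of_real (B1 u)" for u
  define \<Omega>2 where "\<Omega>2 u = complex_of_real (B2 u)" for u
  have d: "(\<Omega> has_vector_derivative \<Omega>1 u) (at u)" "(\<Omega>1 has_vector_derivative \<Omega>2 u) (at u)" for u
    unfolding \<Omega>_def[abs_def] \<Omega>1_def[abs_def] \<Omega>2_def using B(1,2) by (auto intro: has_vector_derivative_of_real)
  define F where "F u = \<Omega> u * p u" for u
  define F1 where "F1 u = \<Omega> u * p1 u + \<Omega>1 u * p u" for u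
  define F2 where "F2 u = (\<Omega> u * p2 u + \<Omega>1 u * p1 u) + (\<Omega>1 u * p1 u + \<Omega>2 u * p u)" for u
  have Fd: "(F has_vector_derivative F1 u) (at u)" for u
    unfolding F_def[abs_def] F1_def by (rule has_vector_derivative_mult[OF d(1) p1(2)])
  have F1d: "(F1 has_vector_derivative F2 u) (at u)" for u
    unfolding F1_def[abs_def] F2_def
    by (intro has_vector_derivative_add has_vector_derivative_mult d p1 p2)
  have dc: "continuous_on S f" if "\<And>u. (f has_vector_derivative f' u) (at u)" for f f' :: "real \<Rightarrow> complex" and S
    using that by (meson continuous_at_imp_continuous_on has_vector_derivative_continuous)
  have Fc: "continuous_on S F" and F1c: "continuous_on S F1" for S
    by (rule dc[OF Fd], rule dc[OF F1d])
  have F2c: "continuous_on S F2" for S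
    unfolding F2_def[abs_def]
    by (intro continuous_intros dc[OF d(1)] dc[OF d(2)] dc[OF p1(2)] dc[OF p2(2)] continuous_on_polymonial_function[OF p2(1)])
      (auto simp: \<Omega>2_def[abs_def] intro!: continuous_intros continuous_on_subset[OF B(3)])
  have r: "C1_representative u\<^sub>0 F F1 F2"
    unfolding C1_representative_def
    using Fd F1d F1c abs_continuous_on_C1[OF has_vector_derivative_at_within[OF F1d] F2c]
    by (auto intro: has_vector_derivative_at_within)
  define G where "G u = - F2 u + of_real (V_pot k u) * F u" for u
  have Gc: "continuous_on {u\<^sub>0..} G"
    unfolding G_def[abs_def] V_pot_def by (intro continuous_intros Fc F2c)
  have z: "\<Omega> u = 0" "\<Omega>1 u = 0" "\<Omega>2 u = 0" if "u \<ge> b" for u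
    using B(5)[OF that] that by (simp_all add: \<Omega>_def \<Omega>1_def \<Omega>2_def bump_def)
  have "(\<lambda>v. if v \<le> b then F v else 0) = F" "(\<lambda>v. if v \<le> b then G v else 0) = G"
    using z by (auto simp: fun_eq_iff F_def G_def F2_def)
  then have L: "F \<in> L2 (half_line u\<^sub>0)" "G \<in> L2 (half_line u\<^sub>0)"
    using truncated_L2(1)[OF Fc, where u=b] truncated_L2(1)[OF Gc, where u=b] by simp_all
  have "boundary_form u\<^sub>0 \<alpha> F F1 = 0"
    by (simp add: boundary_form_def F_def F1_def \<Omega>_def \<Omega>1_def bump_def B(4))
  then have "(F, G) \<in> schrodinger_operator u\<^sub>0 \<alpha> (V_pot k)"
    unfolding schrodinger_operator_iff using L r by (auto simp: G_def)
  then show ?thesis unfolding F_def \<Omega>_def[abs_def] by blast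
qed

text \<open>
  Cut \<open>f\<close> off to the set where \<open>norm f \<le> n * bump\<close>; this converges to \<open>f\<close> in \<open>L2\<close>. There \<open>f / bump\<close> is
  bounded, hence close to a polynomial \<open>p\<close>, and \<open>bump * p\<close> belongs to the domain.
\<close>

theorem operator_densely_defined: "densely_defined (half_line u\<^sub>0) (schrodinger_operator u\<^sub>0 \<alpha> (V_pot k))"
  unfolding densely_defined_def
proof (intro ballI allI impI)
  let ?M = "half_line u\<^sub>0"
  fix f :: "real \<Rightarrow> complex" and \<epsilon> :: real assume f: "f \<in> L2 ?M" and \<epsilon>: "\<epsilon> > 0"
  have fm [measurable]: "f \<in> borel_measurable ?M" by (rule L2D(1)[OF f])
  define b where "b n = u\<^sub>0 + real n" for n
  define \<Omega> where "\<Omega> n = bump u\<^sub>0 (b n)" for n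
  have \<Omega>c: "continuous_on S (\<Omega> n)" for n S unfolding \<Omega>_def bump_def[abs_def] by (intro continuous_intros)
  have [measurable]: "\<Omega> n \<in> borel_measurable ?M" for n by (rule continuous_half_line_measurable[OF \<Omega>c])
  have \<Omega>0: "\<Omega> n u \<ge> 0" if "u \<ge> u\<^sub>0" for n u using that by (simp add: \<Omega>_def bump_def)
  define T where "T n u = (if norm (f u) \<le> real n * \<Omega> n u then f u else 0)" for n u
  have "(\<lambda>n. \<integral>u. (norm (f u - T n u))\<^sup>2 \<partial>?M) \<longlonglongrightarrow> (\<integral>u. 0 \<partial>?M)"
  proof (rule integral_dominated_convergence[where w="\<lambda>u. (norm (f u))\<^sup>2"])
    show "(\<lambda>u. (norm (f u - T n u))\<^sup>2) \<in> borel_measurable ?M" for n unfolding T_def by measurable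
    show "integrable ?M (\<lambda>u. (norm (f u))\<^sup>2)" by (rule L2D(2)[OF f])
    show "AE u in ?M. norm ((norm (f u - T n u))\<^sup>2) \<le> (norm (f u))\<^sup>2" for n by (rule AE_I2) (simp add: T_def)
    show "AE u in ?M. (\<lambda>n. (norm (f u - T n u))\<^sup>2) \<longlonglongrightarrow> 0"
    proof (rule AE_I2)
      fix u assume "u \<in> space ?M"
      then have u: "u > u\<^sub>0" by simp
      define c where "c = (u - u\<^sub>0) ^ 3"
      have c: "c > 0" using u by (simp add: c_def)
      obtain n0 :: nat where n0: "real n0 \<ge> (u - u\<^sub>0) + 1" using real_arch_simple by blast
      obtain n1 :: nat where n1: "norm (f u) / c \<le> real n1" using real_arch_simple by blast
      show "(\<lambda>n. (norm (f u - T n u))\<^sup>2) \<longlonglongrightarrow> 0"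
      proof (rule tendsto_eventually)
        show "\<forall>\<^sub>F n in sequentially. (norm (f u - T n u))\<^sup>2 = 0"
          using eventually_ge_at_top[of "max n0 n1"]
        proof eventually_elim
          fix n assume n: "n \<ge> max n0 n1"
          \<comment> \<open>At a fixed point the bump stays above \<open>(u - u\<^sub>0)\<^sup>3\<close> once the right end is far enough, so the bound \<open>n * bump\<close> eventually exceeds \<open>norm (f u)\<close>.\<close>
          have "b n - u \<ge> 1" using n n0 by (simp add: b_def)
          then have "1 ^ 3 \<le> (max 0 (b n - u)) ^ 3" by (intro power_mono) auto
          then have "1 * c \<le> (max 0 (b n - u)) ^ 3 * c" using c by (intro mult_right_mono) auto
          then have "c \<le> \<Omega> n u" by (simp add: \<Omega>_def bump_def c_def)
          moreover have "norm (f u) \<le> real n * c" using n1 n c by (simp add: divide_le_eq) (smt (verit) mult_right_mono of_nat_le_iff)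
          ultimately have "norm (f u) \<le> real n * \<Omega> n u" by (meson mult_left_mono of_nat_0_le_iff order_trans)
          then show "(norm (f u - T n u))\<^sup>2 = 0" by (simp add: T_def)
        qed
      qed
    qed
  qed simp
  then have "\<forall>\<^sub>F n in sequentially. (\<integral>u. (norm (f u - T n u))\<^sup>2 \<partial>?M) < \<epsilon>\<^sup>2 / 4"
    using \<epsilon> by (intro order_tendstoD) auto
  then obtain n where n: "(\<integral>u. (norm (f u - T n u))\<^sup>2 \<partial>?M) < \<epsilon>\<^sup>2 / 4" by (auto simp: eventually_sequentially)
  define h where "h u = (if \<Omega> n u > 0 \<and> norm (f u) \<le> real n * \<Omega> n u then f u / of_real (\<Omega> n u) else 0)" for u
  have hm [measurable]: "h \<in> borel_measurable ?M" unfolding h_def by measurable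
  have hb: "norm (h u) \<le> real n" for u
    by (auto simp: h_def norm_divide divide_le_eq)
  have Th: "T n u = of_real (\<Omega> n u) * h u" if "u \<ge> u\<^sub>0" for u
    using \<Omega>0[OF that, of n] by (auto simp: T_def h_def)
  have "bounded (\<Omega> n ` {u\<^sub>0..b n})" by (intro compact_imp_bounded compact_continuous_image \<Omega>c) auto
  then obtain S where S: "\<And>u. u \<in> {u\<^sub>0..b n} \<Longrightarrow> \<bar>\<Omega> n u\<bar> \<le> S" unfolding bounded_iff by (metis imageI real_norm_def)
  define \<delta> where "\<delta> = \<epsilon>\<^sup>2 / (4 * (S\<^sup>2 + 1))"
  have \<delta>: "\<delta> > 0" using \<epsilon> by (simp add: \<delta>_def add_nonneg_pos)
  have bn: "b n \<ge> u\<^sub>0" by (simp add: b_def)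
  obtain p where p: "polynomial_function p" "integrable ?M (\<lambda>v. if v \<le> b n then (norm (h v - p v))\<^sup>2 else 0)"
     "(\<integral>v. (if v \<le> b n then (norm (h v - p v))\<^sup>2 else 0) \<partial>?M) < \<delta>"
    using bounded_polynomial_approximation[OF hm hb \<delta> bn] by blast
  define F where "F u = of_real (\<Omega> n u) * p u" for u
  have FD: "F \<in> Domain (schrodinger_operator u\<^sub>0 \<alpha> (V_pot k))"
    unfolding F_def[abs_def] \<Omega>_def by (rule bump_polynomial_in_domain[OF p(1)])
  then have FL: "F \<in> L2 ?M" unfolding Domain_iff schrodinger_operator_iff by blast
  have d1: "integrable ?M (\<lambda>u. (norm (f u - F u))\<^sup>2)"
    using L2D(2)[OF L2_combine[OF f FL, of 1 "-1"]] by simp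
  have Ti: "integrable ?M (\<lambda>u. (norm (f u - T n u))\<^sup>2)"
  proof (rule Bochner_Integration.integrable_bound[OF L2D(2)[OF f]])
    show "(\<lambda>u. (norm (f u - T n u))\<^sup>2) \<in> borel_measurable ?M" unfolding T_def by measurable
    show "AE u in ?M. norm ((norm (f u - T n u))\<^sup>2) \<le> norm ((norm (f u))\<^sup>2)" by (rule AE_I2) (simp add: T_def)
  qed
  have pw: "(norm (f u - F u))\<^sup>2 \<le> 2 * (norm (f u - T n u))\<^sup>2 + 2 * (S\<^sup>2 * (if u \<le> b n then (norm (h u - p u))\<^sup>2 else 0))" if u: "u > u\<^sub>0" for u
  proof -
    have "norm (f u - F u) \<le> norm (f u - T n u) + norm (T n u - F u)"
      using norm_triangle_ineq[of "f u - T n u" "T n u - F u"] by simp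
    then have "(norm (f u - F u))\<^sup>2 \<le> (norm (f u - T n u) + norm (T n u - F u))\<^sup>2" by (rule power_mono) simp
    also have "\<dots> \<le> 2 * (norm (f u - T n u))\<^sup>2 + 2 * (norm (T n u - F u))\<^sup>2"
      using zero_le_power2[of "norm (f u - T n u) - norm (T n u - F u)"] by (simp add: power2_eq_square algebra_simps)
    also have "(norm (T n u - F u))\<^sup>2 \<le> S\<^sup>2 * (if u \<le> b n then (norm (h u - p u))\<^sup>2 else 0)"
    proof (cases "u \<le> b n")
      case True
      have "T n u - F u = of_real (\<Omega> n u) * (h u - p u)" using Th[of u] u by (simp add: F_def algebra_simps)
      then have "(norm (T n u - F u))\<^sup>2 = \<bar>\<Omega> n u\<bar>\<^sup>2 * (norm (h u - p u))\<^sup>2" by (simp add: norm_mult power_mult_distrib)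
      also have "\<dots> \<le> S\<^sup>2 * (norm (h u - p u))\<^sup>2" using S[of u] u True by (intro mult_right_mono power_mono) auto
      finally show ?thesis using True by simp
    next
      case False
      then have "\<Omega> n u = 0" by (simp add: \<Omega>_def bump_def)
      then show ?thesis using Th[of u] u by (simp add: F_def)
    qed
    finally show ?thesis by simp
  qed
  have "(\<integral>u. (norm (f u - F u))\<^sup>2 \<partial>?M)
      \<le> (\<integral>u. 2 * (norm (f u - T n u))\<^sup>2 + 2 * (S\<^sup>2 * (if u \<le> b n then (norm (h u - p u))\<^sup>2 else 0)) \<partial>?M)"
    by (rule integral_mono_AE[OF d1], intro Bochner_Integration.integrable_add integrable_mult_right Ti p, rule AE_I2) (use pw in auto)
  also have "\<dots> = 2 * (\<integral>u. (norm (f u - T n u))\<^sup>2 \<partial>?M) + 2 * (S\<^sup>2 * (\<integral>v. (if v \<le> b n then (norm (h v - p v))\<^sup>2 else 0) \<partial>?M))"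
    using Ti p(2) by (simp only: Bochner_Integration.integral_add integrable_mult_right integral_mult_right_zero)
  also have "\<dots> < \<epsilon>\<^sup>2"
  proof -
    have "S\<^sup>2 * (\<integral>v. (if v \<le> b n then (norm (h v - p v))\<^sup>2 else 0) \<partial>?M) \<le> S\<^sup>2 * \<delta>" using p(3) by (intro mult_left_mono) auto
    also have "\<dots> \<le> (S\<^sup>2 + 1) * \<delta>" using \<delta> by (simp add: distrib_right)
    also have "\<dots> = \<epsilon>\<^sup>2 / 4"
    proof -
      have "S\<^sup>2 + 1 \<noteq> 0" using zero_le_power2[of S] by linarith
      then show ?thesis unfolding \<delta>_def by (simp add: field_simps)
    qed
    finally show ?thesis using n by linarith
  qed
  finally have "sqrt (\<integral>u. (norm (f u - F u))\<^sup>2 \<partial>?M) < sqrt (\<epsilon>\<^sup>2)" by (rule real_sqrt_less_mono)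
  then have "L2_norm ?M (\<lambda>x. f x - F x) < \<epsilon>" using \<epsilon> by (simp add: L2_norm_def)
  then show "\<exists>g\<in>Domain (schrodinger_operator u\<^sub>0 \<alpha> (V_pot k)). L2_norm ?M (\<lambda>x. f x - g x) < \<epsilon>" using FD by blast
qed

section \<open>Boundary values of recessive solutions\<close>

lemma V_pot_lower_bound: "V_pot k u \<ge> - k\<^sup>2"
proof -
  have "V_pot k u = (exp u / 2 + k)\<^sup>2 - k\<^sup>2"
    using exp_double[of u] by (simp add: V_pot_def power2_eq_square field_simps)
  then show ?thesis using zero_le_power2[of "exp u / 2 + k"] by linarith
qed

lemma V_pot_pos: "k \<ge> 0 \<Longrightarrow> V_pot k u > 0"
  unfolding V_pot_def by (rule add_pos_nonneg) auto

text \<open>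
  The derivative of \<open>norm \<psi>\<^sup>2\<close> is nonpositive on the whole half-line by decay. If \<open>\<psi> a = 0\<close>, half of it
  vanishes at \<open>a\<close> and has the derivative \<open>norm (\<psi>' a)\<^sup>2 > 0\<close> there, so it is positive just after \<open>a\<close>.
\<close>

lemma recessive_dirichlet_nonzero:
  assumes \<psi>: "is_recessive k E \<psi> \<psi>'" and E: "\<And>u. u \<ge> a \<Longrightarrow> V_pot k u \<ge> Re E"
  shows "\<psi> a \<noteq> 0"
proof
  assume 0: "\<psi> a = 0"
  define D where "D u = \<psi> u \<bullet> \<psi>' u" for u
  have s: "sol_on S (potE k E) \<psi> \<psi>'" for S by (rule recessive_sol[OF \<psi>])
  have Dneg: "D u \<le> 0" if "u \<ge> a" for u
  proof -
    have "\<psi> u \<bullet> \<psi>' u + 0 * (norm (\<psi> u))\<^sup>2 \<le> 0"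
      by (rule square_integrable_solution_decays[OF s _ _ recessive_square_integrable[OF \<psi>]])
        (use E that in \<open>auto simp: potE_def\<close>)
    then show ?thesis by (simp add: D_def)
  qed
  have "(D has_real_derivative (\<psi> a \<bullet> (potE k E a * \<psi> a) + \<psi>' a \<bullet> \<psi>' a)) (at a)"
    unfolding D_def[abs_def] using sol_onD[OF s[of UNIV], of a] by (intro has_real_derivative_inner) auto
  then have d: "(D has_real_derivative \<psi>' a \<bullet> \<psi>' a) (at a)" using 0 by simp
  have "\<psi>' a \<noteq> 0" using recessive_nontrivial[OF \<psi>, of a] 0 by simp
  then have "\<psi>' a \<bullet> \<psi>' a > 0" by simp
  from DERIV_pos_inc_right[OF d this] obtain e where e: "e > 0" "\<And>h. h > 0 \<Longrightarrow> h < e \<Longrightarrow> D a < D (a + h)" by blast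
  have "D a < D (a + e / 2)" using e by simp
  then show False using Dneg[of "a + e / 2"] e(1) 0 by (simp add: D_def)
qed

text \<open>
  The boundary condition fixes the logarithmic derivative \<open>- cos \<alpha> / sin \<alpha>\<close> at \<open>u\<^sub>0\<close>, while for this \<open>E\<close>
  the recessive solution has one with real part at most \<open>- (\<bar>cos \<alpha> / sin \<alpha>\<bar> + 1)\<close>.
\<close>

lemma recessive_boundary_nonzero:
  assumes \<psi>: "is_recessive k E \<psi> \<psi>'" and E: "Re E \<le> - k\<^sup>2 - (\<bar>cos \<alpha> / sin \<alpha>\<bar> + 1)\<^sup>2"
  shows "boundary_form u\<^sub>0 \<alpha> \<psi> \<psi>' \<noteq> 0"
proof
  assume b: "boundary_form u\<^sub>0 \<alpha> \<psi> \<psi>' = 0"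
  define c where "c = cos \<alpha> / sin \<alpha>"
  define a where "a = \<bar>c\<bar> + 1"
  have Re: "Re (potE k E u) \<ge> a\<^sup>2" for u
    using E V_pot_lower_bound[of k u] by (simp add: potE_def a_def c_def)
  have V: "V_pot k u \<ge> Re E" for u
    using E V_pot_lower_bound[of k u] zero_le_power2[of "\<bar>cos \<alpha> / sin \<alpha>\<bar> + 1"] by linarith
  have \<psi>n: "\<psi> u\<^sub>0 \<noteq> 0" by (rule recessive_dirichlet_nonzero[OF \<psi> V])
  show False
  \<comment> \<open>In the Dirichlet case the quotient is \<open>0\<close> by convention, and \<open>a = 1\<close>.\<close>
  proof (cases "sin \<alpha> = 0")
    case True
    then have "cos \<alpha> \<noteq> 0" using sin_zero_abs_cos_one by fastforce
    then show False using b True \<psi>n by (simp add: boundary_form_def)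
  next
    case False
    have "of_real (sin \<alpha>) * \<psi>' u\<^sub>0 = - (of_real (cos \<alpha>) * \<psi> u\<^sub>0)"
      using b by (simp add: boundary_form_def eq_neg_iff_add_eq_0 add.commute)
    then have "\<psi>' u\<^sub>0 = - (of_real c * \<psi> u\<^sub>0)" using False by (simp add: c_def field_simps)
    then have e: "\<psi>' u\<^sub>0 = (- c) *\<^sub>R \<psi> u\<^sub>0" by (simp add: scaleR_conv_of_real)
    have "\<psi> u\<^sub>0 \<bullet> \<psi>' u\<^sub>0 + a * (norm (\<psi> u\<^sub>0))\<^sup>2 \<le> 0"
      by (rule square_integrable_solution_decays[OF recessive_sol[OF \<psi>] _ Re recessive_square_integrable[OF \<psi>]]) (simp add: a_def)
    then have "(a - c) * (norm (\<psi> u\<^sub>0))\<^sup>2 \<le> 0"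
      unfolding e by (simp add: power2_norm_eq_inner algebra_simps)
    moreover have "a - c > 0" unfolding a_def by linarith
    moreover have "(norm (\<psi> u\<^sub>0))\<^sup>2 > 0" using \<psi>n by simp
    ultimately show False by (meson mult_pos_pos not_less)
  qed
qed

text \<open>
  The complex conjugate of a recessive solution for a real energy is recessive, hence the same.
\<close>

lemma recessive_real:
  assumes \<psi>: "is_recessive k E \<psi> \<psi>'" and E: "E \<in> \<real>"
  shows "cnj (\<psi> u) = \<psi> u" "cnj (\<psi>' u) = \<psi>' u"
proof -
  have q: "cnj (potE k E u) = potE k E u" for u
    using E by (auto simp: potE_def Reals_cnj_iff)
  have s: "sol_on UNIV (potE k E) (\<lambda>u. cnj (\<psi> u)) (\<lambda>u. cnj (\<psi>' u))"
    using sol_on_cnj[OF recessive_sol[OF \<psi>, of UNIV]] by (simp add: q)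
  obtain C U where C: "\<And>u. u \<ge> U \<Longrightarrow> norm (\<psi> u / of_real (weight k u) - 1) \<le> C * exp (- u)"
    using \<psi> unfolding is_recessive_def by blast
  have "cnj (\<psi> u) / of_real (weight k u) - 1 = cnj (\<psi> u / of_real (weight k u) - 1)" for u by simp
  then have "norm (cnj (\<psi> u) / of_real (weight k u) - 1) = norm (\<psi> u / of_real (weight k u) - 1)" for u
    by (metis complex_mod_cnj)
  then have r: "is_recessive k E (\<lambda>u. cnj (\<psi> u)) (\<lambda>u. cnj (\<psi>' u))"
    unfolding is_recessive_def using s C by auto
  have eq: "(\<lambda>u. cnj (\<psi> u)) = \<psi>" by (rule recessive_unique[OF \<psi> r])
  then show "cnj (\<psi> u) = \<psi> u" by (rule fun_cong)
  have "((\<lambda>u. cnj (\<psi> u)) has_vector_derivative cnj (\<psi>' u)) (at u)" using sol_onD(1)[OF s, of u] by simp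
  moreover have "(\<psi> has_vector_derivative \<psi>' u) (at u)" using sol_onD(1)[OF recessive_sol[OF \<psi>, of UNIV], of u] by simp
  ultimately show "cnj (\<psi>' u) = \<psi>' u" unfolding eq by (rule vector_derivative_unique_at)
qed

section \<open>Self-adjointness\<close>

lemma sigma_finite_half_line: "sigma_finite_measure (half_line u\<^sub>0)"
proof
  show "\<exists>A. countable A \<and> A \<subseteq> sets (half_line u\<^sub>0) \<and> \<Union>A = space (half_line u\<^sub>0) \<and> (\<forall>a\<in>A. emeasure (half_line u\<^sub>0) a \<noteq> \<infinity>)"
  proof (intro exI[of _ "range (\<lambda>n::nat. {u\<^sub>0<..u\<^sub>0 + real n})"] conjI ballI)
    show "countable (range (\<lambda>n::nat. {u\<^sub>0<..u\<^sub>0 + real n}))" by (intro countable_image) auto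
    show "range (\<lambda>n::nat. {u\<^sub>0<..u\<^sub>0 + real n}) \<subseteq> sets (half_line u\<^sub>0)"
      by (auto simp: sets_restrict_space_iff)
    show "\<Union>(range (\<lambda>n::nat. {u\<^sub>0<..u\<^sub>0 + real n})) = space (half_line u\<^sub>0)"
    proof (intro set_eqI iffI)
      fix x assume "x \<in> space (half_line u\<^sub>0)"
      moreover obtain n :: nat where "x - u\<^sub>0 \<le> real n" using real_arch_simple by blast
      ultimately show "x \<in> \<Union>(range (\<lambda>n::nat. {u\<^sub>0<..u\<^sub>0 + real n}))" by (intro UN_I[of n]) auto
    qed auto
    fix a assume "a \<in> range (\<lambda>n::nat. {u\<^sub>0<..u\<^sub>0 + real n})"
    then obtain n :: nat where a: "a = {u\<^sub>0<..u\<^sub>0 + real n}" by auto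
    then show "emeasure (half_line u\<^sub>0) a \<noteq> \<infinity>" by (subst emeasure_restrict_space) auto
  qed
qed

context green_function
begin

lemma kern_real:
  assumes E: "E \<in> \<real>"
  shows "cnj (kern u v) = kern u v"
proof -
  have q: "cnj (potE k E u) = potE k E u" for u
    using E by (auto simp: potE_def Reals_cnj_iff)
  have s: "sol_on UNIV (potE k E) (\<lambda>u. cnj (\<phi> u)) (\<lambda>u. cnj (\<phi>' u))"
    using sol_on_cnj[OF \<phi>s] by (simp add: q)
  have "(\<lambda>u. cnj (\<phi> u)) = \<phi>"
    by (rule sol_on_unique_UNIV(1)[OF s \<phi>s potE_continuous, where a="u\<^sub>0"]) (simp_all add: \<phi>0)
  then have "cnj (\<phi> u) = \<phi> u" for u by (rule fun_cong)
  then show ?thesis using recessive_real[OF rec E] by (simp add: kern_def w_def boundary_form_def)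
qed

text \<open>
  The kernel is real and symmetric, so this is Fubini's theorem; the kernel bound supplies the
  integrability on the product.
\<close>

lemma sol_symmetric:
  assumes E: "E \<in> \<real>" and h: "h \<in> L2 M" and g: "g \<in> L2 M"
  shows "L2_inner M (sol h) g = L2_inner M h (sol g)"
proof -
  obtain K where K: "K > 0" "\<And>u. u \<ge> u\<^sub>0 \<Longrightarrow> (\<integral>v. (norm (kern u v))\<^sup>2 \<partial>M) \<le> K * exp (- u)" using kern_bound by blast
  interpret sigma_finite_measure M by (rule sigma_finite_half_line)
  interpret pair_sigma_finite M M ..
  have hm: "h \<in> borel_measurable M" by (rule L2D(1)[OF h])
  have \<phi>m: "\<phi> \<in> borel_measurable M" by (rule continuous_half_line_measurable[OF \<phi>_continuous(1)])
  have \<psi>m: "\<psi> \<in> borel_measurable M" by (rule continuous_half_line_measurable[OF \<psi>_continuous(1)])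
  have cg: "(\<lambda>u. cnj (g u)) \<in> borel_measurable M" by (rule L2D(1)[OF L2_cnj[OF g]])
  define f where "f u v = kern u v * h v * cnj (g u)" for u v
  have fm [measurable]: "case_prod f \<in> borel_measurable (M \<Otimes>\<^sub>M M)"
  proof -
    note S = measurable_compose[OF measurable_snd] and F = measurable_compose[OF measurable_fst]
    note i = id_half_line_measurable
    have "{z \<in> space (M \<Otimes>\<^sub>M M). snd z \<le> fst z} \<in> sets (M \<Otimes>\<^sub>M M)"
      by (rule borel_measurable_le[OF S[OF i] F[OF i]])
    then have "(\<lambda>z. if snd z \<le> fst z then \<psi> (fst z) * \<phi> (snd z) else \<phi> (fst z) * \<psi> (snd z)) \<in> borel_measurable (M \<Otimes>\<^sub>M M)"
      by (intro measurable_If borel_measurable_times S[OF \<phi>m] F[OF \<phi>m] S[OF \<psi>m] F[OF \<psi>m])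
    then have "(\<lambda>z. (if snd z \<le> fst z then \<psi> (fst z) * \<phi> (snd z) else \<phi> (fst z) * \<psi> (snd z)) * (1 / w) * h (snd z) * cnj (g (fst z)))
        \<in> borel_measurable (M \<Otimes>\<^sub>M M)"
      by (intro borel_measurable_times S[OF hm] F[OF cg] borel_measurable_const)
    then show ?thesis by (simp add: f_def kern_def case_prod_beta')
  qed
  have inner: "integrable M (\<lambda>v. f u v)" for u
    unfolding f_def using L2_inner_integrable(2)[OF kern_L2 h] by simp
  define n where "n = sqrt (\<integral>v. (norm (h v))\<^sup>2 \<partial>M)"
  have n2: "n\<^sup>2 = (\<integral>v. (norm (h v))\<^sup>2 \<partial>M)" "n \<ge> 0"
    unfolding n_def by (auto intro!: integral_nonneg_AE)
  have bound: "(\<integral>v. norm (f u v) \<partial>M) \<le> norm (of_real (sqrt K * n * exp (- u / 2)) :: complex) * norm (g u)" if u: "u \<ge> u\<^sub>0" for u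
  proof -
    have 1: "(\<integral>v. norm (f u v) \<partial>M) = (\<integral>v. norm (kern u v) * norm (h v) \<partial>M) * norm (g u)"
      by (simp add: f_def norm_mult)
    have 2: "(\<integral>v. norm (kern u v) * norm (h v) \<partial>M) \<le> sqrt K * n * exp (- u / 2)"
    proof (rule power2_le_imp_le)
      have "(\<integral>v. norm (kern u v) * norm (h v) \<partial>M)\<^sup>2 \<le> (\<integral>v. (norm (kern u v))\<^sup>2 \<partial>M) * (\<integral>v. (norm (h v))\<^sup>2 \<partial>M)"
        by (rule L2_Cauchy_Schwarz[OF kern_L2 h])
      also have "\<dots> \<le> (K * exp (- u)) * n\<^sup>2" unfolding n2 using K(2)[OF u] by (rule mult_right_mono) (auto intro!: integral_nonneg_AE)
      also have "\<dots> = (sqrt K * n * exp (- u / 2))\<^sup>2"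
        using K(1) by (simp add: power_mult_distrib exp_double[symmetric])
      finally show "(\<integral>v. norm (kern u v) * norm (h v) \<partial>M)\<^sup>2 \<le> (sqrt K * n * exp (- u / 2))\<^sup>2" .
      show "0 \<le> sqrt K * n * exp (- u / 2)" using K(1) n2(2) by simp
    qed
    have 3: "norm (of_real (sqrt K * n * exp (- u / 2)) :: complex) = sqrt K * n * exp (- u / 2)"
      using K(1) n2(2) by (simp only: norm_of_real) simp
    show ?thesis unfolding 1 3 by (rule mult_right_mono[OF 2]) simp
  qed
  have eL: "(\<lambda>u. complex_of_real (sqrt K * n * exp (- u / 2))) \<in> L2 M"
  proof (rule continuous_half_line_L2)
    show "continuous_on {u\<^sub>0..} (\<lambda>u. complex_of_real (sqrt K * n * exp (- u / 2)))" by (intro continuous_intros) auto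
    then show "(\<lambda>u. (norm (complex_of_real (sqrt K * n * exp (- u / 2))))\<^sup>2) integrable_on {u\<^sub>0..}"
    proof (rule integrable_norm_squared_bounded)
      fix u :: real
      show "(norm (complex_of_real (sqrt K * n * exp (- u / 2))))\<^sup>2 \<le> (K * n\<^sup>2) * exp (- u)"
        unfolding norm_of_real using K(1) by (simp add: power_mult_distrib exp_double[symmetric])
    qed
  qed
  have outer: "integrable M (\<lambda>u. \<integral>v. norm (f u v) \<partial>M)"
  proof (rule Bochner_Integration.integrable_bound[OF L2_norm_product_integrable[OF eL g]])
    show "(\<lambda>u. \<integral>v. norm (f u v) \<partial>M) \<in> borel_measurable M" by measurable
    show "AE u in M. norm (\<integral>v. norm (f u v) \<partial>M) \<le> norm (norm (complex_of_real (sqrt K * n * exp (- u / 2))) * norm (g u))"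
    proof (rule AE_I2)
      fix u assume "u \<in> space M"
      then have u: "u \<ge> u\<^sub>0" by simp
      have "0 \<le> (\<integral>v. norm (f u v) \<partial>M)" by (rule integral_nonneg_AE) simp
      then show "norm (\<integral>v. norm (f u v) \<partial>M) \<le> norm (norm (complex_of_real (sqrt K * n * exp (- u / 2))) * norm (g u))"
        using bound[OF u] by simp
    qed
  qed
  have fi: "integrable (M \<Otimes>\<^sub>M M) (case_prod f)"
    by (rule Fubini_integrable[OF fm]) (use outer inner in auto)
  have "L2_inner M (sol h) g = (\<integral>u. (\<integral>v. f u v \<partial>M) \<partial>M)"
    unfolding L2_inner_def sol_kernel[OF h] f_def by simp
  also have "\<dots> = (\<integral>v. (\<integral>u. f u v \<partial>M) \<partial>M)" by (rule Fubini_integral[OF fi, symmetric])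
  also have "\<dots> = (\<integral>v. h v * cnj (sol g v) \<partial>M)"
  proof (rule Bochner_Integration.integral_cong[OF refl])
    fix v
    have "(\<integral>u. f u v \<partial>M) = (\<integral>u. h v * cnj (kern v u * g u) \<partial>M)"
      by (rule Bochner_Integration.integral_cong[OF refl]) (simp add: f_def kern_real[OF E] kern_symmetric[of _ v])
    also have "\<dots> = h v * (\<integral>u. cnj (kern v u * g u) \<partial>M)" by (rule integral_mult_right_zero)
    also have "(\<integral>u. cnj (kern v u * g u) \<partial>M) = cnj (sol g v)"
      unfolding sol_kernel[OF g] by (rule Bochner_Integration.integral_cnj)
    finally show "(\<integral>u. f u v \<partial>M) = h v * cnj (sol g v)" .
  qed
  finally show ?thesis unfolding L2_inner_def .
qed

lemma operator_iff_sol: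
  assumes f: "f \<in> L2 M" and g: "g \<in> L2 M"
  shows "(f, g) \<in> schrodinger_operator u\<^sub>0 \<alpha> (V_pot k) \<longleftrightarrow> (AE u in M. f u = sol (\<lambda>u. 1 * g u + (- E) * f u) u)"
proof
  assume ae: "AE u in M. f u = sol (\<lambda>u. 1 * g u + (- E) * f u) u"
  define h where "h = (\<lambda>u. 1 * g u + (- E) * f u)"
  have h: "h \<in> L2 M" unfolding h_def by (rule L2_combine[OF g f])
  obtain F F' F'' where F: "C1_representative u\<^sub>0 F F' F''" "boundary_form u\<^sub>0 \<alpha> F F' = 0"
     "AE u in M. sol h u = F u" "AE u in M. 1 * h u + E * sol h u = - F'' u + of_real (V_pot k u) * F u"
    using sol_in_operator[OF h] unfolding schrodinger_operator_iff by blast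
  have "AE u in M. f u = F u" using ae F(3) unfolding h_def[symmetric] by eventually_elim simp
  moreover have "AE u in M. g u = - F'' u + of_real (V_pot k u) * F u"
    using ae F(4) unfolding h_def[symmetric]
  proof eventually_elim
    case (elim u)
    have "g u = 1 * h u + E * f u" by (simp add: h_def)
    then show ?case using elim by simp
  qed
  ultimately show "(f, g) \<in> schrodinger_operator u\<^sub>0 \<alpha> (V_pot k)"
    unfolding schrodinger_operator_iff using f g F(1,2) by blast
qed (rule operator_eq_sol)

text \<open>
  The inverse of \<open>H - E\<close> is the symmetric operator \<open>sol\<close>, defined on all of \<open>L2\<close>. Symmetry of \<open>H\<close> is
  inherited. If \<open>(g, g2)\<close> is in the adjoint, then \<open>g - sol (g2 - E * g)\<close> is orthogonal to every
  \<open>a = (H - E) (sol a)\<close>, hence zero, and \<open>g\<close> is in the domain.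
\<close>

theorem operator_self_adjoint:
  assumes E: "E \<in> \<real>"
  shows "self_adjoint M (schrodinger_operator u\<^sub>0 \<alpha> (V_pot k))"
proof -
  let ?H = "schrodinger_operator u\<^sub>0 \<alpha> (V_pot k)"
  have cE: "cnj E = E" using E by (simp add: Reals_cnj_iff)
  have HL: "f \<in> L2 M \<and> g \<in> L2 M" if "(f, g) \<in> ?H" for f g using that unfolding schrodinger_operator_iff by blast
  have "?H \<subseteq> adjoint_graph M ?H"
  proof (rule subrelI)
    fix g g2 assume G: "(g, g2) \<in> ?H"
    note gL = HL[OF G, THEN conjunct1] HL[OF G, THEN conjunct2]
    define b where "b = (\<lambda>u. 1 * g2 u + (- E) * g u)"
    have b: "b \<in> L2 M" unfolding b_def by (rule L2_combine[OF gL(2,1)])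
    have gb: "AE u in M. g u = sol b u" unfolding b_def by (rule operator_eq_sol[OF G])
    have "L2_inner M f2 g = L2_inner M f g2" if F: "(f, f2) \<in> ?H" for f f2
    proof -
      note fL = HL[OF F, THEN conjunct1] HL[OF F, THEN conjunct2]
      define a where "a = (\<lambda>u. 1 * f2 u + (- E) * f u)"
      have a: "a \<in> L2 M" unfolding a_def by (rule L2_combine[OF fL(2,1)])
      have fa: "AE u in M. f u = sol a u" unfolding a_def by (rule operator_eq_sol[OF F])
      have "L2_inner M a g = L2_inner M a (sol b)"
        by (rule L2_inner_cong_AE[OF _ gb]) (use a gL sol_L2[OF b] in auto)
      also have "\<dots> = L2_inner M (sol a) b" by (rule sol_symmetric[OF E a b, symmetric])
      also have "\<dots> = L2_inner M f b"
        by (rule L2_inner_cong_AE) (use fa fL a b sol_L2[OF a] in \<open>auto elim: eventually_mono\<close>)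
      finally have "1 * L2_inner M f2 g + (- E) * L2_inner M f g = cnj 1 * L2_inner M f g2 + cnj (- E) * L2_inner M f g"
        unfolding a_def b_def L2_inner_combine_left[OF fL(2,1) gL(1)] L2_inner_combine_right[OF gL(2,1) fL(1)] .
      then show ?thesis by (simp add: cE)
    qed
    then show "(g, g2) \<in> adjoint_graph M ?H" unfolding adjoint_graph_def using gL by auto
  qed
  moreover have "adjoint_graph M ?H \<subseteq> ?H"
  proof (rule subrelI)
    fix g g2 assume "(g, g2) \<in> adjoint_graph M ?H"
    then have gL: "g \<in> L2 M" "g2 \<in> L2 M" and adj: "\<And>f f2. (f, f2) \<in> ?H \<Longrightarrow> L2_inner M f2 g = L2_inner M f g2"
      unfolding adjoint_graph_def by auto
    define b where "b = (\<lambda>u. 1 * g2 u + (- E) * g u)"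
    have b: "b \<in> L2 M" unfolding b_def by (rule L2_combine[OF gL(2,1)])
    have all: "L2_inner M a g = L2_inner M a (sol b)" if a: "a \<in> L2 M" for a
    proof -
      have sa: "sol a \<in> L2 M" by (rule sol_L2[OF a])
      have "L2_inner M (\<lambda>u. 1 * a u + E * sol a u) g = L2_inner M (sol a) g2" by (rule adj[OF sol_in_operator[OF a]])
      then have "L2_inner M a g = cnj 1 * L2_inner M (sol a) g2 + cnj (- E) * L2_inner M (sol a) g"
        unfolding L2_inner_combine_left[OF a sa gL(1)] by (simp add: cE algebra_simps)
      also have "\<dots> = L2_inner M (sol a) b" unfolding b_def L2_inner_combine_right[OF gL(2,1) sa] ..
      also have "\<dots> = L2_inner M a (sol b)" by (rule sol_symmetric[OF E a b])
      finally show ?thesis .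
    qed
    define d where "d = (\<lambda>u. 1 * g u + (- 1) * sol b u)"
    have d: "d \<in> L2 M" unfolding d_def by (rule L2_combine[OF gL(1) sol_L2[OF b]])
    have "L2_inner M d d = cnj 1 * L2_inner M d g + cnj (- 1) * L2_inner M d (sol b)"
      using L2_inner_combine_right[OF gL(1) sol_L2[OF b] d, of 1 "- 1"] unfolding d_def[symmetric] .
    then have "L2_inner M d d = 0" using all[OF d] by simp
    then have "(\<integral>x. (norm (d x))\<^sup>2 \<partial>M) = 0" unfolding L2_inner_self by simp
    then have "AE x in M. d x = 0" using L2_norm_zero_AE[OF d] by simp
    then have "AE x in M. g x = sol b x" unfolding d_def by eventually_elim simp
    then show "(g, g2) \<in> ?H" using operator_iff_sol[OF gL] unfolding b_def by simp
  qed
  ultimately show ?thesis unfolding self_adjoint_def using operator_densely_defined by blast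
qed

end

section \<open>The spectrum\<close>

lemma green_function_exists:
  assumes "is_recessive k E \<psi> \<psi>'" "boundary_form u\<^sub>0 \<alpha> \<psi> \<psi>' \<noteq> 0"
  shows "\<exists>\<phi> \<phi>'. green_function k u\<^sub>0 \<alpha> E \<psi> \<psi>' \<phi> \<phi>'"
proof -
  obtain \<phi> \<phi>' where "sol_on UNIV (potE k E) \<phi> \<phi>'" "\<phi> u\<^sub>0 = of_real (sin \<alpha>)" "\<phi>' u\<^sub>0 = - of_real (cos \<alpha>)"
    using linear_ode_exists[OF potE_continuous] by blast
  then have "green_function k u\<^sub>0 \<alpha> E \<psi> \<psi>' \<phi> \<phi>'" using assms by unfold_locales auto
  then show ?thesis by blast
qed

lemma eigenspace_multiple_of_recessive:
  assumes f: "f \<in> eigenspace (schrodinger_operator u\<^sub>0 \<alpha> (V_pot k)) E" and \<psi>: "is_recessive k E \<psi> \<psi>'"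
  shows "\<exists>c. (AE u in half_line u\<^sub>0. f u = c * \<psi> u) \<and> c * boundary_form u\<^sub>0 \<alpha> \<psi> \<psi>' = 0"
proof -
  obtain F F' F'' where F: "C1_representative u\<^sub>0 F F' F''" "boundary_form u\<^sub>0 \<alpha> F F' = 0"
     "AE u in half_line u\<^sub>0. f u = F u" "AE u in half_line u\<^sub>0. fscale E f u = - F'' u + of_real (V_pot k u) * F u"
     and L: "f \<in> L2 (half_line u\<^sub>0)"
    using f unfolding eigenspace_def mem_Collect_eq schrodinger_operator_iff by blast
  have eq: "AE u in half_line u\<^sub>0. F'' u = potE k E u * F u"
    using F(3,4) by eventually_elim (simp add: fscale_def potE_def algebra_simps)
  have "F \<in> L2 (half_line u\<^sub>0)" by (rule L2_cong_continuous[OF C1_representative_continuous(1)[OF F(1)] L F(3)])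
  from weak_solution_multiple_of_recessive[OF F(1) eq this \<psi>]
  obtain c where c: "\<And>u. u \<ge> u\<^sub>0 \<Longrightarrow> F u = c * \<psi> u \<and> F' u = c * \<psi>' u" by blast
  have "AE u in half_line u\<^sub>0. F u = c * \<psi> u" by (rule AE_I2) (use c in simp)
  then have "AE u in half_line u\<^sub>0. f u = c * \<psi> u" using F(3) by eventually_elim simp
  moreover have "c * boundary_form u\<^sub>0 \<alpha> \<psi> \<psi>' = boundary_form u\<^sub>0 \<alpha> F F'"
    using c[of u\<^sub>0] by (simp add: boundary_form_def algebra_simps)
  ultimately show ?thesis using F(2) by auto
qed

lemma square_integrable_solution_in_eigenspace:
  assumes s: "sol_on UNIV (potE k E) y y'" and L: "y \<in> L2 (half_line u\<^sub>0)" and b: "boundary_form u\<^sub>0 \<alpha> y y' = 0"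
  shows "y \<in> eigenspace (schrodinger_operator u\<^sub>0 \<alpha> (V_pot k)) E"
  unfolding eigenspace_def mem_Collect_eq schrodinger_operator_iff
proof (intro conjI exI)
  show "C1_representative u\<^sub>0 y y' (\<lambda>u. potE k E u * y u)" by (rule sol_on_C1_representative[OF s])
  show "fscale E y \<in> L2 (half_line u\<^sub>0)" unfolding fscale_def by (rule L2_scale[OF L])
  show "AE u in half_line u\<^sub>0. fscale E y u = - (potE k E u * y u) + of_real (V_pot k u) * y u"
    by (simp add: fscale_def potE_def algebra_simps)
qed (simp_all add: L b)

lemma recessive_not_AE_zero:
  assumes "is_recessive k E \<psi> \<psi>'"
  shows "\<not> (AE u in half_line u\<^sub>0. \<psi> u = 0)"
proof
  assume "AE u in half_line u\<^sub>0. \<psi> u = 0"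
  then have "\<psi> u = 0" if "u \<ge> u\<^sub>0" for u
    by (rule AE_half_line_continuous_zero[OF sol_on_continuous(1)[OF recessive_sol[OF assms]] _ that])
  moreover obtain U where "U \<ge> u\<^sub>0" "norm (\<psi> U) \<ge> weight k U / 2" using recessive_bounds(2)[OF assms] by blast
  ultimately show False using weight_pos(1)[of k U] by simp
qed

text \<open>
  The only candidate for an eigenfunction is the recessive solution.
\<close>

lemma eigenvalue_iff_boundary:
  assumes \<psi>: "is_recessive k E \<psi> \<psi>'"
  shows "E \<in> eigenvalues (half_line u\<^sub>0) (schrodinger_operator u\<^sub>0 \<alpha> (V_pot k)) \<longleftrightarrow> boundary_form u\<^sub>0 \<alpha> \<psi> \<psi>' = 0"
proof
  assume "E \<in> eigenvalues (half_line u\<^sub>0) (schrodinger_operator u\<^sub>0 \<alpha> (V_pot k))"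
  then obtain f where f: "f \<in> eigenspace (schrodinger_operator u\<^sub>0 \<alpha> (V_pot k)) E" "\<not> (AE u in half_line u\<^sub>0. f u = 0)"
    unfolding eigenvalues_def by blast
  obtain c where c: "AE u in half_line u\<^sub>0. f u = c * \<psi> u" "c * boundary_form u\<^sub>0 \<alpha> \<psi> \<psi>' = 0"
    using eigenspace_multiple_of_recessive[OF f(1) \<psi>] by blast
  have "c \<noteq> 0" using c(1) f(2) by auto
  then show "boundary_form u\<^sub>0 \<alpha> \<psi> \<psi>' = 0" using c(2) by simp
next
  assume "boundary_form u\<^sub>0 \<alpha> \<psi> \<psi>' = 0"
  from square_integrable_solution_in_eigenspace[OF recessive_sol[OF \<psi>] recessive_L2[OF \<psi>] this]
  show "E \<in> eigenvalues (half_line u\<^sub>0) (schrodinger_operator u\<^sub>0 \<alpha> (V_pot k))"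
    unfolding eigenvalues_def using recessive_not_AE_zero[OF \<psi>] by blast
qed

text \<open>
  Either the recessive solution satisfies the boundary condition and is an eigenfunction, or the Green
  function inverts \<open>H - E\<close>.
\<close>

theorem spectrum_eq_eigenvalues:
  "op_spectrum (half_line u\<^sub>0) (schrodinger_operator u\<^sub>0 \<alpha> (V_pot k))
     = eigenvalues (half_line u\<^sub>0) (schrodinger_operator u\<^sub>0 \<alpha> (V_pot k))"
proof (intro set_eqI)
  fix E
  let ?H = "schrodinger_operator u\<^sub>0 \<alpha> (V_pot k)" and ?M = "half_line u\<^sub>0"
  obtain \<psi> \<psi>' where \<psi>: "is_recessive k E \<psi> \<psi>'" using recessive_exists by blast
  have "E \<in> resolvent_set ?M ?H \<longleftrightarrow> boundary_form u\<^sub>0 \<alpha> \<psi> \<psi>' \<noteq> 0"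
  proof
    assume "boundary_form u\<^sub>0 \<alpha> \<psi> \<psi>' \<noteq> 0"
    then obtain \<phi> \<phi>' where "green_function k u\<^sub>0 \<alpha> E \<psi> \<psi>' \<phi> \<phi>'" using green_function_exists[OF \<psi>] by blast
    then show "E \<in> resolvent_set ?M ?H" by (rule green_function.in_resolvent_set)
  next
    assume r: "E \<in> resolvent_set ?M ?H"
    show "boundary_form u\<^sub>0 \<alpha> \<psi> \<psi>' \<noteq> 0"
    proof
      assume "boundary_form u\<^sub>0 \<alpha> \<psi> \<psi>' = 0"
      from square_integrable_solution_in_eigenspace[OF recessive_sol[OF \<psi>] recessive_L2[OF \<psi>] this]
      have e: "(\<psi>, fscale E \<psi>) \<in> ?H" unfolding eigenspace_def by simp
      obtain C where C: "\<And>f Af. (f, Af) \<in> ?H \<Longrightarrow> L2_norm ?M f \<le> C * L2_norm ?M (\<lambda>x. Af x - E * f x)"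
        using r unfolding resolvent_set_def by blast
      have "L2_norm ?M \<psi> \<le> C * L2_norm ?M (\<lambda>x. fscale E \<psi> x - E * \<psi> x)" by (rule C[OF e])
      then have "L2_norm ?M \<psi> \<le> 0" by (simp add: fscale_def L2_norm_def)
      moreover have "(\<integral>x. (norm (\<psi> x))\<^sup>2 \<partial>?M) \<ge> 0" by (rule integral_nonneg_AE) simp
      ultimately have "(\<integral>x. (norm (\<psi> x))\<^sup>2 \<partial>?M) = 0" by (simp add: L2_norm_def)
      then show False using L2_norm_zero_AE[OF recessive_L2[OF \<psi>]] recessive_not_AE_zero[OF \<psi>] by blast
    qed
  qed
  then show "E \<in> op_spectrum ?M ?H \<longleftrightarrow> E \<in> eigenvalues ?M ?H"
    unfolding op_spectrum_def eigenvalue_iff_boundary[OF \<psi>] by simp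
qed

theorem spectrum_simple:
  "simple_spectrum (half_line u\<^sub>0) (schrodinger_operator u\<^sub>0 \<alpha> (V_pot k))"
  unfolding simple_spectrum_def
proof
  fix E assume E: "E \<in> eigenvalues (half_line u\<^sub>0) (schrodinger_operator u\<^sub>0 \<alpha> (V_pot k))"
  obtain \<psi> \<psi>' where \<psi>: "is_recessive k E \<psi> \<psi>'" using recessive_exists by blast
  have b: "boundary_form u\<^sub>0 \<alpha> \<psi> \<psi>' = 0" using E unfolding eigenvalue_iff_boundary[OF \<psi>] .
  show "simple_eigenvalue (half_line u\<^sub>0) (schrodinger_operator u\<^sub>0 \<alpha> (V_pot k)) E"
    unfolding simple_eigenvalue_def
  proof (intro bexI[of _ \<psi>] conjI ballI recessive_not_AE_zero[OF \<psi>])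
    show "\<psi> \<in> eigenspace (schrodinger_operator u\<^sub>0 \<alpha> (V_pot k)) E"
      by (rule square_integrable_solution_in_eigenspace[OF recessive_sol[OF \<psi>] recessive_L2[OF \<psi>] b])
    fix f assume "f \<in> eigenspace (schrodinger_operator u\<^sub>0 \<alpha> (V_pot k)) E"
    then show "\<exists>c. AE u in half_line u\<^sub>0. f u = c * \<psi> u" using eigenspace_multiple_of_recessive[OF _ \<psi>] by blast
  qed
qed

lemma simple_imp_finite_multiplicity:
  assumes "simple_eigenvalue M A \<zeta>"
  shows "finite_multiplicity M A \<zeta>"
proof -
  obtain b where b: "\<And>f. f \<in> eigenspace A \<zeta> \<Longrightarrow> \<exists>c. AE x in M. f x = c * b x"
    using assms unfolding simple_eigenvalue_def by blast
  show ?thesis unfolding finite_multiplicity_def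
  proof (intro exI[of _ "{b}"] conjI ballI)
    fix f assume "f \<in> eigenspace A \<zeta>"
    then obtain c where c: "AE x in M. f x = c * b x" using b by blast
    have "fscale c b \<in> cfun.span {b}" by (intro cfun.span_scale cfun.span_base) simp
    then show "\<exists>g\<in>cfun.span {b}. AE x in M. f x = g x" using c by (intro bexI[of _ "fscale c b"]) (auto simp: fscale_def)
  qed simp
qed

text \<open>
  Self-adjointness and discreteness need one real energy at which the Green function exists.
\<close>

lemma real_regular_point:
  obtains E \<psi> \<psi>' \<phi> \<phi>' where "E \<in> \<real>" "green_function k u\<^sub>0 \<alpha> E \<psi> \<psi>' \<phi> \<phi>'"
proof -
  define E where "E = complex_of_real (- k\<^sup>2 - (\<bar>cos \<alpha> / sin \<alpha>\<bar> + 1)\<^sup>2)"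
  obtain \<psi> \<psi>' where \<psi>: "is_recessive k E \<psi> \<psi>'" using recessive_exists by blast
  have "Re E \<le> - k\<^sup>2 - (\<bar>cos \<alpha> / sin \<alpha>\<bar> + 1)\<^sup>2" unfolding E_def Re_complex_of_real by simp
  from recessive_boundary_nonzero[OF \<psi> this] obtain \<phi> \<phi>' where "green_function k u\<^sub>0 \<alpha> E \<psi> \<psi>' \<phi> \<phi>'"
    using green_function_exists[OF \<psi>] by blast
  moreover have "E \<in> \<real>" by (simp add: E_def)
  ultimately show ?thesis using that by blast
qed

theorem schrodinger_operator_self_adjoint:
  "self_adjoint (half_line u\<^sub>0) (schrodinger_operator u\<^sub>0 \<alpha> (V_pot k))"
proof -
  obtain E \<psi> \<psi>' \<phi> \<phi>' where "E \<in> \<real>" "green_function k u\<^sub>0 \<alpha> E \<psi> \<psi>' \<phi> \<phi>'" by (rule real_regular_point)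
  then show ?thesis using green_function.operator_self_adjoint by blast
qed

lemma self_adjoint_symmetric:
  assumes "self_adjoint M A" "(f, Af) \<in> A" "(g, Ag) \<in> A"
  shows "L2_inner M Af g = L2_inner M f Ag"
  using assms unfolding self_adjoint_def adjoint_graph_def by blast

lemma L2_inner_fscale:
  assumes "f \<in> L2 M" "g \<in> L2 M"
  shows "L2_inner M (fscale c f) g = c * L2_inner M f g" "L2_inner M f (fscale c g) = cnj c * L2_inner M f g"
  using L2_inner_combine_left[OF assms(1,1,2), of c 0] L2_inner_combine_right[OF assms(2,2,1), of c 0]
  by (simp_all add: fscale_def)

theorem eigenvalue_real:
  assumes E: "E \<in> eigenvalues (half_line u\<^sub>0) (schrodinger_operator u\<^sub>0 \<alpha> (V_pot k))"
  shows "E \<in> \<real>"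
proof -
  let ?H = "schrodinger_operator u\<^sub>0 \<alpha> (V_pot k)" and ?M = "half_line u\<^sub>0"
  obtain f where f: "(f, fscale E f) \<in> ?H" "\<not> (AE u in ?M. f u = 0)" using E unfolding eigenvalues_def eigenspace_def by blast
  have L: "f \<in> L2 ?M" using f(1) unfolding schrodinger_operator_iff by blast
  have "L2_inner ?M f f \<noteq> 0" using f(2) L2_norm_zero_AE[OF L] unfolding L2_inner_self by simp
  moreover have "E * L2_inner ?M f f = cnj E * L2_inner ?M f f"
    using self_adjoint_symmetric[OF schrodinger_operator_self_adjoint f(1) f(1)] unfolding L2_inner_fscale[OF L L] .
  ultimately show ?thesis by (simp add: Reals_cnj_iff)
qed

lemma eigenfunctions_orthogonal:
  assumes f: "f \<in> eigenspace (schrodinger_operator u\<^sub>0 \<alpha> (V_pot k)) E"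
    and g: "g \<in> eigenspace (schrodinger_operator u\<^sub>0 \<alpha> (V_pot k)) E'" and E': "E' \<in> \<real>" and ne: "E \<noteq> E'"
  shows "L2_inner (half_line u\<^sub>0) f g = 0"
proof -
  let ?M = "half_line u\<^sub>0"
  have L: "f \<in> L2 ?M" "g \<in> L2 ?M" using f g unfolding eigenspace_def mem_Collect_eq schrodinger_operator_iff by blast+
  have "E * L2_inner ?M f g = cnj E' * L2_inner ?M f g"
    using self_adjoint_symmetric[OF schrodinger_operator_self_adjoint, of f "fscale E f" u\<^sub>0 \<alpha> k g "fscale E' g"] f g
    unfolding L2_inner_fscale[OF L] by (simp add: eigenspace_def)
  then show ?thesis using ne E' by (simp add: Reals_cnj_iff)
qed

text \<open>
  For an eigenfunction \<open>e\<close> to the eigenvalue \<open>E\<close>, the value \<open>e u\<close> is \<open>E - E\<^sub>0\<close> times the integral of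
  \<open>kern u v * e v\<close>, which is the conjugate of the inner product of the real function \<open>kern u\<close> with \<open>e\<close>.
  By Bessel's inequality, orthonormal eigenfunctions with eigenvalues
  in the ball satisfy \<open>(\<Sum>e. (norm (e u))\<^sup>2) \<le> R\<^sup>2 * K * exp (- u)\<close>, and integrating over \<open>u\<close>
  bounds their number.
\<close>

theorem finitely_many_eigenvalues_in_ball:
  assumes "green_function k u\<^sub>0 \<alpha> E\<^sub>0 \<psi> \<psi>' \<phi> \<phi>'" and E0: "E\<^sub>0 \<in> \<real>"
  shows "finite {E \<in> eigenvalues (half_line u\<^sub>0) (schrodinger_operator u\<^sub>0 \<alpha> (V_pot k)). norm (E - E\<^sub>0) \<le> R}"
proof -
  interpret green_function k u\<^sub>0 \<alpha> E\<^sub>0 \<psi> \<psi>' \<phi> \<phi>' by fact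
  let ?H = "schrodinger_operator u\<^sub>0 \<alpha> (V_pot k)"
  let ?S = "{E \<in> eigenvalues M ?H. norm (E - E\<^sub>0) \<le> R}"
  obtain K where K: "K > 0" "\<And>u. u \<ge> u\<^sub>0 \<Longrightarrow> (\<integral>v. (norm (kern u v))\<^sup>2 \<partial>M) \<le> K * exp (- u)" using kern_bound by blast
  have ei: "integrable M (\<lambda>u. exp (- u))"
    using integrable_on_exp_minus_to_infinity[of 1 u\<^sub>0] by (subst half_line_integrable_iff) auto
  have "\<exists>e. e \<in> eigenspace ?H E \<and> L2_inner M e e = 1" if "E \<in> eigenvalues M ?H" for E
  proof -
    obtain f where f: "f \<in> eigenspace ?H E" "\<not> (AE u in M. f u = 0)" using \<open>E \<in> eigenvalues M ?H\<close> unfolding eigenvalues_def by blast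
    obtain \<eta> \<eta>' where \<eta>: "is_recessive k E \<eta> \<eta>'" using recessive_exists by blast
    have b: "boundary_form u\<^sub>0 \<alpha> \<eta> \<eta>' = 0" using that unfolding eigenvalue_iff_boundary[OF \<eta>] .
    define n where "n = sqrt (\<integral>x. (norm (\<eta> x))\<^sup>2 \<partial>M)"
    have L: "\<eta> \<in> L2 M" by (rule recessive_L2[OF \<eta>])
    have i0: "(\<integral>x. (norm (\<eta> x))\<^sup>2 \<partial>M) \<noteq> 0" using L2_norm_zero_AE[OF L] recessive_not_AE_zero[OF \<eta>] by blast
    have i1: "(\<integral>x. (norm (\<eta> x))\<^sup>2 \<partial>M) \<ge> 0" by (rule integral_nonneg_AE) simp
    have n: "n \<noteq> 0" "n * n = (\<integral>x. (norm (\<eta> x))\<^sup>2 \<partial>M)" using i0 i1 by (auto simp: n_def)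
    define e where "e u = of_real (1 / n) * \<eta> u + 0 * \<eta> u" for u
    define e' where "e' u = of_real (1 / n) * \<eta>' u + 0 * \<eta>' u" for u
    have s: "sol_on UNIV (potE k E) e e'" unfolding e_def[abs_def] e'_def[abs_def]
      by (rule sol_on_combine[OF recessive_sol[OF \<eta>] recessive_sol[OF \<eta>]])
    have eL: "e \<in> L2 M" unfolding e_def[abs_def] by (rule L2_combine[OF L L])
    have "boundary_form u\<^sub>0 \<alpha> e e' = of_real (1 / n) * boundary_form u\<^sub>0 \<alpha> \<eta> \<eta>'"
      by (simp add: boundary_form_def e_def e'_def algebra_simps)
    then have "e \<in> eigenspace ?H E" using square_integrable_solution_in_eigenspace[OF s eL] b by simp
    moreover have "L2_inner M e e = 1"
    proof -
      have "(norm (e x))\<^sup>2 = (1 / (n * n)) * (norm (\<eta> x))\<^sup>2" for x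
        by (simp add: e_def norm_mult norm_divide power_mult_distrib power_divide power2_eq_square)
      then have "(\<integral>x. (norm (e x))\<^sup>2 \<partial>M) = (1 / (n * n)) * (n * n)" unfolding n(2) by simp
      then show ?thesis unfolding L2_inner_self using n(1) by simp
    qed
    ultimately show ?thesis by blast
  qed
  then obtain e where e: "\<And>E. E \<in> eigenvalues M ?H \<Longrightarrow> e E \<in> eigenspace ?H E" "\<And>E. E \<in> eigenvalues M ?H \<Longrightarrow> L2_inner M (e E) (e E) = 1"
    by metis
  have eL: "e E \<in> L2 M" if "E \<in> eigenvalues M ?H" for E
    using e(1)[OF that] unfolding eigenspace_def mem_Collect_eq schrodinger_operator_iff by blast
  define B where "B = R\<^sup>2 * K * (\<integral>u. exp (- u) \<partial>M)"
  have "finite ?S \<and> card ?S \<le> nat \<lceil>B\<rceil>"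
  proof (rule finite_if_finite_subsets_card_bdd)
    fix F assume F: "F \<subseteq> ?S" and fin: "finite F"
    have FE: "E \<in> eigenvalues M ?H" "norm (E - E\<^sub>0) \<le> R" if "E \<in> F" for E using F that by auto
    have "AE u in M. \<forall>E\<in>F. e E u = sol (\<lambda>v. 1 * fscale E (e E) v + (- E\<^sub>0) * e E v) u"
      using fin
    proof (rule AE_finite_allI)
      fix E assume "E \<in> F"
      then have "(e E, fscale E (e E)) \<in> ?H" using e(1)[OF FE(1)] unfolding eigenspace_def by simp
      then show "AE u in M. e E u = sol (\<lambda>v. 1 * fscale E (e E) v + (- E\<^sub>0) * e E v) u" by (rule operator_eq_sol)
    qed
    then have ae: "AE u in M. (\<Sum>E\<in>F. (norm (e E u))\<^sup>2) \<le> R\<^sup>2 * K * exp (- u)"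
    proof (rule AE_mp, intro AE_I2 impI)
      fix u assume u: "u \<in> space M" and eq: "\<forall>E\<in>F. e E u = sol (\<lambda>v. 1 * fscale E (e E) v + (- E\<^sub>0) * e E v) u"
      have one: "(norm (e E u))\<^sup>2 \<le> R\<^sup>2 * (norm (L2_inner M (kern u) (e E)))\<^sup>2" if "E \<in> F" for E
      proof -
        have f: "(\<lambda>v. 1 * fscale E (e E) v + (- E\<^sub>0) * e E v) = (\<lambda>v. (E - E\<^sub>0) * e E v)"
          by (simp add: fscale_def fun_eq_iff algebra_simps)
        have "e E u = sol (\<lambda>v. 1 * fscale E (e E) v + (- E\<^sub>0) * e E v) u" by (rule bspec[OF eq that])
        also have "\<dots> = sol (\<lambda>v. (E - E\<^sub>0) * e E v) u" by (simp only: f)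
        also have "\<dots> = (\<integral>v. kern u v * ((E - E\<^sub>0) * e E v) \<partial>M)" by (rule sol_kernel[OF L2_scale[OF eL[OF FE(1)[OF that]]]])
        also have "\<dots> = (\<integral>v. (E - E\<^sub>0) * cnj (kern u v * cnj (e E v)) \<partial>M)"
          by (rule Bochner_Integration.integral_cong[OF refl]) (simp add: kern_real[OF E0])
        also have "\<dots> = (E - E\<^sub>0) * (\<integral>v. cnj (kern u v * cnj (e E v)) \<partial>M)" by (rule integral_mult_right_zero)
        also have "(\<integral>v. cnj (kern u v * cnj (e E v)) \<partial>M) = cnj (L2_inner M (kern u) (e E))"
          unfolding L2_inner_def by (rule Bochner_Integration.integral_cnj)
        finally have "norm (e E u) = norm (E - E\<^sub>0) * norm (L2_inner M (kern u) (e E))"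
          by (simp only: norm_mult complex_mod_cnj)
        also have "\<dots> \<le> R * norm (L2_inner M (kern u) (e E))" using FE(2)[OF that] by (rule mult_right_mono) simp
        finally have "(norm (e E u))\<^sup>2 \<le> (R * norm (L2_inner M (kern u) (e E)))\<^sup>2" by (rule power_mono) simp
        then show ?thesis by (simp add: power_mult_distrib)
      qed
      have "(\<Sum>E\<in>F. (norm (e E u))\<^sup>2) \<le> (\<Sum>E\<in>F. R\<^sup>2 * (norm (L2_inner M (kern u) (e E)))\<^sup>2)" by (rule sum_mono[OF one])
      also have "\<dots> = R\<^sup>2 * (\<Sum>E\<in>F. (norm (L2_inner M (kern u) (e E)))\<^sup>2)" by (simp add: sum_distrib_left)
      also have "\<dots> \<le> R\<^sup>2 * (\<integral>v. (norm (kern u v))\<^sup>2 \<partial>M)"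
      proof (rule mult_left_mono)
        show "(\<Sum>E\<in>F. (norm (L2_inner M (kern u) (e E)))\<^sup>2) \<le> (\<integral>v. (norm (kern u v))\<^sup>2 \<partial>M)"
        proof (rule L2_bessel[OF fin kern_L2])
          fix i j assume "i \<in> F" "j \<in> F" "i \<noteq> j"
          then show "L2_inner M (e i) (e j) = 0"
            using eigenfunctions_orthogonal[OF e(1)[OF FE(1)] e(1)[OF FE(1)] eigenvalue_real[OF FE(1)]] by blast
        qed (use eL e(2) FE(1) in auto)
      qed simp
      also have "\<dots> \<le> R\<^sup>2 * (K * exp (- u))" using K(2)[of u] u by (intro mult_left_mono) auto
      finally show "(\<Sum>E\<in>F. (norm (e E u))\<^sup>2) \<le> R\<^sup>2 * K * exp (- u)" by simp
    qed
    have "real (card F) = (\<Sum>E\<in>F. (\<integral>u. (norm (e E u))\<^sup>2 \<partial>M))"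
    proof -
      have "(\<integral>u. (norm (e E u))\<^sup>2 \<partial>M) = 1" if "E \<in> F" for E
        using e(2)[OF FE(1)[OF that]] unfolding L2_inner_self by (simp only: of_real_eq_1_iff)
      then show ?thesis by simp
    qed
    also have "\<dots> = (\<integral>u. (\<Sum>E\<in>F. (norm (e E u))\<^sup>2) \<partial>M)"
      by (rule Bochner_Integration.integral_sum[symmetric]) (rule L2D(2)[OF eL[OF FE(1)]])
    also have "\<dots> \<le> (\<integral>u. R\<^sup>2 * K * exp (- u) \<partial>M)"
    proof (rule integral_mono_AE[OF _ _ ae])
      show "integrable M (\<lambda>u. \<Sum>E\<in>F. (norm (e E u))\<^sup>2)"
        by (rule Bochner_Integration.integrable_sum) (rule L2D(2)[OF eL[OF FE(1)]])
      show "integrable M (\<lambda>u. R\<^sup>2 * K * exp (- u))" by (rule integrable_mult_right[OF ei])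
    qed
    also have "\<dots> = B" unfolding B_def by (rule integral_mult_right_zero)
    finally show "card F \<le> nat \<lceil>B\<rceil>" by linarith
  qed
  then show ?thesis by blast
qed

text \<open>
  Only finitely many eigenvalues lie within distance \<open>1\<close> of \<open>\<zeta>\<close>, as they lie in a ball around the
  regular point.
\<close>

theorem spectrum_pure_discrete:
  "pure_discrete_spectrum (half_line u\<^sub>0) (schrodinger_operator u\<^sub>0 \<alpha> (V_pot k))"
  unfolding pure_discrete_spectrum_def spectrum_eq_eigenvalues
proof (intro ballI conjI)
  let ?S = "eigenvalues (half_line u\<^sub>0) (schrodinger_operator u\<^sub>0 \<alpha> (V_pot k))"
  fix \<zeta> assume \<zeta>: "\<zeta> \<in> ?S"
  then show "finite_multiplicity (half_line u\<^sub>0) (schrodinger_operator u\<^sub>0 \<alpha> (V_pot k)) \<zeta>"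
    using spectrum_simple simple_imp_finite_multiplicity unfolding simple_spectrum_def by blast
  obtain E \<psi> \<psi>' \<phi> \<phi>' where E: "E \<in> \<real>" "green_function k u\<^sub>0 \<alpha> E \<psi> \<psi>' \<phi> \<phi>'" by (rule real_regular_point)
  define F where "F = {E' \<in> ?S. norm (E' - E) \<le> norm (\<zeta> - E) + 1}"
  have fin: "finite F" unfolding F_def by (rule finitely_many_eigenvalues_in_ball[OF E(2,1)])
  show "\<zeta> isolated_in ?S"
    unfolding isolated_in_def
  proof (intro conjI \<zeta> exI[of _ "ball \<zeta> 1 - (F - {\<zeta>})"])
    show "open (ball \<zeta> 1 - (F - {\<zeta>}))" using fin by (intro open_Diff finite_imp_closed) auto
    show "(ball \<zeta> 1 - (F - {\<zeta>})) \<inter> ?S = {\<zeta>}"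
    proof (intro set_eqI iffI)
      fix E' assume l: "E' \<in> (ball \<zeta> 1 - (F - {\<zeta>})) \<inter> ?S"
      have "norm (E' - E) \<le> norm (E' - \<zeta>) + norm (\<zeta> - E)" using norm_triangle_ineq[of "E' - \<zeta>" "\<zeta> - E"] by simp
      also have "norm (E' - \<zeta>) \<le> 1" using l by (auto simp: dist_norm norm_minus_commute)
      finally have "E' \<in> F" using l by (simp add: F_def)
      then show "E' \<in> {\<zeta>}" using l by auto
    qed (use \<zeta> in auto)
  qed
qed

lemma eigenvalues_bounded_below:
  assumes "E \<in> eigenvalues (half_line u\<^sub>0) (schrodinger_operator u\<^sub>0 \<alpha> (V_pot k))"
  shows "- k\<^sup>2 - (\<bar>cos \<alpha> / sin \<alpha>\<bar> + 1)\<^sup>2 \<le> Re E"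
proof (rule ccontr)
  assume "\<not> ?thesis"
  then have le: "Re E \<le> - k\<^sup>2 - (\<bar>cos \<alpha> / sin \<alpha>\<bar> + 1)\<^sup>2" by simp
  obtain \<psi> \<psi>' where \<psi>: "is_recessive k E \<psi> \<psi>'" using recessive_exists by blast
  show False using recessive_boundary_nonzero[OF \<psi> le] assms unfolding eigenvalue_iff_boundary[OF \<psi>] by simp
qed

section \<open>The Dirichlet ground state\<close>

text \<open>
  The real solution that satisfies the Dirichlet condition, normalized by its slope, with its derivative.
\<close>

definition dirichlet_pair :: "real \<Rightarrow> real \<Rightarrow> real \<Rightarrow> (real \<Rightarrow> real) \<Rightarrow> (real \<Rightarrow> real) \<Rightarrow> bool" where
  "dirichlet_pair k u\<^sub>0 E y y' \<longleftrightarrow> (\<forall>u. (y has_real_derivative y' u) (at u) \<and>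
     (y' has_real_derivative (V_pot k u - E) * y u) (at u)) \<and> y u\<^sub>0 = 0 \<and> y' u\<^sub>0 = 1"

lemma dirichlet_pairD:
  assumes "dirichlet_pair k u\<^sub>0 E y y'"
  shows "(y has_real_derivative y' u) (at u within S)" "(y' has_real_derivative (V_pot k u - E) * y u) (at u within S)"
    "y u\<^sub>0 = 0" "y' u\<^sub>0 = 1"
  using assms unfolding dirichlet_pair_def by (auto intro: has_field_derivative_at_within)

lemma dirichlet_pair_continuous:
  assumes "dirichlet_pair k u\<^sub>0 E y y'"
  shows "continuous_on S y" "continuous_on S y'"
  using dirichlet_pairD(1,2)[OF assms, where S=UNIV]
  by (auto intro!: continuous_at_imp_continuous_on DERIV_isCont)

lemma dirichlet_pair_complex:
  assumes "dirichlet_pair k u\<^sub>0 E y y'"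
  shows "sol_on UNIV (potE k (of_real E)) (\<lambda>u. of_real (y u)) (\<lambda>u. of_real (y' u))"
  unfolding sol_on_def
proof (intro ballI conjI)
  fix u
  show "((\<lambda>u. complex_of_real (y u)) has_vector_derivative of_real (y' u)) (at u)"
    by (rule has_vector_derivative_of_real[OF dirichlet_pairD(1)[OF assms]])
  show "((\<lambda>u. complex_of_real (y' u)) has_vector_derivative potE k (of_real E) u * of_real (y u)) (at u)"
    using has_vector_derivative_of_real[OF dirichlet_pairD(2)[OF assms, of u UNIV], where 'a=complex] by (simp add: potE_def)
qed

lemma dirichlet_pair_exists: "\<exists>y y'. dirichlet_pair k u\<^sub>0 E y y'"
proof -
  obtain \<phi> \<phi>' where \<phi>: "sol_on UNIV (potE k (of_real E)) \<phi> \<phi>'" "\<phi> u\<^sub>0 = 0" "\<phi>' u\<^sub>0 = 1"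
    using linear_ode_exists[OF potE_continuous] by blast
  have d: "(\<phi> has_vector_derivative \<phi>' u) (at u)" "(\<phi>' has_vector_derivative potE k (of_real E) u * \<phi> u) (at u)" for u
    using sol_onD[OF \<phi>(1), of u] by auto
  have "dirichlet_pair k u\<^sub>0 E (\<lambda>u. Re (\<phi> u)) (\<lambda>u. Re (\<phi>' u))"
    unfolding dirichlet_pair_def has_real_derivative_iff_has_vector_derivative
    using bounded_linear.has_vector_derivative[OF bounded_linear_Re d(1)] bounded_linear.has_vector_derivative[OF bounded_linear_Re d(2)] \<phi>(2,3)
    by (simp add: potE_def)
  then show ?thesis by blast
qed

text \<open>
  The difference of the solutions for two energies satisfies an inhomogeneous equation with right-hand
  side \<open>(E - E1) * y\<close> and zero initial data.
\<close>

lemma dirichlet_pair_stable: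
  assumes y: "dirichlet_pair k u\<^sub>0 E y y'" and b: "b \<ge> u\<^sub>0" and e: "e > 0"
  shows "\<exists>\<delta>>0. \<forall>E1 z z'. dirichlet_pair k u\<^sub>0 E1 z z' \<and> \<bar>E1 - E\<bar> < \<delta> \<longrightarrow>
     (\<forall>u\<in>{u\<^sub>0..b}. \<bar>z u - y u\<bar> < e \<and> \<bar>z' u - y' u\<bar> < e)"
proof -
  have "continuous_on {u\<^sub>0..b} (V_pot k)" unfolding V_pot_def[abs_def] by (intro continuous_intros)
  then obtain Q0 where Q0: "Q0 > 0" "\<forall>u\<in>{u\<^sub>0..b}. \<bar>V_pot k u\<bar> \<le> Q0" using continuous_bounded_Icc by blast
  obtain Y where Y: "Y > 0" "\<forall>u\<in>{u\<^sub>0..b}. \<bar>y u\<bar> \<le> Y" using continuous_bounded_Icc[OF dirichlet_pair_continuous(1)[OF y]] by blast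
  define Q where "Q = Q0 + \<bar>E\<bar> + 1"
  define A where "A = exp ((2 + Q) * (b - u\<^sub>0)) * (Y\<^sup>2 * (b - u\<^sub>0)) + 1"
  have A: "A > 0" using b by (simp add: A_def add_nonneg_pos)
  define \<delta> where "\<delta> = min 1 (e / (sqrt A + 1))"
  have sA: "sqrt A + 1 > 0" using A by (simp add: add_nonneg_pos)
  have \<delta>: "\<delta> > 0" using e sA by (simp add: \<delta>_def)
  show ?thesis
  proof (intro exI[of _ \<delta>] conjI \<delta> allI impI ballI)
    fix E1 z z' u assume asm: "dirichlet_pair k u\<^sub>0 E1 z z' \<and> \<bar>E1 - E\<bar> < \<delta>" and u: "u \<in> {u\<^sub>0..b}"
    then have z: "dirichlet_pair k u\<^sub>0 E1 z z'" and close: "\<bar>E1 - E\<bar> < \<delta>" by auto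
    define d where "d v = complex_of_real (z v - y v)" for v
    define d' where "d' v = complex_of_real (z' v - y' v)" for v
    have "(norm (d u))\<^sup>2 + (norm (d' u))\<^sup>2
       \<le> exp ((2 + Q) * (u - u\<^sub>0)) * ((norm (d u\<^sub>0))\<^sup>2 + (norm (d' u\<^sub>0))\<^sup>2 + (\<bar>E1 - E\<bar> * Y)\<^sup>2 * (u - u\<^sub>0))"
    proof (rule energy_estimate[where q="\<lambda>v. of_real (V_pot k v - E1)" and r="\<lambda>v. of_real ((E - E1) * y v)"])
      show "u\<^sub>0 \<le> u" using u by simp
      fix v assume "v \<in> {u\<^sub>0..u}"
      then have v: "v \<in> {u\<^sub>0..b}" using u by simp
      show "(d has_vector_derivative d' v) (at v within {u\<^sub>0..u})"
        unfolding d_def[abs_def] d'_def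
        by (intro has_vector_derivative_of_real DERIV_diff dirichlet_pairD(1)[OF z] dirichlet_pairD(1)[OF y])
      have "((\<lambda>v. z' v - y' v) has_real_derivative (V_pot k v - E1) * z v - (V_pot k v - E) * y v) (at v within {u\<^sub>0..u})"
        by (intro DERIV_diff dirichlet_pairD(2)[OF z] dirichlet_pairD(2)[OF y])
      moreover have "(V_pot k v - E1) * z v - (V_pot k v - E) * y v = (V_pot k v - E1) * (z v - y v) + (E - E1) * y v"
        by (simp add: algebra_simps)
      ultimately have "((\<lambda>v. z' v - y' v) has_real_derivative (V_pot k v - E1) * (z v - y v) + (E - E1) * y v) (at v within {u\<^sub>0..u})" by simp
      from has_vector_derivative_of_real[OF this, where 'a=complex]
      show "(d' has_vector_derivative of_real (V_pot k v - E1) * d v + of_real ((E - E1) * y v)) (at v within {u\<^sub>0..u})"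
        unfolding d'_def[abs_def] d_def by simp
      have "\<bar>V_pot k v - E1\<bar> \<le> Q"
      proof -
        have "\<bar>V_pot k v\<bar> \<le> Q0" using Q0(2) v by blast
        moreover have "\<bar>E1 - E\<bar> \<le> 1" using close by (simp add: \<delta>_def)
        ultimately show ?thesis unfolding Q_def by linarith
      qed
      then show "norm (complex_of_real (V_pot k v - E1)) \<le> Q" by (simp only: norm_of_real)
      have "\<bar>E - E1\<bar> * \<bar>y v\<bar> \<le> \<bar>E1 - E\<bar> * Y" using Y(2) v by (intro mult_mono) auto
      then show "norm (complex_of_real ((E - E1) * y v)) \<le> \<bar>E1 - E\<bar> * Y" by (simp only: norm_of_real abs_mult)
    qed
    also have "\<dots> = exp ((2 + Q) * (u - u\<^sub>0)) * ((\<bar>E1 - E\<bar> * Y)\<^sup>2 * (u - u\<^sub>0))"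
      by (simp add: d_def d'_def dirichlet_pairD(3,4)[OF z] dirichlet_pairD(3,4)[OF y])
    also have "\<dots> \<le> exp ((2 + Q) * (b - u\<^sub>0)) * ((\<bar>E1 - E\<bar> * Y)\<^sup>2 * (b - u\<^sub>0))"
      using u Q0(1) by (intro mult_mono iffD2[OF exp_le_cancel_iff] mult_left_mono) (auto simp: Q_def)
    also have "\<dots> = \<bar>E1 - E\<bar>\<^sup>2 * (A - 1)" by (simp add: A_def power_mult_distrib)
    also have "\<dots> \<le> \<bar>E1 - E\<bar>\<^sup>2 * A" by (rule mult_left_mono) auto
    also have "\<dots> = (\<bar>E1 - E\<bar> * sqrt A)\<^sup>2" using A by (simp add: power_mult_distrib)
    finally have le: "(norm (d u))\<^sup>2 + (norm (d' u))\<^sup>2 \<le> (\<bar>E1 - E\<bar> * sqrt A)\<^sup>2" .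
    have "\<bar>E1 - E\<bar> * sqrt A \<le> \<delta> * sqrt A" using close A by (intro mult_right_mono) auto
    also have "\<dots> \<le> e / (sqrt A + 1) * sqrt A" using A by (intro mult_right_mono) (auto simp: \<delta>_def)
    also have "\<dots> < e"
    proof -
      have "e * sqrt A < e * (sqrt A + 1)" using e by simp
      then show ?thesis using sA by (simp add: divide_less_eq)
    qed
    finally have small: "\<bar>E1 - E\<bar> * sqrt A < e" .
    have nn: "0 \<le> \<bar>E1 - E\<bar> * sqrt A" using A by simp
    have "norm (d u) \<le> \<bar>E1 - E\<bar> * sqrt A"
      by (rule power2_le_imp_le[OF _ nn]) (use le zero_le_power2[of "norm (d' u)"] in linarith)
    then show "\<bar>z u - y u\<bar> < e" using small unfolding d_def norm_of_real by linarith
    have "norm (d' u) \<le> \<bar>E1 - E\<bar> * sqrt A"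
      by (rule power2_le_imp_le[OF _ nn]) (use le zero_le_power2[of "norm (d u)"] in linarith)
    then show "\<bar>z' u - y' u\<bar> < e" using small unfolding d'_def norm_of_real by linarith
  qed
qed

definition has_node :: "real \<Rightarrow> real \<Rightarrow> real \<Rightarrow> bool" where
  "has_node k u\<^sub>0 E \<longleftrightarrow> (\<exists>y y' u. dirichlet_pair k u\<^sub>0 E y y' \<and> u > u\<^sub>0 \<and> y u = 0)"

lemma continuous_sign_change:
  fixes y :: "real \<Rightarrow> real"
  assumes c: "continuous_on {a..b} y" and ab: "a \<le> b" and s: "y a * y b < 0"
  shows "\<exists>u\<in>{a..b}. y u = 0"
proof (cases "y a < 0")
  case True
  then have "y b > 0" using s by (simp add: mult_less_0_iff)
  then show ?thesis using IVT'[of y a 0 b] c ab True by force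
next
  case False
  then have "y a > 0" "y b < 0" using s by (auto simp: mult_less_0_iff)
  then show ?thesis using IVT2'[of y b 0 a] c ab by force
qed

lemma nodeless_positive:
  assumes y: "dirichlet_pair k u\<^sub>0 E y y'" and n: "\<not> has_node k u\<^sub>0 E" and u: "u > u\<^sub>0"
  shows "y u > 0"
proof (rule ccontr)
  assume "\<not> y u > 0"
  moreover have nz: "y v \<noteq> 0" if "v > u\<^sub>0" for v using n y that unfolding has_node_def by blast
  ultimately have neg: "y u < 0" using u by (meson linorder_neqE_linordered_idom)
  have "(y has_real_derivative 1) (at u\<^sub>0)" using dirichlet_pairD(1)[OF y, of u\<^sub>0 UNIV] dirichlet_pairD(4)[OF y] by simp
  from DERIV_pos_inc_right[OF this] obtain d where d: "d > 0" "\<And>h. h > 0 \<Longrightarrow> h < d \<Longrightarrow> y u\<^sub>0 < y (u\<^sub>0 + h)" by auto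
  define a where "a = u\<^sub>0 + min d (u - u\<^sub>0) / 2"
  have h: "0 < min d (u - u\<^sub>0) / 2" "min d (u - u\<^sub>0) / 2 < d" "min d (u - u\<^sub>0) / 2 \<le> u - u\<^sub>0" using d(1) u by auto
  have a: "u\<^sub>0 < a" "a \<le> u" "y a > 0" using h d(2)[OF h(1,2)] dirichlet_pairD(3)[OF y] by (auto simp: a_def)
  have "y a * y u < 0" using a(3) neg by (simp add: mult_pos_neg)
  from continuous_sign_change[OF dirichlet_pair_continuous(1)[OF y] a(2) this] obtain v where "v \<in> {a..u}" "y v = 0" by blast
  then show False using nz[of v] a(1) by auto
qed

text \<open>
  A zero of a nontrivial solution is simple, so the sign changes there, and a sign change persists for
  nearby energies.
\<close>

lemma node_open:
  assumes "has_node k u\<^sub>0 E"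
  shows "\<exists>\<delta>>0. \<forall>E1. \<bar>E1 - E\<bar> < \<delta> \<longrightarrow> has_node k u\<^sub>0 E1"
proof -
  obtain y y' u where y: "dirichlet_pair k u\<^sub>0 E y y'" and u: "u > u\<^sub>0" "y u = 0" using assms unfolding has_node_def by blast
  have y'n: "y' u \<noteq> 0"
  proof
    assume 0: "y' u = 0"
    have z: "sol_on UNIV (potE k (of_real E)) (\<lambda>_. 0) (\<lambda>_. 0)" by (simp add: sol_on_def has_vector_derivative_const)
    have "(\<lambda>u. complex_of_real (y' u)) = (\<lambda>_. 0)"
      by (rule sol_on_unique_UNIV(2)[OF dirichlet_pair_complex[OF y] z potE_continuous, where a=u]) (simp_all add: u 0)
    then have "complex_of_real (y' u\<^sub>0) = 0" by (rule fun_cong)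
    then show False using dirichlet_pairD(4)[OF y] by simp
  qed
  obtain d where d: "d > 0" "\<And>h. 0 < h \<Longrightarrow> h < d \<Longrightarrow> y (u - h) * y (u + h) < 0"
  proof (cases "y' u > 0")
    case True
    obtain d1 where d1: "d1 > 0" "\<And>h. h > 0 \<Longrightarrow> h < d1 \<Longrightarrow> y u < y (u + h)"
      using DERIV_pos_inc_right[OF dirichlet_pairD(1)[OF y, of u UNIV] True] by auto
    obtain d2 where d2: "d2 > 0" "\<And>h. h > 0 \<Longrightarrow> h < d2 \<Longrightarrow> y (u - h) < y u"
      using DERIV_pos_inc_left[OF dirichlet_pairD(1)[OF y, of u UNIV] True] by auto
    show ?thesis by (rule that[of "min d1 d2"]) (use d1 d2 u in \<open>auto simp: mult_neg_pos\<close>)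
  next
    case False
    then have neg: "y' u < 0" using y'n by simp
    obtain d1 where d1: "d1 > 0" "\<And>h. h > 0 \<Longrightarrow> h < d1 \<Longrightarrow> y u > y (u + h)"
      using DERIV_neg_dec_right[OF dirichlet_pairD(1)[OF y, of u UNIV] neg] by auto
    obtain d2 where d2: "d2 > 0" "\<And>h. h > 0 \<Longrightarrow> h < d2 \<Longrightarrow> y (u - h) > y u"
      using DERIV_neg_dec_left[OF dirichlet_pairD(1)[OF y, of u UNIV] neg] by auto
    show ?thesis by (rule that[of "min d1 d2"]) (use d1 d2 u in \<open>auto simp: mult_pos_neg\<close>)
  qed
  define h where "h = min d (u - u\<^sub>0) / 2"
  have h: "0 < h" "h < d" "h < u - u\<^sub>0" using d(1) u by (auto simp: h_def min_def)
  define a where "a = u - h"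
  define b where "b = u + h"
  have ab: "u\<^sub>0 < a" "a < b" using h by (auto simp: a_def b_def)
  have s: "y a * y b < 0" using d(2)[OF h(1,2)] by (simp add: a_def b_def)
  define e where "e = min \<bar>y a\<bar> \<bar>y b\<bar>"
  have e: "e > 0" using s by (auto simp: e_def)
  obtain \<delta> where \<delta>: "\<delta> > 0" "\<And>E1 z z' v. dirichlet_pair k u\<^sub>0 E1 z z' \<Longrightarrow> \<bar>E1 - E\<bar> < \<delta> \<Longrightarrow> v \<in> {u\<^sub>0..b} \<Longrightarrow> \<bar>z v - y v\<bar> < e"
    using dirichlet_pair_stable[OF y _ e, of b] ab by (metis less_imp_le order_trans)
  show ?thesis
  proof (intro exI[of _ \<delta>] conjI \<delta>(1) allI impI)
    fix E1 assume E1: "\<bar>E1 - E\<bar> < \<delta>"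
    obtain z z' where z: "dirichlet_pair k u\<^sub>0 E1 z z'" using dirichlet_pair_exists by blast
    have za: "\<bar>z a - y a\<bar> < \<bar>y a\<bar>" "\<bar>z b - y b\<bar> < \<bar>y b\<bar>"
      using \<delta>(2)[OF z E1, of a] \<delta>(2)[OF z E1, of b] ab by (auto simp: e_def)
    have "z a * z b < 0"
    proof (cases "y a > 0")
      case True
      then have "y b < 0" using s by (simp add: mult_less_0_iff)
      then have "z a > 0" "z b < 0" using za True by linarith+
      then show ?thesis by (rule mult_pos_neg)
    next
      case False
      then have "y a < 0" "y b > 0" using s by (auto simp: mult_less_0_iff)
      then have "z a < 0" "z b > 0" using za by linarith+
      then show ?thesis by (rule mult_neg_pos)
    qed
    from continuous_sign_change[OF dirichlet_pair_continuous(1)[OF z] _ this] ab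
    obtain v where "v \<in> {a..b}" "z v = 0" by auto
    then show "has_node k u\<^sub>0 E1" unfolding has_node_def using z ab by (intro exI[of _ z] exI[of _ z'] exI[of _ v]) auto
  qed
qed

lemma product_nondecreasing:
  assumes y: "dirichlet_pair k u\<^sub>0 E y y'" and V: "\<And>v. v \<ge> a \<Longrightarrow> V_pot k v \<ge> E" and ab: "a \<le> b"
  shows "y a * y' a \<le> y b * y' b"
proof (rule nondecreasing_from_deriv[OF ab, where f="\<lambda>u. y u * y' u" and f'="\<lambda>u. y' u * y' u + (V_pot k u - E) * y u * y u"])
  fix x assume x: "x \<in> {a..b}"
  show "((\<lambda>u. y u * y' u) has_real_derivative y' x * y' x + (V_pot k x - E) * y x * y x) (at x within {a..b})"
    using DERIV_mult[OF dirichlet_pairD(1)[OF y] dirichlet_pairD(2)[OF y], of x "{a..b}"] by (simp add: algebra_simps)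
  have "0 \<le> (V_pot k x - E) * (y x * y x)" using V[of x] x by (intro mult_nonneg_nonneg[OF _ zero_le_square]) auto
  then show "0 \<le> y' x * y' x + (V_pot k x - E) * y x * y x" by (simp add: mult.assoc)
qed

text \<open>
  For \<open>E = - k\<^sup>2 \<le> V_pot k\<close> the product \<open>y * y'\<close> is nondecreasing; it is zero at \<open>u\<^sub>0\<close> and positive just
  after.
\<close>

lemma no_node_low_energy: "\<not> has_node k u\<^sub>0 (- k\<^sup>2)"
proof
  assume "has_node k u\<^sub>0 (- k\<^sup>2)"
  then obtain y y' u where y: "dirichlet_pair k u\<^sub>0 (- k\<^sup>2) y y'" and u: "u > u\<^sub>0" "y u = 0" unfolding has_node_def by blast
  have "((\<lambda>u. y u * y' u) has_real_derivative 1) (at u\<^sub>0)"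
    using DERIV_mult[OF dirichlet_pairD(1)[OF y, of u\<^sub>0 UNIV] dirichlet_pairD(2)[OF y, of u\<^sub>0 UNIV]] dirichlet_pairD(3,4)[OF y] by simp
  from DERIV_pos_inc_right[OF this] obtain d where d: "d > 0" "\<And>h. h > 0 \<Longrightarrow> h < d \<Longrightarrow> y u\<^sub>0 * y' u\<^sub>0 < y (u\<^sub>0 + h) * y' (u\<^sub>0 + h)" by auto
  define h where "h = min d (u - u\<^sub>0) / 2"
  have h: "0 < h" "h < d" "u\<^sub>0 + h \<le> u" using d(1) u unfolding h_def min_def by (auto simp: field_simps)
  have "0 < y (u\<^sub>0 + h) * y' (u\<^sub>0 + h)" using d(2)[OF h(1,2)] dirichlet_pairD(3)[OF y] by simp
  also have "\<dots> \<le> y u * y' u" by (rule product_nondecreasing[OF y V_pot_lower_bound h(3)])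
  finally show False using u by simp
qed

text \<open>
  Sturm comparison with \<open>sin (pi * (u - u\<^sub>0))\<close> on \<open>{u\<^sub>0..u\<^sub>0 + 1}\<close>: if \<open>y\<close> were positive there and
  \<open>E \<ge> V_pot k + pi\<^sup>2\<close>, the Wronskian of the two would be nondecreasing, but it is zero at the left end
  and negative at the right end.
\<close>

lemma node_high_energy: "\<exists>E. has_node k u\<^sub>0 E"
proof -
  have "continuous_on {u\<^sub>0..u\<^sub>0 + 1} (V_pot k)" unfolding V_pot_def[abs_def] by (intro continuous_intros)
  then obtain B where B: "B > 0" "\<forall>u\<in>{u\<^sub>0..u\<^sub>0 + 1}. \<bar>V_pot k u\<bar> \<le> B" using continuous_bounded_Icc by blast
  define E where "E = B + pi\<^sup>2"
  show ?thesis
  proof (intro exI[of _ E], rule ccontr)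
    assume n: "\<not> has_node k u\<^sub>0 E"
    obtain y y' where y: "dirichlet_pair k u\<^sub>0 E y y'" using dirichlet_pair_exists by blast
    define s where "s u = sin (pi * (u - u\<^sub>0))" for u
    define s' where "s' u = pi * cos (pi * (u - u\<^sub>0))" for u
    have sd: "(s has_real_derivative s' u) (at u within S)" for u S
      unfolding s_def[abs_def] s'_def by (auto intro!: derivative_eq_intros)
    have s'd: "(s' has_real_derivative - (pi\<^sup>2 * s u)) (at u within S)" for u S
      unfolding s'_def[abs_def] s_def by (auto intro!: derivative_eq_intros simp: power2_eq_square)
    define g where "g u = y u * s' u - y' u * s u" for u
    have "g u\<^sub>0 \<le> g (u\<^sub>0 + 1)"
    proof (rule nondecreasing_from_deriv[where f=g and f'="\<lambda>u. (E - pi\<^sup>2 - V_pot k u) * (y u * s u)"])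
      fix x assume x: "x \<in> {u\<^sub>0..u\<^sub>0 + 1}"
      show "(g has_real_derivative (E - pi\<^sup>2 - V_pot k x) * (y x * s x)) (at x within {u\<^sub>0..u\<^sub>0 + 1})"
        unfolding g_def[abs_def]
        by (rule DERIV_cong[OF DERIV_diff[OF DERIV_mult[OF dirichlet_pairD(1)[OF y] s'd] DERIV_mult[OF dirichlet_pairD(2)[OF y] sd]]])
          (simp add: algebra_simps)
      have "pi * (x - u\<^sub>0) \<le> pi * 1" using x by (intro mult_left_mono) auto
      then have "s x \<ge> 0" unfolding s_def using x by (intro sin_ge_zero) auto
      moreover have "y x \<ge> 0"
        using nodeless_positive[OF y n, of x] dirichlet_pairD(3)[OF y] x by (cases "x = u\<^sub>0") (auto simp: less_imp_le)
      moreover have "E - pi\<^sup>2 - V_pot k x \<ge> 0" using B(2) x by (force simp: E_def)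
      ultimately show "0 \<le> (E - pi\<^sup>2 - V_pot k x) * (y x * s x)" by simp
    qed simp
    moreover have "g u\<^sub>0 = 0" by (simp add: g_def s_def dirichlet_pairD(3)[OF y])
    moreover have "g (u\<^sub>0 + 1) = - (pi * y (u\<^sub>0 + 1))" by (simp add: g_def s_def s'_def)
    moreover have "pi * y (u\<^sub>0 + 1) > 0" using nodeless_positive[OF y n, of "u\<^sub>0 + 1"] by simp
    ultimately show False by linarith
  qed
qed

lemma bounded_integrals_integrable:
  fixes N :: "real \<Rightarrow> real"
  assumes c: "continuous_on {a..} N" and N0: "\<And>u. u \<ge> a \<Longrightarrow> N u \<ge> 0" and b: "\<And>b. b \<ge> a \<Longrightarrow> integral {a..b} N \<le> B"
  shows "N integrable_on {a..}"
proof -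
  define f where "f n x = (if x \<in> {..a + real n} then N x else 0)" for n :: nat and x
  have eq: "{..a + real n} \<inter> {a..} = {a..a + real n}" for n by auto
  have i: "N integrable_on {a..a + real n}" for n
    by (intro integrable_continuous_interval continuous_on_subset[OF c]) auto
  have fi: "f n integrable_on {a..}" for n
    unfolding f_def using integrable_restrict_Int[of "{..a + real n}" N "{a..}"] i eq by simp
  have fI: "integral {a..} (f n) = integral {a..a + real n} N" for n
    unfolding f_def using integral_restrict_Int[of "{a..}" "{..a + real n}" N] eq by simp
  show ?thesis
  proof (rule monotone_convergence_increasing[where f=f, THEN conjunct1])
    show "f n x \<le> f (Suc n) x" if "x \<in> {a..}" for n x using N0[of x] that by (simp add: f_def)
    show "(\<lambda>n. f n x) \<longlonglongrightarrow> N x" if "x \<in> {a..}" for x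
    proof (rule tendsto_eventually)
      obtain m :: nat where m: "x - a \<le> real m" using real_arch_simple by blast
      then show "\<forall>\<^sub>F n in sequentially. f n x = N x"
        unfolding eventually_sequentially by (intro exI[of _ m]) (auto simp: f_def)
    qed
    show "bounded (range (\<lambda>n. integral {a..} (f n)))"
    proof (rule boundedI)
      fix x assume "x \<in> range (\<lambda>n. integral {a..} (f n))"
      then obtain n where n: "x = integral {a..a + real n} N" unfolding fI by blast
      have "0 \<le> integral {a..a + real n} N" by (rule integral_nonneg[OF i]) (use N0 in auto)
      then show "norm x \<le> B" using b[of "a + real n"] unfolding n by simp
    qed
  qed (rule fi)
qed

text \<open>
  As \<open>(y * y')' \<ge> y\<^sup>2\<close> beyond \<open>a\<close>, a product that stays nonpositive bounds the integral of \<open>y\<^sup>2\<close>.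
\<close>

lemma growth_of_non_square_integrable:
  assumes y: "dirichlet_pair k u\<^sub>0 E y y'" and V: "\<And>v. v \<ge> a \<Longrightarrow> V_pot k v \<ge> E + 1" and a: "a \<ge> u\<^sub>0"
    and n: "\<not> (\<lambda>u. (y u)\<^sup>2) integrable_on {u\<^sub>0..}"
  shows "\<exists>b\<ge>a. y b * y' b > 0"
proof (rule ccontr)
  assume "\<not> ?thesis"
  then have D: "y b * y' b \<le> 0" if "b \<ge> a" for b using that by force
  have c: "continuous_on S (\<lambda>u. (y u)\<^sup>2)" for S by (intro continuous_intros dirichlet_pair_continuous(1)[OF y])
  have "(\<lambda>u. (y u)\<^sup>2) integrable_on {a..}"
  proof (rule bounded_integrals_integrable[OF c])
    fix b assume b: "b \<ge> a"
    define g where "g u = y u * y' u - integral {a..u} (\<lambda>u. (y u)\<^sup>2)" for u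
    have "g a \<le> g b"
    proof (rule nondecreasing_from_deriv[OF b, where f=g and f'="\<lambda>u. (y u * ((V_pot k u - E) * y u) + y' u * y' u) - (y u)\<^sup>2"])
      fix x assume x: "x \<in> {a..b}"
      show "(g has_real_derivative (y x * ((V_pot k x - E) * y x) + y' x * y' x) - (y x)\<^sup>2) (at x within {a..b})"
        unfolding g_def[abs_def]
        by (intro DERIV_diff DERIV_mult' dirichlet_pairD(1)[OF y] dirichlet_pairD(2)[OF y] integral_has_real_derivative[OF c x])
      have "0 \<le> (V_pot k x - E - 1) * (y x)\<^sup>2" using V[of x] x by (intro mult_nonneg_nonneg) auto
      moreover have "(y x * ((V_pot k x - E) * y x) + y' x * y' x) - (y x)\<^sup>2 = (V_pot k x - E - 1) * (y x)\<^sup>2 + (y' x)\<^sup>2"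
        by (simp add: power2_eq_square algebra_simps)
      ultimately show "0 \<le> (y x * ((V_pot k x - E) * y x) + y' x * y' x) - (y x)\<^sup>2" by simp
    qed
    then show "integral {a..b} (\<lambda>u. (y u)\<^sup>2) \<le> - (y a * y' a)" using D[OF b] by (simp add: g_def)
  qed simp
  moreover have "(\<lambda>u. (y u)\<^sup>2) integrable_on {u\<^sub>0..a}" by (intro integrable_continuous_interval c)
  moreover have "{u\<^sub>0..} = {u\<^sub>0..a} \<union> {a..}" using a by auto
  moreover have "negligible ({u\<^sub>0..a} \<inter> {a..})" by (rule negligible_subset[of "{a}"]) auto
  ultimately have "(\<lambda>u. (y u)\<^sup>2) integrable_on {u\<^sub>0..}" by (metis integrable_Un)
  then show False using n by blast
qed

text \<open>
  At some far point \<open>b\<close> both \<open>y\<close> and \<open>y'\<close> are positive. For a nearby energy the solution has no zero near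
  \<open>u\<^sub>0\<close>, where its slope is close to \<open>1\<close>; none up to \<open>b\<close>, where it is close to \<open>y > 0\<close> on a compact
  interval; and none beyond \<open>b\<close>, where the potential exceeds the energy and \<open>z * z'\<close> starts positive and
  does not decrease.
\<close>

lemma nodeless_open:
  assumes n: "\<not> has_node k u\<^sub>0 E"
    and ns: "\<And>y y'. dirichlet_pair k u\<^sub>0 E y y' \<Longrightarrow> \<not> (\<lambda>u. (y u)\<^sup>2) integrable_on {u\<^sub>0..}"
  shows "\<exists>\<delta>>0. \<forall>E1. \<bar>E1 - E\<bar> < \<delta> \<longrightarrow> \<not> has_node k u\<^sub>0 E1"
proof -
  obtain y y' where y: "dirichlet_pair k u\<^sub>0 E y y'" using dirichlet_pair_exists by blast
  obtain a where a: "a \<ge> u\<^sub>0 + 1" "\<And>v. v \<ge> a \<Longrightarrow> V_pot k v \<ge> E + 1" using potential_large by blast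
  obtain b where b: "b \<ge> a" "y b * y' b > 0" using growth_of_non_square_integrable[where a=a, OF y a(2) _ ns[OF y]] a(1) by auto
  have yb: "y b > 0" using nodeless_positive[OF y n, of b] a b by simp
  have y'b: "y' b > 0" using b(2) yb by (simp add: zero_less_mult_iff)
  have "isCont y' u\<^sub>0" using dirichlet_pairD(2)[OF y, of u\<^sub>0 UNIV] by (auto intro: DERIV_isCont)
  then have "\<forall>\<^sub>F v in at u\<^sub>0. dist (y' v) (y' u\<^sub>0) < 1 / 2" by (intro tendstoD) (auto simp: isCont_def)
  then obtain d where d: "d > 0" "\<And>v. v \<noteq> u\<^sub>0 \<Longrightarrow> dist v u\<^sub>0 < d \<Longrightarrow> dist (y' v) (y' u\<^sub>0) < 1 / 2"
    unfolding eventually_at by blast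
  define c where "c = u\<^sub>0 + min d 1 / 2"
  have c: "u\<^sub>0 < c" "c \<le> b" using d(1) a(1) b(1) by (auto simp: c_def min_def)
  have near: "y' v \<ge> 1 / 2" if "v \<in> {u\<^sub>0..c}" for v
  proof (cases "v = u\<^sub>0")
    case True
    then show ?thesis using dirichlet_pairD(4)[OF y] by simp
  next
    case False
    have "dist v u\<^sub>0 < d" using that d(1) by (auto simp: c_def dist_real_def min_def split: if_splits)
    from d(2)[OF False this] show ?thesis using dirichlet_pairD(4)[OF y] by (simp add: dist_real_def abs_if split: if_splits)
  qed
  have "continuous_on {c..b} y" by (rule dirichlet_pair_continuous(1)[OF y])
  then obtain x where x: "x \<in> {c..b}" "\<And>v. v \<in> {c..b} \<Longrightarrow> y x \<le> y v"
    using continuous_attains_inf[of "{c..b}" y] c by auto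
  have yx: "y x > 0" using nodeless_positive[OF y n, of x] x(1) c by simp
  define e where "e = min (1 / 4) (min (y x) (min (y b) (y' b)))"
  have e: "e > 0" using yx yb y'b by (simp add: e_def)
  have ub: "u\<^sub>0 \<le> b" using c by simp
  obtain \<delta> where \<delta>: "\<delta> > 0" "\<And>E1 z z' v. dirichlet_pair k u\<^sub>0 E1 z z' \<Longrightarrow> \<bar>E1 - E\<bar> < \<delta> \<Longrightarrow> v \<in> {u\<^sub>0..b} \<Longrightarrow> \<bar>z v - y v\<bar> < e \<and> \<bar>z' v - y' v\<bar> < e"
    using dirichlet_pair_stable[OF y ub e] by blast
  show ?thesis
  proof (intro exI[of _ "min \<delta> 1"] conjI allI impI notI)
    show "min \<delta> 1 > 0" using \<delta>(1) by simp
    fix E1 assume E1: "\<bar>E1 - E\<bar> < min \<delta> 1" and "has_node k u\<^sub>0 E1"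
    then obtain z z' u where z: "dirichlet_pair k u\<^sub>0 E1 z z'" and u: "u > u\<^sub>0" "z u = 0" unfolding has_node_def by blast
    have close: "\<bar>z v - y v\<bar> < e" "\<bar>z' v - y' v\<bar> < e" if "v \<in> {u\<^sub>0..b}" for v using \<delta>(2)[OF z _ that] E1 by auto
    consider "u \<le> c" | "c < u" "u \<le> b" | "b < u" by linarith
    then show False
    proof cases
      case 1
      have "z u\<^sub>0 < z u"
      proof (rule DERIV_pos_imp_increasing[OF u(1)])
        fix v assume v: "u\<^sub>0 \<le> v" "v \<le> u"
        have "\<bar>z' v - y' v\<bar> < 1 / 4" using close(2)[of v] v 1 c by (simp add: e_def)
        then have "z' v > 0" using near[of v] v 1 by (simp add: abs_if split: if_splits)
        then show "\<exists>y. DERIV z v :> y \<and> y > 0" using dirichlet_pairD(1)[OF z, of v UNIV] by auto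
      qed
      then show False using u dirichlet_pairD(3)[OF z] by simp
    next
      case 2
      have "\<bar>z u - y u\<bar> < y x" using close(1)[of u] 2 u by (simp add: e_def)
      moreover have "y x \<le> y u" using x(2)[of u] 2 by simp
      ultimately show False using u(2) by simp
    next
      case 3
      have "\<bar>z b - y b\<bar> < y b" "\<bar>z' b - y' b\<bar> < y' b" using close[of b] ub by (auto simp: e_def)
      then have "z b > 0" "z' b > 0" by linarith+
      then have "0 < z b * z' b" by simp
      also have "\<dots> \<le> z u * z' u"
      proof (rule product_nondecreasing[OF z])
        fix v assume "v \<ge> b"
        then have "V_pot k v \<ge> E + 1" using a(2) b(1) by simp
        then show "V_pot k v \<ge> E1" using E1 by linarith
      qed (use 3 in simp)
      finally show False using u(2) by simp
    qed
  qed
qed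

text \<open>
  Otherwise the energies with a node and those without form two nonempty open sets covering the line.
\<close>

lemma square_integrable_dirichlet_solution_exists:
  "\<exists>E y y'. dirichlet_pair k u\<^sub>0 E y y' \<and> (\<lambda>u. (y u)\<^sup>2) integrable_on {u\<^sub>0..}"
proof (rule ccontr)
  assume "\<not> ?thesis"
  then have ns: "\<And>E y y'. dirichlet_pair k u\<^sub>0 E y y' \<Longrightarrow> \<not> (\<lambda>u. (y u)\<^sup>2) integrable_on {u\<^sub>0..}" by blast
  define S where "S = {E. has_node k u\<^sub>0 E}"
  have "open S"
    unfolding open_dist S_def dist_real_def using node_open by (metis mem_Collect_eq)
  moreover have "open (- S)"
    unfolding open_dist S_def dist_real_def
  proof (rule ballI)
    fix E assume "E \<in> - Collect (has_node k u\<^sub>0)"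
    then have "\<not> has_node k u\<^sub>0 E" by simp
    from nodeless_open[OF this ns] show "\<exists>\<delta>>0. \<forall>E1. \<bar>E1 - E\<bar> < \<delta> \<longrightarrow> E1 \<in> - Collect (has_node k u\<^sub>0)" by simp
  qed
  ultimately have "S = {} \<or> S = UNIV" using clopen[of S] by (simp add: closed_def)
  moreover have "- k\<^sup>2 \<notin> S" using no_node_low_energy by (simp add: S_def)
  moreover obtain E where "E \<in> S" using node_high_energy unfolding S_def by blast
  ultimately show False by blast
qed

lemma dirichlet_eigenvalue_exists:
  "\<exists>E::real. of_real E \<in> eigenvalues (half_line u\<^sub>0) (schrodinger_operator u\<^sub>0 0 (V_pot k))"
proof -
  obtain E y y' where y: "dirichlet_pair k u\<^sub>0 E y y'" and i: "(\<lambda>u. (y u)\<^sup>2) integrable_on {u\<^sub>0..}"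
    using square_integrable_dirichlet_solution_exists by blast
  define f where "f u = complex_of_real (y u)" for u
  have s: "sol_on UNIV (potE k (of_real E)) f (\<lambda>u. of_real (y' u))" unfolding f_def[abs_def] by (rule dirichlet_pair_complex[OF y])
  have c: "continuous_on S f" for S by (rule sol_on_continuous(1)[OF sol_on_subset[OF s subset_UNIV]])
  have L: "f \<in> L2 (half_line u\<^sub>0)" by (rule continuous_half_line_L2[OF c]) (use i in \<open>simp add: f_def\<close>)
  have "boundary_form u\<^sub>0 0 f (\<lambda>u. of_real (y' u)) = 0"
    by (simp add: boundary_form_def f_def dirichlet_pairD(3)[OF y])
  from square_integrable_solution_in_eigenspace[OF s L this]
  have e: "f \<in> eigenspace (schrodinger_operator u\<^sub>0 0 (V_pot k)) (of_real E)" .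
  have "\<not> (AE u in half_line u\<^sub>0. f u = 0)"
  proof
    assume "AE u in half_line u\<^sub>0. f u = 0"
    then have z: "y u = 0" if "u \<ge> u\<^sub>0" for u using AE_half_line_continuous_zero[OF c _ that] by (simp add: f_def)
    have "(y has_real_derivative 1) (at u\<^sub>0)" using dirichlet_pairD(1)[OF y, of u\<^sub>0 UNIV] dirichlet_pairD(4)[OF y] by simp
    from DERIV_pos_inc_right[OF this] obtain d where d: "d > 0" "\<And>h. h > 0 \<Longrightarrow> h < d \<Longrightarrow> y u\<^sub>0 < y (u\<^sub>0 + h)" by auto
    have "y u\<^sub>0 < y (u\<^sub>0 + d / 2)" using d by simp
    then show False using z[of u\<^sub>0] z[of "u\<^sub>0 + d / 2"] d(1) by simp
  qed
  then show ?thesis unfolding eigenvalues_def using e by blast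
qed

text \<open>
  The recessive solution vanishes at \<open>u\<^sub>0\<close>, so the potential lies below \<open>E\<close> at some point of the half-line.
\<close>

lemma dirichlet_eigenvalue_bounds:
  assumes "of_real E \<in> eigenvalues (half_line u\<^sub>0) (schrodinger_operator u\<^sub>0 0 (V_pot k))"
  shows "k \<ge> 0 \<Longrightarrow> E > 0" "E > - k\<^sup>2"
proof -
  obtain \<psi> \<psi>' where \<psi>: "is_recessive k (of_real E) \<psi> \<psi>'" using recessive_exists by blast
  have 0: "\<psi> u\<^sub>0 = 0" using assms unfolding eigenvalue_iff_boundary[OF \<psi>] by (simp add: boundary_form_def)
  have *: "\<exists>u\<ge>u\<^sub>0. V_pot k u < E" using recessive_dirichlet_nonzero[OF \<psi>, of u\<^sub>0] 0 by force
  show "k \<ge> 0 \<Longrightarrow> E > 0" using * V_pot_pos[of k] by (meson less_trans)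
  show "E > - k\<^sup>2" using * V_pot_lower_bound[of k] by (meson le_less_trans)
qed

text \<open>
  The eigenvalues up to any given one lie between \<open>- k\<^sup>2\<close> and it, so there are finitely many and a
  smallest one exists.
\<close>

theorem dirichlet_ground_state:
  "\<exists>E\<^sub>0::real.
     of_real E\<^sub>0 \<in> eigenvalues (half_line u\<^sub>0) (schrodinger_operator u\<^sub>0 0 (V_pot k)) \<and>
     (\<forall>\<zeta>\<in>eigenvalues (half_line u\<^sub>0) (schrodinger_operator u\<^sub>0 0 (V_pot k)). E\<^sub>0 \<le> Re \<zeta>) \<and>
     (k \<ge> 0 \<longrightarrow> E\<^sub>0 > 0) \<and> (k < 0 \<longrightarrow> E\<^sub>0 > - k\<^sup>2)"
proof -
  let ?S = "eigenvalues (half_line u\<^sub>0) (schrodinger_operator u\<^sub>0 0 (V_pot k))"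
  obtain E1 :: real where E1: "of_real E1 \<in> ?S" using dirichlet_eigenvalue_exists by blast
  obtain E \<psi> \<psi>' \<phi> \<phi>' where E: "E \<in> \<real>" "green_function k u\<^sub>0 0 E \<psi> \<psi>' \<phi> \<phi>'" by (rule real_regular_point)
  define R where "R = \<bar>E1 - Re E\<bar> + \<bar>- k\<^sup>2 - Re E\<bar>"
  define F where "F = {\<zeta> \<in> ?S. norm (\<zeta> - E) \<le> R}"
  have fin: "finite F" unfolding F_def by (rule finitely_many_eigenvalues_in_ball[OF E(2,1)])
  have inF: "\<zeta> \<in> F" if z: "\<zeta> \<in> ?S" "Re \<zeta> \<le> E1" for \<zeta>
  proof -
    have r: "\<zeta> = of_real (Re \<zeta>)" "E = of_real (Re E)" using eigenvalue_real[OF z(1)] E(1) by (simp_all add: of_real_Re)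
    have "Re \<zeta> > - k\<^sup>2" using dirichlet_eigenvalue_bounds(2)[of "Re \<zeta>" u\<^sub>0 k] z(1) r(1) by simp
    then have "\<bar>Re \<zeta> - Re E\<bar> \<le> R" using z(2) unfolding R_def by linarith
    moreover have "norm (\<zeta> - E) = \<bar>Re \<zeta> - Re E\<bar>" by (metis norm_of_real of_real_diff r)
    ultimately show ?thesis using z(1) by (simp add: F_def)
  qed
  have "of_real E1 \<in> F" using inF[OF E1] by simp
  then have ne: "Re ` F \<noteq> {}" by blast
  define E0 where "E0 = Min (Re ` F)"
  have "E0 \<in> Re ` F" unfolding E0_def by (rule Min_in) (use fin ne in auto)
  then obtain \<zeta> where z: "\<zeta> \<in> F" "E0 = Re \<zeta>" by blast
  then have zS: "\<zeta> \<in> ?S" by (simp add: F_def)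
  have "\<zeta> = of_real E0" using eigenvalue_real[OF zS] z(2) by (simp add: of_real_Re)
  then have E0S: "of_real E0 \<in> ?S" using zS by simp
  have "E0 \<le> Re \<zeta>" if "\<zeta> \<in> ?S" for \<zeta>
  proof (cases "Re \<zeta> \<le> E1")
    case True
    then show ?thesis unfolding E0_def using inF[OF that] fin by (intro Min_le) auto
  next
    case False
    have "E0 \<le> Re (of_real E1)" unfolding E0_def
      by (rule Min_le[OF finite_imageI[OF fin] imageI[OF \<open>of_real E1 \<in> F\<close>]])
    then show ?thesis using False by simp
  qed
  then show ?thesis using E0S dirichlet_eigenvalue_bounds[OF E0S] by blast
qed

section \<open>The Schroedinger equation with the potential \<open>V_pot\<close>\<close>

theorem theorem2p1:
  fixes k u\<^sub>0 :: real
  shows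
    "(\<forall>E.
        cfun.subspace (schrodinger_solutions u\<^sub>0 (V_pot k) E) \<and>
        cfun.dim (schrodinger_solutions u\<^sub>0 (V_pot k) E) = 2 \<and>
        (\<forall>\<kappa> \<mu>. \<kappa> = - of_real k \<and> \<mu>\<^sup>2 = - E \<longrightarrow>
           schrodinger_solutions u\<^sub>0 (V_pot k) E =
             {\<lambda>u. of_real (exp (- u / 2)) * f (exp u) | f.
                f \<in> whittaker_solutions {exp u\<^sub>0..} \<kappa> \<mu>}))
     \<and>
     (\<forall>E.
        cfun.subspace (schrodinger_solutions u\<^sub>0 (V_pot k) E \<inter> L2 (half_line u\<^sub>0)) \<and>
        cfun.dim (schrodinger_solutions u\<^sub>0 (V_pot k) E \<inter> L2 (half_line u\<^sub>0)) = 1 \<and>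
        (\<forall>z. E = z\<^sup>2 \<longrightarrow>
           (\<forall>u\<in>{u\<^sub>0..}.
              of_real (exp (- u / 2)) * whittaker_W (- of_real k) (\<i> * z) (exp u) =
              of_real (exp (- u / 2)) * whittaker_W (- of_real k) (- \<i> * z) (exp u)) \<and>
           schrodinger_solutions u\<^sub>0 (V_pot k) E \<inter> L2 (half_line u\<^sub>0) =
             cfun.span {\<lambda>u. if u \<in> {u\<^sub>0..}
               then of_real (exp (- u / 2)) * whittaker_W (- of_real k) (\<i> * z) (exp u) else 0}))
     \<and>
     limit_point_type u\<^sub>0 (V_pot k) \<and>
     (\<forall>\<alpha>. 0 \<le> \<alpha> \<and> \<alpha> < 2 * pi \<longrightarrow>
        (let M = half_line u\<^sub>0; H = schrodinger_operator u\<^sub>0 \<alpha> (V_pot k) in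
           self_adjoint M H \<and>
           pure_discrete_spectrum M H \<and>
           simple_spectrum M H \<and>
           op_spectrum M H \<subseteq> \<real> \<and>
           (\<exists>c::real. \<forall>\<zeta>\<in>op_spectrum M H. c \<le> Re \<zeta>)))
     \<and>
     (\<exists>E\<^sub>0::real.
        of_real E\<^sub>0 \<in> eigenvalues (half_line u\<^sub>0) (schrodinger_operator u\<^sub>0 0 (V_pot k)) \<and>
        (\<forall>\<zeta>\<in>eigenvalues (half_line u\<^sub>0) (schrodinger_operator u\<^sub>0 0 (V_pot k)). E\<^sub>0 \<le> Re \<zeta>) \<and>
        (k \<ge> 0 \<longrightarrow> E\<^sub>0 > 0) \<and>
        (k < 0 \<longrightarrow> E\<^sub>0 > - k\<^sup>2))"
proof (intro conjI allI impI)
  fix E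
  show "cfun.subspace (schrodinger_solutions u\<^sub>0 (V_pot k) E)" by (rule schrodinger_solutions_subspace)
  show "cfun.dim (schrodinger_solutions u\<^sub>0 (V_pot k) E) = 2" by (rule schrodinger_solutions_dim)
  show "schrodinger_solutions u\<^sub>0 (V_pot k) E =
      {\<lambda>u. of_real (exp (- u / 2)) * f (exp u) | f. f \<in> whittaker_solutions {exp u\<^sub>0..} \<kappa> \<mu>}"
    if "\<kappa> = - of_real k \<and> \<mu>\<^sup>2 = - E" for \<kappa> \<mu>
    using schrodinger_solutions_whittaker[of \<mu> E u\<^sub>0 k] that by simp
next
  fix E
  show "cfun.subspace (schrodinger_solutions u\<^sub>0 (V_pot k) E \<inter> L2 (half_line u\<^sub>0))"
    "cfun.dim (schrodinger_solutions u\<^sub>0 (V_pot k) E \<inter> L2 (half_line u\<^sub>0)) = 1"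
    by (rule square_integrable_solutions)+
  fix z assume "E = z\<^sup>2"
  note S = square_integrable_solutions(3,4)[OF this]
  show "\<forall>u\<in>{u\<^sub>0..}.
      of_real (exp (- u / 2)) * whittaker_W (- of_real k) (\<i> * z) (exp u) =
      of_real (exp (- u / 2)) * whittaker_W (- of_real k) (- \<i> * z) (exp u)" by (rule ballI) (rule S(1))
  show "schrodinger_solutions u\<^sub>0 (V_pot k) E \<inter> L2 (half_line u\<^sub>0) =
      cfun.span {\<lambda>u. if u \<in> {u\<^sub>0..}
        then of_real (exp (- u / 2)) * whittaker_W (- of_real k) (\<i> * z) (exp u) else 0}" by (rule S(2))
next
  show "limit_point_type u\<^sub>0 (V_pot k)" by (rule limit_point_type_V_pot)
next
  fix \<alpha> :: real
  show "let M = half_line u\<^sub>0; H = schrodinger_operator u\<^sub>0 \<alpha> (V_pot k) in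
      self_adjoint M H \<and> pure_discrete_spectrum M H \<and> simple_spectrum M H \<and> op_spectrum M H \<subseteq> \<real> \<and>
      (\<exists>c::real. \<forall>\<zeta>\<in>op_spectrum M H. c \<le> Re \<zeta>)"
    unfolding Let_def
    using schrodinger_operator_self_adjoint spectrum_pure_discrete spectrum_simple eigenvalue_real eigenvalues_bounded_below
    unfolding spectrum_eq_eigenvalues by blast
next
  show "\<exists>E\<^sub>0::real.
        of_real E\<^sub>0 \<in> eigenvalues (half_line u\<^sub>0) (schrodinger_operator u\<^sub>0 0 (V_pot k)) \<and>
        (\<forall>\<zeta>\<in>eigenvalues (half_line u\<^sub>0) (schrodinger_operator u\<^sub>0 0 (V_pot k)). E\<^sub>0 \<le> Re \<zeta>) \<and>
        (k \<ge> 0 \<longrightarrow> E\<^sub>0 > 0) \<and> (k < 0 \<longrightarrow> E\<^sub>0 > - k\<^sup>2)"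
    by (rule dirichlet_ground_state)
qed

end
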